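(* Let $\mathcal X$ be a quasinormal circulant scheme over a finite cyclic group $G$. Then every algebraic automorphism $\varphi$ of $\mathcal X$ that is extendable at a base tuple for $\mathcal X$ is induced by an isomorphism, i.e., there is a permutation $f$ of $G$ with $s^f=\varphi(s)$ for every basis relation $s$ of $\mathcal X$.
   Context: A coherent configuration on $\Omega$ is $(\Omega,S)$, $S$ a partition of $\Omega\times\Omega$ (basis relations) such that $1_\Omega$ is a union of basis relations, $S$ is closed under transposition, and $c^t_{rs}=|\{\gamma:(\alpha,\gamma)\in r,(\gamma,\beta)\in s\}|$ is independent of $(\alpha,\beta)\in t$; trivial if its basis relations are $1_\Omega$ and its complement (only $1_\Omega$ if $|\Omega|=1$). An algebraic automorphism is a permutation of $S$ preserving all $c^t_{rs}$ (extended to unions of basis relations). $\mathrm{Aut}(\mathcal X)$ is the group of permutations fixing each basis relation. For a tuple $x$ with entry set $\Omega(x)$, the point extension $\mathcal X_x$ is the smallest coherent configuration refining $\mathcal X$ in which each $\{(x_i,x_i)\}$ is a basis relation. $\varphi$ is extendable at a tuple $x\in G^m$ if for some $x'\in G^m$ there is an algebraic isomorphism $\psi:\mathcal X_x\to\mathcal X_{x'}$ with $\psi(s)=\varphi(s)$ for every basis relation $s$ of $\mathcal X$ and $\psi(\{(x_i,x_i)\})=\{(x'_i,x'_i)\}$ for all $i$. A circulant scheme over a cyclic group $G$ is a coherent configuration $(G,S)$ with $(\alpha,\beta)\in s\Rightarrow(\alpha g,\beta g)\in s$. $H\le G$ is an $\mathcal X$-group if its coset partition is a union of basis relations. For $\mathcal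 X$-groups $L\le U$, $\mathfrak S=U/L$ is a section, $U(\mathfrak S)=U$, $L(\mathfrak S)=L$; $\mathrm{Sec}_1(\mathcal X)$ is the set of these. $\mathcal X_{\mathfrak S}$ is the circulant scheme over $U/L$ with basis relations $s_{\mathfrak S}=\{(\Gamma,\Gamma')\in\mathfrak S^2:s\cap(\Gamma\times\Gamma')\ne\varnothing\}$ for $s\in S$ meeting $U\times U$. $\mathfrak S$ is a subsection of $\mathfrak T$ if $L(\mathfrak T)\le L(\mathfrak S)\le U(\mathfrak S)\le U(\mathfrak T)$. A section is trivial/normal if $\mathcal X_{\mathfrak S}$ is trivial/normal, where a circulant scheme $\mathcal Y$ over $K$ is normal if the right translations of $K$ form a normal subgroup of $\mathrm{Aut}(\mathcal Y)$. $\mathfrak S$ is a multiple of $\mathfrak T$ if $L(\mathfrak T)=U(\mathfrak T)\cap L(\mathfrak S)$ and $U(\mathfrak S)=U(\mathfrak T)L(\mathfrak S)$; projective equivalence is the equivalence relation on $\mathrm{Sec}_1(\mathcal X)$ generated by this. $\mathcal X$ is quasinormal if every trivial section in $\mathrm{Sec}_1(\mathcal X)$ is projectively equivalent to a subsection of a normal section. For $g\in G$, $g_{\mathfrak S}=gL$ if $g\in U$, else $\varnothing$. A tuple $x$ is a base tuple for $\mathcal X$ if $1_G\in\Omega(x)$ and for every $\mathfrak S\in\mathrm{Sec}_1(\mathcal X)$ of prime power order there is $g\in\Omega(x)\cap U(\mathfrak S)$ with $\mathfrak S=\langle g_{\mathfrak S}\rangle$. *)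

theory Defs
  imports "HOL-Algebra.Algebra" "HOL-Library.Disjoint_Sets"
begin

section \<open>Coherent configurations\<close>

definition union_of_basis :: "'a rel set \<Rightarrow> 'a rel \<Rightarrow> bool" where
  "union_of_basis S R \<longleftrightarrow> (\<exists>T\<subseteq>S. R = \<Union>T)"

definition coherent_configuration :: "'a set \<Rightarrow> 'a rel set \<Rightarrow> bool" where
  "coherent_configuration \<Omega> S \<longleftrightarrow>
     finite \<Omega> \<and> partition_on (\<Omega> \<times> \<Omega>) S \<and>
     union_of_basis S (Id_on \<Omega>) \<and>
     (\<forall>s\<in>S. s\<inverse> \<in> S) \<and>
     (\<forall>r\<in>S. \<forall>s\<in>S. \<forall>t\<in>S. \<exists>c. \<forall>(\<alpha>, \<beta>)\<in>t. card {\<gamma>. (\<alpha>, \<gamma>) \<in> r \<and> (\<gamma>, \<beta>) \<in> s} = c)"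

text \<open>The number \<open>c\<^sup>t\<^sub>r\<^sub>s\<close>; it is well defined for basis relations of a coherent configuration,
  since these are nonempty.\<close>

definition intersection_number :: "'a rel \<Rightarrow> 'a rel \<Rightarrow> 'a rel \<Rightarrow> nat" where
  "intersection_number r s t =
     (THE c. \<forall>(\<alpha>, \<beta>)\<in>t. card {\<gamma>. (\<alpha>, \<gamma>) \<in> r \<and> (\<gamma>, \<beta>) \<in> s} = c)"

text \<open>Subtracting \<open>{{}}\<close> drops the complement of the diagonal when the point set is a singleton.\<close>

definition trivial_configuration :: "'a set \<Rightarrow> 'a rel set \<Rightarrow> bool" where
  "trivial_configuration \<Omega> S \<longleftrightarrow> S = {Id_on \<Omega>, \<Omega> \<times> \<Omega> - Id_on \<Omega>} - {{}}"

definition algebraic_isomorphism ::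
    "'a rel set \<Rightarrow> 'b rel set \<Rightarrow> ('a rel \<Rightarrow> 'b rel) \<Rightarrow> bool" where
  "algebraic_isomorphism S S' \<phi> \<longleftrightarrow> bij_betw \<phi> S S' \<and>
     (\<forall>r\<in>S. \<forall>s\<in>S. \<forall>t\<in>S.
        intersection_number (\<phi> r) (\<phi> s) (\<phi> t) = intersection_number r s t)"

abbreviation algebraic_automorphism :: "'a rel set \<Rightarrow> ('a rel \<Rightarrow> 'a rel) \<Rightarrow> bool" where
  "algebraic_automorphism S \<equiv> algebraic_isomorphism S S"

definition extend_to_unions ::
    "'a rel set \<Rightarrow> ('a rel \<Rightarrow> 'b rel) \<Rightarrow> 'a rel \<Rightarrow> 'b rel" where
  "extend_to_unions S \<phi> R = \<Union> (\<phi> ` {s \<in> S. s \<subseteq> R})"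

definition image_rel :: "('a \<Rightarrow> 'b) \<Rightarrow> 'a rel \<Rightarrow> 'b rel" where
  "image_rel f s = map_prod f f ` s"

definition Aut_configuration :: "'a set \<Rightarrow> 'a rel set \<Rightarrow> ('a \<Rightarrow> 'a) monoid" where
  "Aut_configuration \<Omega> S =
     (BijGroup \<Omega>)\<lparr>carrier := {f \<in> Bij \<Omega>. \<forall>s\<in>S. image_rel f s = s}\<rparr>"


section \<open>Point extensions\<close>

definition fixes_points_refining :: "'a set \<Rightarrow> 'a rel set \<Rightarrow> 'a list \<Rightarrow> 'a rel set \<Rightarrow> bool" where
  "fixes_points_refining \<Omega> S x T \<longleftrightarrow>
     coherent_configuration \<Omega> T \<and> refines (\<Omega> \<times> \<Omega>) T S \<and> (\<forall>y\<in>set x. {(y, y)} \<in> T)"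

text \<open>``Smallest'' means fewest unions of basis relations, i.e.\ the coarsest partition. Existence
  and uniqueness are proved in \<open>point_extension_unique\<close>.\<close>

definition is_point_extension :: "'a set \<Rightarrow> 'a rel set \<Rightarrow> 'a list \<Rightarrow> 'a rel set \<Rightarrow> bool" where
  "is_point_extension \<Omega> S x T \<longleftrightarrow> fixes_points_refining \<Omega> S x T \<and>
     (\<forall>T'. fixes_points_refining \<Omega> S x T' \<longrightarrow> refines (\<Omega> \<times> \<Omega>) T' T)"

definition point_extension :: "'a set \<Rightarrow> 'a rel set \<Rightarrow> 'a list \<Rightarrow> 'a rel set" where
  "point_extension \<Omega> S x = (THE T. is_point_extension \<Omega> S x T)"

definition extendable_at ::
    "'a set \<Rightarrow> 'a rel set \<Rightarrow> ('a rel \<Rightarrow> 'a rel) \<Rightarrow> 'a list \<Rightarrow> bool" where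
  "extendable_at \<Omega> S \<phi> x \<longleftrightarrow>
     (\<exists>x'. length x' = length x \<and> set x' \<subseteq> \<Omega> \<and>
       (\<exists>\<psi>. algebraic_isomorphism (point_extension \<Omega> S x) (point_extension \<Omega> S x') \<psi> \<and>
            (\<forall>s\<in>S. extend_to_unions (point_extension \<Omega> S x) \<psi> s = \<phi> s) \<and>
            (\<forall>i<length x. \<psi> {(x ! i, x ! i)} = {(x' ! i, x' ! i)})))"

lemma partition_on_eqI:
  "partition_on A S \<Longrightarrow> u \<in> S \<Longrightarrow> v \<in> S \<Longrightarrow> z \<in> u \<Longrightarrow> z \<in> v \<Longrightarrow> u = v"
  unfolding partition_on_def disjoint_def by (metis Int_iff empty_iff)

lemma union_of_basis_alt:
  assumes "partition_on A S"
  shows "union_of_basis S R \<longleftrightarrow> R \<subseteq> A \<and> (\<forall>s\<in>S. s \<inter> R \<noteq> {} \<longrightarrow> s \<subseteq> R)"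
proof
  assume "union_of_basis S R"
  then obtain T where T: "T \<subseteq> S" "R = \<Union>T"
    unfolding union_of_basis_def by blast
  show "R \<subseteq> A \<and> (\<forall>s\<in>S. s \<inter> R \<noteq> {} \<longrightarrow> s \<subseteq> R)"
  proof (intro conjI ballI impI)
    show "R \<subseteq> A" using T assms by (auto simp: partition_on_def)
  next
    fix s assume s: "s \<in> S" "s \<inter> R \<noteq> {}"
    then obtain t z where "t \<in> T" "z \<in> s" "z \<in> t" using T by blast
    then have "s = t" using partition_on_eqI[OF assms] s T by blast
    then show "s \<subseteq> R" using T \<open>t \<in> T\<close> by blast
  qed
next
  assume R: "R \<subseteq> A \<and> (\<forall>s\<in>S. s \<inter> R \<noteq> {} \<longrightarrow> s \<subseteq> R)"
  have "R \<subseteq> \<Union>{s\<in>S. s \<subseteq> R}"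
  proof
    fix z assume z: "z \<in> R"
    then obtain s where s: "s \<in> S" "z \<in> s" using R partition_onD1[OF assms] by blast
    then have "s \<inter> R \<noteq> {}" using z by blast
    then have "s \<subseteq> R" using R s by simp
    then show "z \<in> \<Union>{s\<in>S. s \<subseteq> R}" using s by auto
  qed
  then show "union_of_basis S R"
    unfolding union_of_basis_def by (intro exI[of _ "{s\<in>S. s \<subseteq> R}"]) auto
qed

lemma coherent_discrete:
  assumes "finite \<Omega>"
  shows "coherent_configuration \<Omega> ((\<lambda>p. {p}) ` (\<Omega> \<times> \<Omega>))"
proof -
  have "partition_on (\<Omega> \<times> \<Omega>) ((\<lambda>p. {p}) ` (\<Omega> \<times> \<Omega>))"
    by (auto simp: partition_on_def disjoint_def)
  moreover have "union_of_basis ((\<lambda>p. {p}) ` (\<Omega> \<times> \<Omega>)) (Id_on \<Omega>)"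
    unfolding union_of_basis_def by (rule exI[of _ "(\<lambda>p. {p}) ` Id_on \<Omega>"]) auto
  ultimately show ?thesis
    using assms unfolding coherent_configuration_def by auto
qed

lemma coherent_card_unions:
  assumes S: "coherent_configuration \<Omega> S" and R: "union_of_basis S R" and Q: "union_of_basis S Q"
    and t: "t \<in> S" and p: "(\<alpha>, \<beta>) \<in> t" and q: "(\<alpha>', \<beta>') \<in> t"
  shows "card {\<gamma>. (\<alpha>, \<gamma>) \<in> R \<and> (\<gamma>, \<beta>) \<in> Q} = card {\<gamma>. (\<alpha>', \<gamma>) \<in> R \<and> (\<gamma>, \<beta>') \<in> Q}"
proof -
  obtain A B where A: "A \<subseteq> S" "R = \<Union>A" and B: "B \<subseteq> S" "Q = \<Union>B"
    using R Q unfolding union_of_basis_def by blast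
  have part: "partition_on (\<Omega> \<times> \<Omega>) S" and fin: "finite \<Omega>"
    using S unfolding coherent_configuration_def by auto
  have finS: "finite S" using finite_elements[OF _ part] fin by simp
  define W where "W a b rs = {\<gamma>. (a, \<gamma>) \<in> fst rs \<and> (\<gamma>, b) \<in> snd rs}"
    for a b :: 'a and rs :: "'a rel \<times> 'a rel"
  have sub: "s \<subseteq> \<Omega> \<times> \<Omega>" if "s \<in> S" for s using part that by (auto simp: partition_on_def)
  have eq: "card {\<gamma>. (a, \<gamma>) \<in> R \<and> (\<gamma>, b) \<in> Q} = (\<Sum>rs\<in>A \<times> B. card (W a b rs))" for a b
  proof -
    have "{\<gamma>. (a, \<gamma>) \<in> R \<and> (\<gamma>, b) \<in> Q} = (\<Union>rs\<in>A \<times> B. W a b rs)"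
      using A B by (auto simp: W_def)
    moreover have "card (\<Union>rs\<in>A \<times> B. W a b rs) = (\<Sum>rs\<in>A \<times> B. card (W a b rs))"
    proof (rule card_UN_disjoint)
      show "finite (A \<times> B)" using A B finS finite_subset by blast
      show "\<forall>rs\<in>A \<times> B. finite (W a b rs)"
      proof
        fix rs assume "rs \<in> A \<times> B"
        then have "W a b rs \<subseteq> \<Omega>" using sub A B unfolding W_def by fastforce
        then show "finite (W a b rs)" using fin finite_subset by blast
      qed
      have *: "u = v" if "u \<in> S" "v \<in> S" "z \<in> u" "z \<in> v" for u v z
        using partition_on_eqI[OF part] that by blast
      show "\<forall>i\<in>A \<times> B. \<forall>j\<in>A \<times> B. i \<noteq> j \<longrightarrow> W a b i \<inter> W a b j = {}"
      proof (intro ballI impI)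
        fix i j assume ij: "i \<in> A \<times> B" "j \<in> A \<times> B" "i \<noteq> j"
        have "i = j" if "\<gamma> \<in> W a b i" "\<gamma> \<in> W a b j" for \<gamma>
        proof (rule prod_eqI)
          show "fst i = fst j"
            using ij that A(1) by (intro *[of _ _ "(a, \<gamma>)"]) (auto simp: W_def)
          show "snd i = snd j"
            using ij that B(1) by (intro *[of _ _ "(\<gamma>, b)"]) (auto simp: W_def)
        qed
        then show "W a b i \<inter> W a b j = {}" using ij by blast
      qed
    qed
    ultimately show ?thesis by simp
  qed
  have "card (W \<alpha> \<beta> rs) = card (W \<alpha>' \<beta>' rs)" if "rs \<in> A \<times> B" for rs
  proof -
    have "fst rs \<in> S" "snd rs \<in> S" using that A B by auto
    then obtain c where
      c: "\<forall>(\<alpha>, \<beta>)\<in>t. card {\<gamma>. (\<alpha>, \<gamma>) \<in> fst rs \<and> (\<gamma>, \<beta>) \<in> snd rs} = c"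
      using S t unfolding coherent_configuration_def by meson
    then show ?thesis using bspec[OF c p] bspec[OF c q] by (simp add: W_def)
  qed
  then show ?thesis unfolding eq by simp
qed

lemma point_extension_unique:
  assumes S: "coherent_configuration \<Omega> S" and x: "set x \<subseteq> \<Omega>"
  shows "\<exists>!T. is_point_extension \<Omega> S x T"
proof -
  define F where "F = {T. fixes_points_refining \<Omega> S x T}"
  define \<A> where "\<A> = {R. R \<subseteq> \<Omega> \<times> \<Omega> \<and> (\<forall>T\<in>F. \<forall>t\<in>T. t \<inter> R \<noteq> {} \<longrightarrow> t \<subseteq> R)}"
  define atom where "atom p = \<Inter>{R\<in>\<A>. p \<in> R}" for p
  define M where "M = atom ` (\<Omega> \<times> \<Omega>)"
  have part: "partition_on (\<Omega> \<times> \<Omega>) S" and fin: "finite \<Omega>"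
    using S unfolding coherent_configuration_def by auto
  have coh: "coherent_configuration \<Omega> T" if "T \<in> F" for T
    using that by (auto simp: F_def fixes_points_refining_def)
  have partF: "partition_on (\<Omega> \<times> \<Omega>) T" if "T \<in> F" for T
    using coh[OF that] by (auto simp: coherent_configuration_def)
  have uni: "union_of_basis T R" if "T \<in> F" "R \<in> \<A>" for T R
    using that union_of_basis_alt[OF partF[OF that(1)]] by (auto simp: \<A>_def)
  have uniI: "R \<in> \<A>" if "R \<subseteq> \<Omega> \<times> \<Omega>" "\<And>T. T \<in> F \<Longrightarrow> union_of_basis T R" for R
    using that union_of_basis_alt[OF partF] by (auto simp: \<A>_def)
  have top: "\<Omega> \<times> \<Omega> \<in> \<A>" using partF by (auto simp: \<A>_def partition_on_def)
  have compl: "\<Omega> \<times> \<Omega> - R \<in> \<A>" if R: "R \<in> \<A>" for R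
  proof -
    have "t \<subseteq> \<Omega> \<times> \<Omega> - R" if T: "T \<in> F" "t \<in> T" "t \<inter> (\<Omega> \<times> \<Omega> - R) \<noteq> {}" for T t
    proof -
      have "t \<subseteq> \<Omega> \<times> \<Omega>" using partF[OF T(1)] T(2) by (auto simp: partition_on_def)
      moreover have "t \<inter> R = {}" using R T by (auto simp: \<A>_def)
      ultimately show ?thesis by blast
    qed
    then show ?thesis unfolding \<A>_def by blast
  qed
  have atomA: "atom p \<in> \<A>" if "p \<in> \<Omega> \<times> \<Omega>" for p
  proof -
    have "atom p \<subseteq> \<Omega> \<times> \<Omega>" using top that by (auto simp: atom_def)
    moreover have "t \<subseteq> atom p" if "T \<in> F" "t \<in> T" "t \<inter> atom p \<noteq> {}" for T t
      proof -
      obtain z where z: "z \<in> t" "z \<in> atom p"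
        using \<open>t \<inter> atom p \<noteq> {}\<close> by blast
      have "t \<subseteq> R" if R: "R \<in> \<A>" "p \<in> R" for R
      proof -
        have "z \<in> R" using z R by (auto simp: atom_def)
        then show ?thesis using R(1) z \<open>T \<in> F\<close> \<open>t \<in> T\<close> unfolding \<A>_def by blast
      qed
      then show ?thesis by (auto simp: atom_def)
    qed
    ultimately show ?thesis unfolding \<A>_def by blast
  qed
  have self: "p \<in> atom p" for p by (auto simp: atom_def)
  have least: "atom p \<subseteq> R" if "R \<in> \<A>" "p \<in> R" for p R using that by (auto simp: atom_def)
  have dich: "atom p \<subseteq> R" if "R \<in> \<A>" "q \<in> atom p" "q \<in> R" "p \<in> \<Omega> \<times> \<Omega>" for p q R
  proof (cases "p \<in> R")
    case True
    then show ?thesis using least that by blast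
  next
    case False
    then have "atom p \<subseteq> \<Omega> \<times> \<Omega> - R" using least compl that by blast
    then show ?thesis using that by blast
  qed
  have partM: "partition_on (\<Omega> \<times> \<Omega>) M"
  proof (rule partition_onI)
    show "\<Union>M = \<Omega> \<times> \<Omega>" 
    proof
      show "\<Union>M \<subseteq> \<Omega> \<times> \<Omega>" using atomA by (auto simp: M_def \<A>_def)
      show "\<Omega> \<times> \<Omega> \<subseteq> \<Union>M" using self unfolding M_def by blast
    qed
    show "{} \<notin> M" using self unfolding M_def by (metis empty_iff imageE)
    show "disjnt u v" if uv: "u \<in> M" "v \<in> M" "u \<noteq> v" for u v
    proof (rule ccontr)
      obtain p q where pq: "p \<in> \<Omega> \<times> \<Omega>" "q \<in> \<Omega> \<times> \<Omega>" "u = atom p" "v = atom q"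
        using uv by (auto simp: M_def)
      assume "\<not> disjnt u v"
      then obtain z where z: "z \<in> u" "z \<in> v" by (auto simp: disjnt_def)
      have "u \<subseteq> v" using dich[OF atomA[OF pq(2)]] z pq by blast
      moreover have "v \<subseteq> u" using dich[OF atomA[OF pq(1)]] z pq by blast
      ultimately show False using uv by blast
    qed
  qed
  have uniM: "union_of_basis M R" if "R \<in> \<A>" for R
    unfolding union_of_basis_alt[OF partM]
  proof (intro conjI ballI impI)
    show "R \<subseteq> \<Omega> \<times> \<Omega>" using that by (auto simp: \<A>_def)
    fix s assume "s \<in> M" "s \<inter> R \<noteq> {}"
    then obtain p q where "p \<in> \<Omega> \<times> \<Omega>" "s = atom p" "q \<in> atom p" "q \<in> R"
      by (auto simp: M_def)
    then show "s \<subseteq> R" using dich that by blast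
  qed
  have MA: "m \<in> \<A>" if "m \<in> M" for m using that atomA by (auto simp: M_def)
  have convA: "R\<inverse> \<in> \<A>" if R: "R \<in> \<A>" for R
  proof (rule uniI)
    show "R\<inverse> \<subseteq> \<Omega> \<times> \<Omega>" using R by (auto simp: \<A>_def)
    fix T assume T: "T \<in> F"
    then obtain Q where Q: "Q \<subseteq> T" "R = \<Union>Q" using uni R unfolding union_of_basis_def by blast
    have "converse ` Q \<subseteq> T" using coh[OF T] Q by (auto simp: coherent_configuration_def)
    moreover have "R\<inverse> = \<Union>(converse ` Q)" using Q by auto
    ultimately show "union_of_basis T (R\<inverse>)" unfolding union_of_basis_def by blast
  qed
  have cohM: "coherent_configuration \<Omega> M"
    unfolding coherent_configuration_def
  proof (intro conjI ballI)
    show "finite \<Omega>" by fact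
    show "partition_on (\<Omega> \<times> \<Omega>) M" by fact
    show "union_of_basis M (Id_on \<Omega>)"
      by (rule uniM, rule uniI) (use coh in \<open>auto simp: coherent_configuration_def\<close>)
  next
    fix m assume "m \<in> M"
    then obtain p where p: "p \<in> \<Omega> \<times> \<Omega>" "m = atom p" by (auto simp: M_def)
    obtain a b where ab: "p = (a, b)" by fastforce
    have sub: "atom (b, a) \<subseteq> (atom (a, b))\<inverse>" if "(a, b) \<in> \<Omega> \<times> \<Omega>" for a b
      using that convA atomA self by (intro least) auto
    have "m\<inverse> = atom (b, a)" using sub[of a b] sub[of b a] p ab by auto
    then show "m\<inverse> \<in> M" using p ab by (auto simp: M_def)
  next
    fix r s t assume rst: "r \<in> M" "s \<in> M" "t \<in> M"
    obtain \<alpha> \<beta> where t: "t = atom (\<alpha>, \<beta>)" "(\<alpha>, \<beta>) \<in> \<Omega> \<times> \<Omega>" using rst by (auto simp: M_def)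
    define N where "N p = card {\<gamma>. (fst p, \<gamma>) \<in> r \<and> (\<gamma>, snd p) \<in> s}" for p
    define R where "R = {p \<in> \<Omega> \<times> \<Omega>. N p = N (\<alpha>, \<beta>)}"
    have "R \<in> \<A>"
    proof -
      have "u \<subseteq> R" if T: "T \<in> F" "u \<in> T" "u \<inter> R \<noteq> {}" for T u
      proof
        fix z assume z: "z \<in> u"
        obtain w where w: "w \<in> u" "w \<in> R" using T by blast
        have "N z = N w"
          using coherent_card_unions[OF coh[OF T(1)] uni[OF T(1) MA[OF rst(1)]]
              uni[OF T(1) MA[OF rst(2)]] T(2), of "fst z" "snd z" "fst w" "snd w"] z w
          by (simp add: N_def)
        moreover have "z \<in> \<Omega> \<times> \<Omega>" using partF[OF T(1)] T(2) z by (auto simp: partition_on_def)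
        ultimately show "z \<in> R" using w by (simp add: R_def)
      qed
      then show ?thesis unfolding \<A>_def R_def by blast
    qed
    then have "t \<subseteq> R" unfolding t(1) using t by (intro least) (auto simp: R_def)
    then show "\<exists>c. \<forall>(\<alpha>, \<beta>)\<in>t. card {\<gamma>. (\<alpha>, \<gamma>) \<in> r \<and> (\<gamma>, \<beta>) \<in> s} = c"
      by (intro exI[of _ "N (\<alpha>, \<beta>)"]) (auto simp: R_def N_def)
  qed
  have SA: "s \<in> \<A>" if s: "s \<in> S" for s
  proof -
    have "t \<subseteq> s" if T: "T \<in> F" "t \<in> T" "t \<inter> s \<noteq> {}" for T t
    proof -
      have "refines (\<Omega> \<times> \<Omega>) T S" using T(1) by (simp add: F_def fixes_points_refining_def)
      then obtain s' where s': "s' \<in> S" "t \<subseteq> s'" using T(2) unfolding refines_def by blast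
      moreover obtain z where "z \<in> t" "z \<in> s" using T by blast
      ultimately have "s' = s" using partition_on_eqI[OF part, of s' s z] s by blast
      then show ?thesis using s' by blast
    qed
    moreover have "s \<subseteq> \<Omega> \<times> \<Omega>" using part s by (auto simp: partition_on_def)
    ultimately show ?thesis unfolding \<A>_def by blast
  qed
  have refM: "refines (\<Omega> \<times> \<Omega>) M S"
    unfolding refines_def
  proof (intro conjI ballI)
    fix m assume "m \<in> M"
    then obtain p where p: "p \<in> \<Omega> \<times> \<Omega>" "m = atom p" by (auto simp: M_def)
    then obtain s where "s \<in> S" "p \<in> s" using part by (auto simp: partition_on_def)
    then show "\<exists>s\<in>S. m \<subseteq> s" using least SA p by blast
  qed (use part partM in auto)
  have fixM: "{(y, y)} \<in> M" if y: "y \<in> set x" for y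
  proof -
    have "{(y, y)} \<in> \<A>"
    proof (rule uniI)
      fix T assume "T \<in> F"
      then have "{(y, y)} \<in> T" using y by (auto simp: F_def fixes_points_refining_def)
      then show "union_of_basis T {(y, y)}"
        unfolding union_of_basis_def by (intro exI[of _ "{{(y, y)}}"]) auto
    qed (use x y in auto)
    then have "atom (y, y) = {(y, y)}" using least self by blast
    then show ?thesis using x y unfolding M_def by (metis image_eqI mem_Sigma_iff subsetD)
  qed
  have "refines (\<Omega> \<times> \<Omega>) T M" if T: "T \<in> F" for T
    unfolding refines_def
  proof (intro conjI ballI)
    fix t assume t: "t \<in> T"
    then obtain p where p: "p \<in> t" "p \<in> \<Omega> \<times> \<Omega>"
      using partF[OF T] unfolding partition_on_def by (metis UnionI ex_in_conv)
    have "t \<inter> atom p \<noteq> {}" using p self by blast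
    then have "t \<subseteq> atom p" using atomA[OF p(2)] T t unfolding \<A>_def by blast
    then show "\<exists>m\<in>M. t \<subseteq> m" using p by (auto simp: M_def)
  qed (use partM partF T in auto)
  then have "is_point_extension \<Omega> S x M"
    using cohM refM fixM by (auto simp: is_point_extension_def fixes_points_refining_def F_def)
  moreover have "T = T'" if "is_point_extension \<Omega> S x T" "is_point_extension \<Omega> S x T'" for T T'
    using that refines_asym unfolding is_point_extension_def by blast
  ultimately show ?thesis by blast
qed


section \<open>Circulant schemes and their sections\<close>

definition circulant_scheme :: "('a, 'b) monoid_scheme \<Rightarrow> 'a rel set \<Rightarrow> bool" where
  "circulant_scheme G S \<longleftrightarrow> group G \<and> cyclic_group G \<and> coherent_configuration (carrier G) S \<and>
     (\<forall>s\<in>S. \<forall>(\<alpha>, \<beta>)\<in>s. \<forall>g\<in>carrier G. (\<alpha> \<otimes>\<^bsub>G\<^esub> g, \<beta> \<otimes>\<^bsub>G\<^esub> g) \<in> s)"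

text \<open>The coset partition is identified with the equivalence relation it defines.\<close>

definition scheme_subgroup :: "('a, 'b) monoid_scheme \<Rightarrow> 'a rel set \<Rightarrow> 'a set \<Rightarrow> bool" where
  "scheme_subgroup G S H \<longleftrightarrow>
     subgroup H G \<and> union_of_basis S (\<Union>C\<in>rcosets\<^bsub>G\<^esub> H. C \<times> C)"

text \<open>A section \<open>U/L\<close> is represented by the pair \<open>(U, L)\<close>.\<close>

type_synonym 'a sec = "'a set \<times> 'a set"

definition Sec1 :: "('a, 'b) monoid_scheme \<Rightarrow> 'a rel set \<Rightarrow> 'a sec set" where
  "Sec1 G S = {(U, L). scheme_subgroup G S U \<and> scheme_subgroup G S L \<and> L \<subseteq> U}"

definition sec_group :: "('a, 'b) monoid_scheme \<Rightarrow> 'a sec \<Rightarrow> 'a set monoid" where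
  "sec_group G = (\<lambda>(U, L). G\<lparr>carrier := U\<rparr> Mod L)"

definition sec_rel :: "('a, 'b) monoid_scheme \<Rightarrow> 'a sec \<Rightarrow> 'a rel \<Rightarrow> 'a set rel" where
  "sec_rel G \<SS> s =
     {(\<Gamma>, \<Gamma>') \<in> carrier (sec_group G \<SS>) \<times> carrier (sec_group G \<SS>). s \<inter> (\<Gamma> \<times> \<Gamma>') \<noteq> {}}"

definition sec_scheme ::
    "('a, 'b) monoid_scheme \<Rightarrow> 'a rel set \<Rightarrow> 'a sec \<Rightarrow> 'a set rel set" where
  "sec_scheme G S \<SS> = sec_rel G \<SS> ` {s \<in> S. s \<inter> (fst \<SS> \<times> fst \<SS>) \<noteq> {}}"

definition subsection_of :: "'a sec \<Rightarrow> 'a sec \<Rightarrow> bool" where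
  "subsection_of = (\<lambda>(U, L) (U', L'). L' \<subseteq> L \<and> L \<subseteq> U \<and> U \<subseteq> U')"

definition right_translations :: "('a, 'b) monoid_scheme \<Rightarrow> ('a \<Rightarrow> 'a) set" where
  "right_translations K = (\<lambda>k. \<lambda>a\<in>carrier K. a \<otimes>\<^bsub>K\<^esub> k) ` carrier K"

definition normal_scheme :: "('a, 'b) monoid_scheme \<Rightarrow> 'a rel set \<Rightarrow> bool" where
  "normal_scheme K S \<longleftrightarrow> right_translations K \<lhd> Aut_configuration (carrier K) S"

definition trivial_sec :: "('a, 'b) monoid_scheme \<Rightarrow> 'a rel set \<Rightarrow> 'a sec \<Rightarrow> bool" where
  "trivial_sec G S \<SS> \<longleftrightarrow>
     trivial_configuration (carrier (sec_group G \<SS>)) (sec_scheme G S \<SS>)"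

definition normal_sec :: "('a, 'b) monoid_scheme \<Rightarrow> 'a rel set \<Rightarrow> 'a sec \<Rightarrow> bool" where
  "normal_sec G S \<SS> \<longleftrightarrow> normal_scheme (sec_group G \<SS>) (sec_scheme G S \<SS>)"

definition multiple_of :: "('a, 'b) monoid_scheme \<Rightarrow> 'a sec \<Rightarrow> 'a sec \<Rightarrow> bool" where
  "multiple_of G = (\<lambda>(U, L) (U', L'). L' = U' \<inter> L \<and> U = U' <#>\<^bsub>G\<^esub> L)"

definition projectively_equivalent ::
    "('a, 'b) monoid_scheme \<Rightarrow> 'a rel set \<Rightarrow> 'a sec \<Rightarrow> 'a sec \<Rightarrow> bool" where
  "projectively_equivalent G S \<SS> \<TT> \<longleftrightarrow> \<SS> \<in> Sec1 G S \<and> \<TT> \<in> Sec1 G S \<and>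
     equivclp (\<lambda>A B. A \<in> Sec1 G S \<and> B \<in> Sec1 G S \<and> multiple_of G A B) \<SS> \<TT>"

definition quasinormal :: "('a, 'b) monoid_scheme \<Rightarrow> 'a rel set \<Rightarrow> bool" where
  "quasinormal G S \<longleftrightarrow>
     (\<forall>\<SS>\<in>Sec1 G S. trivial_sec G S \<SS> \<longrightarrow>
        (\<exists>\<NN>\<in>Sec1 G S. normal_sec G S \<NN> \<and>
          (\<exists>\<TT>\<in>Sec1 G S. subsection_of \<TT> \<NN> \<and> projectively_equivalent G S \<SS> \<TT>)))"

text \<open>The library forms quotients from the cosets \<open>Lg\<close>, which agree with \<open>gL\<close> because
  cyclic groups are abelian.\<close>

definition sec_elem :: "('a, 'b) monoid_scheme \<Rightarrow> 'a sec \<Rightarrow> 'a \<Rightarrow> 'a set" where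
  "sec_elem G = (\<lambda>(U, L) g. if g \<in> U then g <#\<^bsub>G\<^esub> L else {})"

text \<open>Whether order \<open>1\<close> counts as a prime power is immaterial: the identity generates the group
  of order \<open>1\<close>.\<close>

definition base_tuple :: "('a, 'b) monoid_scheme \<Rightarrow> 'a rel set \<Rightarrow> 'a list \<Rightarrow> bool" where
  "base_tuple G S x \<longleftrightarrow> set x \<subseteq> carrier G \<and> \<one>\<^bsub>G\<^esub> \<in> set x \<and>
     (\<forall>\<SS>\<in>Sec1 G S. (\<exists>p k. Factorial_Ring.prime (p :: nat) \<and> order (sec_group G \<SS>) = p ^ k) \<longrightarrow>
        (\<exists>g\<in>set x \<inter> fst \<SS>.
           carrier (sec_group G \<SS>) = generate (sec_group G \<SS>) {sec_elem G \<SS> g}))"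

end

theory Submission
  imports Defs "HOL-Number_Theory.Number_Theory" "HOL-Computational_Algebra.Polynomial"
begin

text \<open>Identify \<open>G\<close> with \<open>Z/N\<close>, let \<open>c x\<close> be the basis relation of the pairs with difference \<open>x\<close>, and
  let \<open>c'\<close> be its pullback along \<open>\<phi>\<close>. A permutation \<open>f\<close> induces \<open>\<phi>\<close> iff \<open>c' (f b - f a) = c (b - a)\<close> for all
  \<open>a\<close>, \<open>b\<close>. Consider a class of \<open>c\<close> in the section between the subgroup that it generates and its group of
  periods. Up to direct summands of composite order on which the scheme is trivial, it consists of generators
  of the section, and all subgroups of that section are unions of classes. On such a section
  \<open>\<phi>\<close> acts on the class as a multiplier, which a base point determines; where the order of the
  section is divisible by \<open>p\<^sup>2\<close>, the whole extension of \<open>\<phi>\<close> is given by this multiplier modulo the power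
  of \<open>p\<close>. Hence the multipliers of different classes agree as far as their \<open>p\<close>-adic ranges overlap.
  They can therefore be interpolated by one function modulo each prime power dividing \<open>N\<close>, and \<open>f\<close> is obtained
  by the Chinese remainder theorem.\<close>

section \<open>Pairs of colourings of the integers modulo N\<close>

text \<open>Two facts carry the structure theory. Class functions are closed under convolution,
  which transports sums, translators and generated subgroups to the other side of the isomorphism.
  The Frobenius congruence for \<open>p\<close>-th convolution powers yields Schur's multipliers
  and, for \<open>p\<close> dividing \<open>N\<close>, the set \<open>frob\<close>. The obstacle is
  a class with trivial radical that does not consist of generators. It is almost invariant under
  translation by elements of order \<open>p\<close>; counting shows that it fills more than half of
  certain cosets, which leaves no room for its image under a multiplier and lets a trivial summand
  split off. A class of units is a coset of a multiplier group without nontrivial elements close to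
  \<open>1\<close>. This rigidity makes all subgroups unions of classes and, once
  \<open>p * p\<close> divides the order, extends the multiplier from units to the whole fibre.
  Where only the first power of \<open>p\<close> divides the order this fails, and multipliers can
  be compared only if they come from the same base point: \<open>bp\<close> chooses one for each
  prime and exponent. The prime \<open>2\<close> needs extra care, since squaring
  \<open>1 + 2 * s\<close> may come much closer to \<open>1\<close>.\<close>

definition periodic :: "int \<Rightarrow> (int \<Rightarrow> 'b) \<Rightarrow> bool" where
  "periodic N f \<longleftrightarrow> (\<forall>x y. N dvd x - y \<longrightarrow> f x = f y)"

definition conv :: "int \<Rightarrow> (int \<Rightarrow> int) \<Rightarrow> (int \<Rightarrow> int) \<Rightarrow> int \<Rightarrow> int" where
  "conv N f g x = (\<Sum>y\<in>{0..<N}. f y * g (x - y))"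

text \<open>With equal ranges of \<open>c\<close> and \<open>c'\<close> this makes \<open>f\<close>
  and \<open>f'\<close> functions of the class, \<open>f'\<close> being the transport of
  \<open>f\<close>. As a relation it can be reversed and needs no chosen representatives.\<close>

definition compat :: "(int \<Rightarrow> 'k) \<Rightarrow> (int \<Rightarrow> 'k) \<Rightarrow> (int \<Rightarrow> 'b) \<Rightarrow> (int \<Rightarrow> 'b) \<Rightarrow> bool" where
  "compat c c' f f' \<longleftrightarrow> (\<forall>x y. c x = c' y \<longrightarrow> f x = f' y)"

text \<open>A circulant scheme on \<open>Z/N\<close> together with an algebraic isomorphism: \<open>c x = c' y\<close> says that
  the isomorphism maps the class of \<open>x\<close> to the class of \<open>y\<close>.\<close>

definition spair :: "int \<Rightarrow> (int \<Rightarrow> 'k) \<Rightarrow> (int \<Rightarrow> 'k) \<Rightarrow> bool" where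
  "spair N c c' \<longleftrightarrow> 0 < N \<and> range c = range c' \<and> periodic N c \<and> periodic N c' \<and>
     (\<forall>x y. c x = c' y \<longrightarrow> (N dvd x \<longleftrightarrow> N dvd y)) \<and>
     (\<forall>x y. c x = c' y \<longrightarrow> c (- x) = c' (- y)) \<and>
     (\<forall>f f' g g'. compat c c' f f' \<longrightarrow> compat c c' g g' \<longrightarrow> compat c c' (conv N f g) (conv N f' g'))"

text \<open>\<open>D\<close> is a union of classes of \<open>c\<close>, and \<open>D'\<close> is the
  corresponding union of classes of \<open>c'\<close>. So \<open>xset\<close> is the notion of an
  S-set of a Schur ring.\<close>

abbreviation xs :: "(int \<Rightarrow> 'k) \<Rightarrow> (int \<Rightarrow> 'k) \<Rightarrow> int set \<Rightarrow> int set \<Rightarrow> bool" where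
  "xs c c' D D' \<equiv> compat c c' (\<lambda>x. x \<in> D) (\<lambda>x. x \<in> D')"

abbreviation xset :: "(int \<Rightarrow> 'k) \<Rightarrow> int set \<Rightarrow> bool" where
  "xset c D \<equiv> xs c c D D"

definition splus :: "int set \<Rightarrow> int set \<Rightarrow> int set" where
  "splus A B = {a + b |a b. a \<in> A \<and> b \<in> B}"

definition mult :: "int \<Rightarrow> int set" where "mult d = {x. d dvd x}"

definition cl :: "(int \<Rightarrow> 'k) \<Rightarrow> int \<Rightarrow> int set" where "cl c k = {x. c x = c k}"

definition cnt :: "int \<Rightarrow> int set \<Rightarrow> int" where "cnt N D = (\<Sum>x\<in>{0..<N}. of_bool (x \<in> D))"

abbreviation pset :: "int \<Rightarrow> int set \<Rightarrow> bool" where "pset N D \<equiv> periodic N (\<lambda>x. x \<in> D)"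

lemma mult_iff [simp]: "x \<in> mult d \<longleftrightarrow> d dvd x" by (simp add: mult_def)
lemma cl_iff [simp]: "x \<in> cl c k \<longleftrightarrow> c x = c k" by (simp add: cl_def)

lemma periodicD: "periodic N f \<Longrightarrow> N dvd x - y \<Longrightarrow> f x = f y" by (simp add: periodic_def)

lemma periodic_mod: "periodic N f \<Longrightarrow> f (x mod N) = f x"
  by (rule periodicD) (auto simp: mod_eq_dvd_iff[symmetric])

section \<open>Counting residues and transporting unions of classes\<close>

lemma sum_reindex_mod:
  assumes N: "0 < (N::int)" and f: "periodic N f" and h: "\<And>x y. N dvd h x - h y \<Longrightarrow> N dvd x - y"
  shows "(\<Sum>x\<in>{0..<N}. f (h x)) = (\<Sum>x\<in>{0..<N}. f x)"
proof -
  have inj: "inj_on (\<lambda>x. h x mod N) {0..<N}"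
  proof (rule inj_onI)
    fix x y assume xy: "x \<in> {0..<N}" "y \<in> {0..<N}" "h x mod N = h y mod N"
    then have "N dvd x - y" using h by (simp add: mod_eq_dvd_iff)
    then have "x mod N = y mod N" by (simp add: mod_eq_dvd_iff)
    then show "x = y" using xy by simp
  qed
  have im: "(\<lambda>x. h x mod N) ` {0..<N} = {0..<N}"
    by (rule endo_inj_surj[OF _ _ inj]) (use N in auto)
  have "(\<Sum>x\<in>{0..<N}. f (h x)) = (\<Sum>x\<in>{0..<N}. f (h x mod N))"
    using periodic_mod[OF f] by simp
  also have "\<dots> = (\<Sum>x\<in>(\<lambda>x. h x mod N) ` {0..<N}. f x)"
    using sum.reindex[OF inj, of f] by simp
  finally show ?thesis using im by simp
qed

lemma sum_shift: "0 < (N::int) \<Longrightarrow> periodic N f \<Longrightarrow> (\<Sum>x\<in>{0..<N}. f (x + a)) = (\<Sum>x\<in>{0..<N}. f x)"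
  by (rule sum_reindex_mod) auto

lemma sum_refl: "0 < (N::int) \<Longrightarrow> periodic N f \<Longrightarrow> (\<Sum>x\<in>{0..<N}. f (a - x)) = (\<Sum>x\<in>{0..<N}. f x)"
  by (rule sum_reindex_mod) (auto simp: dvd_diff_commute)

lemma sum_unit: "0 < (N::int) \<Longrightarrow> periodic N f \<Longrightarrow> coprime a N \<Longrightarrow>
    (\<Sum>x\<in>{0..<N}. f (a * x)) = (\<Sum>x\<in>{0..<N}. f x)"
  by (rule sum_reindex_mod)
    (auto simp flip: right_diff_distrib simp: coprime_commute coprime_dvd_mult_right_iff)

lemma compatD: "compat c c' f f' \<Longrightarrow> c x = c' y \<Longrightarrow> f x = f' y" by (simp add: compat_def)

lemma xsD: "xs c c' D D' \<Longrightarrow> c x = c' y \<Longrightarrow> x \<in> D \<longleftrightarrow> y \<in> D'" by (simp add: compat_def)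

lemma compat_comp: "compat c c' f f' \<Longrightarrow> compat c c' (\<lambda>x. h (f x)) (\<lambda>x. h (f' x))"
  unfolding compat_def by metis

lemma spair_pos: "spair N c c' \<Longrightarrow> 0 < N" by (simp add: spair_def)
lemma spair_per: "spair N c c' \<Longrightarrow> periodic N c" by (simp add: spair_def)
lemma spair_per': "spair N c c' \<Longrightarrow> periodic N c'" by (simp add: spair_def)
lemma spair_eq: "spair N c c' \<Longrightarrow> N dvd x - y \<Longrightarrow> c x = c y" using spair_per periodicD by metis
lemma spair_zero: "spair N c c' \<Longrightarrow> c x = c' y \<Longrightarrow> N dvd x \<longleftrightarrow> N dvd y" by (simp add: spair_def)
lemma spair_neg: "spair N c c' \<Longrightarrow> c x = c' y \<Longrightarrow> c (- x) = c' (- y)" by (simp add: spair_def)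
lemma spair_conv: "spair N c c' \<Longrightarrow> compat c c' f f' \<Longrightarrow> compat c c' g g' \<Longrightarrow>
    compat c c' (conv N f g) (conv N f' g')"
  by (simp add: spair_def)

lemma spair_ex: assumes "spair N c c'" obtains y where "c x = c' y"
proof -
  have "c x \<in> range c'" using assms unfolding spair_def by (metis rangeI)
  then show ?thesis using that by auto
qed

lemma spair_ex': assumes "spair N c c'" obtains x where "c x = c' y"
proof -
  have "c' y \<in> range c" using assms unfolding spair_def by (metis rangeI)
  then show ?thesis using that by auto
qed

lemma compat_sym: "compat c c' f f' \<Longrightarrow> compat c' c f' f" unfolding compat_def by metis

lemma spair_sym: assumes "spair N c c'" shows "spair N c' c"
proof -
  have "compat c' c (conv N f g) (conv N f' g')" if "compat c' c f f'" "compat c' c g g'" for f f' g g'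
    using spair_conv[OF assms compat_sym[OF that(1)] compat_sym[OF that(2)]] by (rule compat_sym)
  moreover have "\<forall>x y. c' x = c y \<longrightarrow> (N dvd x \<longleftrightarrow> N dvd y)" "\<forall>x y. c' x = c y \<longrightarrow> c' (- x) = c (- y)"
    using spair_zero[OF assms] spair_neg[OF assms] by metis+
  ultimately show ?thesis using assms unfolding spair_def by metis
qed

lemma compat_complete:
  assumes S: "spair N c c'" and f: "compat c c f f"
  obtains f' where "compat c c' f f'"
proof
  define f' where "f' y = f (SOME x. c x = c' y)" for y
  have "c (SOME x. c x = c' y) = c' y" for y by (metis (mono_tags) S someI_ex spair_ex')
  then show "compat c c' f f'" using f unfolding compat_def f'_def by metis
qed

lemma compat_left: assumes "spair N c c'" "compat c c' f f'" shows "compat c c f f"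
  using assms unfolding compat_def by (metis spair_ex)

lemma spair_left: assumes S: "spair N c c'" shows "spair N c c"
proof -
  have "compat c c (conv N f g) (conv N f2 g2)" if fg: "compat c c f f2" "compat c c g g2" for f g f2 g2
  proof -
    have [simp]: "f2 = f" "g2 = g" using fg unfolding compat_def by (metis ext)+
    obtain f' where f': "compat c c' f f'" using fg compat_complete[OF S] by auto
    obtain g' where g': "compat c c' g g'" using fg compat_complete[OF S] by auto
    show ?thesis using compat_left[OF S spair_conv[OF S f' g']] by simp
  qed
  moreover have "\<forall>x y. c x = c y \<longrightarrow> (N dvd x \<longleftrightarrow> N dvd y)" "\<forall>x y. c x = c y \<longrightarrow> c (- x) = c (- y)"
    by (metis S spair_ex spair_zero, metis S spair_ex spair_neg)
  ultimately show ?thesis using S unfolding spair_def by metis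
qed

lemma spair_right: "spair N c c' \<Longrightarrow> spair N c' c'" using spair_left spair_sym by metis

lemma compat_per: assumes S: "spair N c c'" and f: "compat c c' f f'" shows "periodic N f"
  unfolding periodic_def
proof (intro allI impI)
  fix x y assume "N dvd x - y"
  then have "c x = c y" using spair_eq[OF S] by simp
  then show "f x = f y" by (rule compatD[OF compat_left[OF S f]])
qed

lemma compat_per': assumes S: "spair N c c'" and f: "compat c c' f f'" shows "periodic N f'"
  using compat_per[OF spair_sym[OF S] compat_sym[OF f]] .

lemma spair_00: assumes S: "spair N c c'" shows "c 0 = c' 0"
proof -
  obtain y where y: "c 0 = c' y" using spair_ex[OF S] .
  then have "N dvd y" using spair_zero[OF S y] by simp
  then have "c' y = c' 0" using periodicD[OF spair_per'[OF S]] by simp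
  then show ?thesis using y by simp
qed

lemma xs_Un: "xs c c' A A' \<Longrightarrow> xs c c' B B' \<Longrightarrow> xs c c' (A \<union> B) (A' \<union> B')"
  unfolding compat_def by blast
lemma xs_Int: "xs c c' A A' \<Longrightarrow> xs c c' B B' \<Longrightarrow> xs c c' (A \<inter> B) (A' \<inter> B')"
  unfolding compat_def by blast
lemma xs_Diff: "xs c c' A A' \<Longrightarrow> xs c c' B B' \<Longrightarrow> xs c c' (A - B) (A' - B')"
  unfolding compat_def by blast
lemma xs_UN: "(\<And>i. i \<in> I \<Longrightarrow> xs c c' (A i) (A' i)) \<Longrightarrow> xs c c' (\<Union>i\<in>I. A i) (\<Union>i\<in>I. A' i)"
  unfolding compat_def by blast
lemma xs_Compl: "xs c c' A A' \<Longrightarrow> xs c c' (- A) (- A')"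
  unfolding compat_def by blast
lemma xs_zero: "spair N c c' \<Longrightarrow> xs c c' (mult N) (mult N)"
  unfolding compat_def mult_iff using spair_zero by blast
lemma uminus_image_iff: "(x::int) \<in> uminus ` A \<longleftrightarrow> - x \<in> A"
proof
  show "x \<in> uminus ` A" if "- x \<in> A" using imageI[OF that, of uminus] by simp
qed auto

lemma xs_neg: assumes "spair N c c'" "xs c c' A A'" shows "xs c c' (uminus ` A) (uminus ` A')"
proof -
  have "x \<in> uminus ` A \<longleftrightarrow> y \<in> uminus ` A'" if "c x = c' y" for x y
    using xsD[OF assms(2) spair_neg[OF assms(1) that]] unfolding uminus_image_iff .
  then show ?thesis unfolding compat_def by metis
qed
lemma xs_cl: "c k = c' k' \<Longrightarrow> xs c c' (cl c k) (cl c' k')"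
  by (simp add: compat_def)

lemma conv_of_bool:
  "conv N (\<lambda>x. of_bool (x \<in> A)) (\<lambda>x. of_bool (x \<in> B)) x = cnt N {y. y \<in> A \<and> x - y \<in> B}"
  unfolding conv_def cnt_def by (rule sum.cong) auto

lemma compat_cnt:
  assumes "spair N c c'" "xs c c' A A'" "xs c c' B B'"
  shows "compat c c' (\<lambda>x. cnt N {y. y \<in> A \<and> x - y \<in> B}) (\<lambda>x. cnt N {y. y \<in> A' \<and> x - y \<in> B'})"
proof -
  have *: "compat c c' (\<lambda>x. of_bool (x \<in> A) :: int) (\<lambda>x. of_bool (x \<in> A'))" if "xs c c' A A'" for A A'
    using that unfolding compat_def by (intro allI impI arg_cong[of _ _ of_bool]) blast
  show ?thesis
    using spair_conv[OF assms(1) *[OF assms(2)] *[OF assms(3)]] unfolding compat_def conv_of_bool .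
qed

lemma cnt_empty [simp]: "cnt N {} = 0" by (simp add: cnt_def)

lemma cnt_zero_iff: assumes "0 < N" "pset N D" shows "cnt N D = 0 \<longleftrightarrow> D = {}"
proof
  assume "cnt N D = 0"
  then have "\<forall>x\<in>{0..<N}. of_bool (x \<in> D) = (0::int)"
    unfolding cnt_def by (subst (asm) sum_nonneg_eq_0_iff) auto
  then have "\<forall>x\<in>{0..<N}. x \<notin> D" by (metis of_bool_eq_0_iff)
  then have "x mod N \<notin> D" for x using assms(1) by simp
  then show "D = {}" using periodic_mod[OF assms(2)] by blast
qed (simp add: cnt_def)

lemma cnt_mono: "(\<And>x. x \<in> A \<Longrightarrow> x \<in> B) \<Longrightarrow> cnt N A \<le> cnt N B"
  unfolding cnt_def by (rule sum_mono) auto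

lemma cnt_nonneg: "0 \<le> cnt N A" unfolding cnt_def by (rule sum_nonneg) auto

lemma cnt_Un: "A \<inter> B = {} \<Longrightarrow> cnt N (A \<union> B) = cnt N A + cnt N B"
  unfolding cnt_def sum.distrib[symmetric] by (rule sum.cong) (auto simp: of_bool_def)

lemma cnt_Diff: "B \<subseteq> A \<Longrightarrow> cnt N (A - B) = cnt N A - cnt N B"
  using cnt_Un[of B "A - B" N] by (simp add: Un_absorb1)

lemma pset_Int: "pset N A \<Longrightarrow> pset N B \<Longrightarrow> pset N (A \<inter> B)" unfolding periodic_def by blast
lemma pset_Diff: "pset N A \<Longrightarrow> pset N B \<Longrightarrow> pset N (A - B)" unfolding periodic_def by blast
lemma pset_mult: assumes "d dvd N" shows "pset N (mult d)"
proof -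
  have "d dvd x \<longleftrightarrow> d dvd y" if "N dvd x - y" for x y
    using dvd_add_right_iff[OF dvd_trans[OF assms that], of y] by simp
  then show ?thesis unfolding periodic_def mult_iff by blast
qed

lemma cnt_subset_eq:
  assumes N: "0 < N" "pset N A" "pset N B" "A \<subseteq> B" "cnt N A = cnt N B" shows "A = B"
proof -
  have "cnt N (B - A) = 0" using cnt_Diff[OF assms(4)] assms(5) by simp
  then have "B - A = {}" using cnt_zero_iff[of N "B - A"] assms pset_Diff by blast
  then show ?thesis using assms by auto
qed

lemma pset_of_bool: "pset N A \<Longrightarrow> periodic N (\<lambda>x. of_bool (x \<in> A) :: int)"
  unfolding periodic_def by (intro allI impI arg_cong[of _ _ of_bool]) blast

lemma cnt_shift: assumes "0 < N" "pset N A" shows "cnt N {x. x + a \<in> A} = cnt N A"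
  unfolding cnt_def using sum_shift[OF assms(1) pset_of_bool[OF assms(2)], of a] by simp

lemma cnt_refl: assumes "0 < N" "pset N A" shows "cnt N {x. a - x \<in> A} = cnt N A"
  unfolding cnt_def using sum_refl[OF assms(1) pset_of_bool[OF assms(2)], of a] by simp

lemma cnt_unit: assumes "0 < N" "pset N A" "coprime a N" shows "cnt N {x. a * x \<in> A} = cnt N A"
  unfolding cnt_def using sum_unit[OF assms(1) pset_of_bool[OF assms(2)] assms(3)] by simp

lemma xs_per: "spair N c c' \<Longrightarrow> xs c c' A A' \<Longrightarrow> pset N A" by (rule compat_per)
lemma xs_per': "spair N c c' \<Longrightarrow> xs c c' A A' \<Longrightarrow> pset N A'" by (rule compat_per')

lemma xs_cnt_eq: assumes S: "spair N c c'" and A: "xs c c' A A'" shows "cnt N A = cnt N A'"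
proof -
  have U: "xs c c' UNIV UNIV" by (simp add: compat_def)
  have "cnt N {y. y \<in> UNIV \<and> 0 - y \<in> A} = cnt N {y. y \<in> UNIV \<and> 0 - y \<in> A'}"
    using compatD[OF compat_cnt[OF S U A] spair_00[OF S]] .
  then show ?thesis
    using cnt_refl[OF spair_pos[OF S] xs_per[OF S A], of 0] cnt_refl[OF spair_pos[OF S] xs_per'[OF S A], of 0]
    by simp
qed

text \<open>The sumset is the support of the convolution of the two indicator functions. The
  coefficients are numbers of representations, so nothing cancels.\<close>

lemma xs_splus: assumes S: "spair N c c'" and A: "xs c c' A A'" and B: "xs c c' B B'"
  shows "xs c c' (splus A B) (splus A' B')"
proof -
  have *: "x \<in> splus A B \<longleftrightarrow> cnt N {y. y \<in> A \<and> x - y \<in> B} \<noteq> 0" if "pset N A" "pset N B" for A B x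
  proof -
    have "pset N {y. y \<in> A \<and> x - y \<in> B}"
    proof -
      have "a \<in> A \<longleftrightarrow> b \<in> A" "x - a \<in> B \<longleftrightarrow> x - b \<in> B" if d: "N dvd a - b" for a b
      proof -
        show "a \<in> A \<longleftrightarrow> b \<in> A" by (rule periodicD[OF \<open>pset N A\<close> d])
        have "N dvd (x - a) - (x - b)" using d by (simp add: dvd_diff_commute)
        then show "x - a \<in> B \<longleftrightarrow> x - b \<in> B" by (rule periodicD[OF \<open>pset N B\<close>])
      qed
      then show ?thesis unfolding periodic_def by blast
    qed
    then have "cnt N {y. y \<in> A \<and> x - y \<in> B} \<noteq> 0 \<longleftrightarrow> {y. y \<in> A \<and> x - y \<in> B} \<noteq> {}"
      using cnt_zero_iff spair_pos[OF S] by blast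
    also have "\<dots> \<longleftrightarrow> x \<in> splus A B"
      unfolding splus_def by (auto intro: exI[of _ "x - _"]) (metis add.commute diff_add_cancel)
    finally show ?thesis by simp
  qed
  show ?thesis
    unfolding *[OF xs_per[OF S A] xs_per[OF S B]] *[OF xs_per'[OF S A] xs_per'[OF S B]]
    by (rule compat_comp[OF compat_cnt[OF S A B]])
qed

definition trans_set :: "int set \<Rightarrow> int set \<Rightarrow> int set" where
  "trans_set A B = {w. \<forall>a\<in>A. w + a \<in> B}"

text \<open>An element \<open>w\<close> fails to translate \<open>A\<close> into \<open>B\<close>
  exactly if it is a sum of an element outside \<open>B\<close> and one of \<open>- A\<close>. Hence
  complements, negatives and sumsets suffice.\<close>

lemma xs_trans_set: assumes S: "spair N c c'" and A: "xs c c' A A'" and B: "xs c c' B B'"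
  shows "xs c c' (trans_set A B) (trans_set A' B')"
proof -
  have *: "trans_set A B = - splus (- B) (uminus ` A)" for A B
  proof (rule equalityI; rule subsetI)
    fix w assume w: "w \<in> trans_set A B"
    show "w \<in> - splus (- B) (uminus ` A)"
    proof
      assume "w \<in> splus (- B) (uminus ` A)"
      then obtain b a where "w = b + a" "b \<notin> B" "- a \<in> A" unfolding splus_def uminus_image_iff by blast
      then show False using w unfolding trans_set_def by force
    qed
  next
    fix w assume w: "w \<in> - splus (- B) (uminus ` A)"
    have "w + a \<in> B" if "a \<in> A" for a
    proof (rule ccontr)
      assume "w + a \<notin> B"
      moreover have "w = (w + a) + (- a)" by simp
      ultimately show False using w that unfolding splus_def by blast
    qed
    then show "w \<in> trans_set A B" unfolding trans_set_def by blast
  qed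
  show ?thesis unfolding * by (intro xs_Compl xs_splus[OF S] xs_neg[OF S] A B)
qed

section \<open>Subgroups\<close>

lemma mult_subset_iff: "mult a \<subseteq> mult b \<longleftrightarrow> b dvd a"
proof
  assume "mult a \<subseteq> mult b"
  then have "a \<in> mult b" by (rule subsetD) simp
  then show "b dvd a" by simp
next
  assume "b dvd a" then show "mult a \<subseteq> mult b" using dvd_trans[of b a] by (simp add: subset_iff)
qed

lemma int_subgroup:
  fixes S :: "int set"
  assumes 0: "0 \<in> S" and d: "\<And>x y. x \<in> S \<Longrightarrow> y \<in> S \<Longrightarrow> x - y \<in> S" and N: "N \<in> S" "0 < N"
  shows "S = mult (Gcd S)"
proof -
  define m where "m = (LEAST n. 0 < n \<and> int n \<in> S)"
  have ex: "0 < nat N \<and> int (nat N) \<in> S" using N by simp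
  then have m: "0 < m" "int m \<in> S" unfolding m_def by (metis (mono_tags, lifting) LeastI)+
  have least: "m \<le> n" if "0 < n" "int n \<in> S" for n unfolding m_def by (rule Least_le) (use that in simp)
  have neg: "- x \<in> S" if "x \<in> S" for x using d[OF 0 that] by simp
  have add: "x + y \<in> S" if "x \<in> S" "y \<in> S" for x y using d[OF that(1) neg[OF that(2)]] by simp
  have nm: "int n * int m \<in> S" for n
    by (induction n) (use 0 add m in \<open>auto simp: algebra_simps\<close>)
  have km: "k * int m \<in> S" for k
    by (cases k rule: int_cases2) (use nm[of "nat \<bar>k\<bar>"] neg in force)+
  have div: "int m dvd x" if "x \<in> S" for x
  proof -
    have "x mod int m \<in> S" using d[OF that km[of "x div int m"]] by (simp add: minus_div_mult_eq_mod)
    moreover have "0 \<le> x mod int m" "x mod int m < int m" using m by simp_all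
    ultimately have "x mod int m = 0"
      using least[of "nat (x mod int m)"] by (cases "x mod int m > 0") auto
    then show ?thesis by auto
  qed
  have 1: "Gcd S dvd int m" using m by (simp add: Gcd_dvd)
  have 2: "int m dvd Gcd S" using div by (simp add: Gcd_greatest)
  have "x \<in> S \<longleftrightarrow> Gcd S dvd x" for x
  proof
    assume "Gcd S dvd x" then have "int m dvd x" using 2 dvd_trans by blast
    then show "x \<in> S" using km by (metis dvdE mult.commute)
  qed (simp add: Gcd_dvd)
  then show ?thesis unfolding mult_def by blast
qed

text \<open>A subgroup of \<open>Z/N\<close> is given by the divisor of \<open>N\<close> that generates it: \<open>gn N D\<close> stands for the
  subgroup generated by \<open>D\<close>, \<open>rd D\<close> for the group of periods of \<open>D\<close>, and \<open>xdiv N c d\<close> says that the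
  subgroup is a union of classes.\<close>
definition gn :: "int \<Rightarrow> int set \<Rightarrow> int" where "gn N D = Gcd (insert N D)"

definition rd :: "int set \<Rightarrow> int" where "rd D = Gcd (trans_set D D)"

definition xdiv :: "int \<Rightarrow> (int \<Rightarrow> 'k) \<Rightarrow> int \<Rightarrow> bool" where
  "xdiv N c d \<longleftrightarrow> 0 < d \<and> d dvd N \<and> xset c (mult d)"

lemma gn_dvd: "gn N D dvd N" "x \<in> D \<Longrightarrow> gn N D dvd x"
  unfolding gn_def by (rule Gcd_dvd; simp)+

lemma gn_greatest: "d dvd N \<Longrightarrow> (\<And>x. x \<in> D \<Longrightarrow> d dvd x) \<Longrightarrow> d dvd gn N D"
  unfolding gn_def by (rule Gcd_greatest) auto

lemma gn_pos: "0 < N \<Longrightarrow> 0 < gn N D"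
  using gn_dvd(1)[of N D] by (metis Gcd_int_greater_eq_0 dvd_0_left gn_def not_less_iff_gr_or_eq order_less_le)

primrec sumset_iter :: "int \<Rightarrow> int set \<Rightarrow> nat \<Rightarrow> int set" where
  "sumset_iter N A 0 = mult N"
| "sumset_iter N A (Suc n) = splus (sumset_iter N A n) A"

text \<open>The generated subgroup is the union of the iterated sumsets of \<open>D\<close>,
  \<open>- D\<close> and the multiples of \<open>N\<close>, and each of these is
  transported.\<close>

lemma gen_xs:
  assumes S: "spair N c c'" and D: "xs c c' D D'"
  shows "xs c c' (mult (gn N D)) (mult (gn N D'))"
proof -
  define A where "A D = D \<union> uminus ` D \<union> mult N" for D
  define H where "H D = (\<Union>n. sumset_iter N (A D) n)" for D
  have A: "xs c c' (A D) (A D')"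
    unfolding A_def by (intro xs_Un D xs_neg[OF S] xs_zero[OF S])
  have it: "xs c c' (sumset_iter N (A D) n) (sumset_iter N (A D') n)" for n
    by (induction n) (use xs_zero[OF S] in \<open>simp_all add: xs_splus[OF S _ A] del: mult_iff\<close>)
  have "xs c c' (H D) (H D')" unfolding H_def by (rule xs_UN) (rule it)
  moreover have "H D = mult (gn N D)" for D
  proof -
    let ?I = "sumset_iter N (A D)"
    have negA: "- x \<in> A D" if "x \<in> A D" for x using that unfolding A_def by (auto simp: uminus_image_iff)
    have neg: "- x \<in> ?I n" if "x \<in> ?I n" for x n using that
    proof (induction n arbitrary: x)
      case (Suc n)
      then obtain y a where "x = y + a" "y \<in> ?I n" "a \<in> A D" by (auto simp: splus_def)
      then have "- x = - y + - a" "- y \<in> ?I n" "- a \<in> A D" using Suc.IH negA by auto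
      then show ?case unfolding sumset_iter.simps splus_def by blast
    qed simp
    have per: "x + y \<in> ?I n" if "x \<in> ?I n" "N dvd y" for x y n using that
    proof (induction n arbitrary: x)
      case (Suc n)
      then obtain z a where "x = z + a" "z \<in> ?I n" "a \<in> A D" by (auto simp: splus_def)
      then have "x + y = (z + y) + a" "z + y \<in> ?I n" "a \<in> A D" using Suc by auto
      then show ?case unfolding sumset_iter.simps splus_def by blast
    qed simp
    have add: "x + y \<in> ?I (m + n)" if "x \<in> ?I m" "y \<in> ?I n" for x y m n using that
    proof (induction n arbitrary: y)
      case (Suc n)
      then obtain z a where "y = z + a" "z \<in> ?I n" "a \<in> A D" by (auto simp: splus_def)
      then have "x + y = (x + z) + a" "x + z \<in> ?I (m + n)" "a \<in> A D" using Suc by auto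
      then show ?case unfolding add_Suc_right sumset_iter.simps splus_def by blast
    qed (simp add: per)
    have N: "N \<in> ?I 0" "0 \<in> ?I 0" by simp_all
    have eq: "H D = mult (Gcd (H D))"
    proof (rule int_subgroup)
      show "0 \<in> H D" "N \<in> H D" unfolding H_def using N by blast+
      show "0 < N" by (rule spair_pos[OF S])
      show "x - y \<in> H D" if xy: "x \<in> H D" "y \<in> H D" for x y
      proof -
        obtain m n where "x \<in> ?I m" "y \<in> ?I n" using xy unfolding H_def by blast
        then have "x + - y \<in> ?I (m + n)" using add neg by blast
        then show ?thesis unfolding H_def by auto
      qed
    qed
    have "gn N D dvd x" if "x \<in> ?I n" for x n using that
    proof (induction n arbitrary: x)
      case 0 then show ?case using gn_dvd(1)[of N D] by (auto intro: dvd_trans)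
    next
      case (Suc n)
      then obtain z a where "x = z + a" "z \<in> ?I n" "a \<in> A D" by (auto simp: splus_def)
      moreover have "gn N D dvd a"
      proof -
        have "a \<in> D \<or> - a \<in> D \<or> N dvd a" using \<open>a \<in> A D\<close> unfolding A_def by (simp add: uminus_image_iff)
        then show ?thesis using gn_dvd(2)[of a D N] gn_dvd(2)[of "- a" D N] dvd_trans[OF gn_dvd(1)[of N D]]
          by (metis dvd_minus_iff)
      qed
      ultimately show ?case using Suc.IH by simp
    qed
    then have 1: "gn N D dvd Gcd (H D)" unfolding H_def by (blast intro: Gcd_greatest)
    have "x \<in> H D" if "x \<in> D" for x
    proof -
      have "0 \<in> mult N" "x \<in> A D" using that unfolding A_def by simp_all
      then have "0 + x \<in> ?I (Suc 0)" unfolding sumset_iter.simps splus_def by blast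
      then show ?thesis unfolding H_def add_0 by blast
    qed
    moreover have "N \<in> H D" unfolding H_def using N(1) by blast
    ultimately have 2: "Gcd (H D) dvd gn N D" by (intro gn_greatest Gcd_dvd)
    have "mult (Gcd (H D)) = mult (gn N D)" using 1 2 by (simp add: mult_subset_iff subset_antisym)
    then show ?thesis using eq by simp
  qed
  ultimately show ?thesis by simp
qed

lemma cnt_mult: assumes "0 < d" "d dvd N" "0 < N" shows "cnt N (mult d) = N div d"
proof -
  have "cnt N (mult d) = int (card {x \<in> {0..<N}. d dvd x})"
    by (simp add: cnt_def Int_def conj_commute)
  also have "{x \<in> {0..<N}. d dvd x} = (*) d ` {0..<N div d}"
  proof (rule equalityI; rule subsetI)
    fix x assume "x \<in> {x \<in> {0..<N}. d dvd x}"
    then obtain k where k: "x = d * k" "0 \<le> d * k" "d * k < N" by auto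
    have "0 \<le> k" using k assms by (simp add: zero_le_mult_iff)
    moreover have "k < N div d" using k assms by (metis dvd_mult_div_cancel mult_less_cancel_left_pos)
    ultimately show "x \<in> (*) d ` {0..<N div d}" unfolding k(1) by (intro imageI) simp
  next
    fix x assume "x \<in> (*) d ` {0..<N div d}"
    then obtain k where k0: "x = d * k" "k \<in> {0..<N div d}" by (rule imageE)
    then have k: "x = d * k" "0 \<le> k" "k < N div d" by simp_all
    have "d * k < d * (N div d)" using k assms(1) by (simp only: mult_less_cancel_left_pos)
    then have "d * k < N" using assms by simp
    then show "x \<in> {x \<in> {0..<N}. d dvd x}" using k assms by auto
  qed
  also have "card \<dots> = nat (N div d)"
    using assms by (subst card_image) (auto simp: inj_on_def)
  finally show ?thesis using assms by (simp add: pos_imp_zdiv_nonneg_iff)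
qed

lemma div_eq_imp_eq: "(0::int) < N \<Longrightarrow> a dvd N \<Longrightarrow> b dvd N \<Longrightarrow> N div a = N div b \<Longrightarrow> a = b"
  by (metis dvd_div_mult_self mult_cancel_left mult_zero_left less_irrefl)

text \<open>Corresponding sets have equally many residues, and a subgroup of a cyclic group is
  determined by its order.\<close>

lemma gn_eq: assumes S: "spair N c c'" and D: "xs c c' D D'" shows "gn N D = gn N D'"
proof -
  have N: "0 < N" by (rule spair_pos[OF S])
  have "N div gn N D = N div gn N D'"
    using xs_cnt_eq[OF S gen_xs[OF S D]] by (simp add: cnt_mult N gn_pos gn_dvd)
  then show ?thesis using div_eq_imp_eq[OF N] gn_dvd(1) by blast
qed

text \<open>The image \<open>D'\<close> of the subgroup generates a subgroup of the same order,
  namely \<open>mult d\<close> itself, and has as many residues as \<open>mult d\<close>; so it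
  equals it. This is why one divisor can stand for a subgroup on both sides.\<close>

lemma xdiv_pair: assumes S: "spair N c c'" and d: "xdiv N c d" shows "xs c c' (mult d) (mult d)"
proof -
  define D' where "D' = {y. c' y \<in> c ` mult d}"
  have N: "0 < N" by (rule spair_pos[OF S])
  have d: "0 < d" "d dvd N" "xset c (mult d)" using d by (auto simp: xdiv_def)
  have "x \<in> mult d \<longleftrightarrow> y \<in> D'" if "c x = c' y" for x y
  proof
    assume "y \<in> D'"
    then have "c x \<in> c ` mult d" using that unfolding D'_def by simp
    then obtain z where "c x = c z" "z \<in> mult d" by (rule imageE)
    then show "x \<in> mult d" using xsD[OF d(3)] by blast
  next
    assume "x \<in> mult d"
    then have "c x \<in> c ` mult d" by (rule imageI)
    then show "y \<in> D'" using that unfolding D'_def by simp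
  qed
  then have x: "xs c c' (mult d) D'" unfolding compat_def by blast
  have "gn N (mult d) dvd d" by (rule gn_dvd(2)) simp
  moreover have "d dvd gn N (mult d)" by (rule gn_greatest[OF d(2)]) simp
  ultimately have "gn N (mult d) = d"
    by (rule zdvd_antisym_nonneg[rotated 2]) (use d(1) gn_pos[OF N, of "mult d"] in linarith)+
  then have g: "gn N D' = d" using gn_eq[OF S x] by simp
  have "D' \<subseteq> mult d" using gn_dvd(2)[of _ D' N] g by auto
  moreover have "cnt N D' = cnt N (mult d)" using xs_cnt_eq[OF S x] by simp
  ultimately have "D' = mult d" using cnt_subset_eq[OF N xs_per'[OF S x] pset_mult[OF d(2)]] by simp
  then show ?thesis using x by simp
qed

lemma xdiv_iff: "spair N c c' \<Longrightarrow> xdiv N c d \<Longrightarrow> c x = c' y \<Longrightarrow> d dvd x \<longleftrightarrow> d dvd y"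
  using xsD[OF xdiv_pair] by fastforce

lemma xdiv_pos: "xdiv N c d \<Longrightarrow> 0 < d" and xdiv_dvd: "xdiv N c d \<Longrightarrow> d dvd N"
  by (simp_all add: xdiv_def)

lemma xdivI: "0 < d \<Longrightarrow> d dvd N \<Longrightarrow> xset c (mult d) \<Longrightarrow> xdiv N c d" by (simp add: xdiv_def)

lemma xdiv_transfer: assumes S: "spair N c c'" and d: "xdiv N c d" shows "xdiv N c' d"
proof (rule xdivI)
  show "0 < d" "d dvd N" using d xdiv_pos xdiv_dvd by blast+
  show "xset c' (mult d)" by (rule compat_left[OF spair_sym[OF S] compat_sym[OF xdiv_pair[OF S d]]])
qed

lemma xdiv_gn: assumes S: "spair N c c" and "xset c D" shows "xdiv N c (gn N D)"
  by (rule xdivI) (use gn_pos spair_pos[OF S] gn_dvd gen_xs[OF assms] in auto)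

lemma xdiv_N: assumes S: "spair N c c" shows "xdiv N c N"
  by (rule xdivI) (use spair_pos[OF S] xs_zero[OF S] in auto)

lemma xdiv_1: assumes S: "spair N c c" shows "xdiv N c 1"
  by (rule xdivI) (simp_all add: mult_def compat_def)

lemma xdiv_lcm: assumes S: "spair N c c" and a: "xdiv N c a" and b: "xdiv N c b" shows "xdiv N c (lcm a b)"
proof (rule xdivI)
  have "mult (lcm a b) = mult a \<inter> mult b" unfolding mult_def by auto
  then show "xset c (mult (lcm a b))" using xs_Int a b unfolding xdiv_def by metis
qed (use a b in \<open>auto simp: xdiv_def lcm_pos_int\<close>)

lemma mult_gcd: "mult (gcd a b) = splus (mult a) (mult b)"
proof (rule equalityI; rule subsetI)
  fix x assume "x \<in> mult (gcd a b)"
  then obtain k where k: "x = gcd a b * k" by auto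
  obtain u v where uv: "u * a + v * b = gcd a b" using bezout_int by blast
  have "x = (u * a) * k + (v * b) * k" using k uv by (metis distrib_right)
  then show "x \<in> splus (mult a) (mult b)" unfolding splus_def mult_def by fastforce
next
  fix x assume "x \<in> splus (mult a) (mult b)"
  then obtain u v where "x = u + v" "a dvd u" "b dvd v" unfolding splus_def mult_def by blast
  then show "x \<in> mult (gcd a b)" unfolding mult_iff by (metis dvd_add gcd_dvd1 gcd_dvd2 dvd_trans)
qed

lemma xdiv_gcd: assumes S: "spair N c c" and a: "xdiv N c a" and b: "xdiv N c b" shows "xdiv N c (gcd a b)"
proof (rule xdivI)
  show "xset c (mult (gcd a b))" unfolding mult_gcd using xs_splus[OF S] a b unfolding xdiv_def by metis
  show "gcd a b dvd N" using a unfolding xdiv_def by (meson gcd_dvd1 dvd_trans)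
  show "0 < gcd a b" using a unfolding xdiv_def by (simp add: gcd_pos_int)
qed

section \<open>The group of periods of a set\<close>

context
  fixes N :: int and D :: "int set"
  assumes N: "0 < N" and D: "pset N D"
begin

lemma trans_iff: assumes "t \<in> trans_set D D" shows "x + t \<in> D \<longleftrightarrow> x \<in> D"
proof -
  have p: "pset N {x. x + t \<in> D}" unfolding periodic_def mem_Collect_eq
    by (intro allI impI periodicD[OF D]) simp
  have "D \<subseteq> {x. x + t \<in> D}" using assms unfolding trans_set_def by (auto simp: add.commute)
  then have "D = {x. x + t \<in> D}" using cnt_subset_eq[OF N D p] cnt_shift[OF N D, of t] by simp
  then show ?thesis by blast
qed

lemma trans_set_rd: "trans_set D D = mult (rd D)"
  unfolding rd_def
proof (rule int_subgroup)
  show "0 \<in> trans_set D D" by (simp add: trans_set_def)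
  show "N \<in> trans_set D D"
  proof -
    have "N + x \<in> D \<longleftrightarrow> x \<in> D" for x using periodicD[OF D, of "N + x" x] by simp
    then show ?thesis unfolding trans_set_def by blast
  qed
  show "0 < N" by (rule N)
  show "x - y \<in> trans_set D D" if "x \<in> trans_set D D" "y \<in> trans_set D D" for x y
  proof -
    have "x - y + a \<in> D" if "a \<in> D" for a
    proof -
      have "a + x \<in> D" using trans_iff \<open>x \<in> trans_set D D\<close> that by blast
      then show ?thesis using trans_iff[OF \<open>y \<in> trans_set D D\<close>, of "x - y + a"] by (simp add: add.commute)
    qed
    then show ?thesis unfolding trans_set_def by blast
  qed
qed

lemma rd_dvd: "rd D dvd N"
proof -
  have "N + x \<in> D \<longleftrightarrow> x \<in> D" for x using periodicD[OF D, of "N + x" x] by simp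
  then have "N \<in> trans_set D D" unfolding trans_set_def by blast
  then show ?thesis unfolding trans_set_rd by simp
qed

lemma rd_pos: "0 < rd D"
  using rd_dvd N unfolding rd_def by (metis Gcd_int_greater_eq_0 dvd_0_left order_less_le less_irrefl)

lemma rd_period: "rd D dvd t \<Longrightarrow> x + t \<in> D \<longleftrightarrow> x \<in> D"
  using trans_iff trans_set_rd by (metis mult_iff)

lemma rd_dvd_iff: "rd D dvd t \<longleftrightarrow> (\<forall>x\<in>D. x + t \<in> D)"
proof
  assume "\<forall>x\<in>D. x + t \<in> D" then have "t \<in> trans_set D D" unfolding trans_set_def by (simp add: add.commute)
  then show "rd D dvd t" using trans_set_rd by simp
qed (use rd_period in blast)

end

lemma rd_eq: assumes S: "spair N c c'" and D: "xs c c' D D'" shows "rd D = rd D'"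
proof -
  have N: "0 < N" by (rule spair_pos[OF S])
  note p = xs_per[OF S D] and p' = xs_per'[OF S D]
  have "xs c c' (mult (rd D)) (mult (rd D'))"
    using xs_trans_set[OF S D D] unfolding trans_set_rd[OF N p] trans_set_rd[OF N p'] .
  from xs_cnt_eq[OF S this] have "N div rd D = N div rd D'"
    by (simp add: cnt_mult N rd_pos[OF N p] rd_pos[OF N p'] rd_dvd[OF N p] rd_dvd[OF N p'])
  then show ?thesis using div_eq_imp_eq[OF N] rd_dvd[OF N p] rd_dvd[OF N p'] by blast
qed

lemma xdiv_rd: assumes S: "spair N c c" and D: "xset c D" shows "xdiv N c (rd D)"
proof -
  have N: "0 < N" by (rule spair_pos[OF S])
  note p = xs_per[OF S D]
  show ?thesis
    by (rule xdivI rd_pos[OF N p] rd_dvd[OF N p]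
        xs_trans_set[OF S D D, unfolded trans_set_rd[OF N p]])+
qed

lemma xset_cl: "xset c (cl c k)" by (rule xs_cl) simp

lemma class_subset: "xset c D \<Longrightarrow> k \<in> D \<Longrightarrow> cl c k \<subseteq> D"
  using xsD by (metis cl_iff subsetI)

section \<open>Schur's theorem on multipliers and the Frobenius map\<close>

lemma add_power_prime_dvd:
  fixes a b :: "'r::comm_ring_1"
  assumes p: "Factorial_Ring.prime (p::nat)"
  shows "of_nat p dvd (a + b) ^ p - a ^ p - b ^ p"
proof -
  have p0: "0 < p" using p prime_gt_0_nat by blast
  have "(a + b) ^ p = (\<Sum>k\<le>p. of_nat (p choose k) * a ^ k * b ^ (p - k))" by (rule binomial_ring)
  also have "{..p} = insert 0 (insert p {0<..<p})" using p0 by auto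
  also have "(\<Sum>k\<in>insert 0 (insert p {0<..<p}). of_nat (p choose k) * a ^ k * b ^ (p - k)) =
      b ^ p + (a ^ p + (\<Sum>k\<in>{0<..<p}. of_nat (p choose k) * a ^ k * b ^ (p - k)))"
    using p0 by simp
  finally have "(a + b) ^ p - a ^ p - b ^ p = (\<Sum>k\<in>{0<..<p}. of_nat (p choose k) * a ^ k * b ^ (p - k))"
    by simp
  also have "of_nat p dvd \<dots>"
  proof (rule dvd_sum)
    fix k assume "k \<in> {0<..<p}"
    then have "p dvd (p choose k)" using p by (intro dvd_choose_prime) auto
    then have "(of_nat p :: 'r) dvd of_nat (p choose k)" by (metis dvd_def of_nat_mult)
    then show "of_nat p dvd of_nat (p choose k) * a ^ k * b ^ (p - k)" by simp
  qed
  finally show ?thesis .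
qed

lemma sum_power_prime_dvd:
  fixes h :: "'i \<Rightarrow> 'r::comm_ring_1"
  assumes p: "Factorial_Ring.prime (p::nat)" and A: "finite A"
  shows "of_nat p dvd (\<Sum>x\<in>A. h x) ^ p - (\<Sum>x\<in>A. h x ^ p)"
  using A
proof (induction A rule: finite_induct)
  case empty
  then show ?case using prime_gt_0_nat[OF p] by (simp add: zero_power)
next
  case (insert x F)
  let ?s = "\<Sum>x\<in>F. h x"
  have "of_nat p dvd ((h x + ?s) ^ p - h x ^ p - ?s ^ p) + (?s ^ p - (\<Sum>x\<in>F. h x ^ p))"
    using insert.IH add_power_prime_dvd[OF p] by (intro dvd_add)
  then show ?case using insert.hyps by (simp add: algebra_simps)
qed

text \<open>Convolutions are computed in the polynomial ring, where the Frobenius congruence holds.\<close>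
definition act :: "int poly \<Rightarrow> (int \<Rightarrow> int) \<Rightarrow> int \<Rightarrow> int" where
  "act P g x = (\<Sum>i\<le>degree P. coeff P i * g (x - int i))"

lemma act_bound: assumes "degree P \<le> m" shows "act P g x = (\<Sum>i\<le>m. coeff P i * g (x - int i))"
  unfolding act_def using assms by (intro sum.mono_neutral_left) (auto simp: coeff_eq_0)

lemma act_add: "act (P + Q) g x = act P g x + act Q g x"
proof -
  let ?m = "max (degree P) (degree Q)"
  have "act (P + Q) g x = (\<Sum>i\<le>?m. coeff (P + Q) i * g (x - int i))"
    by (rule act_bound) (rule degree_add_le_max)
  also have "\<dots> = (\<Sum>i\<le>?m. coeff P i * g (x - int i)) + (\<Sum>i\<le>?m. coeff Q i * g (x - int i))"
    unfolding sum.distrib[symmetric] by (rule sum.cong) (simp_all add: distrib_right)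
  also have "\<dots> = act P g x + act Q g x"
    using act_bound[of P ?m g x, OF max.cobounded1] act_bound[of Q ?m g x, OF max.cobounded2] by simp
  finally show ?thesis .
qed

lemma act_0 [simp]: "act 0 g x = 0" by (simp add: act_def)

lemma act_1 [simp]: "act 1 g x = g x" by (simp add: act_def)

lemma act_sum: "finite A \<Longrightarrow> act (\<Sum>y\<in>A. P y) g x = (\<Sum>y\<in>A. act (P y) g x)"
  by (induction A rule: finite_induct) (simp_all add: act_add)

lemma act_smult: "act (smult a P) g x = a * act P g x"
proof -
  have "act (smult a P) g x = (\<Sum>i\<le>degree P. coeff (smult a P) i * g (x - int i))"
    by (rule act_bound) (rule degree_smult_le)
  then show ?thesis by (simp add: act_def sum_distrib_left mult.assoc)
qed

lemma act_monom_mult: "act (monom a n * P) g x = a * act P g (x - int n)"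
proof -
  have "degree (monom a n * P) \<le> n + degree P"
    by (rule order_trans[OF degree_mult_le]) (simp add: degree_monom_le)
  then have "act (monom a n * P) g x = (\<Sum>i\<le>n + degree P. coeff (monom a n * P) i * g (x - int i))"
    by (rule act_bound)
  also have "\<dots> = (\<Sum>i\<in>{n..n + degree P}. coeff (monom a n * P) i * g (x - int i))"
    by (rule sum.mono_neutral_right) (auto simp: coeff_monom_mult)
  also have "\<dots> = (\<Sum>i\<le>degree P. a * coeff P i * g (x - int (i + n)))"
    by (rule sum.reindex_bij_witness[of _ "\<lambda>i. i + n" "\<lambda>i. i - n"]) (auto simp: coeff_monom_mult)
  also have "\<dots> = a * act P g (x - int n)"
    unfolding act_def sum_distrib_left by (rule sum.cong) (simp_all add: algebra_simps)
  finally show ?thesis .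
qed

lemma act_monom: "act (monom a n) g x = a * g (x - int n)"
  using act_monom_mult[of a n 1 g x] by simp

primrec conv_pow :: "int \<Rightarrow> (int \<Rightarrow> int) \<Rightarrow> nat \<Rightarrow> int \<Rightarrow> int" where
  "conv_pow N f 0 = (\<lambda>x. of_bool (N dvd x))"
| "conv_pow N f (Suc n) = conv N f (conv_pow N f n)"

lemma conv_pow_compat: assumes S: "spair N c c'" and f: "compat c c' f f'"
  shows "compat c c' (conv_pow N f n) (conv_pow N f' n)"
proof (induction n)
  case 0
  have "of_bool (N dvd x) = (of_bool (N dvd y) :: int)" if "c x = c' y" for x y
    using spair_zero[OF S that] by simp
  then show ?case unfolding compat_def conv_pow.simps by blast
qed (simp add: spair_conv[OF S f])

lemma conv_pow_act:
  "conv_pow N f n x = act ((\<Sum>y\<in>{0..<N}. monom (f y) (nat y)) ^ n) (\<lambda>x. of_bool (N dvd x)) x"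
proof (induction n arbitrary: x)
  case (Suc n)
  let ?P = "\<Sum>y\<in>{0..<N}. monom (f y) (nat y)"
  show ?case
    by (simp add: conv_def sum_distrib_right act_sum act_monom_mult Suc)
qed simp

text \<open>The function is the polynomial with these monomials acting by shifts. Modulo
  \<open>p\<close> the \<open>p\<close>-th power of the sum is the sum of the \<open>p\<close>-th
  powers, and a \<open>p\<close>-th power of a monomial shifts by \<open>p * y\<close>.\<close>

lemma conv_pow_prime:
  assumes p: "Factorial_Ring.prime (p::nat)"
  shows "int p dvd conv_pow N f p x - (\<Sum>y\<in>{0..<N}. f y ^ p * of_bool (N dvd x - int p * y))"
proof -
  define F where "F = (\<Sum>y\<in>{0..<N}. monom (f y) (nat y))"
  define F' where "F' = (\<Sum>y\<in>{0..<N}. monom (f y) (nat y) ^ p)"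
  obtain R where R: "F ^ p - F' = of_nat p * R"
    using sum_power_prime_dvd[OF p, of "{0..<N}" "\<lambda>y. monom (f y) (nat y)"] unfolding F_def F'_def by auto
  have "F ^ p = F' + smult (int p) R" using R by (simp add: of_nat_poly algebra_simps)
  then have "conv_pow N f p x = act F' (\<lambda>x. of_bool (N dvd x)) x + int p * act R (\<lambda>x. of_bool (N dvd x)) x"
    by (simp add: conv_pow_act F_def[symmetric] act_add act_smult)
  also have "act F' (\<lambda>x. of_bool (N dvd x)) x = (\<Sum>y\<in>{0..<N}. f y ^ p * of_bool (N dvd x - int p * y))"
    unfolding F'_def by (subst act_sum) (auto simp: monom_power act_monom mult.commute intro!: sum.cong)
  finally show ?thesis by simp
qed

lemma compat_frob_count:
  assumes S: "spair N c c'" and D: "xs c c' D D'" and p: "Factorial_Ring.prime (p::nat)"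
  shows "compat c c' (\<lambda>g. cnt N {y. y \<in> D \<and> N dvd g - int p * y} mod int p)
    (\<lambda>g. cnt N {y. y \<in> D' \<and> N dvd g - int p * y} mod int p)"
proof -
  have p0: "0 < p" using p prime_gt_0_nat by blast
  have *: "conv_pow N (\<lambda>x. of_bool (x \<in> D)) p g mod int p = cnt N {y. y \<in> D \<and> N dvd g - int p * y} mod int p" for D g
  proof -
    have "(\<Sum>y\<in>{0..<N}. of_bool (y \<in> D) ^ p * of_bool (N dvd g - int p * y)) = cnt N {y. y \<in> D \<and> N dvd g - int p * y}"
      unfolding cnt_def by (rule sum.cong) (auto simp: p0)
    then show ?thesis using conv_pow_prime[OF p, of N "\<lambda>x. of_bool (x \<in> D)" g] by (simp add: mod_eq_dvd_iff)
  qed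
  have "compat c c' (\<lambda>x. of_bool (x \<in> D) :: int) (\<lambda>x. of_bool (x \<in> D'))"
    using D unfolding compat_def by (intro allI impI arg_cong[of _ _ of_bool]) blast
  from compat_comp[OF conv_pow_compat[OF S this, of p], of "\<lambda>n. n mod int p"] show ?thesis unfolding * .
qed

text \<open>Modulo \<open>p\<close>, the \<open>p\<close>-th convolution power of the indicator of
  \<open>D\<close> counts at \<open>p * x\<close> the points of \<open>D\<close> in the coset of
  \<open>x\<close> of order \<open>p\<close> (here \<open>p\<close> divides \<open>N\<close>). That
  number lies between \<open>0\<close> and \<open>p\<close>, so it is nonzero modulo
  \<open>p\<close> exactly if the coset meets \<open>D\<close> without being contained in it.
  \<open>frob\<close> is the set where this happens.\<close>

definition frob :: "int \<Rightarrow> int \<Rightarrow> int set \<Rightarrow> int set" where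
  "frob N p D = {g. \<exists>x\<in>D. \<exists>j. x + j * (N div p) \<notin> D \<and> N dvd g - p * x}"

definition dil :: "int \<Rightarrow> int \<Rightarrow> int set \<Rightarrow> int set" where
  "dil N a D = {g. \<exists>x\<in>D. N dvd g - a * x}"

lemma xs_frob:
  assumes S: "spair N c c'" and D: "xs c c' D D'" and p: "Factorial_Ring.prime (p::int)" and pN: "p dvd N"
  shows "xs c c' (frob N p D) (frob N p D')"
proof -
  define q where "q = N div p"
  have N: "0 < N" by (rule spair_pos[OF S])
  have p0: "1 < p" using p prime_gt_1_int by blast
  have Nq: "N = p * q" using pN by (simp add: q_def)
  have q0: "0 < q" using N Nq p0 by (simp add: zero_less_mult_iff)
  have *: "g \<in> frob N p D \<longleftrightarrow> cnt N {y. y \<in> D \<and> N dvd g - p * y} mod p \<noteq> 0" if D: "pset N D" for D g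
  proof (cases "\<exists>y. N dvd g - p * y")
    case False
    then have "{y. y \<in> D \<and> N dvd g - p * y} = {}" by blast
    then have "cnt N {y. y \<in> D \<and> N dvd g - p * y} = 0" by (simp only: cnt_empty)
    then show ?thesis using False by (auto simp: frob_def)
  next
    case True
    then obtain z where z: "N dvd g - p * z" by blast
    have zq: "N dvd g - p * y \<longleftrightarrow> q dvd y - z" for y
    proof -
      have "N dvd g - p * y \<longleftrightarrow> N dvd (g - p * z) - (g - p * y)"
        using z by (metis dvd_diff dvd_diff_commute diff_diff_eq2 add_diff_cancel_left' dvd_add_right_iff diff_add_cancel)
      also have "(g - p * z) - (g - p * y) = p * (y - z)" by (simp add: algebra_simps)
      also have "N dvd p * (y - z) \<longleftrightarrow> q dvd y - z" using p0 Nq by simp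
      finally show ?thesis .
    qed
    define A where "A = {y. q dvd y - z}"
    define B where "B = {y. y \<in> D \<and> q dvd y - z}"
    have pA: "pset N A"
    proof -
      have "y \<in> A \<longleftrightarrow> y' \<in> A" if "N dvd y - y'" for y y'
      proof -
        have "q dvd y - y'" using that Nq dvd_mult_right by blast
        moreover have "y - z = (y - y') + (y' - z)" by simp
        ultimately show ?thesis unfolding A_def mem_Collect_eq by (metis dvd_add_right_iff)
      qed
      then show ?thesis unfolding periodic_def by blast
    qed
    have BA: "B = D \<inter> A" unfolding A_def B_def by blast
    have pB: "pset N B" unfolding BA by (rule pset_Int[OF D pA])
    have "cnt N A = cnt N {x. x + (- z) \<in> mult q}" by (simp add: A_def)
    also have "\<dots> = cnt N (mult q)" by (rule cnt_shift[OF N pset_mult]) (simp add: Nq)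
    also have "\<dots> = p" using cnt_mult[of q N] q0 N Nq by simp
    finally have cA: "cnt N A = p" .
    have "cnt N B \<le> cnt N A" by (rule cnt_mono) (simp add: BA)
    then have "cnt N B mod p \<noteq> 0 \<longleftrightarrow> cnt N B \<noteq> 0 \<and> cnt N B \<noteq> cnt N A"
      using cA cnt_nonneg[of N B] p0 by (cases "cnt N B = p") auto
    also have "\<dots> \<longleftrightarrow> B \<noteq> {} \<and> B \<noteq> A"
      using cnt_zero_iff[OF N pB] cnt_subset_eq[OF N pB pA] BA by blast
    also have "\<dots> \<longleftrightarrow> g \<in> frob N p D"
    proof
      assume h: "B \<noteq> {} \<and> B \<noteq> A"
      then obtain x where x: "x \<in> D" "x \<in> A" using BA by blast
      obtain y where y: "y \<notin> D" "y \<in> A" using h BA by blast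
      have "q dvd y - z" "q dvd x - z" using x y unfolding A_def by blast+
      then obtain j where "(y - z) - (x - z) = q * j" by (meson dvdE dvd_diff)
      then have "y = x + j * q" by (simp add: algebra_simps)
      then show "g \<in> frob N p D" using x y zq unfolding frob_def q_def[symmetric] A_def by blast
    next
      assume "g \<in> frob N p D"
      then obtain x j where x: "x \<in> D" "x + j * q \<notin> D" "N dvd g - p * x"
        unfolding frob_def q_def[symmetric] by blast
      have "x \<in> A" using x zq unfolding A_def by blast
      moreover have "x + j * q \<in> A"
      proof -
        have "q dvd (x - z) + j * q" using \<open>x \<in> A\<close> unfolding A_def by simp
        then show ?thesis unfolding A_def by (simp add: algebra_simps)
      qed
      ultimately show "B \<noteq> {} \<and> B \<noteq> A" using x BA by blast
    qed
    finally show ?thesis unfolding B_def zq by simp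
  qed
  have pn: "Factorial_Ring.prime (nat p)" "int (nat p) = p"
    using iffD1[OF prime_int_nat_transfer p] p0 by linarith+
  show ?thesis unfolding *[OF xs_per[OF S D]] *[OF xs_per'[OF S D]]
    using compat_comp[OF compat_frob_count[OF S D pn(1)], of "\<lambda>n. n \<noteq> 0"] unfolding pn(2) .
qed

lemma dil_inj: assumes "coprime a (N::int)" "N dvd g - a * x" "N dvd g - a * y" shows "N dvd x - y"
proof -
  have "(g - a * y) - (g - a * x) = a * (x - y)" by (simp add: algebra_simps)
  then have "N dvd a * (x - y)" using dvd_diff[OF assms(3,2)] by simp
  then show ?thesis using assms(1) by (simp add: coprime_commute coprime_dvd_mult_right_iff)
qed

text \<open>Multiplication by \<open>p\<close> is injective modulo \<open>N\<close> here, so the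
  coefficients of the \<open>p\<close>-th power are congruent to \<open>0\<close> or
  \<open>1\<close> and remain distinguishable modulo \<open>p\<close>.\<close>

lemma xs_dil_prime:
  assumes S: "spair N c c'" and D: "xs c c' D D'" and p: "Factorial_Ring.prime (p::nat)" and pN: "coprime (int p) N"
  shows "xs c c' (dil N (int p) D) (dil N (int p) D')"
proof -
  have N: "0 < N" by (rule spair_pos[OF S])
  have p0: "1 < p" using p prime_gt_1_nat by blast
  have *: "g \<in> dil N (int p) D \<longleftrightarrow> cnt N {y. y \<in> D \<and> N dvd g - int p * y} mod int p \<noteq> 0" if D: "pset N D" for D g
  proof (cases "g \<in> dil N (int p) D")
    case True
    then obtain x where x: "x \<in> D" "N dvd g - int p * x" unfolding dil_def by blast
    have "N dvd g - int p * y" if "N dvd y - x" for y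
    proof -
      have "g - int p * y = (g - int p * x) - int p * (y - x)" by (simp add: algebra_simps)
      then show ?thesis using dvd_diff[OF x(2) dvd_mult[OF that]] by metis
    qed
    then have eq: "{y. y \<in> D \<and> N dvd g - int p * y} = {y. N dvd y - x}"
      using dil_inj[OF pN _ x(2)] periodicD[OF D] x(1) by blast
    have "cnt N {y. N dvd y - x} = cnt N {y. y + (- x) \<in> mult N}" by simp
    also have "\<dots> = cnt N (mult N)" by (rule cnt_shift[OF N pset_mult]) simp
    also have "\<dots> = 1" using N by (simp add: cnt_mult)
    finally show ?thesis using True eq p0 by simp
  next
    case False
    then have "{y. y \<in> D \<and> N dvd g - int p * y} = {}" unfolding dil_def by blast
    then have "cnt N {y. y \<in> D \<and> N dvd g - int p * y} = 0" by (simp only: cnt_empty)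
    then show ?thesis using False by simp
  qed
  show ?thesis unfolding *[OF xs_per[OF S D]] *[OF xs_per'[OF S D]]
    by (rule compat_comp[OF compat_frob_count[OF S D p]])
qed

lemma dil_mult: assumes "pset N D" shows "dil N (a * b) D = dil N a (dil N b D)"
proof -
  have "(\<exists>x\<in>D. N dvd g - a * b * x) \<longleftrightarrow> (\<exists>y. (\<exists>x\<in>D. N dvd y - b * x) \<and> N dvd g - a * y)" for g
  proof
    assume "\<exists>x\<in>D. N dvd g - a * b * x"
    then obtain x where "x \<in> D" "N dvd g - a * (b * x)" by (auto simp: mult.assoc)
    then show "\<exists>y. (\<exists>x\<in>D. N dvd y - b * x) \<and> N dvd g - a * y" by force
  next
    assume "\<exists>y. (\<exists>x\<in>D. N dvd y - b * x) \<and> N dvd g - a * y"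
    then obtain x y where xy: "x \<in> D" "N dvd y - b * x" "N dvd g - a * y" by blast
    have "g - a * b * x = (g - a * y) + a * (y - b * x)" by (simp add: algebra_simps)
    then have "N dvd g - a * b * x" using dvd_add[OF xy(3) dvd_mult[OF xy(2)]] by metis
    then show "\<exists>x\<in>D. N dvd g - a * b * x" using xy by blast
  qed
  then show ?thesis unfolding dil_def by blast
qed

lemma xs_dil_nat:
  assumes S: "spair N c c'" and D: "xs c c' D D'" and a: "0 < (a::nat)" "coprime (int a) N"
  shows "xs c c' (dil N (int a) D) (dil N (int a) D')"
  using a
proof (induction a rule: less_induct)
  case (less a)
  show ?case
  proof (cases "a = 1")
    case True
    have "dil N 1 D = D" if "pset N D" for D
      unfolding dil_def using periodicD[OF that] by (auto intro: exI[of _ "_::int"]) force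
    then show ?thesis using True D xs_per[OF S D] xs_per'[OF S D] by simp
  next
    case False
    then obtain p where p: "Factorial_Ring.prime p" "p dvd a" using prime_factor_nat by blast
    then obtain b where b: "a = p * b" by blast
    have "1 < p" using p prime_gt_1_nat by blast
    then have "b < a" "0 < b" using b less.prems by auto
    moreover have cop: "coprime (int p) N" "coprime (int b) N" using less.prems b by auto
    ultimately have "xs c c' (dil N (int b) D) (dil N (int b) D')" using less.IH by blast
    from xs_dil_prime[OF S this p(1) cop(1)] show ?thesis
      by (simp add: b dil_mult[OF xs_per[OF S D]] dil_mult[OF xs_per'[OF S D]])
  qed
qed

text \<open>Schur's theorem on multipliers, for the isomorphism as well. Positive multipliers were
  treated prime by prime, so a positive inverse \<open>b\<close> of \<open>a\<close> is applied to
  the class of \<open>a * x\<close>; the result is a union of classes containing \<open>x\<close>,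
  hence its image contains \<open>y\<close>.\<close>

lemma multiplier:
  assumes S: "spair N c c'" and xy: "c x = c' y" and a: "coprime a N"
  shows "c (a * x) = c' (a * y)"
proof -
  have N: "0 < N" by (rule spair_pos[OF S])
  obtain b0 where b0: "N dvd b0 * a - 1"
    using a by (metis cong_iff_dvd_diff coprime_iff_invertible_int mult.commute)
  \<comment> \<open>Adding \<open>N\<close> keeps \<open>b\<close> positive even if the residue is
    \<open>0\<close>, which happens for \<open>N = 1\<close>.\<close>
  define b where "b = b0 mod N + N"
  have b1: "0 < b" unfolding b_def using N by (simp add: add_nonneg_pos)
  have bb: "N dvd b - b0"
    by (simp add: b_def mod_eq_dvd_iff[symmetric])
  have b: "N dvd b * a - 1"
  proof -
    have "b * a - 1 = (b - b0) * a + (b0 * a - 1)" by (simp add: algebra_simps)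
    then show ?thesis using dvd_add[OF dvd_mult2[OF bb] b0] by metis
  qed
  have cop: "coprime b N"
  proof -
    have "\<exists>k. b * a - 1 = N * k" using b by auto
    then obtain k where "b * a - N * k = 1" by (auto simp: algebra_simps)
    then show ?thesis by (intro coprimeI) (metis dvd_diff dvd_mult2)
  qed
  define E where "E = cl c (a * x)"
  define E' where "E' = {z. c' z = c (a * x)}"
  have E: "xs c c' E E'" unfolding E_def E'_def compat_def by simp
  have x: "xs c c' (dil N b E) (dil N b E')"
    using xs_dil_nat[OF S E, of "nat b"] b1 cop by simp
  have "N dvd x - b * (a * x)"
  proof -
    have "x - b * (a * x) = - ((b * a - 1) * x)" by (simp add: algebra_simps)
    then show ?thesis using dvd_mult2[OF b] by (metis dvd_minus_iff)
  qed
  then have "x \<in> dil N b E" unfolding dil_def E_def by force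
  then have "y \<in> dil N b E'" using xsD[OF x xy] by blast
  then obtain z where z: "c' z = c (a * x)" "N dvd y - b * z" unfolding dil_def E'_def by blast
  have "a * y - z = a * (y - b * z) + (b * a - 1) * z" by (simp add: algebra_simps)
  then have "N dvd a * y - z" using dvd_add[OF dvd_mult[OF z(2)] dvd_mult2[OF b]] by metis
  then have "c' (a * y) = c' z" using periodicD[OF spair_per'[OF S]] by blast
  then show ?thesis using z by simp
qed

section \<open>Restriction to a subgroup and quotients\<close>

definition sub :: "(int \<Rightarrow> 'k) \<Rightarrow> int \<Rightarrow> int \<Rightarrow> 'k" where "sub c u x = c (u * x)"

text \<open>The colour of a coset is the set of colours occurring on it, which avoids choosing
  representatives; only the type of colours changes.\<close>

definition quot :: "(int \<Rightarrow> 'k) \<Rightarrow> int \<Rightarrow> int \<Rightarrow> 'k set" where "quot c r x = c ` {y. r dvd y - x}"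

lemma spair_sub:
  assumes S: "spair N c c'" and u: "xdiv N c u"
  shows "spair (N div u) (sub c u) (sub c' u)"
proof -
  define n where "n = N div u"
  have N: "0 < N" by (rule spair_pos[OF S])
  have u0: "0 < u" "u dvd N" using u xdiv_pos xdiv_dvd by blast+
  have Nn: "N = u * n" using u0 by (simp add: n_def)
  have n0: "0 < n" using N Nn u0 by (simp add: zero_less_mult_iff)
  have ran: "range (sub c u) \<subseteq> range (sub c' u)" if S: "spair N c c'" and u: "xdiv N c u" for c c' :: "int \<Rightarrow> 'a"
  proof
    fix k assume "k \<in> range (sub c u)"
    then obtain x where x: "k = c (u * x)" unfolding sub_def by blast
    obtain y where y: "c (u * x) = c' y" using spair_ex[OF S] .
    then have "u dvd y" using xdiv_iff[OF S u y] by simp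
    then obtain z where "y = u * z" by blast
    then show "k \<in> range (sub c' u)" using x y unfolding sub_def by simp
  qed
  have per: "periodic n (sub c u)" if p: "periodic N c" for c :: "int \<Rightarrow> 'a"
    unfolding periodic_def sub_def
  proof (intro allI impI)
    fix x y assume "n dvd x - y"
    then have "N dvd u * x - u * y" using Nn u0 by (simp add: right_diff_distrib[symmetric])
    then show "c (u * x) = c (u * y)" by (rule periodicD[OF p])
  qed
  \<comment> \<open>Extension by zero embeds the functions on the subgroup, and on multiples of
    \<open>u\<close> convolution modulo \<open>N\<close> restricts to convolution modulo
    \<open>n\<close>.\<close>
  have conv: "conv N (\<lambda>z. if u dvd z then f (z div u) else 0) (\<lambda>z. if u dvd z then g (z div u) else 0) (u * x) =
      conv n f g x" for f g :: "int \<Rightarrow> int" and x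
  proof -
    let ?h = "\<lambda>y. (if u dvd y then f (y div u) else 0) * (if u dvd u * x - y then g ((u * x - y) div u) else 0)"
    have "(\<Sum>y\<in>{0..<N}. ?h y) = (\<Sum>y\<in>(*) u ` {0..<n}. ?h y)"
    proof (rule sum.mono_neutral_right)
      show "(*) u ` {0..<n} \<subseteq> {0..<N}"
      proof
        fix y assume "y \<in> (*) u ` {0..<n}"
        then obtain k where k: "y = u * k" "k \<in> {0..<n}" by (rule imageE)
        then have "u * k < u * n" using u0 by (simp only: mult_less_cancel_left_pos atLeastLessThan_iff)
        then show "y \<in> {0..<N}" using k u0 Nn by simp
      qed
      show "\<forall>y\<in>{0..<N} - (*) u ` {0..<n}. ?h y = 0"
      proof
        fix y assume y: "y \<in> {0..<N} - (*) u ` {0..<n}"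
        have "\<not> u dvd y"
        proof
          assume "u dvd y"
          then obtain k where k: "y = u * k" by blast
          have "0 \<le> u * k" "u * k < u * n" using y k Nn by simp_all
          then have "0 \<le> k" "k < n" using u0 by (simp_all add: zero_le_mult_iff)
          then have "y \<in> (*) u ` {0..<n}" unfolding k by (intro imageI) simp
          then show False using y by blast
        qed
        then show "?h y = 0" by simp
      qed
    qed simp
    also have "\<dots> = (\<Sum>i\<in>{0..<n}. ?h (u * i))"
      by (subst sum.reindex) (use u0 in \<open>auto simp: inj_on_def\<close>)
    also have "\<dots> = (\<Sum>i\<in>{0..<n}. f i * g (x - i))"
      by (rule sum.cong) (use u0 in \<open>auto simp: right_diff_distrib[symmetric]\<close>)
    finally show ?thesis unfolding conv_def .
  qed
  have lift: "compat c c' (\<lambda>z. if u dvd z then f (z div u) else 0) (\<lambda>z. if u dvd z then f' (z div u) else 0)"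
    if f: "compat (sub c u) (sub c' u) f f'" for f f' :: "int \<Rightarrow> int"
    unfolding compat_def
  proof (intro allI impI)
    fix x y assume xy: "c x = c' y"
    show "(if u dvd x then f (x div u) else 0) = (if u dvd y then f' (y div u) else 0)"
    proof (cases "u dvd x")
      case True
      then have "u dvd y" using xdiv_iff[OF S u xy] by simp
      then have "sub c u (x div u) = sub c' u (y div u)" using True xy by (simp add: sub_def)
      then show ?thesis using compatD[OF f] True \<open>u dvd y\<close> by simp
    next
      case False
      then show ?thesis using xdiv_iff[OF S u xy] by simp
    qed
  qed
  show ?thesis unfolding spair_def n_def[symmetric]
  proof (intro conjI allI impI)
    show "0 < n" by (rule n0)
    show "range (sub c u) = range (sub c' u)"
      by (rule equalityI[OF ran[OF S u] ran[OF spair_sym[OF S] xdiv_transfer[OF S u]]])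
    show "periodic n (sub c u)" "periodic n (sub c' u)" using per spair_per[OF S] spair_per'[OF S] by blast+
    fix x y assume "sub c u x = sub c' u y"
    then have e: "c (u * x) = c' (u * y)" by (simp add: sub_def)
    show "n dvd x \<longleftrightarrow> n dvd y" using spair_zero[OF S e] Nn u0 by simp
    show "sub c u (- x) = sub c' u (- y)" using spair_neg[OF S e] by (simp add: sub_def)
  next
    fix f f' g g' :: "int \<Rightarrow> int"
    assume f: "compat (sub c u) (sub c' u) f f'" and g: "compat (sub c u) (sub c' u) g g'"
    show "compat (sub c u) (sub c' u) (conv n f g) (conv n f' g')"
      unfolding compat_def conv[symmetric] sub_def
      using compatD[OF spair_conv[OF S lift[OF f] lift[OF g]]] by blast
  qed
qed

lemma sum_periodic_mult:
  assumes h: "periodic r (h :: int \<Rightarrow> int)" and r: "0 < r"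
  shows "(\<Sum>x\<in>{0..<r * int m}. h x) = int m * (\<Sum>x\<in>{0..<r}. h x)"
proof (induction m)
  case (Suc m)
  have "{0..<r * int (Suc m)} = {0..<r * int m} \<union> {r * int m..<r * int m + r}"
  proof -
    have "0 \<le> r * int m" using r by simp
    then show ?thesis using r ivl_disj_un_two(3)[of 0 "r * int m" "r * int m + r"] by (simp add: algebra_simps)
  qed
  moreover have "(\<Sum>x\<in>{r * int m..<r * int m + r}. h x) = (\<Sum>x\<in>{0..<r}. h (x + r * int m))"
    by (rule sum.reindex_bij_witness[of _ "\<lambda>x. x + r * int m" "\<lambda>x. x - r * int m"]) auto
  moreover have "\<dots> = (\<Sum>x\<in>{0..<r}. h x)" by (rule sum_shift[OF r h])
  ultimately show ?case using Suc by (simp add: sum.union_disjoint algebra_simps)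
qed simp

lemma conv_quot:
  assumes f: "periodic r f" and g: "periodic r g" and r: "0 < r" "r dvd N" "0 < N"
  shows "conv N f g x = (N div r) * conv r f g x"
proof -
  have "periodic r (\<lambda>y. f y * g (x - y))"
    unfolding periodic_def
  proof (intro allI impI)
    fix y z assume d: "r dvd y - z"
    have "r dvd (x - y) - (x - z)" using d by (simp add: dvd_diff_commute)
    then show "f y * g (x - y) = f z * g (x - z)" using periodicD[OF f d] periodicD[OF g] by simp
  qed
  moreover have "N = r * int (nat (N div r))" using r by (simp add: pos_imp_zdiv_nonneg_iff)
  ultimately show ?thesis unfolding conv_def using sum_periodic_mult[OF _ r(1), of "\<lambda>y. f y * g (x - y)" "nat (N div r)"] r
    by (simp add: pos_imp_zdiv_nonneg_iff)
qed

lemma quot_per: "periodic r (quot c r)"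
  unfolding periodic_def quot_def
proof (intro allI impI arg_cong[of _ _ "(`) c"] Collect_cong)
  fix x y z assume "r dvd x - y"
  moreover have "z - y = (z - x) + (x - y)" by simp
  ultimately show "r dvd z - x \<longleftrightarrow> r dvd z - y" by (metis dvd_add_left_iff)
qed

lemma quot_obtain:
  assumes "quot c r x = quot c' r y" obtains w where "c x = c' w" "r dvd w - y"
proof -
  have "c x \<in> quot c r x" unfolding quot_def by simp
  then have "c x \<in> c' ` {w. r dvd w - y}" using assms unfolding quot_def by simp
  then obtain w where "c x = c' w" "w \<in> {w. r dvd w - y}" by (rule imageE)
  then show ?thesis using that by simp
qed

text \<open>If \<open>z\<close> lies in the coset of \<open>x\<close>, then \<open>x\<close> lies in
  the class of \<open>z\<close> plus \<open>mult r\<close>. That sumset has a known image, which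
  must contain \<open>y\<close>; hence the colour of \<open>z\<close> also occurs in the coset of
  \<open>y\<close>.\<close>

lemma quot_eqI:
  assumes S: "spair N c c'" and r: "xdiv N c r" and xy: "c x = c' y"
  shows "quot c r x = quot c' r y"
proof -
  have "quot c r x \<subseteq> quot c' r y" if S: "spair N c c'" and r: "xdiv N c r" and xy: "c x = c' y"
    for c c' :: "int \<Rightarrow> 'a" and x y
  proof
    fix k assume "k \<in> quot c r x"
    then have "k \<in> c ` {z. r dvd z - x}" unfolding quot_def .
    then obtain z where z: "k = c z" "z \<in> {z. r dvd z - x}" by (rule imageE)
    obtain w where w: "c z = c' w" using spair_ex[OF S] .
    have s: "xs c c' (splus (cl c z) (mult r)) (splus (cl c' w) (mult r))"
      by (rule xs_splus[OF S xs_cl[of c z c' w, OF w] xdiv_pair[OF S r]])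
    have "x = z + (x - z)" "c z = c z" "r dvd x - z" using z by (simp_all add: dvd_diff_commute)
    then have "x \<in> splus (cl c z) (mult r)" unfolding splus_def cl_def mult_def by blast
    then have "y \<in> splus (cl c' w) (mult r)" using xsD[OF s xy] by simp
    then obtain a b where "y = a + b" "c' a = c' w" "r dvd b" unfolding splus_def cl_def mult_def by blast
    then have "r dvd a - y" "k = c' a" using z w by simp_all
    then show "k \<in> quot c' r y" unfolding quot_def by blast
  qed
  from this[OF S r xy] this[OF spair_sym[OF S] xdiv_transfer[OF S r] xy[symmetric]] show ?thesis by blast
qed

text \<open>A function of the quotient colour is \<open>r\<close>-periodic, so its convolution
  modulo \<open>N\<close> is \<open>N div r\<close> times the one modulo \<open>r\<close>; the
  positive factor cancels.\<close>

lemma spair_quot: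
  assumes S: "spair N c c'" and r: "xdiv N c r"
  shows "spair r (quot c r) (quot c' r)"
  unfolding spair_def
proof (intro conjI allI impI)
  have N: "0 < N" by (rule spair_pos[OF S])
  have r0: "0 < r" "r dvd N" using r xdiv_pos xdiv_dvd by blast+
  show "0 < r" by (rule r0)
  show "range (quot c r) = range (quot c' r)"
  proof (rule equalityI; rule subsetI)
    fix k assume "k \<in> range (quot c r)"
    then obtain x where "k = quot c r x" by blast
    then show "k \<in> range (quot c' r)" using quot_eqI[OF S r] spair_ex[OF S, of x] by (metis rangeI)
  next
    fix k assume "k \<in> range (quot c' r)"
    then obtain x where "k = quot c' r x" by blast
    then show "k \<in> range (quot c r)" using quot_eqI[OF S r] spair_ex'[OF S, of x] by (metis rangeI)
  qed
  show "periodic r (quot c r)" "periodic r (quot c' r)" by (rule quot_per)+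
  fix x y assume q: "quot c r x = quot c' r y"
  obtain w where w: "c x = c' w" "r dvd w - y" using quot_obtain[OF q] .
  have "r dvd w \<longleftrightarrow> r dvd y" using w(2) by (metis dvd_diff_left_iff dvd_diff_right_iff)
  then show "r dvd x \<longleftrightarrow> r dvd y" using xdiv_iff[OF S r w(1)] by simp
  have "r dvd (- w) - (- y)" using w(2) by (simp add: dvd_diff_commute)
  then have "quot c' r (- w) = quot c' r (- y)" by (rule periodicD[OF quot_per])
  then show "quot c r (- x) = quot c' r (- y)" using quot_eqI[OF S r spair_neg[OF S w(1)]] by simp
next
  fix f f' g g' :: "int \<Rightarrow> int"
  assume f: "compat (quot c r) (quot c' r) f f'" and g: "compat (quot c r) (quot c' r) g g'"
  have N: "0 < N" by (rule spair_pos[OF S])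
  have r0: "0 < r" "r dvd N" using r xdiv_pos xdiv_dvd by blast+
  have lift: "compat c c' f f'" if "compat (quot c r) (quot c' r) f f'" for f f' :: "int \<Rightarrow> int"
    using compatD[OF that] quot_eqI[OF S r] unfolding compat_def by blast
  have per: "periodic r f" "periodic r f'" if f: "compat (quot c r) (quot c' r) f f'" for f f' :: "int \<Rightarrow> int"
  proof -
    show "periodic r f" unfolding periodic_def
    proof (intro allI impI)
      fix x y assume "r dvd x - y"
      then have e: "quot c r x = quot c r y" by (rule periodicD[OF quot_per])
      obtain z where "c x = c' z" using spair_ex[OF S] .
      from quot_eqI[OF S r this] show "f x = f y" using compatD[OF f, of x z] compatD[OF f, of y z] e by simp
    qed
    show "periodic r f'" unfolding periodic_def
    proof (intro allI impI)
      fix x y assume "r dvd x - y"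
      then have e: "quot c' r x = quot c' r y" by (rule periodicD[OF quot_per])
      obtain z where "c z = c' x" using spair_ex'[OF S] .
      from quot_eqI[OF S r this] show "f' x = f' y" using compatD[OF f, of z x] compatD[OF f, of z y] e by simp
    qed
  qed
  have "0 < N div r" using N r0 by (simp add: pos_imp_zdiv_pos_iff zdvd_imp_le)
  have conv: "conv r f g x = conv r f' g' y" if "c x = c' y" for x y
    using compatD[OF spair_conv[OF S lift[OF f] lift[OF g]] that] \<open>0 < N div r\<close>
    unfolding conv_quot[OF per(1)[OF f] per(1)[OF g] r0 N] conv_quot[OF per(2)[OF f] per(2)[OF g] r0 N] by simp
  have cper: "periodic r (conv r f' g')"
    unfolding periodic_def conv_def
  proof (intro allI impI sum.cong refl)
    fix x y z assume "r dvd x - y"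
    then have "r dvd (x - z) - (y - z)" by simp
    then show "f' z * g' (x - z) = f' z * g' (y - z)" using periodicD[OF per(2)[OF g]] by metis
  qed
  show "compat (quot c r) (quot c' r) (conv r f g) (conv r f' g')"
    unfolding compat_def
  proof (intro allI impI)
    fix x y assume "quot c r x = quot c' r y"
    then obtain w where w: "c x = c' w" "r dvd w - y" by (rule quot_obtain)
    show "conv r f g x = conv r f' g' y" using conv[OF w(1)] periodicD[OF cper w(2)] by simp
  qed
qed

lemma xs_quot_iff:
  assumes S: "spair N c c'" and r: "xdiv N c r" and D: "pset r D" "pset r D'"
  shows "xs (quot c r) (quot c' r) D D' \<longleftrightarrow> xs c c' D D'"
proof
  assume x: "xs (quot c r) (quot c' r) D D'"
  show "xs c c' D D'" unfolding compat_def using compatD[OF x quot_eqI[OF S r]] by blast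
next
  assume x: "xs c c' D D'"
  show "xs (quot c r) (quot c' r) D D'" unfolding compat_def
  proof (intro allI impI)
    fix u v assume "quot c r u = quot c' r v"
    then obtain w where w: "c u = c' w" "r dvd w - v" by (rule quot_obtain)
    show "u \<in> D \<longleftrightarrow> v \<in> D'" using xsD[OF x w(1)] periodicD[OF D(2) w(2)] by simp
  qed
qed

lemma cl_quot: assumes S: "spair N c c" and r: "xdiv N c r"
  shows "cl (quot c r) k = splus (cl c k) (mult r)"
proof (rule equalityI; rule subsetI)
  fix x assume "x \<in> cl (quot c r) k"
  then have "quot c r k = quot c r x" by simp
  then obtain w where "c k = c w" "r dvd w - x" by (rule quot_obtain)
  then have "x = w + (x - w)" "c w = c k" "r dvd x - w" by (simp_all add: dvd_diff_commute)
  then show "x \<in> splus (cl c k) (mult r)" unfolding splus_def cl_def mult_def by blast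
next
  fix x assume "x \<in> splus (cl c k) (mult r)"
  then obtain a b where ab: "x = a + b" "c a = c k" "r dvd b" unfolding splus_def cl_def mult_def by blast
  have "quot c r x = quot c r a" by (rule periodicD[OF quot_per]) (use ab in simp)
  then show "x \<in> cl (quot c r) k" using quot_eqI[OF S r ab(2)] by simp
qed

lemma xdiv_quot_iff: assumes S: "spair N c c" and r: "xdiv N c r" and d: "d dvd r"
  shows "xdiv r (quot c r) d \<longleftrightarrow> xdiv N c d"
proof -
  have "d dvd N" using d xdiv_dvd[OF r] dvd_trans by blast
  then show ?thesis using xs_quot_iff[OF S r pset_mult[OF d] pset_mult[OF d]] d unfolding xdiv_def by blast
qed

lemma xdiv_sub_iff: assumes S: "spair N c c" and u: "xdiv N c u"
  shows "xdiv (N div u) (sub c u) d \<longleftrightarrow> xdiv N c (u * d)"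
proof -
  have u0: "0 < u" "u dvd N" using u xdiv_pos xdiv_dvd by blast+
  have 1: "u * d dvd N \<longleftrightarrow> d dvd N div u" using u0 by (metis dvd_mult_div_cancel dvd_times_left_cancel_iff less_irrefl)
  have 2: "xset (sub c u) (mult d) \<longleftrightarrow> xset c (mult (u * d))"
  proof
    assume x: "xset c (mult (u * d))"
    show "xset (sub c u) (mult d)" unfolding compat_def
    proof (intro allI impI)
      fix x y assume "sub c u x = sub c u y"
      then have "u * x \<in> mult (u * d) \<longleftrightarrow> u * y \<in> mult (u * d)" using xsD[OF x] unfolding sub_def by blast
      then show "x \<in> mult d \<longleftrightarrow> y \<in> mult d" using u0 by simp
    qed
  next
    assume x: "xset (sub c u) (mult d)"
    have *: "y \<in> mult (u * d)" if "c x = c y" "x \<in> mult (u * d)" for x y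
    proof -
      obtain e where "x = u * d * e" using \<open>x \<in> mult (u * d)\<close> unfolding mult_iff by (rule dvdE)
      then obtain a where a: "x = u * a" "d dvd a" by (metis dvd_triv_left mult.assoc)
      have "u dvd y" using xdiv_iff[OF S u \<open>c x = c y\<close>] a by simp
      then obtain b where b: "y = u * b" by blast
      have "sub c u a = sub c u b" using \<open>c x = c y\<close> a b by (simp add: sub_def)
      then have "d dvd b" using xsD[OF x, of a b] a by simp
      then show ?thesis using b by simp
    qed
    show "xset c (mult (u * d))" unfolding compat_def using * by metis
  qed
  show ?thesis unfolding xdiv_def using u0 1 2 by (auto simp: zero_less_mult_iff)
qed

lemma gn_quot: assumes S: "spair N c c" and r: "xdiv N c r" and D: "pset r D"
  and x: "gn N D dvd r" shows "gn r D = gn N D"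
proof -
  have "gn r D dvd gn N D"
    by (rule gn_greatest) (use gn_dvd xdiv_dvd[OF r] dvd_trans in blast)+
  moreover have "gn N D dvd gn r D"
    by (rule gn_greatest) (use gn_dvd(2)[of _ D N] x in blast)+
  ultimately show ?thesis
    by (rule zdvd_antisym_nonneg[rotated 2]) (use gn_pos[OF xdiv_pos[OF r]] gn_pos[OF spair_pos[OF S]] in \<open>metis less_imp_le\<close>)+
qed

lemma gn_dvd_rd: assumes S: "spair N c c" and D: "xset c D" and "D \<noteq> {}" shows "gn N D dvd rd D"
proof -
  note p = xs_per[OF S D]
  obtain x where x: "x \<in> D" using assms by blast
  have "x + rd D \<in> D" using rd_period[OF spair_pos[OF S] p, of "rd D" x] x by simp
  then have "gn N D dvd (x + rd D) - x" using gn_dvd(2)[of x D N] gn_dvd(2)[of "x + rd D" D N] x by (metis dvd_diff)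
  then show ?thesis by simp
qed

lemma cl_sub: "cl (sub c u) k = {x. u * x \<in> cl c (u * k)}"
  unfolding cl_def sub_def by simp

lemma gn_sub: assumes S: "spair N c c" and u: "u dvd N" "0 < u" and D: "\<And>x. x \<in> D \<Longrightarrow> u dvd x"
  shows "u * gn (N div u) {x. u * x \<in> D} = gn N D"
proof -
  have "u * gn (N div u) {x. u * x \<in> D} dvd gn N D"
  proof (rule gn_greatest)
    show "u * gn (N div u) {x. u * x \<in> D} dvd N"
      using gn_dvd(1)[of "N div u" "{x. u * x \<in> D}"] u by (metis dvd_mult_div_cancel mult_dvd_mono dvd_refl)
    fix x assume "x \<in> D"
    then obtain y where "x = u * y" "y \<in> {x. u * x \<in> D}" using D by (metis dvdE mem_Collect_eq)
    then show "u * gn (N div u) {x. u * x \<in> D} dvd x" using gn_dvd(2) by (metis mult_dvd_mono dvd_refl)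
  qed
  moreover have "gn N D dvd u * gn (N div u) {x. u * x \<in> D}"
  proof -
    have "u dvd gn N D" using gn_greatest[OF u(1)] D by blast
    then obtain e where e: "gn N D = u * e" by blast
    have "e dvd gn (N div u) {x. u * x \<in> D}"
    proof (rule gn_greatest)
      show "e dvd N div u" using gn_dvd(1)[of N D] e u by (metis dvd_mult_div_cancel dvd_times_left_cancel_iff less_irrefl)
      fix x assume "x \<in> {x. u * x \<in> D}"
      then have "u * e dvd u * x" using gn_dvd(2)[of "u * x" D N] e by simp
      then show "e dvd x" using u by simp
    qed
    then show ?thesis using e by simp
  qed
  moreover have "0 \<le> gn N D" by (simp add: gn_def)
  moreover have "0 \<le> u * gn (N div u) {x. u * x \<in> D}" using u by (simp add: gn_def)
  ultimately show ?thesis using zdvd_antisym_nonneg by blast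
qed

lemma rd_sub: assumes S: "spair N c c" and u: "u dvd N" "0 < u" and p: "pset N D" and ne: "D \<noteq> {}"
  and D: "\<And>x. x \<in> D \<Longrightarrow> u dvd x"
  shows "u * rd {x. u * x \<in> D} = rd D"
proof -
  have N: "0 < N" by (rule spair_pos[OF S])
  have n: "0 < N div u" using N u by (simp add: pos_imp_zdiv_pos_iff zdvd_imp_le)
  define D' where "D' = {x. u * x \<in> D}"
  have p': "pset (N div u) D'"
    unfolding periodic_def D'_def mem_Collect_eq
  proof (intro allI impI)
    fix x y assume "N div u dvd x - y"
    then have "u * (N div u) dvd u * (x - y)" by (rule mult_dvd_mono[OF dvd_refl])
    then have "N dvd u * x - u * y" using u by (simp add: right_diff_distrib)
    then show "u * x \<in> D \<longleftrightarrow> u * y \<in> D" by (rule periodicD[OF p])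
  qed
  have rdu: "u dvd rd D"
  proof -
    obtain x where x: "x \<in> D" using ne by blast
    then have "x + rd D \<in> D" using rd_period[OF N p, of "rd D" x] by simp
    then have "u dvd x" "u dvd x + rd D" using D x by blast+
    then show ?thesis by (metis dvd_add_right_iff)
  qed
  then obtain e where e: "rd D = u * e" by blast
  have "rd D' dvd e"
    unfolding rd_dvd_iff[OF n p']
  proof
    fix x assume "x \<in> D'"
    then have "u * x + rd D \<in> D" using rd_period[OF N p, of "rd D" "u * x"] unfolding D'_def by simp
    then show "x + e \<in> D'" unfolding D'_def e by (simp add: distrib_left)
  qed
  moreover have "rd D dvd u * rd D'"
    unfolding rd_dvd_iff[OF N p]
  proof
    fix x assume "x \<in> D"
    then obtain y where y: "x = u * y" "y \<in> D'" using D unfolding D'_def by (metis dvdE mem_Collect_eq)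
    then have "y + rd D' \<in> D'" using rd_period[OF n p', of "rd D'" y] by simp
    then show "x + u * rd D' \<in> D" unfolding D'_def y by (simp add: distrib_left)
  qed
  ultimately have "u * rd D' dvd rd D" "rd D dvd u * rd D'" using e by simp_all
  moreover have "0 \<le> u * rd D'" "0 \<le> rd D" using u by (simp_all add: rd_def)
  ultimately show ?thesis unfolding D'_def using zdvd_antisym_nonneg by blast
qed

section \<open>The part of a class at one prime\<close>

lemma prime_power_dvd_cases:
  assumes p: "Factorial_Ring.prime (p::int)" and d: "d dvd p ^ e" "\<not> p ^ e dvd d"
  shows "d * p dvd p ^ e"
proof -
  obtain i where i: "i \<le> e" "normalize d = p ^ i"
    using divides_primepow[OF p, of d e] d(1) p by (metis normalize_idem_imp_unit_factor_eq prime_imp_prime_elem divides_primepow_weak)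
  have "i < e"
  proof (rule ccontr)
    assume "\<not> i < e"
    then have "p ^ e dvd normalize d" using i by simp
    then show False using d(2) by simp
  qed
  then have "p ^ i * p dvd p ^ e" by (metis Suc_leI le_imp_power_dvd power_Suc2)
  then have "normalize d * p dvd p ^ e" using i by simp
  then show ?thesis by (metis dvd_normalize_div mult_dvd_mono dvd_refl normalize_dvd_iff dvd_trans dvd_normalize_iff)
qed

lemma solve_cong: fixes a t n :: int assumes "gcd a n dvd t" shows "\<exists>s. n dvd s * a - t"
proof -
  obtain u v where "u * a + v * n = gcd a n" using bezout_int by blast
  moreover obtain k where "t = gcd a n * k" using assms by blast
  moreover have "(k * u) * a - t = k * (u * a + v * n) - t - n * (k * v)" by (simp add: algebra_simps)
  ultimately have "(k * u) * a - t = n * (- (k * v))" by (simp add: mult.commute)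
  then show ?thesis by (metis dvd_triv_left)
qed

lemma crt_int: fixes m n :: int assumes "coprime m n" shows "\<exists>x. m dvd x - a \<and> n dvd x - b"
proof -
  have "gcd m n dvd b - a" using assms by simp
  then obtain s where "n dvd s * m - (b - a)" using solve_cong by blast
  then have "m dvd (a + s * m) - a \<and> n dvd (a + s * m) - b" by (simp add: algebra_simps)
  then show ?thesis by blast
qed

lemma coprime_cong: assumes "n dvd a - (b::int)" "coprime b n" shows "coprime a n"
proof -
  have "[a = b] (mod n)" using assms(1) by (simp add: cong_iff_dvd_diff)
  then show ?thesis using assms(2) cong_imp_coprime cong_sym by blast
qed

lemma coprime_primesI:
  assumes "n \<noteq> (0::int)" "\<And>s. Factorial_Ring.prime s \<Longrightarrow> s dvd b \<Longrightarrow> s dvd n \<Longrightarrow> False"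
  shows "coprime b n"
proof (rule ccontr)
  assume "\<not> coprime b n"
  then have "\<not> is_unit (gcd b n)" by (simp add: coprime_iff_gcd_eq_1)
  moreover have "gcd b n \<noteq> 0" using assms(1) by simp
  ultimately obtain s where "s dvd gcd b n" "Factorial_Ring.prime s" using prime_divisor_exists by blast
  then show False using assms(2)[of s] by auto
qed

text \<open>Add to \<open>a\<close> the product of \<open>A\<close> with all primes of
  \<open>N\<close> that do not divide \<open>a\<close>. Each prime of \<open>N\<close> then divides
  exactly one of the two summands, because a prime dividing \<open>a\<close> cannot divide
  \<open>A\<close>.\<close>

lemma coprime_lift: fixes a A N :: int assumes N: "0 < N" and a: "coprime a A" shows "\<exists>b. coprime b N \<and> A dvd b - a"
proof -
  define K where "K = {r. Factorial_Ring.prime r \<and> r dvd N \<and> \<not> r dvd a}"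
  have fin: "finite K"
    by (rule finite_subset[of _ "{r. r dvd N}"]) (use N in \<open>auto simp: K_def intro!: finite_divisors_int\<close>)
  define b where "b = a + A * \<Prod>K"
  have "coprime b N"
  proof (rule coprime_primesI)
    show "N \<noteq> 0" using N by simp
    fix s :: int assume s: "Factorial_Ring.prime s" "s dvd b" "s dvd N"
    show False
    proof (cases "s dvd a")
      case True
      then have "s dvd A * \<Prod>K" using s(2) unfolding b_def by (simp add: dvd_add_right_iff)
      then have "s dvd A \<or> (\<exists>r\<in>K. s dvd r)" using s(1) fin by (simp add: prime_dvd_mult_iff prime_dvd_prod_iff)
      moreover have "\<not> s dvd A" using True a s(1) by (meson coprime_common_divisor not_prime_unit)
      ultimately obtain r where "r \<in> K" "s dvd r" by blast
      then have "s = r" using s(1) unfolding K_def by (simp add: primes_dvd_imp_eq)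
      then show False using \<open>r \<in> K\<close> True unfolding K_def by simp
    next
      case False
      then have "s \<in> K" using s unfolding K_def by simp
      then have "s dvd \<Prod>K" using fin by (rule dvd_prodI[rotated])
      then show False using s(2) False unfolding b_def by (simp add: dvd_add_left_iff)
    qed
  qed
  then show ?thesis unfolding b_def by (intro exI[of _ "a + A * \<Prod>K"]) simp
qed

text \<open>\<open>P\<close> is the full power of \<open>p\<close> in \<open>N\<close>. So \<open>P dvd x\<close> says that the \<open>p\<close>-component of \<open>x\<close> in
  \<open>Z/N\<close> is trivial, \<open>P dvd p * x\<close> that its order divides \<open>p\<close>, and \<open>q\<close> has order \<open>p\<close>.\<close>
locale pring =
  fixes N :: int and c :: "int \<Rightarrow> 'k" and p P M q :: int
  assumes S: "spair N c c" and p: "Factorial_Ring.prime p" and pP: "p dvd P" and Pp: "\<exists>e. P = p ^ e"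
    and NPM: "N = P * M" and cop: "coprime P M" and Npq: "N = p * q"
begin

text \<open>These are the multipliers that act on the \<open>p\<close>-component only.\<close>

definition gam :: "int \<Rightarrow> bool" where "gam a \<longleftrightarrow> coprime a N \<and> M dvd a - 1"

definition gaminv :: "int set \<Rightarrow> bool" where "gaminv D \<longleftrightarrow> (\<forall>a x. gam a \<longrightarrow> x \<in> D \<longrightarrow> a * x \<in> D)"

text \<open>A substitute for being a single orbit. A class of a rational scheme has this property,
  and so does the \<open>gam\<close>-orbit of a class of any scheme.\<close>

definition gmin :: "int set \<Rightarrow> bool" where
  "gmin D \<longleftrightarrow> (\<forall>D'. xset c D' \<longrightarrow> gaminv D' \<longrightarrow> D' \<inter> D \<noteq> {} \<longrightarrow> D \<subseteq> D')"

text \<open>For a \<open>gam\<close>-invariant union of classes this is \<open>frob N p D\<close>,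
  moved by a unit that undoes the multiplication by \<open>p\<close> on the component of order
  \<open>M\<close>.\<close>

definition Zset :: "int set \<Rightarrow> int set" where
  "Zset D = {g. P dvd g \<and> (\<exists>j. g + j * q \<in> D) \<and> (\<exists>j. g + j * q \<notin> D)}"

lemma N0: "0 < N" by (rule spair_pos[OF S])
lemma p1: "1 < p" using p prime_gt_1_int by blast
lemma PN: "P dvd N" and MN: "M dvd N" by (simp_all add: NPM)
lemma pN: "p dvd N" using pP PN dvd_trans by blast
lemma qdiv: "N div p = q" using Npq p1 by simp
lemma P0: "0 < P" using Pp p1 by (metis zero_less_power order.strict_trans zero_less_one)
lemma M0: "0 < M" using N0 P0 unfolding NPM by (simp add: zero_less_mult_iff)
lemma q0: "0 < q"
proof -
  have "0 < p * q" using N0 Npq by simp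
  then show ?thesis using p1 zero_less_mult_pos by fastforce
qed
lemma Ppp: "P = p * (P div p)" using pP by simp
lemma qPM: "q = (P div p) * M"
proof -
  have "p * q = p * ((P div p) * M)" using Npq NPM Ppp by (metis mult.assoc)
  then show ?thesis using p1 by simp
qed
lemma Mq: "M dvd q" unfolding qPM by simp
lemma pM: "coprime p M" using cop pP by (metis coprime_divisors dvd_refl)

lemma N_dvd_iff: "N dvd x \<longleftrightarrow> P dvd x \<and> M dvd x"
proof
  assume "N dvd x" then show "P dvd x \<and> M dvd x" using PN MN dvd_trans by blast
next
  assume "P dvd x \<and> M dvd x" then show "N dvd x" unfolding NPM using divides_mult[OF _ _ cop] by blast
qed

lemma q_dvd_iff: "q dvd x \<longleftrightarrow> P dvd p * x \<and> M dvd x"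
proof -
  have "q dvd x \<longleftrightarrow> N dvd p * x" unfolding Npq using p1 by simp
  also have "\<dots> \<longleftrightarrow> P dvd p * x \<and> M dvd p * x" by (rule N_dvd_iff)
  also have "M dvd p * x \<longleftrightarrow> M dvd x" using pM by (metis coprime_commute coprime_dvd_mult_right_iff)
  finally show ?thesis .
qed

lemma N_dvd_jq: "N dvd j * q \<longleftrightarrow> p dvd j" unfolding Npq using q0 by simp

lemma coprime_N: "\<not> p dvd a \<Longrightarrow> coprime a M \<Longrightarrow> coprime a N"
proof -
  assume a: "\<not> p dvd a" "coprime a M"
  have "coprime a p" using a(1) p by (metis coprime_commute prime_imp_coprime)
  then have "coprime a P" using Pp by (metis coprime_power_right_iff)
  then show ?thesis using a(2) unfolding NPM by simp
qed

lemma coprime_pD: "coprime a N \<Longrightarrow> \<not> p dvd a"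
  using pN p by (meson coprime_common_divisor not_prime_unit)

lemma gam_fix: "gam a \<Longrightarrow> P dvd x \<Longrightarrow> N dvd a * x - x"
proof -
  assume "gam a" "P dvd x"
  then have "P dvd (a - 1) * x" "M dvd (a - 1) * x" unfolding gam_def by simp_all
  then show ?thesis using N_dvd_iff[of "(a - 1) * x"] by (simp add: algebra_simps)
qed

text \<open>With \<open>a = 1 + M * t * s\<close> the task is to solve
  \<open>M * s * t * x = j * q\<close> modulo \<open>N\<close>. This is possible since the
  \<open>p\<close>-part of \<open>t * x\<close> is nontrivial, so that \<open>gcd (t * x) P\<close>
  divides \<open>P div p\<close>; and \<open>p dvd t\<close> keeps \<open>a\<close> prime to
  \<open>p\<close>.\<close>

lemma gam_shift:
  assumes "p dvd t" "\<not> P dvd t * x" shows "\<exists>a. gam a \<and> t dvd a - 1 \<and> N dvd a * x - (x + j * q)"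
proof -
  obtain e where e: "P = p ^ e" using Pp by blast
  have "\<not> P dvd gcd (t * x) P" using assms by simp
  then have "gcd (t * x) P * p dvd P" using prime_power_dvd_cases[OF p] e by simp
  then have "gcd (t * x) P dvd P div p" using Ppp p1 by (metis dvd_times_right_cancel_iff mult.commute not_one_less_zero order_less_irrefl)
  then have "gcd (t * x) P dvd j * (P div p)" by simp
  then obtain s where s: "P dvd s * (t * x) - j * (P div p)" using solve_cong by blast
  define a where "a = 1 + M * t * s"
  have "\<not> p dvd a"
  proof
    assume "p dvd a"
    moreover have "p dvd M * t * s" using assms(1) by simp
    ultimately have "p dvd a - M * t * s" by (rule dvd_diff)
    then show False unfolding a_def using p1 by simp
  qed
  moreover have "coprime a M"
    by (rule coprime_cong[of M a 1]) (simp_all add: a_def)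
  ultimately have "gam a" unfolding gam_def using coprime_N by (simp add: a_def)
  moreover have "a * x - (x + j * q) = M * (s * (t * x) - j * (P div p))"
    unfolding a_def qPM by (simp add: algebra_simps)
  then have "N dvd a * x - (x + j * q)" unfolding NPM using s by (metis mult.commute mult_dvd_mono dvd_refl)
  moreover have "t dvd a - 1" unfolding a_def by simp
  ultimately show ?thesis by blast
qed

lemma gam_shift1:
  assumes "P dvd x" "\<not> p dvd i" "\<not> p dvd j" shows "\<exists>a. gam a \<and> N dvd a * (x + i * q) - (x + j * q)"
proof -
  have "coprime i p" using assms(2) p by (metis coprime_commute prime_imp_coprime)
  then have "gcd i p dvd j" by simp
  then obtain b where b: "p dvd b * i - j" using solve_cong by blast
  obtain a where a: "p dvd a - b" "M dvd a - 1" using crt_int[OF pM] by blast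
  have ai: "p dvd a * i - j"
  proof -
    have "a * i - j = (a - b) * i + (b * i - j)" by (simp add: algebra_simps)
    then show ?thesis using a(1) b by (metis dvd_add dvd_mult2)
  qed
  have "\<not> p dvd a"
  proof
    assume "p dvd a"
    then have "p dvd a * i - (a * i - j)" using ai by (metis dvd_diff dvd_mult2)
    then show False using assms(3) by simp
  qed
  moreover have "coprime a M" by (rule coprime_cong[OF a(2)]) simp
  ultimately have g: "gam a" unfolding gam_def using coprime_N a(2) by blast
  have "a * (x + i * q) - (x + j * q) = (a * x - x) + (a * i - j) * q" by (simp add: algebra_simps)
  moreover have "N dvd (a * i - j) * q" using ai N_dvd_jq by blast
  ultimately show ?thesis using g gam_fix[OF g assms(1)] by (metis dvd_add)
qed

lemma gaminv_shift:
  assumes D: "pset N D" "gaminv D" and x: "x \<in> D" "\<not> P dvd p * x" shows "x + j * q \<in> D"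
proof -
  obtain a where "gam a" "N dvd a * x - (x + j * q)" using gam_shift[OF dvd_refl x(2)] by blast
  then show ?thesis using D(2) x(1) periodicD[OF D(1)] unfolding gaminv_def by blast
qed

lemma gaminv_shift1:
  assumes D: "pset N D" "gaminv D" and x: "P dvd x" "\<not> p dvd i" "\<not> p dvd j" "x + i * q \<in> D" shows "x + j * q \<in> D"
proof -
  obtain a where "gam a" "N dvd a * (x + i * q) - (x + j * q)" using gam_shift1[OF x(1-3)] by blast
  then show ?thesis using D(2) x(4) periodicD[OF D(1)] unfolding gaminv_def by blast
qed

lemma Zset_gaminv: assumes "pset N D" shows "gaminv (Zset D)"
  unfolding gaminv_def
proof (intro allI impI)
  fix a x assume a: "gam a" and x: "x \<in> Zset D"
  then have Px: "P dvd x" unfolding Zset_def by blast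
  have "N dvd (a * x + j * q) - (x + j * q)" for j using gam_fix[OF a Px] by simp
  then have "a * x + j * q \<in> D \<longleftrightarrow> x + j * q \<in> D" for j using periodicD[OF assms] by blast
  then show "a * x \<in> Zset D" using x Px unfolding Zset_def by simp
qed

text \<open>By invariance an element that leaves \<open>D\<close> inside its coset of order
  \<open>p\<close> has a \<open>p\<close>-part of order at most \<open>p\<close>. With
  \<open>a\<close> inverse to \<open>p\<close> modulo \<open>M\<close> and \<open>1\<close> modulo
  \<open>P\<close>, the element \<open>a * p * x\<close> is then the point of the coset of
  \<open>x\<close> with trivial \<open>p\<close>-part.\<close>

lemma Zset_frob: assumes D: "xset c D" "gaminv D"
  obtains a where "coprime a N" "Zset D = dil N a (frob N p D)"
    "\<And>x j. x \<in> D \<Longrightarrow> x + j * q \<notin> D \<Longrightarrow> a * p * x \<in> Zset D"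
proof -
  note per = xs_per[OF S D(1)]
  have "gcd p M dvd 1" using pM by simp
  then obtain b where b: "M dvd b * p - 1" using solve_cong by blast
  obtain a where a: "M dvd a - b" "P dvd a - 1" using crt_int[of M P b 1] cop by (metis coprime_commute)
  have ap: "M dvd a * p - 1"
  proof -
    have "a * p - 1 = (a - b) * p + (b * p - 1)" by (simp add: algebra_simps)
    then show ?thesis using a(1) b by (metis dvd_add dvd_mult2)
  qed
  have "coprime a P" by (rule coprime_cong[OF a(2)]) simp
  moreover have "coprime a M"
  proof -
    have "coprime (a * p) M" by (rule coprime_cong[OF ap]) simp
    then show ?thesis by simp
  qed
  ultimately have ca: "coprime a N" unfolding NPM by simp
  have fwd: "g \<in> Zset D" if x: "x \<in> D" "x + j * q \<notin> D" and g: "N dvd g - a * (p * x)" for g x j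
  proof -
    have px: "P dvd p * x" using gaminv_shift[OF per D(2) x(1)] x(2) by blast
    have "P dvd a * (p * x)" using px by simp
    moreover have "P dvd g - a * (p * x)" using g PN dvd_trans by blast
    ultimately have Pg: "P dvd g" by (metis dvd_diffD1 dvd_add_right_iff diff_add_cancel)
    have "M dvd x - g"
    proof -
      have "M dvd g - a * (p * x)" using g MN dvd_trans by blast
      moreover have "x - g = - (g - a * (p * x)) - (a * p - 1) * x" by (simp add: algebra_simps)
      ultimately show ?thesis using ap by (metis dvd_diff dvd_minus_iff dvd_mult2)
    qed
    moreover have "P dvd p * (x - g)" using px Pg by (simp add: right_diff_distrib)
    ultimately have "q dvd x - g" using q_dvd_iff by blast
    then obtain k where k: "x = g + k * q" by (metis diff_add_cancel dvdE mult.commute add.commute)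
    then have "g + k * q \<in> D" "g + (k + j) * q \<notin> D" using x by (simp_all add: algebra_simps)
    then show ?thesis using Pg unfolding Zset_def by blast
  qed
  have "Zset D = dil N a (frob N p D)"
  proof (rule equalityI; rule subsetI)
    fix g assume "g \<in> Zset D"
    then obtain i j where g: "P dvd g" "g + i * q \<in> D" "g + j * q \<notin> D" unfolding Zset_def by blast
    have "(g + i * q) + (j - i) * (N div p) \<notin> D" using g(3) unfolding qdiv by (simp add: algebra_simps)
    then have f: "p * (g + i * q) \<in> frob N p D" using g(2) unfolding frob_def by force
    have "M dvd (a * p - 1) * g" using ap by simp
    moreover have "P dvd (a * p - 1) * g" using g(1) by simp
    ultimately have "N dvd (a * p - 1) * g" using N_dvd_iff by blast
    moreover have "g - a * (p * (g + i * q)) = - ((a * p - 1) * g) - a * i * N" unfolding Npq by (simp add: algebra_simps)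
    ultimately have "N dvd g - a * (p * (g + i * q))" by (metis dvd_diff dvd_minus_iff dvd_triv_right)
    then show "g \<in> dil N a (frob N p D)" using f unfolding dil_def by blast
  next
    fix g assume "g \<in> dil N a (frob N p D)"
    then obtain h x j where h: "N dvd g - a * h" "N dvd h - p * x" "x \<in> D" "x + j * (N div p) \<notin> D"
      unfolding dil_def frob_def by blast
    have "g - a * (p * x) = (g - a * h) + a * (h - p * x)" by (simp add: algebra_simps)
    then have "N dvd g - a * (p * x)" using h by (metis dvd_add dvd_mult)
    then show "g \<in> Zset D" using fwd[of x j g] h unfolding qdiv by blast
  qed
  moreover have "a * p * x \<in> Zset D" if "x \<in> D" "x + j * q \<notin> D" for x j
    by (rule fwd[OF that]) (simp add: mult.assoc)
  ultimately show ?thesis using that ca by blast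
qed

lemma xs_dil: assumes D: "xset c D" and a: "coprime a N" shows "xset c (dil N a D)"
proof -
  have *: "y \<in> dil N a D" if xy: "c x = c y" and "x \<in> dil N a D" for x y
  proof -
    obtain z where z: "z \<in> D" "N dvd x - a * z" using \<open>x \<in> dil N a D\<close> unfolding dil_def by blast
    have "gcd a N dvd 1" using a by simp
    then obtain b where b: "N dvd b * a - 1" using solve_cong by blast
    have "coprime (b * a) N" by (rule coprime_cong[OF b]) simp
    then have cb: "coprime b N" by simp
    have "b * x - z = b * (x - a * z) + (b * a - 1) * z" by (simp add: algebra_simps)
    then have "N dvd b * x - z" using z b by (metis dvd_add dvd_mult dvd_mult2)
    then have "b * x \<in> D" using periodicD[OF xs_per[OF S D]] z(1) by blast
    then have "b * y \<in> D" using xsD[OF D multiplier[OF S xy cb]] by simp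
    moreover have "y - a * (b * y) = - ((b * a - 1) * y)" by (simp add: algebra_simps)
    then have "N dvd y - a * (b * y)" using b by (metis dvd_minus_iff dvd_mult2)
    ultimately show ?thesis unfolding dil_def by blast
  qed
  show ?thesis unfolding compat_def using * by metis
qed

lemma xset_Zset: assumes D: "xset c D" "gaminv D" shows "xset c (Zset D)"
proof -
  obtain a where a: "coprime a N" "Zset D = dil N a (frob N p D)" using Zset_frob[OF D] by metis
  show ?thesis unfolding a(2) by (rule xs_dil[OF xs_frob[OF S D(1) p pN] a(1)])
qed

text \<open>If the sets met, \<open>gmin\<close> would put \<open>D\<close> inside
  \<open>Zset D\<close>, all of whose members have trivial \<open>p\<close>-part.\<close>

lemma Zset_disj:
  assumes D: "xset c D" "gaminv D" "gmin D" and x: "x \<in> D" "\<not> P dvd x"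
  shows "Zset D \<inter> D = {}"
proof (rule ccontr)
  assume "Zset D \<inter> D \<noteq> {}"
  then have "D \<subseteq> Zset D" using D xset_Zset[OF D(1,2)] Zset_gaminv[OF xs_per[OF S D(1)]] unfolding gmin_def by blast
  then show False using x unfolding Zset_def by blast
qed

lemma Zset_ne:
  assumes D: "xset c D" "gaminv D" and np: "\<not> rd D dvd q" shows "Zset D \<noteq> {}"
proof -
  note per = xs_per[OF S D(1)]
  obtain x where "x \<in> D" "x + 1 * q \<notin> D" using np rd_dvd_iff[OF N0 per, of q] by auto
  then show ?thesis using Zset_frob[OF D] by (metis empty_iff)
qed

text \<open>The multipliers in \<open>gam\<close> permute the points \<open>g + j * q\<close> with
  \<open>j\<close> prime to \<open>p\<close> transitively, and \<open>D\<close> contains one of them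
  because it does not contain \<open>g\<close>. So \<open>g\<close> is the only point of its coset
  missing from \<open>D\<close>.\<close>

lemma Zset_hash:
  assumes D: "xset c D" "gaminv D" "gmin D" and x: "x \<in> D" "\<not> P dvd x"
    and g: "g \<in> Zset D" and j: "\<not> p dvd j" shows "g + j * q \<in> D"
proof -
  note per = xs_per[OF S D(1)]
  obtain i where i: "P dvd g" "g + i * q \<in> D" using g unfolding Zset_def by blast
  have "g \<notin> D" using Zset_disj[OF D x] g by blast
  have "\<not> p dvd i"
  proof
    assume "p dvd i"
    then have "N dvd (g + i * q) - g" using N_dvd_jq by simp
    then show False using periodicD[OF per] i(2) \<open>g \<notin> D\<close> by blast
  qed
  then show ?thesis using gaminv_shift1[OF per D(2) i(1) _ j i(2)] by blast
qed

lemma Zset_full: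
  assumes D: "xset c D" "gaminv D" "gmin D" and x: "x \<in> D" "\<not> P dvd x"
    and g: "g \<in> D" "P dvd g" shows "g + j * q \<in> D"
proof -
  have "g \<notin> Zset D" using Zset_disj[OF D x] g by blast
  moreover have "g + 0 * q \<in> D" using g by simp
  ultimately show ?thesis using g(2) unfolding Zset_def by blast
qed

end

lemma ex_pring:
  assumes S: "spair N c c" and p: "Factorial_Ring.prime p" "p dvd N"
  obtains P M q where "pring N c p P M q"
proof -
  have N: "0 < N" by (rule spair_pos[OF S])
  obtain M where M: "N = p ^ multiplicity p N * M" "\<not> p dvd M"
    using multiplicity_decompose'[of N p] N p(1) by (metis less_irrefl not_prime_unit)
  have "multiplicity p N \<noteq> 0" using N p by (metis prime_multiplicity_gt_zero_iff less_irrefl prime_imp_prime_elem)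
  then have 1: "p dvd p ^ multiplicity p N" by (simp add: dvd_power)
  have "coprime p M" using M(2) p(1) by (simp add: prime_imp_coprime)
  then have "coprime (p ^ multiplicity p N) M" by simp
  then have "pring N c p (p ^ multiplicity p N) M (N div p)" by unfold_locales (use S p M 1 in auto)
  then show ?thesis by (rule that)
qed

section \<open>Rational schemes\<close>

lemma pos_dvd_antisym: "0 < (a::int) \<Longrightarrow> 0 < b \<Longrightarrow> a dvd b \<Longrightarrow> b dvd a \<Longrightarrow> a = b"
  by (rule zdvd_antisym_nonneg) simp_all

definition rational :: "int \<Rightarrow> (int \<Rightarrow> 'k) \<Rightarrow> bool" where
  "rational N c \<longleftrightarrow> (\<forall>a x. coprime a N \<longrightarrow> c (a * x) = c x)"

text \<open>The rational closure: the new colour collects the colours of all unit multiples, so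
  classes conjugate under multipliers are merged.\<close>

definition ctr :: "int \<Rightarrow> (int \<Rightarrow> 'k) \<Rightarrow> int \<Rightarrow> 'k set" where
  "ctr N c x = (\<lambda>a. c (a * x)) ` {a. coprime a N}"

lemma unit_inverse: assumes "coprime a (N::int)" obtains b where "coprime b N" "N dvd b * a - 1"
proof -
  have "gcd a N dvd 1" using assms by simp
  then obtain b where b: "N dvd b * a - 1" using solve_cong by blast
  have "coprime (b * a) N" by (rule coprime_cong[OF b]) simp
  then have "coprime b N" by simp
  then show ?thesis using b by (rule that)
qed

lemma ctr_iff: assumes S: "spair N c c"
  shows "ctr N c x = ctr N c y \<longleftrightarrow> (\<exists>a. coprime a N \<and> c x = c (a * y))"
proof
  assume e: "ctr N c x = ctr N c y"
  have "c (1 * x) \<in> ctr N c x" unfolding ctr_def by (rule imageI) simp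
  then have "c (1 * x) \<in> (\<lambda>a. c (a * y)) ` {a. coprime a N}" unfolding e unfolding ctr_def .
  then obtain a where "c (1 * x) = c (a * y)" "a \<in> {a. coprime a N}" by (rule imageE)
  then show "\<exists>a. coprime a N \<and> c x = c (a * y)" by auto
next
  have sub: "ctr N c x \<subseteq> ctr N c y" if a: "coprime a N" "c x = c (a * y)" for a x y
  proof
    fix k assume "k \<in> ctr N c x"
    then obtain b where b: "k = c (b * x)" "b \<in> {a. coprime a N}" unfolding ctr_def by (rule imageE)
    have "c (b * x) = c ((b * a) * y)" using multiplier[OF S a(2), of b] b(2) by (simp add: mult.assoc)
    moreover have "b * a \<in> {a. coprime a N}" using a(1) b(2) by simp
    then have "(\<lambda>a. c (a * y)) (b * a) \<in> ctr N c y" unfolding ctr_def by (rule imageI)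
    ultimately show "k \<in> ctr N c y" using b(1) by simp
  qed
  assume "\<exists>a. coprime a N \<and> c x = c (a * y)"
  then obtain a where a: "coprime a N" "c x = c (a * y)" by blast
  obtain b where b: "coprime b N" "N dvd b * a - 1" using unit_inverse[OF a(1)] .
  have "N dvd (b * a - 1) * y" using b(2) by simp
  then have "c (b * (a * y)) = c y" using spair_eq[OF S, of "b * (a * y)" y] by (simp add: algebra_simps)
  then have "c y = c (b * x)" using multiplier[OF S a(2) b(1)] by simp
  then show "ctr N c x = ctr N c y" using sub[OF a] sub[OF b(1)] by blast
qed

text \<open>Substituting \<open>a * y\<close> for the summation variable shows that the convolution
  of functions invariant under units is again invariant under units.\<close>

lemma spair_ctr: assumes S: "spair N c c" shows "spair N (ctr N c) (ctr N c)"
  unfolding spair_def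
proof (intro conjI allI impI)
  have N: "0 < N" by (rule spair_pos[OF S])
  show "0 < N" by (rule N)
  show p: "periodic N (ctr N c)" "periodic N (ctr N c)"
  proof -
    show "periodic N (ctr N c)" unfolding periodic_def
    proof (intro allI impI)
      fix x y assume "N dvd x - y"
      then have "c x = c (1 * y)" using spair_eq[OF S] by simp
      then show "ctr N c x = ctr N c y" unfolding ctr_iff[OF S] by (intro exI[of _ 1]) simp
    qed
    then show "periodic N (ctr N c)" .
  qed
  fix x y assume "ctr N c x = ctr N c y"
  then obtain a where a: "coprime a N" "c x = c (a * y)" unfolding ctr_iff[OF S] by blast
  show "N dvd x \<longleftrightarrow> N dvd y"
    using spair_zero[OF S a(2)] a(1) by (metis coprime_commute coprime_dvd_mult_right_iff)
  have "c (- x) = c (a * (- y))" using spair_neg[OF S a(2)] by simp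
  then show "ctr N c (- x) = ctr N c (- y)" unfolding ctr_iff[OF S] using a(1) by blast
next
  have N: "0 < N" by (rule spair_pos[OF S])
  fix f f' g g' :: "int \<Rightarrow> int"
  assume f: "compat (ctr N c) (ctr N c) f f'" and g: "compat (ctr N c) (ctr N c) g g'"
  have eq: "f' = f" "g' = g" using f g unfolding compat_def by (metis ext)+
  have inv: "f (a * x) = f x" if f: "compat (ctr N c) (ctr N c) f f" and a: "coprime a N" for f :: "int \<Rightarrow> int" and a x
  proof -
    have "ctr N c (a * x) = ctr N c x" unfolding ctr_iff[OF S] using a by blast
    then show ?thesis using compatD[OF f] by blast
  qed
  have lift: "compat c c f f" if f: "compat (ctr N c) (ctr N c) f f" for f :: "int \<Rightarrow> int"
    unfolding compat_def
  proof (intro allI impI)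
    fix x y assume "c x = c y"
    then have "c x = c (1 * y)" by simp
    then have "ctr N c x = ctr N c y" unfolding ctr_iff[OF S] by (intro exI[of _ 1]) simp
    then show "f x = f y" using compatD[OF f] by blast
  qed
  note f = f[unfolded eq] and g = g[unfolded eq]
  have ci: "conv N f g (a * x) = conv N f g x" if a: "coprime a N" for a x
  proof -
    have per: "periodic N (\<lambda>y. f y * g (a * x - y))"
      unfolding periodic_def
    proof (intro allI impI)
      fix y z assume d: "N dvd y - z"
      have "N dvd (a * x - y) - (a * x - z)" using d by (simp add: dvd_diff_commute)
      then show "f y * g (a * x - y) = f z * g (a * x - z)"
        using periodicD[OF compat_per[OF S lift[OF f]] d] periodicD[OF compat_per[OF S lift[OF g]]] by simp
    qed
    have "conv N f g (a * x) = (\<Sum>y\<in>{0..<N}. f (a * y) * g (a * x - a * y))"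
      unfolding conv_def using sum_unit[OF N per a] by simp
    also have "\<dots> = conv N f g x"
      unfolding conv_def by (rule sum.cong) (simp_all add: inv[OF f a] inv[OF g a] flip: right_diff_distrib)
    finally show ?thesis .
  qed
  show "compat (ctr N c) (ctr N c) (conv N f g) (conv N f' g')"
    unfolding compat_def eq
  proof (intro allI impI)
    fix x y assume "ctr N c x = ctr N c y"
    then obtain a where a: "coprime a N" "c x = c (a * y)" unfolding ctr_iff[OF S] by blast
    show "conv N f g x = conv N f g y"
      using compatD[OF spair_conv[OF S lift[OF f] lift[OF g]] a(2)] ci[OF a(1)] by simp
  qed
qed simp

lemma rational_ctr: assumes S: "spair N c c" shows "rational N (ctr N c)"
  unfolding rational_def ctr_iff[OF S] by blast

lemma xset_ctr: assumes S: "spair N c c" and D: "xset (ctr N c) D" shows "xset c D"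
  unfolding compat_def
proof (intro allI impI)
  fix x y assume "c x = c y"
  then have "c x = c (1 * y)" by simp
  then have "ctr N c x = ctr N c y" unfolding ctr_iff[OF S] by (intro exI[of _ 1]) simp
  then show "x \<in> D \<longleftrightarrow> y \<in> D" using xsD[OF D] by blast
qed

lemma xdiv_ctr: assumes S: "spair N c c" shows "xdiv N (ctr N c) d \<Longrightarrow> xdiv N c d"
  using xset_ctr[OF S] unfolding xdiv_def by blast

context
  fixes N :: int and c :: "int \<Rightarrow> 'k"
  assumes S: "spair N c c" and R: "rational N c"
begin

lemma rational_gaminv: "pring N c p P M q \<Longrightarrow> xset c D \<Longrightarrow> pring.gaminv N M D"
proof -
  assume "pring N c p P M q" and D: "xset c D"
  then interpret pring N c p P M q by simp
  show ?thesis unfolding gaminv_def gam_def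
    using R xsD[OF D] unfolding rational_def by blast
qed

lemma rational_gmin: "pring N c p P M q \<Longrightarrow> pring.gmin N c M (cl c k)"
proof -
  assume "pring N c p P M q"
  then interpret pring N c p P M q by simp
  show ?thesis unfolding gmin_def
  proof (intro allI impI)
    fix D' assume D: "xset c D'" "D' \<inter> cl c k \<noteq> {}"
    then obtain x where "x \<in> D'" "c x = c k" by auto
    then have "k \<in> D'" using xsD[OF D(1)] by blast
    then show "cl c k \<subseteq> D'" using class_subset[OF D(1)] by blast
  qed
qed

lemma rd_not_0: assumes "\<not> N dvd x" "rd (cl c x) dvd x" shows False
proof -
  have "x + (- x) \<in> cl c x"
    using rd_period[OF spair_pos[OF S] xs_per[OF S xset_cl], of x "- x" x] assms(2) by simp
  then have "c 0 = c x" by simp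
  then show False using spair_zero[OF S, of 0 x] assms(1) by simp
qed

lemma pring_gn:
  assumes "pring N c p P M q" and D: "xset c D" and "\<forall>x\<in>D. P dvd x"
  shows "P dvd gn N D"
proof -
  interpret pring N c p P M q by fact
  show ?thesis by (rule gn_greatest) (use assms PN in auto)
qed

lemma pring_not_dvd: assumes "pring N c p P M q" and v: "v dvd N" "p dvd N div v" shows "\<not> P dvd v"
proof
  interpret pring N c p P M q by fact
  assume "P dvd v"
  then obtain k where k: "v = P * k" by blast
  obtain l where l: "N = v * l" using v(1) by blast
  have v0: "v \<noteq> 0" using l N0 by auto
  have "p dvd l" using v(2) l v0 by simp
  then obtain m where "l = p * m" by blast
  then have "P * M = P * (p * (k * m))" using k l NPM by (simp add: mult_ac)
  then have "M = p * (k * m)" using P0 by simp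
  then have "p dvd M" by simp
  then show False using pM p by (metis coprime_absorb_left not_prime_unit)
qed

text \<open>Let \<open>C\<close> be a class of nonzero elements in the minimal subgroup. It
  generates that subgroup and has trivial radical. For a prime \<open>r\<close> dividing the order,
  \<open>Zset C\<close> has trivial \<open>r\<close>-part, so it generates a proper subgroup and
  contains only \<open>0\<close>. By \<open>Zset_hash\<close> the element \<open>q\<close> of order
  \<open>r\<close> lies in \<open>C\<close>; hence every such class is the class of
  \<open>q\<close>.\<close>

lemma rational_minimal:
  assumes v: "xdiv N c v" and vmin: "\<And>d. xdiv N c d \<Longrightarrow> v dvd d \<Longrightarrow> d = v \<or> d = N"
    and x: "v dvd x" "\<not> N dvd x" and y: "v dvd y" "\<not> N dvd y"
  shows "c x = c y"
proof -
  have N: "0 < N" by (rule spair_pos[OF S])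
  have vN: "0 < v" "v dvd N" using v xdiv_pos xdiv_dvd by blast+
  obtain w where w: "N = v * w" using vN by blast
  have "w \<noteq> 0" using w N by auto
  moreover have "\<not> is_unit w" using x w by (metis dvd_mult_unit_iff dvd_trans mult_unit_dvd_iff dvd_refl)
  ultimately obtain r where r: "r dvd w" "Factorial_Ring.prime r" using prime_divisor_exists by blast
  have rN: "r dvd N" "r dvd N div v" using r w vN by auto
  obtain P M q where pr: "pring N c r P M q" using ex_pring[OF S r(2) rN(1)] .
  then interpret pring N c r P M q .
  have vq: "v dvd q"
  proof -
    have "r * v dvd r * q" using w r(1) unfolding Npq[symmetric] by auto
    then show ?thesis using p1 by simp
  qed
  have "c x = c q" if x: "v dvd x" "\<not> N dvd x" for x
  proof -
    define C where "C = cl c x"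
    have C: "xset c C" unfolding C_def by (rule xset_cl)
    have Cv: "C \<subseteq> mult v" unfolding C_def
      by (rule class_subset) (use v x in \<open>unfold xdiv_def, auto\<close>)
    have xC: "x \<in> C" by (simp add: C_def)
    have "v dvd gn N C" by (rule gn_greatest) (use vN Cv in auto)
    moreover have "gn N C \<noteq> N" using gn_dvd(2)[OF xC, of N] x(2) by auto
    ultimately have gC: "gn N C = v" using vmin[OF xdiv_gn[OF S C]] by blast
    have nP: "\<not> P dvd v" by (rule pring_not_dvd[OF pr vN(2) rN(2)])
    then have "\<not> (\<forall>x\<in>C. P dvd x)" using pring_gn[OF pr C] gC by auto
    then obtain z where z: "z \<in> C" "\<not> P dvd z" by blast
    have "v dvd rd C" using gn_dvd_rd[OF S C] xC gC by auto
    moreover have "rd C \<noteq> v" using rd_not_0[OF x(2)] x(1) unfolding C_def by auto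
    ultimately have rC: "rd C = N" using vmin[OF xdiv_rd[OF S C]] by blast
    have gi: "gaminv D" if "xset c D" for D by (rule rational_gaminv[OF pr that])
    have gm: "gmin C" unfolding C_def by (rule rational_gmin[OF pr])
    have "\<not> N dvd q" using p1 q0 zdvd_imp_le[of N q] unfolding Npq by auto
    then have "Zset C \<noteq> {}" using Zset_ne[OF C gi[OF C]] rC by simp
    then obtain g where g: "g \<in> Zset C" by blast
    have xZ: "xset c (Zset C)" by (rule xset_Zset[OF C gi[OF C]])
    have vZ: "v dvd h" if hZ: "h \<in> Zset C" for h
    proof -
      obtain j where "h + j * q \<in> C" using hZ unfolding Zset_def by blast
      then have "v dvd h + j * q" using Cv by auto
      then show ?thesis using vq by (metis dvd_add_left_iff dvd_mult)
    qed
    have "v dvd gn N (Zset C)" by (rule gn_greatest) (use vN vZ in auto)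
    moreover have "gn N (Zset C) \<noteq> v"
    proof
      assume "gn N (Zset C) = v"
      moreover have "\<forall>x\<in>Zset C. P dvd x" unfolding Zset_def by blast
      ultimately show False using pring_gn[OF pr xZ] nP by simp
    qed
    ultimately have "gn N (Zset C) = N" using vmin[OF xdiv_gn[OF S xZ]] by blast
    then have "N dvd g" using gn_dvd(2)[OF g, of N] by simp
    have "\<not> r dvd 1" using p1 by simp
    from Zset_hash[OF C gi[OF C] gm z g this] have "g + q \<in> C" by simp
    moreover have "c (g + q) = c q" using spair_eq[OF S] \<open>N dvd g\<close> by simp
    ultimately show ?thesis by (simp add: C_def)
  qed
  then show ?thesis using x y by metis
qed

lemma ex_minimal: assumes u: "xdiv N c u" "u \<noteq> N"
  obtains v where "xdiv N c v" "u dvd v" "v \<noteq> N" "\<And>d. xdiv N c d \<Longrightarrow> v dvd d \<Longrightarrow> d = v \<or> d = N"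
proof -
  have N: "0 < N" by (rule spair_pos[OF S])
  define K where "K = {d. xdiv N c d \<and> u dvd d \<and> d \<noteq> N}"
  have "finite K" by (rule finite_subset[of _ "{r. r dvd N}"]) (use N in \<open>auto simp: K_def xdiv_def intro!: finite_divisors_int\<close>)
  moreover have "u \<in> K" using u by (simp add: K_def)
  ultimately have m: "Max K \<in> K" "\<And>d. d \<in> K \<Longrightarrow> d \<le> Max K" using Max_in Max_ge by blast+
  have "d = Max K \<or> d = N" if d: "xdiv N c d" "Max K dvd d" for d
  proof (rule ccontr)
    assume h: "\<not> (d = Max K \<or> d = N)"
    have "u dvd d" using m(1) d(2) dvd_trans unfolding K_def by blast
    then have "d \<le> Max K" using m(2) d h unfolding K_def by blast
    moreover have "Max K \<le> d" using zdvd_imp_le[OF d(2) xdiv_pos[OF d(1)]] .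
    ultimately show False using h by simp
  qed
  then show ?thesis using that m(1) unfolding K_def by blast
qed

text \<open>Schur's theorem for a class with trivial radical.\<close>
lemma rational_trivial_radical:
  assumes pr: "pring N c p P M q" and rB: "rd (cl c q) = N"
  shows "cl c q = {x. gn N (cl c q) dvd x \<and> \<not> N dvd x}"
proof -
  interpret pring N c p P M q by fact
  define B where "B = cl c q"
  define u where "u = gn N B"
  have xB: "xset c B" unfolding B_def by (rule xset_cl)
  have nq: "\<not> N dvd q" using p1 q0 zdvd_imp_le[of N q] unfolding Npq by auto
  have qB: "q \<in> B" by (simp add: B_def)
  have xu: "xdiv N c u" unfolding u_def by (rule xdiv_gn[OF S xB])
  have uq: "u dvd q" unfolding u_def by (rule gn_dvd(2)[OF qB])
  have uN: "u \<noteq> N" using uq nq by auto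
  obtain v where v: "xdiv N c v" "u dvd v" "v \<noteq> N" "\<And>d. xdiv N c d \<Longrightarrow> v dvd d \<Longrightarrow> d = v \<or> d = N"
    using ex_minimal[OF xu uN] by blast
  have vN: "0 < v" "v dvd N" using v xdiv_pos xdiv_dvd by blast+
  have hash: "c x = c y" if "v dvd x" "\<not> N dvd x" "v dvd y" "\<not> N dvd y" for x y
    using rational_minimal[OF v(1) v(4) that] .
  have B0: "\<not> N dvd x" if "x \<in> B" for x using that spair_zero[OF S, of x q] nq unfolding B_def by simp
  \<comment> \<open>Otherwise \<open>p\<close> does not divide the order \<open>w\<close> of the
    minimal subgroup, whose elements then have trivial \<open>p\<close>-part. The contradiction
    comes from the single point that \<open>B\<close> misses in the coset of
    \<open>q\<close>.\<close>
  have vq: "v dvd q"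
  proof (rule ccontr)
    assume nvq: "\<not> v dvd q"
    obtain w where w: "N = v * w" using vN by blast
    have w0: "w \<noteq> 0" "\<not> is_unit w"
    proof -
      show "w \<noteq> 0" using w N0 by auto
      show "\<not> is_unit w"
      proof
        assume "is_unit w"
        then have "w = 1" using w N0 vN(1) by (metis zero_less_mult_pos zdvd1_eq abs_of_pos)
        then show False using w v(3) by simp
      qed
    qed
    obtain r where r: "r dvd w" "Factorial_Ring.prime r" using prime_divisor_exists w0 by blast
    have npw: "\<not> p dvd w"
    proof
      assume "p dvd w"
      then have "p * v dvd p * q" using w unfolding Npq[symmetric] by auto
      then show False using nvq p1 by simp
    qed
    have Pv: "P dvd v"
    proof -
      have "coprime P w" using npw p Pp by (metis coprime_power_left_iff prime_imp_coprime)
      moreover have "P dvd v * w" using PN w by simp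
      ultimately show ?thesis by (simp add: coprime_dvd_mult_left_iff)
    qed
    have nondiv: "\<not> P' dvd u" if "pring N c r P' M' q'" "r dvd w" for r P' M' q'
    proof -
      have "r dvd N div v" using that(2) w vN by simp
      then have "\<not> P' dvd v" using pring_not_dvd[OF that(1) vN(2)] by simp
      then show ?thesis using v(2) dvd_trans by blast
    qed
    have full: "\<exists>z\<in>B. \<not> P' dvd z" if "pring N c r P' M' q'" "r dvd w" for r P' M' q'
    proof (rule ccontr)
      assume "\<not> (\<exists>z\<in>B. \<not> P' dvd z)"
      then have "P' dvd u" unfolding u_def using pring_gn[OF that(1) xB] by blast
      then show False using nondiv[OF that] by simp
    qed
    text \<open>Every coset of the subgroup generated by \<open>v\<close> that meets \<open>B\<close> misses exactly one point of it.\<close>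
    have card: "cnt N {y. y \<in> B \<and> v dvd q - y} = w - 1"
    proof -
      have rN: "r dvd N" using r(1) w by simp
      obtain P' M' q' where pr': "pring N c r P' M' q'" using ex_pring[OF S r(2) rN] .
      then interpret r: pring N c r P' M' q' .
      obtain z where z: "z \<in> B" "\<not> P' dvd z" using full[OF pr' r(1)] by blast
      have gi: "r.gaminv B" by (rule rational_gaminv[OF pr' xB])
      have gm: "r.gmin B" unfolding B_def by (rule rational_gmin[OF pr'])
      have nq': "\<not> N dvd q'" using r.p1 r.q0 zdvd_imp_le[of N q'] unfolding r.Npq by auto
      have "r.Zset B \<noteq> {}" by (rule r.Zset_ne[OF xB gi]) (use rB nq' in \<open>simp add: B_def\<close>)
      then obtain g where g: "g \<in> r.Zset B" by blast
      \<comment> \<open>The elements translating \<open>Zset B\<close> into \<open>B\<close> form a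
        union of classes. It contains \<open>q'\<close>, an element of the minimal subgroup, and so
        all nonzero elements of that subgroup.\<close>
      have xT: "xset c (trans_set (r.Zset B) B)" by (rule xs_trans_set[OF S r.xset_Zset[OF xB gi] xB])
      have "\<not> r dvd 1" using r.p1 by simp
      then have "a + q' \<in> B" if "a \<in> r.Zset B" for a
        using r.Zset_hash[OF xB gi gm z that, of 1] by simp
      then have "q' \<in> trans_set (r.Zset B) B"
        unfolding trans_set_def by (simp add: add.commute)
      moreover have "v dvd q'"
      proof -
        have "r * v dvd r * q'" using w r(1) unfolding r.Npq[symmetric] by auto
        then show ?thesis using r.p1 by simp
      qed
      ultimately have T: "t \<in> trans_set (r.Zset B) B" if "v dvd t" "\<not> N dvd t" for t
        using xsD[OF xT hash[OF that _ nq']] by blast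
      have gB: "t + g \<in> B" if "v dvd t" "\<not> N dvd t" for t using T[OF that] g unfolding trans_set_def by blast
      have gnB: "g \<notin> B" using r.Zset_disj[OF xB gi gm z] g by blast
      have set: "{y. y \<in> B \<and> v dvd (q' + g) - y} = {x. x + (- g) \<in> mult v} - {x. x + (- g) \<in> mult N}"
      proof (rule equalityI; rule subsetI)
        fix y assume "y \<in> {y. y \<in> B \<and> v dvd (q' + g) - y}"
        then have y: "y \<in> B" "v dvd (q' + g) - y" by blast+
        have "v dvd q' - ((q' + g) - y)" using y(2) \<open>v dvd q'\<close> by (rule dvd_diff[rotated])
        then have "v dvd y - g" by simp
        moreover have "\<not> N dvd y - g"
          using periodicD[OF xs_per[OF S xB], of y g] y(1) gnB by blast
        ultimately show "y \<in> {x. x + (- g) \<in> mult v} - {x. x + (- g) \<in> mult N}" by simp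
      next
        fix y assume "y \<in> {x. x + (- g) \<in> mult v} - {x. x + (- g) \<in> mult N}"
        then have y: "v dvd y - g" "\<not> N dvd y - g" by simp_all
        have "y \<in> B" using gB[OF y] by simp
        moreover have "v dvd q' - (y - g)" using y(1) \<open>v dvd q'\<close> by (rule dvd_diff[rotated])
        then have "v dvd (q' + g) - y" by (simp add: algebra_simps)
        ultimately show "y \<in> {y. y \<in> B \<and> v dvd (q' + g) - y}" by blast
      qed
      have "cnt N {y. y \<in> B \<and> v dvd (q' + g) - y} = cnt N {x. x + (- g) \<in> mult v} - cnt N {x. x + (- g) \<in> mult N}"
        unfolding set by (rule cnt_Diff) (use vN(2) dvd_trans in auto)
      also have "\<dots> = w - 1"
        unfolding cnt_shift[OF N0 pset_mult[OF vN(2)]] cnt_shift[OF N0 pset_mult[OF dvd_refl]]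
        using cnt_mult[OF vN N0] cnt_mult[OF N0 dvd_refl N0] w vN N0 w0(1) by simp
      finally have "cnt N {y. y \<in> B \<and> v dvd (q' + g) - y} = w - 1" .
      moreover have "c (q' + g) = c q" using gB[OF \<open>v dvd q'\<close> nq'] unfolding B_def by simp
      moreover have "compat c c (\<lambda>x. cnt N {y. y \<in> B \<and> v dvd x - y}) (\<lambda>x. cnt N {y. y \<in> B \<and> v dvd x - y})"
        using compat_cnt[OF S xB, of "mult v" "mult v"] v(1) unfolding xdiv_def mult_iff by blast
      ultimately show ?thesis using compatD[of c c "\<lambda>x. cnt N {y. y \<in> B \<and> v dvd x - y}" _ "q' + g" q] by simp
    qed
    define V where "V = {x. x + (- q) \<in> mult v}"
    define Bq where "Bq = {y. y \<in> B \<and> v dvd q - y}"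
    have pV: "pset N V" unfolding V_def periodic_def mem_Collect_eq
      by (intro allI impI periodicD[OF pset_mult[OF vN(2)]]) simp
    have BV: "Bq = B \<inter> V" unfolding Bq_def V_def by (auto simp: dvd_diff_commute)
    have pBq: "pset N Bq" unfolding BV by (rule pset_Int[OF xs_per[OF S xB] pV])
    have cV: "cnt N V = w" unfolding V_def cnt_shift[OF N0 pset_mult[OF vN(2)]]
      using cnt_mult[OF vN N0] w vN by simp
    have miss: "cnt N (V - Bq) = 1" using cnt_Diff[of Bq V N] BV card cV unfolding Bq_def[symmetric] by simp
    have "V - Bq \<noteq> {}"
    proof
      assume "V - Bq = {}"
      then have "cnt N (V - Bq) = cnt N {}" by (rule arg_cong)
      then show False using miss by simp
    qed
    then obtain z where z: "z \<in> V" "z \<notin> B" unfolding BV by blast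
    have uniq: "N dvd z' - z" if z': "z' \<in> V" "z' \<notin> B" for z'
    proof (rule ccontr)
      assume n: "\<not> N dvd z' - z"
      define Z where "Z = {x. x + (- z) \<in> mult N}"
      have pZ: "pset N Z" unfolding Z_def periodic_def mem_Collect_eq
        by (intro allI impI periodicD[OF pset_mult[OF dvd_refl]]) simp
      have "Z \<subseteq> V - Bq"
      proof
        fix x assume "x \<in> Z"
        then have "N dvd x - z" unfolding Z_def by simp
        then have "x \<in> V - Bq \<longleftrightarrow> z \<in> V - Bq" by (rule periodicD[OF pset_Diff[OF pV pBq]])
        then show "x \<in> V - Bq" using z BV by blast
      qed
      moreover have "cnt N Z = 1" unfolding Z_def cnt_shift[OF N0 pset_mult[OF dvd_refl]]
        using cnt_mult[OF N0 dvd_refl N0] N0 by simp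
      ultimately have "Z = V - Bq" using cnt_subset_eq[OF N0 pZ pset_Diff[OF pV pBq]] miss by simp
      then have "z' \<in> Z" using z' BV by blast
      then show False using n unfolding Z_def by simp
    qed
    define v0 where "v0 = z - q"
    have vv0: "v dvd v0" using z(1) unfolding V_def v0_def by simp
    have nv0: "\<not> N dvd v0"
    proof
      assume "N dvd v0"
      then have "z \<in> B \<longleftrightarrow> q \<in> B" unfolding v0_def by (rule periodicD[OF xs_per[OF S xB]])
      then show False using z qB by blast
    qed
    \<comment> \<open>This unit fixes \<open>q\<close>, whose order is \<open>p\<close>, and inverts
      \<open>v0\<close>, whose \<open>p\<close>-part is trivial. It maps the missing point
      \<open>q + v0\<close> to \<open>q - v0\<close>, which is missing too; uniqueness gives
      \<open>2 * v0 = 0\<close> modulo \<open>N\<close>.\<close>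
    obtain a where a: "P dvd a - 1" "M dvd a - (- 1)" using crt_int[OF cop] by blast
    have "coprime a P" by (rule coprime_cong[OF a(1)]) simp
    moreover have "coprime a M" by (rule coprime_cong[OF a(2)]) simp
    ultimately have ca: "coprime a N" unfolding NPM by simp
    have aq: "N dvd a * q - q"
    proof -
      have "P dvd (a - 1) * q" "M dvd (a - 1) * q" using a(1) Mq by simp_all
      then show ?thesis using N_dvd_iff[of "(a - 1) * q"] by (simp add: algebra_simps)
    qed
    have av: "N dvd a * v0 + v0"
    proof -
      have "P dvd (a + 1) * v0" "M dvd (a + 1) * v0" using a(2) vv0 Pv dvd_trans by auto
      then show ?thesis using N_dvd_iff[of "(a + 1) * v0"] by (simp add: algebra_simps)
    qed
    have "a * z \<notin> B"
    proof -
      have "c (a * z) = c z" using R ca unfolding rational_def by blast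
      then show ?thesis using z(2) unfolding B_def by simp
    qed
    moreover have "a * z \<in> V"
    proof -
      have "v dvd (a * q - q) + a * v0" using aq vN(2) vv0 dvd_trans by (metis dvd_add dvd_mult)
      moreover have "(a * q - q) + a * v0 = a * z + - q" unfolding v0_def by (simp add: algebra_simps)
      ultimately show ?thesis unfolding V_def by simp
    qed
    ultimately have "N dvd a * z - z" using uniq by blast
    moreover have "2 * v0 = (a * q - q) + (a * v0 + v0) - (a * z - z)" unfolding v0_def by (simp add: algebra_simps)
    ultimately have N2: "N dvd 2 * v0" using aq av by (metis dvd_add dvd_diff)
    have ev: "2 dvd w"
    proof (rule ccontr)
      assume "\<not> 2 dvd w"
      obtain k where k: "v0 = v * k" using vv0 by blast
      have "v * w dvd v * (2 * k)" using N2 w k by (simp add: mult_ac)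
      then have "w dvd 2 * k" using vN(1) by simp
      moreover have "coprime w 2" using \<open>\<not> 2 dvd w\<close> by simp
      ultimately have "w dvd k" by (simp add: coprime_dvd_mult_right_iff)
      then show False using nv0 w k by simp
    qed
    \<comment> \<open>So \<open>v0\<close> is the involution, and \<open>p\<close> is odd. Now
      \<open>q\<close> is a point of \<open>B\<close> with trivial \<open>2\<close>-part, hence its
      whole coset of order \<open>2\<close> lies in \<open>B\<close>, including the missing
      point.\<close>
    have two: "Factorial_Ring.prime (2::int)" by simp
    have "2 dvd N" using ev w by simp
    then obtain P' M' q' where pr': "pring N c 2 P' M' q'" using ex_pring[OF S two] by blast
    then interpret t: pring N c 2 P' M' q' .
    obtain y where y: "y \<in> B" "\<not> P' dvd y" using full[OF pr' ev] by blast
    have gi: "t.gaminv B" by (rule rational_gaminv[OF pr' xB])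
    have gm: "t.gmin B" unfolding B_def by (rule rational_gmin[OF pr'])
    have "coprime P' p"
    proof -
      have "p \<noteq> 2" using npw ev by auto
      then have "coprime 2 p" using primes_coprime[OF two p] by metis
      moreover obtain e where "P' = 2 ^ e" using t.Pp by blast
      ultimately show ?thesis by (simp only: coprime_power_left_iff) simp
    qed
    moreover have "P' dvd p * q" using t.PN Npq by simp
    ultimately have "P' dvd q" by (simp add: coprime_dvd_mult_right_iff)
    then have qj: "q + j * q' \<in> B" for j using t.Zset_full[OF xB gi gm y qB] by blast
    have "2 * q' dvd 2 * v0" using N2 t.Npq by simp
    then have "q' dvd v0" by simp
    then obtain j where "v0 = j * q'" by (metis dvdE mult.commute)
    then have "z = q + j * q'" unfolding v0_def by simp
    then show False using qj z(2) by simp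
  qed
  have "B = {x. v dvd x \<and> \<not> N dvd x}"
  proof (rule equalityI; rule subsetI)
    fix x assume "x \<in> B"
    then have "x \<in> mult v" using class_subset[of c "mult v" q] v(1) vq unfolding xdiv_def B_def by auto
    then show "x \<in> {x. v dvd x \<and> \<not> N dvd x}" using B0[OF \<open>x \<in> B\<close>] by simp
  next
    fix x assume "x \<in> {x. v dvd x \<and> \<not> N dvd x}"
    then show "x \<in> B" unfolding B_def using hash[of x q] vq nq by simp
  qed
  moreover have "v dvd u" unfolding u_def by (rule gn_greatest) (use vN calculation in auto)
  then have "v = u" by (rule pos_dvd_antisym[OF vN(1) xdiv_pos[OF xu] _ v(2)])
  ultimately show ?thesis unfolding u_def B_def by simp
qed

end

context pring begin

lemma not_N_dvd_q: "\<not> N dvd q" using p1 q0 zdvd_imp_le[of N q] unfolding Npq by auto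

text \<open>The orbit of the class of an element of order \<open>p\<close> is the difference of two subgroups.\<close>

definition pcl :: "int \<Rightarrow> int \<Rightarrow> bool" where
  "pcl u A \<longleftrightarrow> xdiv N c u \<and> xdiv N c A \<and> u dvd q \<and> u dvd A \<and> P dvd A \<and> \<not> A dvd q \<and>
    (\<forall>x. (u dvd x \<and> \<not> A dvd x) \<longleftrightarrow> (\<exists>b. coprime b N \<and> c x = c (b * q)))"

lemma pclD:
  assumes "pcl u A"
  shows "xdiv N c u" "xdiv N c A" "u dvd q" "u dvd A" "P dvd A" "\<not> A dvd q"
    "(u dvd x \<and> \<not> A dvd x) \<longleftrightarrow> (\<exists>b. coprime b N \<and> c x = c (b * q))"
  using assms unfolding pcl_def by blast+

text \<open>In the rational closure, factor out the radical \<open>A\<close> of the class of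
  \<open>q\<close>. The image of the class has trivial radical, where Schur's theorem applies, and
  it is still the class of an element of order \<open>p\<close> because \<open>p\<close> does not
  divide \<open>N div A\<close>.\<close>

lemma order_p_class: "\<exists>u A. pcl u A"
proof -
  define c0 where "c0 = ctr N c"
  have S0: "spair N c0 c0" unfolding c0_def by (rule spair_ctr[OF S])
  have R0: "rational N c0" unfolding c0_def by (rule rational_ctr[OF S])
  define B where "B = cl c0 q"
  define A where "A = rd B"
  have xB: "xset c0 B" unfolding B_def by (rule xset_cl)
  have xA: "xdiv N c0 A" unfolding A_def by (rule xdiv_rd[OF S0 xB])
  have A0: "0 < A" "A dvd N" using xA xdiv_pos xdiv_dvd by blast+
  have nAq: "\<not> A dvd q" using rd_not_0[OF S0 R0 not_N_dvd_q] unfolding A_def B_def by blast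
  obtain w where w: "N = A * w" using A0 by blast
  have npw: "\<not> p dvd w"
  proof
    assume "p dvd w"
    then obtain k where "w = p * k" by blast
    then have "p * q = p * (A * k)" using w Npq by simp
    then show False using nAq p1 by simp
  qed
  have PA: "P dvd A"
  proof -
    have "coprime P w" using npw p Pp by (metis coprime_power_left_iff prime_imp_coprime)
    moreover have "P dvd A * w" using PN w by simp
    ultimately show ?thesis by (simp add: coprime_dvd_mult_left_iff)
  qed
  then obtain M1 where M1: "A = P * M1" by blast
  have pA: "p dvd A" using pP PA dvd_trans by blast
  then obtain q1 where q1: "A = p * q1" by blast
  have cop1: "coprime P M1"
  proof -
    have "P * M = P * (M1 * w)" using w NPM M1 by (simp add: mult.assoc)
    then have "M = M1 * w" using P0 by simp
    then show ?thesis using cop by simp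
  qed
  define c1 where "c1 = quot c0 A"
  have S1: "spair A c1 c1" unfolding c1_def by (rule spair_quot[OF S0 xA])
  have R1: "rational A c1" unfolding rational_def
  proof (intro allI impI)
    fix a x assume "coprime a A"
    then obtain b where b: "coprime b N" "A dvd b - a" using coprime_lift[OF N0] by blast
    have "c0 (b * x) = c0 x" using R0 b(1) unfolding rational_def by blast
    then have 1: "c1 (b * x) = c1 x" unfolding c1_def by (rule quot_eqI[OF S0 xA])
    have "A dvd b * x - a * x" using b(2) by (simp add: left_diff_distrib[symmetric])
    then have "c1 (b * x) = c1 (a * x)" unfolding c1_def by (rule periodicD[OF quot_per])
    then show "c1 (a * x) = c1 x" using 1 by simp
  qed
  have pr1: "pring A c1 p P M1 q1" by unfold_locales (use S1 p pP Pp M1 cop1 q1 in auto)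
  interpret r: pring A c1 p P M1 q1 by (rule pr1)
  \<comment> \<open>In the quotient \<open>q\<close> is \<open>w\<close> times the standard element
    \<open>q1\<close> of order \<open>p\<close>. As \<open>p\<close> does not divide
    \<open>w\<close>, a unit congruent to \<open>w\<close> modulo \<open>p\<close> has the same
    effect on \<open>q1\<close>.\<close>
  have qq1: "c1 q = c1 q1"
  proof -
    have "coprime w p" using npw p by (metis coprime_commute prime_imp_coprime)
    then obtain a where a: "coprime a A" "p dvd a - w" using coprime_lift[OF A0(1)] by blast
    have "p * q = p * (w * q1)" using w q1 Npq by (simp add: mult_ac)
    then have "q = w * q1" using p1 by simp
    then have "a * q1 - q = (a - w) * q1" by (simp add: algebra_simps)
    moreover have "A dvd (a - w) * q1" unfolding q1 using a(2) by simp
    ultimately have "A dvd a * q1 - q" by simp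
    then have "c1 (a * q1) = c1 q" by (rule spair_eq[OF S1])
    then show ?thesis using R1 a(1) unfolding rational_def by metis
  qed
  have clB: "cl c1 q1 = B"
  proof -
    have "cl c1 q1 = cl c1 q" unfolding cl_def qq1 by simp
    also have "\<dots> = splus B (mult A)" unfolding c1_def B_def by (rule cl_quot[OF S0 xA])
    also have "\<dots> = B"
    proof (rule equalityI; rule subsetI)
      fix x assume "x \<in> splus B (mult A)"
      then obtain a b where "x = a + b" "a \<in> B" "A dvd b" unfolding splus_def mult_def by blast
      then show "x \<in> B" using rd_period[OF N0 xs_per[OF S0 xB]] unfolding A_def by simp
    next
      fix x assume "x \<in> B"
      then have "x = x + 0 \<and> x \<in> B \<and> 0 \<in> mult A" by simp
      then show "x \<in> splus B (mult A)" unfolding splus_def by blast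
    qed
    finally show ?thesis .
  qed
  define u where "u = gn A B"
  have Bu: "B = {x. u dvd x \<and> \<not> A dvd x}"
    using rational_trivial_radical[OF S1 R1 pr1] unfolding clB u_def A_def by blast
  have uA: "u dvd A" unfolding u_def by (rule gn_dvd)
  have "xdiv A c1 u" unfolding u_def by (rule xdiv_gn[OF S1]) (metis clB xset_cl)
  then have "xdiv N c0 u" unfolding c1_def using xdiv_quot_iff[OF S0 xA uA] by simp
  then have xu: "xdiv N c u" unfolding c0_def by (rule xdiv_ctr[OF S])
  have xA': "xdiv N c A" using xA unfolding c0_def by (rule xdiv_ctr[OF S])
  have "q \<in> B" unfolding B_def by simp
  then have uq: "u dvd q" unfolding Bu by blast
  have "(u dvd x \<and> \<not> A dvd x) \<longleftrightarrow> (\<exists>b. coprime b N \<and> c x = c (b * q))" for x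
  proof -
    have "(u dvd x \<and> \<not> A dvd x) \<longleftrightarrow> x \<in> B" unfolding Bu by blast
    also have "\<dots> \<longleftrightarrow> ctr N c x = ctr N c q" unfolding B_def c0_def by simp
    finally show ?thesis unfolding ctr_iff[OF S] .
  qed
  then have "pcl u A" using xu xA' uq uA PA nAq unfolding pcl_def by blast
  then show ?thesis by blast
qed

end

section \<open>Double counting inside cosets of subgroups\<close>

lemma double_count:
  "(\<Sum>w\<in>{0..<N}. of_bool (w \<in> W) * cnt N' {y. y \<in> Q \<and> R w y}) =
   (\<Sum>y\<in>{0..<N'}. of_bool (y \<in> Q) * cnt N {w. w \<in> W \<and> R w y})"
proof -
  have "(\<Sum>w\<in>{0..<N}. of_bool (w \<in> W) * cnt N' {y. y \<in> Q \<and> R w y}) =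
    (\<Sum>w\<in>{0..<N}. \<Sum>y\<in>{0..<N'}. of_bool (w \<in> W) * of_bool (y \<in> Q \<and> R w y))"
    by (simp only: cnt_def sum_distrib_left mem_Collect_eq)
  also have "\<dots> = (\<Sum>y\<in>{0..<N'}. \<Sum>w\<in>{0..<N}. of_bool (w \<in> W) * of_bool (y \<in> Q \<and> R w y))"
    by (rule sum.swap)
  also have "\<dots> = (\<Sum>y\<in>{0..<N'}. \<Sum>w\<in>{0..<N}. of_bool (y \<in> Q) * of_bool (w \<in> W \<and> R w y))"
    by (intro sum.cong refl) auto
  also have "\<dots> = (\<Sum>y\<in>{0..<N'}. of_bool (y \<in> Q) * cnt N {w. w \<in> W \<and> R w y})"
    by (simp only: cnt_def sum_distrib_left mem_Collect_eq)
  finally show ?thesis .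
qed

lemma sum_const_cnt:
  assumes "\<And>w. w \<in> W \<Longrightarrow> f w = k"
  shows "(\<Sum>w\<in>{0..<N}. of_bool (w \<in> W) * f w) = k * cnt N W"
proof -
  have "(\<Sum>w\<in>{0..<N}. of_bool (w \<in> W) * f w) = (\<Sum>w\<in>{0..<N}. k * of_bool (w \<in> W))"
    by (rule sum.cong) (auto simp: assms)
  then show ?thesis by (simp only: cnt_def sum_distrib_left mem_Collect_eq)
qed

lemma sum_le_cnt:
  assumes "\<And>w. w \<in> W \<Longrightarrow> f w \<le> k"
  shows "(\<Sum>w\<in>{0..<N}. of_bool (w \<in> W) * f w) \<le> k * cnt N W"
proof -
  have "(\<Sum>w\<in>{0..<N}. of_bool (w \<in> W) * f w) \<le> (\<Sum>w\<in>{0..<N}. k * of_bool (w \<in> W))"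
    by (rule sum_mono) (auto simp: assms)
  then show ?thesis by (simp only: cnt_def sum_distrib_left mem_Collect_eq)
qed

lemma sum_ge_cnt:
  assumes "\<And>w. w \<in> W \<Longrightarrow> k \<le> f w"
  shows "k * cnt N W \<le> (\<Sum>w\<in>{0..<N}. of_bool (w \<in> W) * f w)"
proof -
  have "(\<Sum>w\<in>{0..<N}. k * of_bool (w \<in> W)) \<le> (\<Sum>w\<in>{0..<N}. of_bool (w \<in> W) * f w)"
    by (rule sum_mono) (auto simp: assms)
  then show ?thesis by (simp only: cnt_def sum_distrib_left mem_Collect_eq)
qed

lemma pset_shift: assumes "pset N A" shows "pset N {x. x + a \<in> A}"
  unfolding periodic_def mem_Collect_eq by (intro allI impI periodicD[OF assms]) simp

lemma fibre_count:
  assumes S: "spair N c c" and d: "xdiv N c d" and xy: "c x = c k"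
  shows "cnt N {y. y \<in> cl c k \<and> d dvd y - x} = cnt N {y. y \<in> cl c k \<and> d dvd y - k}"
proof -
  have "compat c c (\<lambda>x. cnt N {y. y \<in> cl c k \<and> x - y \<in> mult d}) (\<lambda>x. cnt N {y. y \<in> cl c k \<and> x - y \<in> mult d})"
    by (rule compat_cnt[OF S xset_cl]) (use d in \<open>simp only: xdiv_def\<close>)
  from compatD[OF this xy] show ?thesis by (simp add: dvd_diff_commute)
qed

text \<open>All cosets of \<open>mult A\<close> that meet the class contain equally many of its
  points, and a coset of \<open>mult u\<close> consists of \<open>(N div u) / (N div A)\<close> such
  cosets.\<close>

lemma fibre_ratio:
  assumes S: "spair N c c" and u: "xdiv N c u" and A: "xdiv N c A" and uA: "u dvd A"
  shows "cnt N {y. y \<in> cl c k \<and> u dvd y - k} * (N div A) \<le> (N div u) * cnt N {y. y \<in> cl c k \<and> A dvd y - k}"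
proof -
  have N: "0 < N" by (rule spair_pos[OF S])
  have u0: "0 < u" "u dvd N" and A0: "0 < A" "A dvd N" using u A xdiv_pos xdiv_dvd by blast+
  let ?Q = "cl c k"
  let ?s = "\<Sum>w\<in>{0..<N}. of_bool (w \<in> mult u) * cnt N {y. y \<in> ?Q \<and> A dvd y - k - w}"
  have "?s = (\<Sum>y\<in>{0..<N}. of_bool (y \<in> ?Q) * cnt N {w. w \<in> mult u \<and> A dvd y - k - w})"
    by (rule double_count)
  also have "\<dots> = (\<Sum>y\<in>{0..<N}. of_bool (y \<in> {y. y \<in> ?Q \<and> u dvd y - k}) * (N div A))"
  proof (rule sum.cong[OF refl])
    fix y
    have "cnt N {w. w \<in> mult u \<and> A dvd y - k - w} = of_bool (u dvd y - k) * (N div A)"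
    proof (cases "u dvd y - k")
      case True
      have "{w. w \<in> mult u \<and> A dvd y - k - w} = {w. (y - k) - w \<in> mult A}"
      proof (rule equalityI; rule subsetI)
        fix w assume "w \<in> {w. (y - k) - w \<in> mult A}"
        then have w: "A dvd (y - k) - w" by simp
        then have "u dvd (y - k) - ((y - k) - w)" using uA dvd_trans True by (metis dvd_diff)
        then show "w \<in> {w. w \<in> mult u \<and> A dvd y - k - w}" using w by simp
      qed simp
      then show ?thesis using cnt_refl[OF N pset_mult[OF A0(2)], of "y - k"] cnt_mult[OF A0 N] True by simp
    next
      case False
      have "{w. w \<in> mult u \<and> A dvd y - k - w} = {}"
      proof -
        have "u dvd y - k" if w: "u dvd w" "A dvd y - k - w" for w
        proof -
          have "u dvd (y - k - w) + w" using w uA dvd_trans by (metis dvd_add)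
          then show ?thesis by simp
        qed
        then show ?thesis using False by auto
      qed
      then have "cnt N {w. w \<in> mult u \<and> A dvd y - k - w} = 0" by (simp only: cnt_empty)
      then show ?thesis using False by simp
    qed
    then show "of_bool (y \<in> ?Q) * cnt N {w. w \<in> mult u \<and> A dvd y - k - w} =
      of_bool (y \<in> {y. y \<in> ?Q \<and> u dvd y - k}) * (N div A)" by auto
  qed
  also have "\<dots> = (N div A) * cnt N {y. y \<in> ?Q \<and> u dvd y - k}"
    by (rule sum_const_cnt) simp
  finally have 1: "?s = (N div A) * cnt N {y. y \<in> ?Q \<and> u dvd y - k}" .
  have "?s \<le> cnt N {y. y \<in> ?Q \<and> A dvd y - k} * cnt N (mult u)"
  proof (rule sum_le_cnt)
    fix w
    show "cnt N {y. y \<in> ?Q \<and> A dvd y - k - w} \<le> cnt N {y. y \<in> ?Q \<and> A dvd y - k}"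
    proof (cases "{y. y \<in> ?Q \<and> A dvd y - k - w} = {}")
      case True
      have "cnt N {y. y \<in> ?Q \<and> A dvd y - k - w} = 0" unfolding True by simp
      then show ?thesis using cnt_nonneg by simp
    next
      case False
      then obtain z where z: "c z = c k" "A dvd z - k - w" by auto
      have "cnt N {y. y \<in> ?Q \<and> A dvd y - k - w} \<le> cnt N {y. y \<in> ?Q \<and> A dvd y - z}"
      proof (rule cnt_mono)
        fix y assume "y \<in> {y. y \<in> ?Q \<and> A dvd y - k - w}"
        then have y: "y \<in> ?Q" "A dvd y - k - w" by blast+
        have "A dvd (y - k - w) - (z - k - w)" using y(2) z(2) by (rule dvd_diff)
        then show "y \<in> {y. y \<in> ?Q \<and> A dvd y - z}" using y(1) by simp
      qed
      then show ?thesis using fibre_count[OF S A z(1)] by simp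
    qed
  qed
  then show ?thesis using 1 cnt_mult[OF u0 N] by (simp add: mult.commute)
qed

context pring begin

lemma gam_mult: "gam a \<Longrightarrow> gam b \<Longrightarrow> gam (a * b)"
proof -
  assume a: "gam a" and b: "gam b"
  have "a * b - 1 = (a - 1) * b + (b - 1)" by (simp add: algebra_simps)
  then have "M dvd a * b - 1" using a b unfolding gam_def by (metis dvd_add dvd_mult2)
  then show ?thesis using a b unfolding gam_def by simp
qed

lemma gam_1: "gam 1" unfolding gam_def by simp

lemma gam_inverse: assumes "gam a" obtains b where "gam b" "N dvd b * a - 1"
proof -
  obtain b where b: "coprime b N" "N dvd b * a - 1" using unit_inverse assms unfolding gam_def by blast
  have "M dvd b * a - 1" using b(2) MN dvd_trans by blast
  moreover have "b - 1 = (b * a - 1) - b * (a - 1)" by (simp add: algebra_simps)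
  ultimately have "M dvd b - 1" using assms unfolding gam_def by (metis dvd_diff dvd_mult)
  then show ?thesis using that b unfolding gam_def by blast
qed

lemma gam_class: "gam a \<Longrightarrow> c x = c y \<Longrightarrow> c (a * x) = c (a * y)"
  using multiplier[OF S] unfolding gam_def by blast

lemma gam_fix_class: assumes "t dvd a - 1" "gam a" "c y = c k" "P dvd t * y" shows "c (a * k) = c k"
proof -
  obtain s where s: "a - 1 = t * s" using assms(1) by blast
  have "P dvd s * (t * y)" using assms(4) by simp
  then have "P dvd (a - 1) * y" unfolding s by (simp add: mult_ac)
  moreover have "M dvd (a - 1) * y" using assms(2) unfolding gam_def by simp
  ultimately have "N dvd a * y - y" using N_dvd_iff[of "(a - 1) * y"] by (simp add: algebra_simps)
  then have "c (a * y) = c y" by (rule spair_eq[OF S])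
  then show ?thesis using gam_class[OF assms(2,3)] assms(3) by simp
qed

text \<open>Multipliers in \<open>gam\<close> that are \<open>1\<close> modulo \<open>t\<close> fix
  \<open>y\<close>, hence the class. By \<open>gam_shift\<close> they move \<open>x\<close> through
  its coset of order \<open>p\<close>. So the points whose coset leaves the class are all killed by
  \<open>t\<close> in the \<open>p\<close>-component.\<close>

lemma class_shift:
  assumes "p dvd t" "c y = c k" "P dvd t * y" "c x = c k" "\<not> P dvd t * x"
  shows "c (x + j * q) = c k"
proof -
  obtain a where a: "gam a" "t dvd a - 1" "N dvd a * x - (x + j * q)" using gam_shift[OF assms(1,5)] by blast
  have "c (a * x) = c (a * k)" by (rule gam_class[OF a(1) assms(4)])
  then show ?thesis using spair_eq[OF S a(3)] gam_fix_class[OF a(2,1) assms(2,3)] by simp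
qed

text \<open>For a point \<open>w\<close> let \<open>n w\<close> be the number of points of the class
  that \<open>w\<close> translates into the class. This is a class function, and on unit multiples
  of \<open>q\<close> it misses at most the exceptional points counted in \<open>good\<close>. By
  \<open>pcl\<close> the same bound holds for all \<open>w\<close> in \<open>mult u\<close> outside
  \<open>mult A\<close>, and summing over these \<open>w\<close> bounds the trace of the class on a
  coset of \<open>mult u\<close> from below.\<close>

lemma density:
  assumes pcl: "pcl u A"
    and good: "(p + 1) * cnt N {x. x \<in> cl c k \<and> (\<exists>j. x + j * q \<notin> cl c k)} \<le> cnt N (cl c k)"
  shows "N div u < 2 * cnt N {y. y \<in> cl c k \<and> u dvd y - k}"
proof -
  note u = pclD(1)[OF pcl] and A = pclD(2)[OF pcl] and uq = pclD(3)[OF pcl]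
    and uA = pclD(4)[OF pcl] and Aq = pclD(6)[OF pcl] and W = pclD(7)[OF pcl]
  have u0: "0 < u" "u dvd N" and A0: "0 < A" "A dvd N" using u A xdiv_pos xdiv_dvd by blast+
  define Q where "Q = cl c k"
  define G where "G = {x. x \<in> Q \<and> (\<exists>j. x + j * q \<notin> Q)}"
  define C where "C d = cnt N {y. y \<in> Q \<and> d dvd y - k}" for d
  define n where "n w = cnt N {x. x \<in> Q \<and> x + w \<in> Q}" for w
  have xQ: "xset c Q" unfolding Q_def by (rule xset_cl)
  note per = xs_per[OF S xQ]
  have ncompat: "n w = n w'" if "c w = c w'" for w w'
  proof -
    have "n w = cnt N {y. y \<in> uminus ` Q \<and> w - y \<in> Q}" for w
    proof -
      have pp: "pset N {x. x \<in> Q \<and> x + w \<in> Q}" using pset_Int[OF per pset_shift[OF per, of w]] by (simp add: Int_def)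
      have "n w = cnt N {x. 0 - x \<in> {x. x \<in> Q \<and> x + w \<in> Q}}" unfolding n_def
        using cnt_refl[OF N0 pp, of 0] by simp
      then show ?thesis by (simp add: uminus_image_iff add.commute)
    qed
    then show ?thesis using compatD[OF compat_cnt[OF S xs_neg[OF S xQ] xQ] that] by simp
  qed
  define Ws where "Ws = {x. u dvd x \<and> \<not> A dvd x}"
  have Ws: "Ws = mult u - mult A" unfolding Ws_def mult_def by blast
  have AU: "mult A \<subseteq> mult u" using uA unfolding mult_subset_iff .
  have cW: "cnt N Ws = N div u - N div A"
    unfolding Ws cnt_Diff[OF AU] using cnt_mult[OF u0 N0] cnt_mult[OF A0 N0] by simp
  have low: "cnt N Q - cnt N G \<le> n w" if wW: "w \<in> Ws" for w
  proof -
    obtain b where b: "coprime b N" "c w = c (b * q)" using wW W unfolding Ws_def by blast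
    have "cnt N Q - cnt N G = cnt N (Q - G)" by (rule cnt_Diff[symmetric]) (auto simp: G_def)
    also have "\<dots> \<le> n (b * q)" unfolding n_def by (rule cnt_mono) (auto simp: G_def)
    finally show ?thesis using ncompat[OF b(2)] by simp
  qed
  have "(cnt N Q - cnt N G) * cnt N Ws \<le> (\<Sum>w\<in>{0..<N}. of_bool (w \<in> Ws) * n w)"
    by (rule sum_ge_cnt) (rule low)
  also have "\<dots> = (\<Sum>x\<in>{0..<N}. of_bool (x \<in> Q) * cnt N {w. w \<in> Ws \<and> x + w \<in> Q})"
    unfolding n_def by (rule double_count)
  also have "\<dots> = (C u - C A) * cnt N Q"
  proof (rule sum_const_cnt)
    fix x assume "x \<in> Q"
    then have xk: "c x = c k" by (simp add: Q_def)
    have fc: "cnt N {y. y \<in> Q \<and> d dvd y - x} = C d" if "xdiv N c d" for d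
      unfolding C_def Q_def by (rule fibre_count[OF S that xk])
    have ps: "pset N {y. y \<in> Q \<and> d dvd y - x}" if "d dvd N" for d
      using pset_Int[OF per pset_shift[OF pset_mult[OF that], of "- x"]] by (simp add: Int_def)
    have "{w. w \<in> Ws \<and> x + w \<in> Q} = {w. w + x \<in> {y. y \<in> Q \<and> u dvd y - x} - {y. y \<in> Q \<and> A dvd y - x}}"
      unfolding Ws_def by (auto simp: add.commute)
    also have "cnt N \<dots> = cnt N ({y. y \<in> Q \<and> u dvd y - x} - {y. y \<in> Q \<and> A dvd y - x})"
      by (rule cnt_shift[OF N0 pset_Diff[OF ps ps]]) (use u0 A0 in auto)
    also have "\<dots> = cnt N {y. y \<in> Q \<and> u dvd y - x} - cnt N {y. y \<in> Q \<and> A dvd y - x}"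
      by (rule cnt_Diff) (use uA dvd_trans in blast)
    finally show "cnt N {w. w \<in> Ws \<and> x + w \<in> Q} = C u - C A" using fc[OF u] fc[OF A] by simp
  qed
  finally have main: "(cnt N Q - cnt N G) * (N div u - N div A) \<le> (C u - C A) * cnt N Q" unfolding cW .
  have ratio: "C u * (N div A) \<le> (N div u) * C A"
    unfolding C_def Q_def by (rule fibre_ratio[OF S u A uA])
  define n1 m1 where "n1 = N div u" and "m1 = N div A"
  have nm: "N = u * n1" "N = A * m1" using u0 A0 by (simp_all add: n1_def m1_def)
  have m0: "0 < m1" using nm(2) A0(1) N0 zero_less_mult_pos by metis
  have n10: "0 < n1" using nm(1) u0(1) N0 zero_less_mult_pos by metis
  have "A \<noteq> u" using uq Aq by auto
  then have "u < A" using zdvd_imp_le[OF uA A0(1)] by simp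
  have n0: "m1 < n1"
  proof (rule ccontr)
    assume "\<not> m1 < n1"
    then have "u * n1 < A * m1" using \<open>u < A\<close> u0 m0 n10 by (intro mult_less_le_imp_less) auto
    then show False using nm by simp
  qed
  define Qc g where "Qc = cnt N Q" and "g = cnt N G"
  have Q0: "0 < Qc"
  proof -
    have "Q \<noteq> {}" unfolding Q_def by auto
    then have "Qc \<noteq> 0" unfolding Qc_def using cnt_zero_iff[OF N0 per] by blast
    then show ?thesis using cnt_nonneg[of N Q] unfolding Qc_def by simp
  qed
  have 1: "(Qc - g) * (n1 - m1) \<le> (C u - C A) * Qc" using main unfolding n1_def m1_def Qc_def g_def .
  have 2: "C u * m1 \<le> n1 * C A" using ratio unfolding n1_def m1_def .
  have 3: "(p + 1) * g \<le> Qc" using good unfolding Qc_def g_def G_def Q_def .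
  have "n1 * ((Qc - g) * (n1 - m1)) \<le> n1 * ((C u - C A) * Qc)" using 1 n0 m0 by (intro mult_left_mono) auto
  also have "\<dots> = (n1 * C u - n1 * C A) * Qc" by (simp add: algebra_simps)
  also have "\<dots> \<le> (n1 * C u - C u * m1) * Qc" using 2 Q0 by (intro mult_right_mono) auto
  finally have "(n1 * (Qc - g)) * (n1 - m1) \<le> (C u * Qc) * (n1 - m1)" by (simp add: algebra_simps)
  then have 4: "n1 * (Qc - g) \<le> C u * Qc" using n0 by simp
  have "0 \<le> g" unfolding g_def by (rule cnt_nonneg)
  \<comment> \<open>Since \<open>p + 1\<close> is at least \<open>3\<close>, at least two thirds of
    the class are not exceptional; this bounds the density by two thirds, which exceeds one
    half.\<close>
  have "3 * g \<le> (p + 1) * g" using p1 \<open>0 \<le> g\<close> by (intro mult_right_mono) auto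
  then have "3 * g \<le> Qc" using 3 by simp
  then have "n1 * (2 * Qc) \<le> n1 * (3 * (Qc - g))" using n0 m0 by (intro mult_left_mono) auto
  also have "n1 * (3 * (Qc - g)) = 3 * (n1 * (Qc - g))" by simp
  also have "\<dots> \<le> 3 * (C u * Qc)" using 4 by linarith
  finally have "(2 * n1) * Qc \<le> (3 * C u) * Qc" by (simp add: algebra_simps)
  then have "2 * n1 \<le> 3 * C u" using Q0 by simp
  then have "n1 < 2 * C u" using n0 m0 by linarith
  then show ?thesis unfolding n1_def C_def Q_def .
qed

text \<open>The class and its image under \<open>a\<close> are disjoint, and they have equally large
  traces on the same coset of \<open>mult u\<close>.\<close>

lemma two_translates:
  assumes u: "xdiv N c u" and a: "gam a" and x: "c x = c k" "u dvd a * x - x" "c (a * x) \<noteq> c x"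
  shows "2 * cnt N {y. y \<in> cl c k \<and> u dvd y - k} \<le> N div u"
proof -
  have u0: "0 < u" "u dvd N" using u xdiv_pos xdiv_dvd by blast+
  define Vx where "Vx = {y. y \<in> cl c k \<and> u dvd y - x}"
  define Y where "Y = {y. y \<in> cl c (a * k) \<and> u dvd y - x}"
  define V where "V = {y. y + (- x) \<in> mult u}"
  have pcl: "pset N (cl c z)" for z by (rule xs_per[OF S xset_cl])
  have pV: "pset N V" unfolding V_def by (rule pset_shift[OF pset_mult[OF u0(2)]])
  have pY: "pset N Y" using pset_Int[OF pcl pV] unfolding Y_def V_def by (simp add: Int_def)
  have dis: "Vx \<inter> Y = {}" using x gam_class[OF a x(1)] unfolding Vx_def Y_def by auto
  have "cnt N Vx \<le> cnt N {y. a * y \<in> Y}"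
  proof (rule cnt_mono)
    fix y assume "y \<in> Vx"
    then have y: "c y = c k" "u dvd y - x" unfolding Vx_def by simp_all
    have "a * y - x = a * (y - x) + (a * x - x)" by (simp add: algebra_simps)
    then have "u dvd a * y - x" using y(2) x(2) by (metis dvd_add dvd_mult)
    then show "y \<in> {y. a * y \<in> Y}" using gam_class[OF a y(1)] unfolding Y_def by simp
  qed
  also have "\<dots> = cnt N Y" by (rule cnt_unit[OF N0 pY]) (use a in \<open>simp add: gam_def\<close>)
  finally have "2 * cnt N Vx \<le> cnt N Vx + cnt N Y" by simp
  also have "\<dots> = cnt N (Vx \<union> Y)" by (rule cnt_Un[OF dis, symmetric])
  also have "\<dots> \<le> cnt N V" by (rule cnt_mono) (auto simp: Vx_def Y_def V_def)
  also have "\<dots> = N div u" unfolding V_def cnt_shift[OF N0 pset_mult[OF u0(2)]] by (rule cnt_mult[OF u0 N0])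
  finally show ?thesis unfolding Vx_def using fibre_count[OF S u x(1)] by simp
qed

text \<open>A density above one half excludes the two disjoint traces. The exceptional points of
  \<open>density\<close> are among those counted in \<open>few\<close>, by
  \<open>class_shift\<close>.\<close>

lemma stable_if_few:
  assumes pcl: "pcl u A"
    and y: "p dvd t" "c y = c k" "P dvd t * y"
    and few: "(p + 1) * cnt N {x. x \<in> cl c k \<and> P dvd t * x} \<le> cnt N (cl c k)"
    and a: "gam a" and x: "c x = c k" "u dvd a * x - x"
  shows "c (a * x) = c x"
proof (rule ccontr)
  assume n: "c (a * x) \<noteq> c x"
  have "cnt N {x. x \<in> cl c k \<and> (\<exists>j. x + j * q \<notin> cl c k)} \<le> cnt N {x. x \<in> cl c k \<and> P dvd t * x}"
    by (rule cnt_mono) (use class_shift[OF y] in auto)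
  then have "(p + 1) * cnt N {x. x \<in> cl c k \<and> (\<exists>j. x + j * q \<notin> cl c k)} \<le> (p + 1) * cnt N {x. x \<in> cl c k \<and> P dvd t * x}"
    using p1 by (intro mult_left_mono) auto
  then have "N div u < 2 * cnt N {y. y \<in> cl c k \<and> u dvd y - k}"
    using few by (intro density[OF pcl]) auto
  then show False using two_translates[OF pclD(1)[OF pcl] a x n] by simp
qed

end

section \<open>Classes with trivial radical\<close>

lemma cnt_UN_le:
  "finite I \<Longrightarrow> D \<subseteq> (\<Union>i\<in>I. E i) \<Longrightarrow> (\<And>i. i \<in> I \<Longrightarrow> cnt N (E i) \<le> k) \<Longrightarrow> cnt N D \<le> int (card I) * k"
proof (induction I arbitrary: D rule: finite_induct)
  case empty
  then have "D = {}" by blast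
  then show ?case by simp
next
  case (insert i I)
  have "cnt N D \<le> cnt N (E i \<union> (D - E i))" by (rule cnt_mono) blast
  also have "\<dots> = cnt N (E i) + cnt N (D - E i)" by (rule cnt_Un) blast
  also have "cnt N (D - E i) \<le> int (card I) * k" by (rule insert.IH) (use insert.prems in auto)
  finally show ?case using insert.prems(2)[of i] insert.hyps by (simp add: algebra_simps)
qed

lemma cnt_UN_ge:
  "finite I \<Longrightarrow> (\<Union>i\<in>I. E i) \<subseteq> D \<Longrightarrow> (\<And>i. i \<in> I \<Longrightarrow> cnt N (E i) = k) \<Longrightarrow>
    (\<And>i j. i \<in> I \<Longrightarrow> j \<in> I \<Longrightarrow> i \<noteq> j \<Longrightarrow> E i \<inter> E j = {}) \<Longrightarrow> int (card I) * k \<le> cnt N D"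
proof (induction I arbitrary: D rule: finite_induct)
  case empty
  then show ?case using cnt_nonneg by simp
next
  case (insert i I)
  have "int (card I) * k \<le> cnt N (D - E i)"
  proof (rule insert.IH)
    show "\<Union> (E ` I) \<subseteq> D - E i"
    proof
      fix x assume "x \<in> \<Union> (E ` I)"
      then obtain j where j: "j \<in> I" "x \<in> E j" by blast
      then have "E j \<inter> E i = {}" using insert.prems(3)[of j i] insert.hyps by auto
      then show "x \<in> D - E i" using j insert.prems(1) by blast
    qed
  qed (use insert.prems in blast)+
  moreover have "cnt N (D - E i) = cnt N D - cnt N (E i)" by (rule cnt_Diff) (use insert.prems(1) in blast)
  ultimately show ?case using insert.prems(2)[of i] insert.hyps by (simp add: algebra_simps)
qed

lemma quotient_count:
  assumes S: "spair N c c" and r: "xdiv N c r" and V: "pset r V"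
  shows "cnt N (cl c k \<inter> V) = cnt N {y. y \<in> cl c k \<and> r dvd y - k} * cnt r (cl (quot c r) k \<inter> V)"
proof -
  have N: "0 < N" by (rule spair_pos[OF S])
  have r0: "0 < r" "r dvd N" using r xdiv_pos xdiv_dvd by blast+
  let ?Q = "cl c k" and ?Q' = "cl (quot c r) k"
  have "(\<Sum>z\<in>{0..<r}. of_bool (z \<in> ?Q' \<inter> V) * cnt N {y. y \<in> ?Q \<inter> V \<and> r dvd y - z}) =
    cnt N {y. y \<in> ?Q \<and> r dvd y - k} * cnt r (?Q' \<inter> V)"
  proof (rule sum_const_cnt)
    fix z assume z: "z \<in> ?Q' \<inter> V"
    then have "z \<in> splus ?Q (mult r)" using cl_quot[OF S r, of k] by blast
    then obtain x b where x: "z = x + b" "c x = c k" "r dvd b"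
      unfolding splus_def cl_def mult_def by blast
    have "{y. y \<in> ?Q \<inter> V \<and> r dvd y - z} = {y. y \<in> ?Q \<and> r dvd y - x}"
    proof (rule equalityI; rule subsetI)
      fix y assume "y \<in> {y. y \<in> ?Q \<inter> V \<and> r dvd y - z}"
      then have y: "y \<in> ?Q" "r dvd y - z" by blast+
      have "r dvd (y - z) + b" using y(2) x(3) by (rule dvd_add)
      then show "y \<in> {y. y \<in> ?Q \<and> r dvd y - x}" using y(1) x(1) by simp
    next
      fix y assume "y \<in> {y. y \<in> ?Q \<and> r dvd y - x}"
      then have y: "y \<in> ?Q" "r dvd y - x" by blast+
      have "r dvd (y - x) - b" using y(2) x(3) by (rule dvd_diff)
      then have "r dvd y - z" using x(1) by (simp add: algebra_simps)
      then have "y \<in> V" using periodicD[OF V] z by blast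
      then show "y \<in> {y. y \<in> ?Q \<inter> V \<and> r dvd y - z}" using y(1) \<open>r dvd y - z\<close> by blast
    qed
    then show "cnt N {y. y \<in> ?Q \<inter> V \<and> r dvd y - z} = cnt N {y. y \<in> ?Q \<and> r dvd y - k}"
      using fibre_count[OF S r x(2)] by simp
  qed
  moreover have "(\<Sum>z\<in>{0..<r}. of_bool (z \<in> ?Q' \<inter> V) * cnt N {y. y \<in> ?Q \<inter> V \<and> r dvd y - z}) =
    (\<Sum>y\<in>{0..<N}. of_bool (y \<in> ?Q \<inter> V) * cnt r {z. z \<in> ?Q' \<inter> V \<and> r dvd y - z})"
    by (rule double_count)
  moreover have "\<dots> = 1 * cnt N (?Q \<inter> V)"
  proof (rule sum_const_cnt)
    fix y assume y: "y \<in> ?Q \<inter> V"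
    have "{z. z \<in> ?Q' \<inter> V \<and> r dvd y - z} = {z. y - z \<in> mult r}"
    proof (rule equalityI; rule subsetI)
      fix z assume "z \<in> {z. y - z \<in> mult r}"
      then have z: "r dvd y - z" by simp
      have "z = y + - (y - z)" "- (y - z) \<in> mult r" using z by (simp_all add: dvd_diff_commute)
      then have "z \<in> splus ?Q (mult r)" unfolding splus_def using y by blast
      then have "z \<in> ?Q'" using cl_quot[OF S r, of k] by blast
      moreover have "z \<in> V" using periodicD[OF V z] y by blast
      ultimately show "z \<in> {z. z \<in> ?Q' \<inter> V \<and> r dvd y - z}" using z by blast
    qed simp
    then show "cnt r {z. z \<in> ?Q' \<inter> V \<and> r dvd y - z} = 1"
      using cnt_refl[OF r0(1) pset_mult[OF dvd_refl], of y] cnt_mult[OF r0(1) dvd_refl r0(1)] r0 by simp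
  qed
  ultimately show ?thesis by simp
qed

context pring begin

definition orb :: "int \<Rightarrow> int set" where "orb k = {x. \<exists>a. gam a \<and> c x = c (a * k)}"

lemma xset_orb: "xset c (orb k)"
  unfolding compat_def
proof (intro allI impI)
  fix x y assume "c x = c y" then show "x \<in> orb k \<longleftrightarrow> y \<in> orb k" unfolding orb_def by simp
qed

lemma gaminv_orb: "gaminv (orb k)"
  unfolding gaminv_def
proof (intro allI impI)
  fix a x assume a: "gam a" and "x \<in> orb k"
  then obtain b where b: "gam b" "c x = c (b * k)" unfolding orb_def by blast
  have "c (a * x) = c ((a * b) * k)" using gam_class[OF a b(2)] by (simp add: mult.assoc)
  then show "a * x \<in> orb k" using gam_mult[OF a b(1)] unfolding orb_def by blast
qed

lemma gam_cancel: assumes a: "gam a" and e: "c (a * x) = c (a * y)" shows "c x = c y"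
proof -
  obtain b where b: "gam b" "N dvd b * a - 1" using gam_inverse[OF a] .
  have "c (b * (a * x)) = c x" for x
  proof -
    have "N dvd (b * a - 1) * x" using b(2) by simp
    then show ?thesis using spair_eq[OF S, of "b * (a * x)" x] by (simp add: algebra_simps)
  qed
  then show ?thesis using gam_class[OF b(1) e] by metis
qed

lemma orb_ex: assumes "x \<in> orb k" obtains a where "gam a" "c (a * x) = c k"
proof -
  obtain b where b: "gam b" "c x = c (b * k)" using assms unfolding orb_def by blast
  obtain a where a: "gam a" "N dvd a * b - 1" using gam_inverse[OF b(1)] .
  have "N dvd (a * b - 1) * k" using a(2) by simp
  then have "c (a * (b * k)) = c k" using spair_eq[OF S, of "a * (b * k)" k] by (simp add: algebra_simps)
  then show ?thesis using that[OF a(1)] gam_class[OF a(1) b(2)] by simp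
qed

lemma gmin_orb: "gmin (orb k)"
  unfolding gmin_def
proof (intro allI impI)
  fix D' assume D: "xset c D'" "gaminv D'" "D' \<inter> orb k \<noteq> {}"
  then obtain x where x: "x \<in> D'" "x \<in> orb k" by blast
  obtain a where a: "gam a" "c (a * x) = c k" using orb_ex[OF x(2)] .
  have "a * x \<in> D'" using D(2) a(1) x(1) unfolding gaminv_def by blast
  then have k: "k \<in> D'" using xsD[OF D(1) a(2)] by blast
  show "orb k \<subseteq> D'"
  proof
    fix z assume "z \<in> orb k"
    then obtain b where b: "gam b" "c z = c (b * k)" unfolding orb_def by blast
    have "b * k \<in> D'" using D(2) b(1) k unfolding gaminv_def by blast
    then show "z \<in> D'" using xsD[OF D(1) b(2)] by blast
  qed
qed

lemma cl_subset_orb: "cl c k \<subseteq> orb k"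
proof
  fix x assume "x \<in> cl c k"
  then have "c x = c (1 * k)" by simp
  then show "x \<in> orb k" using gam_1 unfolding orb_def by blast
qed

text \<open>The orbit is the disjoint union of the \<open>m\<close> different classes of multiples
  \<open>a * k\<close> with \<open>gam a\<close>, and multiplication by \<open>a\<close> preserves
  the residue count inside an invariant set.\<close>

lemma orb_count:
  obtains m where "0 < m" "\<And>V. pset N V \<Longrightarrow> (\<And>a x. gam a \<Longrightarrow> a * x \<in> V \<longleftrightarrow> x \<in> V) \<Longrightarrow>
    cnt N (orb k \<inter> V) = m * cnt N (cl c k \<inter> V)"
proof -
  define I where "I = (\<lambda>a. c (a * k)) ` {a. gam a}"
  have "I \<subseteq> c ` {0..<N}"
  proof
    fix l assume "l \<in> I"
    then obtain a where "l = c (a * k)" unfolding I_def by blast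
    then have "l = c ((a * k) mod N)" using periodic_mod[OF spair_per[OF S]] by simp
    then show "l \<in> c ` {0..<N}" using N0 by simp
  qed
  then have fin: "finite I" by (rule finite_subset) simp
  have "c (1 * k) \<in> I" unfolding I_def using gam_1 by blast
  then have c0: "0 < int (card I)" using fin by (metis card_gt_0_iff empty_iff of_nat_0_less_iff)
  show ?thesis
  proof (rule that[OF c0])
    fix V assume V: "pset N V" "\<And>a x. gam a \<Longrightarrow> a * x \<in> V \<longleftrightarrow> x \<in> V"
    have eq: "(\<Sum>x\<in>{0..<N}. of_bool (c x = l \<and> x \<in> V)) = cnt N (cl c k \<inter> V)" if l: "l \<in> I" for l
    proof -
      obtain a where a: "l = c (a * k)" "gam a" using l unfolding I_def by blast
      have pp: "pset N (cl c (a * k) \<inter> V)" by (rule pset_Int[OF xs_per[OF S xset_cl] V(1)])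
      have "(\<Sum>x\<in>{0..<N}. of_bool (c x = l \<and> x \<in> V)) = cnt N (cl c (a * k) \<inter> V)"
        unfolding cnt_def by (rule sum.cong) (auto simp: a(1))
      also have "\<dots> = cnt N {x. a * x \<in> cl c (a * k) \<inter> V}"
        by (rule cnt_unit[OF N0 pp, symmetric]) (use a in \<open>simp add: gam_def\<close>)
      also have "{x. a * x \<in> cl c (a * k) \<inter> V} = cl c k \<inter> V"
      proof (rule equalityI; rule subsetI)
        fix x assume "x \<in> {x. a * x \<in> cl c (a * k) \<inter> V}"
        then show "x \<in> cl c k \<inter> V" using gam_cancel[OF a(2), of x k] V(2)[OF a(2)] by simp
      next
        fix x assume "x \<in> cl c k \<inter> V"
        then show "x \<in> {x. a * x \<in> cl c (a * k) \<inter> V}" using gam_class[OF a(2), of x k] V(2)[OF a(2)] by simp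
      qed
      finally show ?thesis .
    qed
    have "cnt N (orb k \<inter> V) = (\<Sum>x\<in>{0..<N}. \<Sum>l\<in>I. of_bool (c x = l \<and> x \<in> V))"
      unfolding cnt_def
    proof (rule sum.cong[OF refl])
      fix x
      have "(\<Sum>l\<in>I. of_bool (c x = l \<and> x \<in> V)) = (\<Sum>l\<in>I. if l = c x then of_bool (x \<in> V) else (0::int))"
        by (rule sum.cong) auto
      also have "\<dots> = of_bool (c x \<in> I \<and> x \<in> V)" using fin by simp
      also have "c x \<in> I \<longleftrightarrow> x \<in> orb k" unfolding I_def orb_def by blast
      finally show "of_bool (x \<in> orb k \<inter> V) = (\<Sum>l\<in>I. of_bool (c x = l \<and> x \<in> V) :: int)" by simp
    qed
    also have "\<dots> = (\<Sum>l\<in>I. \<Sum>x\<in>{0..<N}. of_bool (c x = l \<and> x \<in> V))" by (rule sum.swap)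
    also have "\<dots> = (\<Sum>l\<in>I. cnt N (cl c k \<inter> V))" by (rule sum.cong[OF refl]) (rule eq)
    finally show "cnt N (orb k \<inter> V) = int (card I) * cnt N (cl c k \<inter> V)" by simp
  qed
qed

lemma decompose: assumes "P dvd p * x" obtains g j where "P dvd g" "x = g + j * q"
proof -
  obtain g where g: "P dvd g - 0" "M dvd g - x" using crt_int[OF cop] by blast
  have "M dvd x - g" using g(2) by (simp add: dvd_diff_commute)
  moreover have "P dvd p * x - p * g" using assms g(1) by (intro dvd_diff) simp_all
  then have "P dvd p * (x - g)" by (simp add: right_diff_distrib)
  ultimately have "q dvd x - g" using q_dvd_iff by blast
  then obtain j where "x - g = q * j" by blast
  then have "x = g + j * q" by (simp add: algebra_simps)
  then show ?thesis by (rule that[rotated]) (use g(1) in simp)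
qed

lemma gn_1_prime: assumes "gn N (cl c k) = 1" "Factorial_Ring.prime r" "r dvd N" shows "\<exists>x. c x = c k \<and> \<not> r dvd x"
proof (rule ccontr)
  assume "\<not> (\<exists>x. c x = c k \<and> \<not> r dvd x)"
  then have "r dvd gn N (cl c k)" by (intro gn_greatest[OF assms(3)]) auto
  then show False using assms(1,2) by (metis not_prime_unit)
qed

text \<open>The orbit of a class containing an element with \<open>p\<close>-part of order at most \<open>p\<close>: inside a coset of
  \<open>u\<close> it misses exactly one coset of \<open>A\<close>.\<close>
lemma orbit_structure:
  assumes gn1: "gn N (cl c k) = 1" and rdN: "rd (cl c k) = N" and y: "c y = c k" "P dvd p * y"
  obtains u A where "pcl u A" "\<not> p dvd u" "xset c (Zset (orb k))" "Zset (orb k) \<noteq> {}"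
    "\<forall>x\<in>orb k. \<exists>d\<in>Zset (orb k). u dvd x - d"
    "\<forall>d\<in>Zset (orb k). \<forall>x. u dvd x - d \<longrightarrow> (x \<in> orb k \<longleftrightarrow> \<not> A dvd x - d)"
proof -
  obtain u A where pcl: "pcl u A" using order_p_class by blast
  note uA = pclD(1-6)[OF pcl] and W = pclD(7)[OF pcl]
  define D where "D = Zset (orb k)"
  note X = xset_orb[of k] and G = gaminv_orb[of k] and Gm = gmin_orb[of k]
  note per = xs_per[OF S X]
  obtain z where z: "c z = c k" "\<not> p dvd z" using gn_1_prime[OF gn1 p pN] by blast
  have zQ: "z \<in> orb k" using subsetD[OF cl_subset_orb, of z k] z(1) by simp
  have zP: "\<not> P dvd z" using z(2) pP dvd_trans by blast
  have yQ: "y \<in> orb k" using subsetD[OF cl_subset_orb, of y k] y(1) by simp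
  \<comment> \<open>If \<open>q\<close> were a period, the orbit would contain a point with trivial
    \<open>p\<close>-part, which \<open>gam\<close> fixes. The orbit would then be a single class
    and have trivial radical.\<close>
  have nper: "\<not> rd (orb k) dvd q"
  proof
    assume h: "rd (orb k) dvd q"
    obtain g j where g: "P dvd g" "y = g + j * q" using decompose[OF y(2)] .
    have "rd (orb k) dvd - (j * q)" using h by simp
    then have "g \<in> orb k" using rd_period[OF N0 per, of "- (j * q)" y] yQ g(2) by simp
    then obtain a where a: "gam a" "c (a * g) = c k" using orb_ex by blast
    have cg: "c (a * g) = c g" using spair_eq[OF S gam_fix[OF a(1) g(1)]] .
    have "orb k \<subseteq> cl c k"
    proof
      fix x assume "x \<in> orb k"
      then obtain b where b: "gam b" "c x = c (b * k)" unfolding orb_def by blast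
      have "c (b * k) = c (b * g)" using gam_class[OF b(1), of k g] a(2) cg by simp
      also have "\<dots> = c g" using spair_eq[OF S gam_fix[OF b(1) g(1)]] .
      finally show "x \<in> cl c k" using a(2) cg b(2) by simp
    qed
    then have "orb k = cl c k" using cl_subset_orb by blast
    then show False using h rdN not_N_dvd_q by simp
  qed
  have xD: "xset c D" unfolding D_def by (rule xset_Zset[OF X G])
  have Dne: "D \<noteq> {}" unfolding D_def by (rule Zset_ne[OF X G nper])
  have DP: "P dvd d" if "d \<in> D" for d using that unfolding D_def Zset_def by blast
  have disj: "D \<inter> orb k = {}" unfolding D_def by (rule Zset_disj[OF X G Gm zQ zP])
  have xT: "xset c (trans_set D (orb k))" by (rule xs_trans_set[OF S xD X])
  have T: "w + d \<in> orb k" if w: "u dvd w" "\<not> A dvd w" and d: "d \<in> D" for w d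
  proof -
    obtain b where b: "coprime b N" "c w = c (b * q)" using w W by blast
    have "b * q + d \<in> orb k" if "d \<in> D" for d
      using Zset_hash[OF X G Gm zQ zP _ coprime_pD[OF b(1)]] that unfolding D_def by (simp add: add.commute)
    then have "b * q \<in> trans_set D (orb k)" unfolding trans_set_def by blast
    then have "w \<in> trans_set D (orb k)" using xsD[OF xT b(2)] by blast
    then show ?thesis using d unfolding trans_set_def by blast
  qed
  \<comment> \<open>By \<open>pcl\<close>, translating \<open>D\<close> by one unit multiple of
    \<open>q\<close> transfers to all elements of \<open>mult u - mult A\<close>. The resulting part
    of the orbit is itself a \<open>gam\<close>-invariant union of classes, so it is the whole
    orbit.\<close>
  define W' where "W' = splus (mult u - mult A) D"
  have xW: "xset c W'" unfolding W'_def
    by (rule xs_splus[OF S xs_Diff xD]) (use uA in \<open>simp_all only: xdiv_def\<close>)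
  have WQ: "W' \<subseteq> orb k"
  proof
    fix x assume "x \<in> W'"
    then obtain w d where "x = w + d" "w \<in> mult u - mult A" "d \<in> D" unfolding W'_def splus_def by blast
    then show "x \<in> orb k" using T by simp
  qed
  have gW: "gaminv W'" unfolding gaminv_def
  proof (intro allI impI)
    fix a x assume a: "gam a" and "x \<in> W'"
    then obtain w d where w: "x = w + d" "w \<in> mult u - mult A" "d \<in> D" unfolding W'_def splus_def by blast
    have "coprime a A" using a xdiv_dvd[OF uA(2)] unfolding gam_def by (meson coprime_divisors dvd_refl)
    then have "a * w \<in> mult u - mult A" using w(2) by (simp add: coprime_commute coprime_dvd_mult_right_iff)
    moreover have "N dvd a * d - d" using gam_fix[OF a DP[OF w(3)]] .
    then have "a * d \<in> D" using periodicD[OF xs_per[OF S xD]] w(3) by blast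
    moreover have "a * x = a * w + a * d" using w(1) by (simp add: algebra_simps)
    ultimately show "a * x \<in> W'" unfolding W'_def splus_def by blast
  qed
  have Wne: "W' \<noteq> {}"
  proof -
    obtain d where "d \<in> D" using Dne by blast
    then have "q + d \<in> W'" using uA(3,6) unfolding W'_def splus_def by fastforce
    then show ?thesis by blast
  qed
  have "orb k \<subseteq> W'" using Gm xW gW Wne WQ unfolding gmin_def by blast
  then have orbW: "orb k = W'" using WQ by blast
  have cover: "\<exists>d\<in>D. u dvd x - d" if x: "x \<in> orb k" for x
  proof -
    obtain w d where "x = w + d" "w \<in> mult u - mult A" "d \<in> D" using x unfolding orbW W'_def splus_def by blast
    then have "u dvd x - d" "d \<in> D" by simp_all
    then show ?thesis by blast
  qed
  have Aper: "x + t \<in> orb k" if x: "x \<in> orb k" and t: "A dvd t" for x t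
  proof -
    obtain w d where w: "x = w + d" "u dvd w" "\<not> A dvd w" "d \<in> D" using x unfolding orbW W'_def splus_def by auto
    have "u dvd w + t" using w(2) dvd_trans[OF uA(4) t] by simp
    moreover have "\<not> A dvd w + t" using w(3) t by (simp add: dvd_add_left_iff)
    moreover have "x + t = (w + t) + d" using w(1) by simp
    ultimately show ?thesis using T w(4) by metis
  qed
  have struct: "x \<in> orb k \<longleftrightarrow> \<not> A dvd x - d" if d: "d \<in> D" "u dvd x - d" for d x
  proof
    assume x: "x \<in> orb k"
    show "\<not> A dvd x - d"
    proof
      assume "A dvd x - d"
      then have "A dvd - (x - d)" by (simp only: dvd_minus_iff)
      then have "d \<in> orb k" using Aper[OF x] by fastforce
      then show False using disj d(1) by blast
    qed
  next
    assume "\<not> A dvd x - d"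
    then show "x \<in> orb k" using T[OF d(2) _ d(1)] by simp
  qed
  have "\<not> p dvd u"
  proof
    assume pu: "p dvd u"
    obtain d where d: "d \<in> D" "u dvd z - d" using cover[OF zQ] by blast
    have "p dvd (z - d) + d" using pu d(2) DP[OF d(1)] pP dvd_trans by (metis dvd_add)
    then show False using z(2) by simp
  qed
  then show ?thesis using that[OF pcl] xD Dne cover struct unfolding D_def by blast
qed

end

section \<open>Splitting off a trivial summand at one prime\<close>

context pring begin

lemma coprime_uP: assumes "\<not> p dvd u" shows "coprime u P"
proof -
  have "coprime p u" using assms p by (rule prime_imp_coprime[rotated])
  then show ?thesis using Pp by (metis coprime_commute coprime_power_left_iff)
qed

text \<open>Translating \<open>D = Zset (orb k)\<close> by \<open>M * i\<close> for
  \<open>0 < i < P\<close> stays in the orbit and gives \<open>P - 1\<close> disjoint copies,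
  whereas \<open>p - 1\<close> copies cover all points whose \<open>p\<close>-part has order at most
  \<open>p\<close>. The factor \<open>p + 1\<close> comes from
  \<open>(p + 1) * (p - 1) = p * p - 1\<close>, which is at most \<open>P - 1\<close>. Proportions
  are the same in the orbit and in the class.\<close>

lemma few_minimal:
  assumes gn1: "gn N (cl c k) = 1" and rdN: "rd (cl c k) = N" and y: "c y = c k" "P dvd p * y"
    and no: "\<And>x. c x = c k \<Longrightarrow> \<not> P dvd x" and pp: "p * p dvd P"
  shows "(p + 1) * cnt N {x. x \<in> cl c k \<and> P dvd p * x} \<le> cnt N (cl c k)"
proof -
  obtain u A where pcl: "pcl u A" and pu: "\<not> p dvd u" and xD: "xset c (Zset (orb k))"
    and struct: "\<forall>d\<in>Zset (orb k). \<forall>x. u dvd x - d \<longrightarrow> (x \<in> orb k \<longleftrightarrow> \<not> A dvd x - d)"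
    using orbit_structure[OF gn1 rdN y] .
  note uA = pclD(1-6)[OF pcl]
  define D where "D = Zset (orb k)"
  have pD: "pset N D" unfolding D_def by (rule xs_per[OF S xD])
  have DP: "P dvd d" if "d \<in> D" for d using that unfolding D_def Zset_def by blast
  have noorb: "\<not> P dvd x" if x: "x \<in> orb k" for x
  proof
    assume P: "P dvd x"
    obtain a where a: "gam a" "c (a * x) = c k" using orb_ex[OF x] .
    then show False using no[OF a(2)] P by simp
  qed
  have uM: "u dvd M"
  proof -
    have "u dvd P * M" using xdiv_dvd[OF uA(1)] NPM by simp
    then show ?thesis using coprime_uP[OF pu] by (simp add: coprime_dvd_mult_right_iff)
  qed
  have "int (card {1..P - 1}) * cnt N D \<le> cnt N (orb k)"
  proof (rule cnt_UN_ge)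
    show "(\<Union>i\<in>{1..P - 1}. {x. x + (- (M * i)) \<in> D}) \<subseteq> orb k"
    proof
      fix x assume "x \<in> (\<Union>i\<in>{1..P - 1}. {x. x + (- (M * i)) \<in> D})"
      then obtain i where i: "1 \<le> i" "i \<le> P - 1" "x + (- (M * i)) \<in> D" by auto
      have "u dvd x - (x + (- (M * i)))" using uM by simp
      moreover have "\<not> A dvd x - (x + (- (M * i)))"
      proof
        assume "A dvd x - (x + (- (M * i)))"
        then have "P dvd M * i" using uA(5) dvd_trans by auto
        then have "P dvd i" using cop by (simp add: coprime_dvd_mult_right_iff)
        then show False using i zdvd_imp_le[of P i] by simp
      qed
      ultimately show "x \<in> orb k" using struct[rule_format, of "x + (- (M * i))" x] i(3) unfolding D_def by blast
    qed
    show "cnt N {x. x + (- (M * i)) \<in> D} = cnt N D" for i by (rule cnt_shift[OF N0 pD])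
    fix i j assume ij: "i \<in> {1..P - 1}" "j \<in> {1..P - 1}" "i \<noteq> j"
    show "{x. x + (- (M * i)) \<in> D} \<inter> {x. x + (- (M * j)) \<in> D} = {}"
    proof (rule ccontr)
      assume "\<not> ?thesis"
      then obtain x where "x + (- (M * i)) \<in> D" "x + (- (M * j)) \<in> D" by blast
      then have "P dvd (x + (- (M * i))) - (x + (- (M * j)))" using DP by (intro dvd_diff)
      then have "P dvd M * (j - i)" by (simp add: algebra_simps)
      then have "P dvd j - i" using cop by (simp add: coprime_dvd_mult_right_iff)
      moreover have "\<bar>j - i\<bar> < P" using ij by auto
      ultimately show False using ij(3) dvd_imp_le_int[of "j - i" P] P0 by auto
    qed
  qed simp
  then have 1: "(P - 1) * cnt N D \<le> cnt N (orb k)" using P0 by simp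
  define V where "V = {x. P dvd p * x}"
  have "cnt N (orb k \<inter> V) \<le> int (card {1..p - 1}) * cnt N D"
  proof (rule cnt_UN_le)
    show "orb k \<inter> V \<subseteq> (\<Union>j\<in>{1..p - 1}. {x. x + (- (j * q)) \<in> D})"
    proof
      fix x assume x: "x \<in> orb k \<inter> V"
      then obtain g j where g: "P dvd g" "x = g + j * q" using decompose unfolding V_def by blast
      have "g + j * q \<in> orb k" using x g by simp
      moreover have "g + 0 * q \<notin> orb k" using noorb g(1) by auto
      ultimately have gD: "g \<in> D" using g(1) unfolding D_def Zset_def by blast
      define i where "i = j mod p"
      have "p dvd j - i" unfolding i_def by (simp add: mod_eq_dvd_iff[symmetric])
      then have "N dvd (j - i) * q" using N_dvd_jq by blast
      then have N1: "N dvd (x + (- (i * q))) - g" using g(2) by (simp add: algebra_simps)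
      then have "x + (- (i * q)) \<in> D" using periodicD[OF pD N1] gD by blast
      moreover have "i \<noteq> 0"
      proof
        assume "i = 0"
        then have "P dvd x - g" using N1 PN dvd_trans by auto
        then have "P dvd (x - g) + g" using g(1) by (rule dvd_add)
        then show False using noorb x by simp
      qed
      then have "i \<in> {1..p - 1}" using p1 pos_mod_bound[of p j] pos_mod_sign[of p j] unfolding i_def by auto
      ultimately show "x \<in> (\<Union>j\<in>{1..p - 1}. {x. x + (- (j * q)) \<in> D})" by blast
    qed
    show "cnt N {x. x + (- (j * q)) \<in> D} \<le> cnt N D" for j by (simp only: cnt_shift[OF N0 pD] order_refl)
  qed simp
  then have 2: "cnt N (orb k \<inter> V) \<le> (p - 1) * cnt N D" using p1 by simp
  have "(p + 1) * cnt N (orb k \<inter> V) \<le> (p + 1) * ((p - 1) * cnt N D)" using 2 p1 by (intro mult_left_mono) auto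
  moreover have "(p + 1) * ((p - 1) * cnt N D) = (p * p - 1) * cnt N D" by (simp add: algebra_simps)
  moreover have "(p * p - 1) * cnt N D \<le> (P - 1) * cnt N D"
    using zdvd_imp_le[OF pp P0] cnt_nonneg[of N D] by (intro mult_right_mono) auto
  ultimately have 3: "(p + 1) * cnt N (orb k \<inter> V) \<le> cnt N (orb k)" using 1 by linarith
  obtain m where m: "0 < m" "\<And>V. pset N V \<Longrightarrow> (\<And>a x. gam a \<Longrightarrow> a * x \<in> V \<longleftrightarrow> x \<in> V) \<Longrightarrow>
    cnt N (orb k \<inter> V) = m * cnt N (cl c k \<inter> V)" using orb_count by blast
  have "pset N UNIV" by (simp add: periodic_def)
  then have m1: "cnt N (orb k) = m * cnt N (cl c k)" using m(2)[of UNIV] by simp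
  have pV: "pset N V" unfolding periodic_def V_def mem_Collect_eq
  proof (intro allI impI)
    fix x y assume "N dvd x - y"
    then have "P dvd p * (x - y)" using PN dvd_trans by (meson dvd_mult)
    then have "P dvd p * x - p * y" by (simp add: right_diff_distrib)
    then show "P dvd p * x \<longleftrightarrow> P dvd p * y" using dvd_add_right_iff[of P "p * x - p * y" "p * y"] by simp
  qed
  have "a * x \<in> V \<longleftrightarrow> x \<in> V" if a: "gam a" for a x
  proof -
    have "coprime P a" using a PN unfolding gam_def by (meson coprime_commute coprime_divisors dvd_refl)
    then have "P dvd a * (p * x) \<longleftrightarrow> P dvd p * x" by (simp add: coprime_dvd_mult_right_iff)
    then show ?thesis unfolding V_def by (simp add: mult_ac)
  qed
  then have "cnt N (orb k \<inter> V) = m * cnt N (cl c k \<inter> V)" using m(2)[OF pV] by blast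
  then have "m * ((p + 1) * cnt N (cl c k \<inter> V)) \<le> m * cnt N (cl c k)" using 3 m1 by (simp add: algebra_simps)
  then have "(p + 1) * cnt N (cl c k \<inter> V) \<le> cnt N (cl c k)" using m(1) by simp
  then show ?thesis unfolding V_def by (simp add: Int_def)
qed

lemma gam_moves_little: assumes a: "gam a" and y: "P dvd p * y" and u: "u dvd q" shows "u dvd a * y - y"
proof -
  have "P dvd (a - 1) * (p * y)" using y by simp
  then have "P dvd p * ((a - 1) * y)" by (simp add: mult_ac)
  moreover have "M dvd (a - 1) * y" using a unfolding gam_def by simp
  ultimately have "q dvd (a - 1) * y" using q_dvd_iff by blast
  then show ?thesis using dvd_trans[OF u] by (simp add: algebra_simps)
qed

text \<open>A point of the class with trivial \<open>p\<close>-part is fixed by \<open>gam\<close>.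
  Without such a point, \<open>z\<close> shows that \<open>p * p\<close> divides \<open>P\<close>;
  then \<open>few_minimal\<close> and \<open>stable_if_few\<close> apply to \<open>y\<close>, whose
  images under \<open>gam\<close> stay in its coset of \<open>mult u\<close>.\<close>

lemma orb_eq_class:
  assumes gn1: "gn N (cl c k) = 1" and rdN: "rd (cl c k) = N" and y: "c y = c k" "P dvd p * y"
    and z: "c z = c k" "p dvd z"
  shows "orb k = cl c k"
proof -
  have st: "c (a * k) = c k" if a: "gam a" for a
  proof (cases "\<exists>x. c x = c k \<and> P dvd x")
    case True
    then obtain x where x: "c x = c k" "P dvd x" by blast
    have "c (a * x) = c x" using spair_eq[OF S gam_fix[OF a x(2)]] .
    then show ?thesis using gam_class[OF a x(1)] x(1) by simp
  next
    case False
    obtain e where e: "P = p ^ e" using Pp by blast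
    have "e \<noteq> 0" using e pP p1 by (metis power_0 zdvd1_eq abs_of_pos less_irrefl order.strict_trans zero_less_one)
    moreover have "e \<noteq> 1" using False z e by auto
    ultimately have "2 \<le> e" by simp
    then have pp: "p * p dvd P" unfolding e using le_imp_power_dvd[of 2 e p] by (simp add: power2_eq_square)
    obtain u A where pcl: "pcl u A" using order_p_class by blast
    have few: "(p + 1) * cnt N {x. x \<in> cl c k \<and> P dvd p * x} \<le> cnt N (cl c k)"
      by (rule few_minimal[OF gn1 rdN y _ pp]) (use False in blast)
    have "c (a * y) = c y"
      by (rule stable_if_few[OF pcl dvd_refl y few a y(1) gam_moves_little[OF a y(2) pclD(3)[OF pcl]]])
    then show ?thesis using gam_class[OF a y(1)] y(1) by simp
  qed
  have "orb k \<subseteq> cl c k" using st unfolding orb_def by auto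
  then show ?thesis using cl_subset_orb by blast
qed

text \<open>The hypotheses say that the least order of a \<open>p\<close>-part in the class is
  \<open>p * t\<close>, a proper divisor of \<open>P\<close>. A suitable quotient has
  \<open>p\<close>-part \<open>P'\<close> and least order \<open>p\<close>, so
  \<open>few_minimal\<close> applies there, and the bound on proportions lifts back. By
  \<open>stable_if_few\<close> the class is then stable under a multiplier moving \<open>x0\<close>
  to \<open>x0 + q\<close>, although \<open>x0 + q\<close> was chosen outside it.\<close>

lemma no_large_order:
  assumes gn1: "gn N (cl c k) = 1" and rdN: "rd (cl c k) = N"
    and t: "p dvd t" and y: "c y = c k" "P dvd (p * t) * y" and no: "\<And>x. c x = c k \<Longrightarrow> \<not> P dvd t * x"
    and tP: "P = t * P'" "p * p dvd P'"
  shows False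
proof -
  define Q where "Q = cl c k"
  have xQ: "xset c Q" unfolding Q_def by (rule xset_cl)
  note per = xs_per[OF S xQ]
  have tP0: "P' \<noteq> 0" "t \<noteq> 0" using tP(1) P0 by auto
  have Pt: "P dvd t * x \<longleftrightarrow> P' dvd x" for x unfolding tP(1) using tP0 by simp
  have P'P: "P' dvd P" unfolding tP(1) by simp
  have P'N: "P' dvd N" using P'P PN dvd_trans by blast
  have y': "P' dvd p * y"
  proof -
    have "P dvd t * (p * y)" using y(2) by (simp add: mult_ac)
    then show ?thesis unfolding Pt .
  qed
  have no': "\<not> P' dvd x" if "c x = c k" for x using no[OF that] unfolding Pt .
  define F where "F = frob N p Q"
  have xF: "xset c F" unfolding F_def by (rule xs_frob[OF S xQ p pN])
  have "\<not> rd Q dvd q" using rdN not_N_dvd_q unfolding Q_def by simp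
  then obtain x0 where "x0 \<in> Q" "x0 + q \<notin> Q" using rd_dvd_iff[OF N0 per] by blast
  then have x0: "x0 \<in> Q" "x0 + 1 * q \<notin> Q" by simp_all
  have good: "P' dvd p * x" if x: "x \<in> Q" "x + j * q \<notin> Q" for x j
  proof -
    have "p dvd p * t" by simp
    then have "P dvd (p * t) * x" using class_shift[OF _ y, of x j] x unfolding Q_def by auto
    then have "P dvd t * (p * x)" by (simp add: mult_ac)
    then show ?thesis unfolding Pt .
  qed
  \<comment> \<open>Adding this subgroup removes most of the \<open>p\<close>-part. It is divisible
    by \<open>P'\<close>, since \<open>p * x\<close> is for every point \<open>x\<close> that leaves
    the class, and it divides \<open>p * x0\<close>, so the \<open>p\<close>-part of
    \<open>r\<close> turns out to be exactly \<open>P'\<close>.\<close>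
  define H where "H = gn N F"
  have xH: "xdiv N c H" unfolding H_def by (rule xdiv_gn[OF S xF])
  have P'H: "P' dvd H" unfolding H_def
  proof (rule gn_greatest[OF P'N])
    fix g assume "g \<in> F"
    then obtain x j where x: "x \<in> Q" "x + j * (N div p) \<notin> Q" "N dvd g - p * x" unfolding F_def frob_def by blast
    have "P' dvd p * x" using good[of x j] x(1,2) unfolding qdiv by blast
    moreover have "P' dvd g - p * x" using P'N x(3) by (rule dvd_trans)
    ultimately have "P' dvd (g - p * x) + p * x" by (intro dvd_add)
    then show "P' dvd g" by simp
  qed
  have Hx0: "H dvd p * x0"
  proof -
    have "x0 + 1 * (N div p) \<notin> Q" using x0(2) unfolding qdiv .
    then have "p * x0 \<in> F" unfolding F_def frob_def using x0(1) by fastforce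
    then show ?thesis unfolding H_def by (rule gn_dvd(2))
  qed
  define QH where "QH = splus Q (mult H)"
  have xQH: "xset c QH" unfolding QH_def by (rule xs_splus[OF S xQ]) (use xH in \<open>simp only: xdiv_def\<close>)
  note perH = xs_per[OF S xQH]
  have noH: "\<not> P' dvd z" if z: "z \<in> QH" for z
  proof
    assume "P' dvd z"
    obtain x h where x: "z = x + h" "x \<in> Q" "H dvd h" using z unfolding QH_def splus_def mult_def by blast
    have "P' dvd z - h" using \<open>P' dvd z\<close> dvd_trans[OF P'H x(3)] by (rule dvd_diff)
    then show False using no'[of x] x unfolding Q_def by simp
  qed
  have QQH: "Q \<subseteq> QH"
  proof
    fix x assume "x \<in> Q"
    then have "x = x + 0 \<and> x \<in> Q \<and> 0 \<in> mult H" by simp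
    then show "x \<in> QH" unfolding QH_def splus_def by blast
  qed
  have yQH: "y \<in> QH" using QQH y(1) unfolding Q_def by auto
  define r where "r = rd QH"
  have xr: "xdiv N c r" unfolding r_def by (rule xdiv_rd[OF S xQH])
  have r0: "0 < r" "r dvd N" using xr xdiv_pos xdiv_dvd by blast+
  have rper: "x + s \<in> QH" if "x \<in> QH" "r dvd s" for x s
    using rd_period[OF N0 perH, of s x] that unfolding r_def by blast
  have rH: "r dvd H" unfolding r_def rd_dvd_iff[OF N0 perH]
  proof
    fix z assume "z \<in> QH"
    then obtain x h where x: "z = x + h" "x \<in> Q" "H dvd h" unfolding QH_def splus_def mult_def by blast
    have "z + H = x + (h + H)" "h + H \<in> mult H" using x by simp_all
    then show "z + H \<in> QH" unfolding QH_def splus_def using x(2) by blast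
  qed
  \<comment> \<open>Otherwise a multiple of the period \<open>r\<close> would move \<open>y\<close>
    to a point of \<open>QH\<close> divisible by \<open>P'\<close>, and there is none.\<close>
  have P'r: "P' dvd r"
  proof (rule ccontr)
    assume n: "\<not> P' dvd r"
    obtain e where e: "P = p ^ e" using Pp by blast
    obtain e' where e': "P' = p ^ e' \<or> P' = - (p ^ e')"
    proof -
      obtain i where "i \<le> e" "normalize P' = p ^ i"
        using divides_primepow[OF p, of P' e] P'P e p
        by (metis normalize_idem_imp_unit_factor_eq prime_imp_prime_elem divides_primepow_weak)
      then have "\<bar>P'\<bar> = p ^ i" by simp
      then have "P' = p ^ i \<or> P' = - (p ^ i)" by linarith
      then show ?thesis by (rule that)
    qed
    have dd: "P' dvd z \<longleftrightarrow> p ^ e' dvd z" "z dvd P' \<longleftrightarrow> z dvd p ^ e'" for z using e' by auto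
    have "gcd r P' dvd p ^ e'" using iffD1[OF dd(2) gcd_dvd2] .
    moreover have "\<not> p ^ e' dvd gcd r P'" using n dvd_trans[OF iffD2[OF dd(1)] gcd_dvd1] iffD2[OF dd(1)] by (metis gcd_dvd1 dvd_trans)
    ultimately have "gcd r P' * p dvd p ^ e'" by (rule prime_power_dvd_cases[OF p])
    then have "gcd r P' * p dvd p * y" using dd(2) y' dvd_trans by blast
    then have "gcd r P' dvd - y" using p1 by (simp add: mult.commute)
    then obtain s where s: "P' dvd s * r - (- y)" using solve_cong by blast
    have "y + s * r \<in> QH" by (rule rper[OF yQH]) simp
    then show False using noH s by (simp add: add.commute)
  qed
  have npr: "\<not> p * P' dvd r"
  proof
    assume "p * P' dvd r"
    then have "p * P' dvd p * x0" by (rule dvd_trans[OF _ dvd_trans[OF rH Hx0]])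
    then have "P' dvd x0" using p1 by simp
    then show False using no'[of x0] x0(1) unfolding Q_def by simp
  qed
  obtain M' where M': "r = P' * M'" using P'r by blast
  have npM: "\<not> p dvd M'"
  proof
    assume "p dvd M'"
    then have "P' * p dvd r" unfolding M' by simp
    then show False using npr by (simp add: mult.commute)
  qed
  have "coprime p M'" using npM p by (rule prime_imp_coprime[rotated])
  then have "coprime P M'" using Pp by auto
  then have cop': "coprime P' M'" using P'P by (meson coprime_divisors dvd_refl)
  have ppr: "p dvd r" using tP(2) P'r by (meson dvd_mult_left dvd_trans)
  define c1 where "c1 = quot c r"
  have S1: "spair r c1 c1" unfolding c1_def by (rule spair_quot[OF S xr])
  define P1 where "P1 = \<bar>P'\<bar>"
  have P1: "P1 dvd z \<longleftrightarrow> P' dvd z" "z dvd P1 \<longleftrightarrow> z dvd P'" for z unfolding P1_def by simp_all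
  have Pp1: "\<exists>e. P1 = p ^ e"
  proof -
    obtain e where e: "P = p ^ e" using Pp by blast
    obtain i where "i \<le> e" "normalize P' = p ^ i"
      using divides_primepow[OF p, of P' e] P'P e p
      by (metis normalize_idem_imp_unit_factor_eq prime_imp_prime_elem divides_primepow_weak)
    then show ?thesis unfolding P1_def by auto
  qed
  obtain M1 where M1: "r = P1 * M1" using P'r P1(1) by blast
  have cop1: "coprime P1 M1"
  proof -
    have "P' * M' = P' * M1 \<or> P' * M' = P' * (- M1)" using M1 M' unfolding P1_def by (cases "P' > 0") auto
    then have "M1 = M' \<or> M1 = - M'" using tP0(1) unfolding mult_cancel_left by auto
    then show ?thesis using cop' unfolding P1_def by auto
  qed
  have pP1: "p dvd P1" using tP(2) P1(2) by (metis dvd_mult_left)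
  have pr1: "pring r c1 p P1 M1 (r div p)"
    by unfold_locales (use S1 p pP1 Pp1 M1 cop1 ppr in auto)
  interpret r: pring r c1 p P1 M1 "r div p" by (rule pr1)
  have clQ: "cl c1 k = QH"
  proof -
    have 1: "cl c1 k = splus Q (mult r)" unfolding c1_def Q_def by (rule cl_quot[OF S xr])
    show ?thesis
    proof (rule equalityI; rule subsetI)
      fix z assume "z \<in> cl c1 k"
      then obtain x h where x: "z = x + h" "x \<in> Q" "r dvd h" unfolding 1 splus_def mult_def by blast
      show "z \<in> QH" unfolding x(1) by (rule rper[OF _ x(3)]) (use QQH x(2) in blast)
    next
      fix z assume "z \<in> QH"
      then obtain x h where x: "z = x + h" "x \<in> Q" "H dvd h" unfolding QH_def splus_def mult_def by blast
      have "h \<in> mult r" using dvd_trans[OF rH x(3)] by simp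
      then show "z \<in> cl c1 k" unfolding 1 splus_def using x by blast
    qed
  qed
  have g1: "gn r (cl c1 k) = 1"
  proof -
    have "gn r QH dvd gn N Q"
    proof (rule gn_greatest)
      show "gn r QH dvd N" by (rule dvd_trans[OF gn_dvd(1) r0(2)])
      show "gn r QH dvd x" if "x \<in> Q" for x by (rule gn_dvd(2)) (use QQH that in blast)
    qed
    then have "gn r QH dvd 1" using gn1 unfolding Q_def by simp
    then show ?thesis using gn_pos[OF r0(1), of QH] unfolding clQ by simp
  qed
  have rd1: "rd (cl c1 k) = r" unfolding clQ r_def ..
  have few1: "(p + 1) * cnt r {x. x \<in> cl c1 k \<and> P1 dvd p * x} \<le> cnt r (cl c1 k)"
  proof (rule r.few_minimal[OF g1 rd1])
    show "c1 y = c1 k" using yQH clQ by auto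
    show "P1 dvd p * y" using y' P1(1) by simp
    show "\<not> P1 dvd x" if "c1 x = c1 k" for x using noH[of x] that clQ P1(1) by auto
    show "p * p dvd P1" using tP(2) P1(2) by simp
  qed
  define V where "V = {x. P' dvd p * x}"
  have pV: "pset r V" unfolding periodic_def V_def mem_Collect_eq
  proof (intro allI impI)
    fix x y assume "r dvd x - y"
    then have "P' dvd p * (x - y)" using P'r dvd_trans by (meson dvd_mult)
    then have "P' dvd p * x - p * y" by (simp add: right_diff_distrib)
    then show "P' dvd p * x \<longleftrightarrow> P' dvd p * y" using dvd_add_right_iff[of P' "p * x - p * y" "p * y"] by simp
  qed
  have pU: "pset r UNIV" by (simp add: periodic_def)
  define kap where "kap = cnt N {y. y \<in> cl c k \<and> r dvd y - k}"
  have k1: "cnt N (cl c k \<inter> V) = kap * cnt r (cl c1 k \<inter> V)"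
    unfolding kap_def c1_def by (rule quotient_count[OF S xr pV])
  have k2: "cnt N (cl c k) = kap * cnt r (cl c1 k)"
    using quotient_count[OF S xr pU, of k] unfolding kap_def c1_def by simp
  have e1: "{x. x \<in> cl c1 k \<and> P1 dvd p * x} = cl c1 k \<inter> V" unfolding V_def P1(1) by blast
  have e2: "{x. x \<in> cl c k \<and> P dvd (p * t) * x} = cl c k \<inter> V"
  proof -
    have "P dvd (p * t) * x \<longleftrightarrow> P' dvd p * x" for x
      using Pt[of "p * x"] by (simp add: mult_ac)
    then show ?thesis unfolding V_def by blast
  qed
  have "(p + 1) * cnt N (cl c k \<inter> V) = kap * ((p + 1) * cnt r (cl c1 k \<inter> V))" unfolding k1 by (simp add: algebra_simps)
  also have "\<dots> \<le> kap * cnt r (cl c1 k)"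
    using few1 cnt_nonneg[of N "{y. y \<in> cl c k \<and> r dvd y - k}"] unfolding e1 kap_def by (intro mult_left_mono) auto
  finally have few: "(p + 1) * cnt N {x. x \<in> cl c k \<and> P dvd (p * t) * x} \<le> cnt N (cl c k)"
    unfolding e2 k2 .
  obtain u A where pcl: "pcl u A" using order_p_class by blast
  note uA = pclD(1-3)[OF pcl]
  have cx0: "c x0 = c k" using x0(1) unfolding Q_def by simp
  obtain a where a: "gam a" "N dvd a * x0 - (x0 + 1 * q)" using gam_shift[OF t no[OF cx0]] by blast
  have ua: "u dvd a * x0 - x0"
  proof -
    have "u dvd (a * x0 - (x0 + 1 * q)) + q" using dvd_trans[OF xdiv_dvd[OF uA(1)] a(2)] uA(3) by (rule dvd_add)
    then show ?thesis by simp
  qed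
  have "p dvd p * t" by simp
  from stable_if_few[OF pcl this y few a(1) cx0 ua] have "c (a * x0) = c x0" .
  then have "c (x0 + 1 * q) = c k" using spair_eq[OF S a(2)] cx0 by simp
  then show False using x0(2) unfolding Q_def by simp
qed

end

text \<open>The class of \<open>k\<close> is the sum of all nonzero elements of a direct summand of order \<open>t\<close>, on which the
  scheme is trivial, and of a class of the complementary summand.\<close>
definition splits :: "int \<Rightarrow> (int \<Rightarrow> 'k) \<Rightarrow> int \<Rightarrow> int \<Rightarrow> int \<Rightarrow> bool" where
  "splits N c k t th \<longleftrightarrow> t dvd N \<and> coprime t (N div t) \<and> xdiv N c t \<and> xdiv N c (N div t) \<and> t dvd th \<and>
     (\<forall>x y. N div t dvd x \<longrightarrow> \<not> N dvd x \<longrightarrow> N div t dvd y \<longrightarrow> \<not> N dvd y \<longrightarrow> c x = c y) \<and>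
     cl c k = splus (mult (N div t) - mult N) (cl c th) \<and> \<not> Factorial_Ring.prime t \<and> 1 < t"

context pring begin

text \<open>Let \<open>p ^ i\<close> be the least order of a \<open>p\<close>-part in the class. The
  element \<open>z\<close> gives \<open>i < e\<close>, and \<open>i\<close> of at least
  \<open>2\<close> is excluded by \<open>no_large_order\<close> with
  \<open>t = p ^ (i - 1)\<close>.\<close>

lemma bad_small_order:
  assumes gn1: "gn N (cl c k) = 1" and rdN: "rd (cl c k) = N" and z: "c z = c k" "p dvd z"
  obtains y where "c y = c k" "P dvd p * y"
proof -
  obtain e where e: "P = p ^ e" using Pp by blast
  define i where "i = (LEAST i. \<exists>y. c y = c k \<and> P dvd p ^ i * y)"
  have ex: "\<exists>y. c y = c k \<and> P dvd p ^ e * y" unfolding e by (intro exI[of _ k]) simp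
  have i: "\<exists>y. c y = c k \<and> P dvd p ^ i * y"     unfolding i_def by (rule LeastI[of "\<lambda>i. \<exists>y. c y = c k \<and> P dvd p ^ i * y", OF ex])
  then obtain y where y: "c y = c k" "P dvd p ^ i * y" by blast
  have min: "\<not> P dvd p ^ j * x" if "j < i" "c x = c k" for j x
    using not_less_Least[of j "\<lambda>i. \<exists>y. c y = c k \<and> P dvd p ^ i * y"] that unfolding i_def by blast
  have e0: "e \<noteq> 0" using e pP p1 by (metis power_0 zdvd1_eq abs_of_pos less_irrefl order.strict_trans zero_less_one)
  have "i < e"
  proof (rule ccontr)
    assume "\<not> i < e"
    then have "e - 1 < i" using e0 by simp
    moreover have "p ^ (e - 1) * p dvd p ^ (e - 1) * z" using z(2) by (intro mult_dvd_mono) simp_all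
    then have "P dvd p ^ (e - 1) * z" unfolding e using e0 by (metis power_Suc2 Suc_pred neq0_conv One_nat_def)
    ultimately show False using min z(1) by blast
  qed
  have "i < 2"
  proof (rule ccontr)
    assume "\<not> i < 2"
    then obtain l where l: "i = Suc (Suc l)" by (metis add_2_eq_Suc le_Suc_ex not_less)
    show False
    proof (rule no_large_order[OF gn1 rdN, of "p ^ Suc l" y "p ^ (e - Suc l)"])
      show "p dvd p ^ Suc l" by simp
      show "c y = c k" by (rule y)
      show "P dvd p * p ^ Suc l * y" using y(2) unfolding l by simp
      show "\<not> P dvd p ^ Suc l * x" if "c x = c k" for x using min[of "Suc l" x] that l by simp
      show "P = p ^ Suc l * p ^ (e - Suc l)" unfolding e power_add[symmetric] using \<open>i < e\<close> l by simp
      have "2 \<le> e - Suc l" using \<open>i < e\<close> l by simp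
      then show "p * p dvd p ^ (e - Suc l)" using le_imp_power_dvd[of 2 "e - Suc l" p] by (simp add: power2_eq_square)
    qed
  qed
  then have "i = 0 \<or> i = 1" by auto
  then have "P dvd p * y" using y(2) by auto
  then show ?thesis using that y(1) by blast
qed

text \<open>The class coincides with its \<open>gam\<close>-orbit, whose structure is known. Trivial
  radical makes \<open>A\<close> equal to \<open>N\<close>, and then \<open>mult u\<close> and the
  subgroup generated by \<open>Zset (orb k)\<close> turn out to be complementary.\<close>

lemma bad_split:
  assumes gn1: "gn N (cl c k) = 1" and rdN: "rd (cl c k) = N" and z: "c z = c k" "p dvd z"
  shows "\<exists>t th. splits N c k t th \<and> p dvd t"
proof -
  obtain y where y: "c y = c k" "P dvd p * y" using bad_small_order[OF gn1 rdN z] .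
  define Q where "Q = cl c k"
  have orbQ: "orb k = Q" unfolding Q_def by (rule orb_eq_class[OF gn1 rdN y z])
  obtain u A where pcl: "pcl u A" and pu: "\<not> p dvd u" and xD: "xset c (Zset (orb k))" and Dne: "Zset (orb k) \<noteq> {}"
    and cover: "\<forall>x\<in>orb k. \<exists>d\<in>Zset (orb k). u dvd x - d"
    and struct: "\<forall>d\<in>Zset (orb k). \<forall>x. u dvd x - d \<longrightarrow> (x \<in> orb k \<longleftrightarrow> \<not> A dvd x - d)"
    using orbit_structure[OF gn1 rdN y] .
  note uA = pclD(1-6)[OF pcl]
  define D where "D = Zset (orb k)"
  have xQ: "xset c Q" unfolding Q_def by (rule xset_cl)
  note per = xs_per[OF S xQ]
  have cov: "\<exists>d\<in>D. u dvd x - d" if "x \<in> Q" for x using cover that unfolding D_def orbQ by blast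
  have str: "x \<in> Q \<longleftrightarrow> \<not> A dvd x - d" if "d \<in> D" "u dvd x - d" for d x
    using struct that unfolding D_def orbQ by blast
  have DP: "P dvd d" if "d \<in> D" for d using that unfolding D_def Zset_def by blast
  have AN: "A = N"
  proof -
    have "rd Q dvd A"
      unfolding rd_dvd_iff[OF N0 per]
    proof
      fix x assume x: "x \<in> Q"
      obtain d where d: "d \<in> D" "u dvd x - d" using cov[OF x] by blast
      have "u dvd (x - d) + A" using d(2) uA(4) by (rule dvd_add)
      then have "u dvd (x + A) - d" by (simp add: algebra_simps)
      moreover have "\<not> A dvd x - d" using str[OF d] x by blast
      then have "\<not> A dvd (x + A) - d" using dvd_add_left_iff[of A A "x - d"] by (simp add: algebra_simps)
      ultimately show "x + A \<in> Q" using str[OF d(1)] by blast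
    qed
    then have "N dvd A" using rdN unfolding Q_def by simp
    then show ?thesis by (rule pos_dvd_antisym[OF xdiv_pos[OF uA(2)] N0 xdiv_dvd[OF uA(2)]])
  qed
  define h where "h = gn N D"
  have xD': "xset c D" using xD unfolding D_def .
  have xh: "xdiv N c h" unfolding h_def by (rule xdiv_gn[OF S xD'])
  have hd: "h dvd d" if "d \<in> D" for d unfolding h_def by (rule gn_dvd(2)[OF that])
  have Ph: "P dvd h" unfolding h_def by (rule gn_greatest[OF PN DP])
  have gc: "gcd u h = 1"
  proof -
    have "gcd u h dvd gn N Q"
    proof (rule gn_greatest)
      show "gcd u h dvd N" by (rule dvd_trans[OF gcd_dvd1 xdiv_dvd[OF uA(1)]])
      fix x assume x: "x \<in> Q"
      obtain d where d: "d \<in> D" "u dvd x - d" using cov[OF x] by blast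
      have "gcd u h dvd (x - d) + d"
        by (rule dvd_add[OF dvd_trans[OF gcd_dvd1 d(2)] dvd_trans[OF gcd_dvd2 hd[OF d(1)]]])
      then show "gcd u h dvd x" by simp
    qed
    then have "gcd u h dvd 1" using gn1 unfolding Q_def by simp
    then show ?thesis by simp
  qed
  have W: "c x = c (b * q) \<Longrightarrow> coprime b N \<Longrightarrow> u dvd x \<and> \<not> N dvd x" for x b
    using pclD(7)[OF pcl] unfolding AN by blast
  have W': "u dvd x \<Longrightarrow> \<not> N dvd x \<Longrightarrow> \<exists>b. coprime b N \<and> c x = c (b * q)" for x
    using pclD(7)[OF pcl] unfolding AN by blast
  \<comment> \<open>The intersection of the two subgroups is trivial: nonzero elements of
    \<open>mult u\<close> lie in classes of unit multiples of \<open>q\<close>, with nontrivial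
    \<open>p\<close>-part, whereas \<open>mult h\<close> has trivial \<open>p\<close>-part.\<close>
  have lc: "lcm u h = N"
  proof (rule ccontr)
    assume n: "lcm u h \<noteq> N"
    have xl: "xdiv N c (lcm u h)" by (rule xdiv_lcm[OF S uA(1) xh])
    have "\<not> N dvd lcm u h" using n pos_dvd_antisym[OF xdiv_pos[OF xl] N0 xdiv_dvd[OF xl]] by blast
    then obtain b where b: "coprime b N" "c (lcm u h) = c (b * q)" using W' dvd_lcm1 by blast
    have "lcm u h dvd b * q" using xdiv_iff[OF S xl b(2)] by simp
    then have "P dvd b * q" using Ph by (meson dvd_lcm2 dvd_trans)
    moreover have "coprime P b" using b(1) PN by (meson coprime_commute coprime_divisors dvd_refl)
    ultimately have "P dvd q" by (simp add: coprime_dvd_mult_right_iff)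
    then have "N dvd q" using N_dvd_iff Mq by blast
    then show False using not_N_dvd_q by simp
  qed
  have Nuh: "N = u * h"
  proof -
    have "gcd u h * lcm u h = \<bar>u * h\<bar>" by (metis prod_gcd_lcm_int abs_mult)
    then show ?thesis using gc lc xdiv_pos[OF uA(1)] xdiv_pos[OF xh] by simp
  qed
  have u0: "0 < u" and h0: "0 < h" using xdiv_pos uA(1) xh by blast+
  have Nh: "N div h = u" using Nuh h0 by simp
  have Ndiv: "N dvd x" if "u dvd x" "h dvd x" for x using that lc by (metis lcm_least)
  \<comment> \<open>For each class \<open>C\<close> of nonzero elements of \<open>mult u\<close> the
    sum \<open>C + D\<close> lies in the class \<open>Q\<close>, so it equals \<open>Q\<close>.
    Comparing components in the direct sum puts all these elements into \<open>C\<close>.\<close>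
  have hash: "c x = c x'" if x: "u dvd x" "\<not> N dvd x" and x': "u dvd x'" "\<not> N dvd x'" for x x'
  proof -
    define C where "C = cl c x"
    have xC: "xset c C" unfolding C_def by (rule xset_cl)
    have CT: "u dvd w \<and> \<not> N dvd w" if "w \<in> C" for w
    proof -
      have w: "c w = c x" using that unfolding C_def by simp
      show ?thesis using xdiv_iff[OF S uA(1) w] spair_zero[OF S w] x by blast
    qed
    have xs: "xset c (splus C D)" by (rule xs_splus[OF S xC xD'])
    have sub: "splus C D \<subseteq> Q"
    proof
      fix z assume "z \<in> splus C D"
      then obtain w d where w: "z = w + d" "w \<in> C" "d \<in> D" unfolding splus_def by blast
      then show "z \<in> Q" using str[OF w(3), of z] CT[OF w(2)] unfolding AN by simp
    qed
    obtain d where d: "d \<in> D" using Dne unfolding D_def by blast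
    have "x \<in> C" unfolding C_def by simp
    then have xd: "x + d \<in> splus C D" unfolding splus_def using d by blast
    then have "c (x + d) = c k" using sub unfolding Q_def by auto
    then have "k \<in> splus C D" using xsD[OF xs, of "x + d" k] xd by blast
    then have QC: "Q \<subseteq> splus C D" unfolding Q_def by (rule class_subset[OF xs])
    have "x' + d \<in> Q" using str[OF d, of "x' + d"] x' unfolding AN by simp
    then obtain w d' where w: "x' + d = w + d'" "w \<in> C" "d' \<in> D" using QC unfolding splus_def by blast
    have "x' - w = d' - d" using w(1) by simp
    moreover have "u dvd x' - w" using x'(1) CT[OF w(2)] by (intro dvd_diff) simp_all
    moreover have "h dvd d' - d" using hd[OF w(3)] hd[OF d] by (rule dvd_diff)
    ultimately have "N dvd x' - w" using Ndiv by metis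
    then have "c x' = c w" by (rule spair_eq[OF S])
    then show ?thesis using w(2) unfolding C_def by simp
  qed
  have uq: "u dvd q" and nq: "\<not> N dvd q" using uA(3) not_N_dvd_q by blast+
  have xT: "xset c (mult u - mult N)"
    by (rule xs_Diff[OF _ xs_zero[OF S]]) (use uA(1) in \<open>simp only: xdiv_def\<close>)
  obtain d where d: "d \<in> D" using Dne unfolding D_def by blast
  have Qeq: "Q = splus (mult u - mult N) (cl c d)"
  proof -
    have xs: "xset c (splus (mult u - mult N) (cl c d))" by (rule xs_splus[OF S xT xset_cl])
    have cd: "cl c d \<subseteq> D" by (rule class_subset[OF xD' d])
    have sub: "splus (mult u - mult N) (cl c d) \<subseteq> Q"
    proof
      fix z assume "z \<in> splus (mult u - mult N) (cl c d)"
      then obtain w d' where w: "z = w + d'" "w \<in> mult u - mult N" "d' \<in> cl c d" unfolding splus_def by blast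
      then show "z \<in> Q" using str[of d' z] cd unfolding AN by auto
    qed
    have "q \<in> mult u - mult N" using uq nq by simp
    moreover have "d \<in> cl c d" by simp
    ultimately have qd: "q + d \<in> splus (mult u - mult N) (cl c d)" unfolding splus_def by blast
    then have "c (q + d) = c k" using sub unfolding Q_def by auto
    then have "k \<in> splus (mult u - mult N) (cl c d)" using xsD[OF xs, of "q + d" k] qd by blast
    then have "Q \<subseteq> splus (mult u - mult N) (cl c d)" unfolding Q_def by (rule class_subset[OF xs])
    then show ?thesis using sub by blast
  qed
  have ph: "p dvd h" using pP Ph dvd_trans by blast
  have h1: "1 < h"
  proof -
    have "p \<le> h" by (rule zdvd_imp_le[OF ph h0])
    then show ?thesis using p1 by simp
  qed
  \<comment> \<open>If \<open>h\<close> were \<open>p\<close>, then \<open>z\<close>, being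
    divisible by \<open>p\<close>, would have trivial component in \<open>mult u\<close>, against
    the description of the class.\<close>
  have np: "\<not> Factorial_Ring.prime h"
  proof
    assume "Factorial_Ring.prime h"
    then have hp: "h = p" using primes_dvd_imp_eq[OF p _ ph] by simp
    have zQ: "z \<in> Q" using z(1) unfolding Q_def by simp
    obtain d where d: "d \<in> D" "u dvd z - d" using cov[OF zQ] by blast
    have "h dvd z - d" unfolding hp by (rule dvd_diff[OF z(2) dvd_trans[OF pP DP[OF d(1)]]])
    then have "A dvd z - d" unfolding AN using Ndiv d(2) by blast
    then show False using str[OF d] zQ by blast
  qed
  have "splits N c k h d"
    unfolding splits_def Nh
  proof (intro conjI)
    show "h dvd N" using Nuh by simp
    show "coprime h u" using gc by (simp add: coprime_iff_gcd_eq_1 gcd.commute)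
    show "xdiv N c h" "xdiv N c u" by (rule xh, rule uA)
    show "h dvd d" by (rule hd[OF d])
    show "\<forall>x y. u dvd x \<longrightarrow> \<not> N dvd x \<longrightarrow> u dvd y \<longrightarrow> \<not> N dvd y \<longrightarrow> c x = c y" using hash by blast
    show "cl c k = splus (mult u - mult N) (cl c d)" using Qeq unfolding Q_def .
    show "\<not> Factorial_Ring.prime h" "1 < h" by (rule np, rule h1)
  qed
  then show ?thesis using ph by blast
qed

end

text \<open>Only the lattice of subgroups is recorded: no subgroup lies strictly between, and the
  order of the section is not a prime. That is enough to show later that such a section cannot
  overlap the \<open>p\<close>-adic range of a class regular at \<open>p\<close>.\<close>

definition primitive_section :: "int \<Rightarrow> (int \<Rightarrow> 'k) \<Rightarrow> int \<Rightarrow> int \<Rightarrow> bool" where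
  "primitive_section N c d1 d2 \<longleftrightarrow> xdiv N c d1 \<and> xdiv N c d2 \<and> d1 dvd d2 \<and> \<not> Factorial_Ring.prime (d2 div d1) \<and>
     (\<forall>d. xdiv N c d \<longrightarrow> d1 dvd d \<longrightarrow> d dvd d2 \<longrightarrow> d = d1 \<or> d = d2)"

text \<open>\<open>th\<close> is a regular part of \<open>k\<close>: what remains of \<open>k\<close> after removing the components in the direct
  summands on which the scheme is trivial; \<open>t\<close> is the product of the orders of these summands.\<close>
definition regular_part :: "int \<Rightarrow> (int \<Rightarrow> 'k) \<Rightarrow> (int \<Rightarrow> 'k) \<Rightarrow> int \<Rightarrow> int \<Rightarrow> int \<Rightarrow> bool" where
  "regular_part N c c' k t th \<longleftrightarrow> 0 < t \<and> t dvd N \<and> coprime t (N div t) \<and> xdiv N c t \<and>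
     gn N (cl c th) = t \<and> rd (cl c th) = N \<and> N div t dvd k - th \<and>
     (\<forall>x p. c x = c th \<longrightarrow> Factorial_Ring.prime p \<longrightarrow> p dvd N div t \<longrightarrow> \<not> t * p dvd x) \<and>
     (\<forall>p. Factorial_Ring.prime p \<longrightarrow> p dvd t \<longrightarrow>
       (\<exists>d1 d2. primitive_section N c d1 d2 \<and> \<not> p dvd d1 \<and> \<not> p dvd N div d2)) \<and>
     (\<forall>th'. c th = c' th' \<longrightarrow> c k = c' (k - th + th'))"

lemma primitive_section_sub:
  assumes S: "spair N c c" and t: "xdiv N c t" and P: "primitive_section (N div t) (sub c t) d1 d2"
  shows "primitive_section N c (t * d1) (t * d2)"
  unfolding primitive_section_def
proof (intro conjI allI impI)
  have t0: "0 < t" by (rule xdiv_pos[OF t])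
  show "xdiv N c (t * d1)" "xdiv N c (t * d2)" "t * d1 dvd t * d2" "\<not> Factorial_Ring.prime (t * d2 div (t * d1))"
    using P t0 xdiv_sub_iff[OF S t] unfolding primitive_section_def by auto
  fix d assume d: "xdiv N c d" "t * d1 dvd d" "d dvd t * d2"
  then obtain e where e: "d = t * e" by (meson dvd_mult_left dvdE)
  have "xdiv (N div t) (sub c t) e" using d(1) xdiv_sub_iff[OF S t] e by simp
  moreover have "d1 dvd e" "e dvd d2" using d(2,3) t0 unfolding e by simp_all
  ultimately show "d = t * d1 \<or> d = t * d2" using P unfolding primitive_section_def e by auto
qed

lemma splits_primitive:
  assumes S: "spair N c c" and sp: "splits N c k t th"
  shows "primitive_section N c (N div t) N"
  unfolding primitive_section_def
proof (intro conjI allI impI)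
  have N: "0 < N" by (rule spair_pos[OF S])
  have t: "t dvd N" "xdiv N c (N div t)" "\<not> Factorial_Ring.prime t" "1 < t"
    and hash: "\<And>x y. N div t dvd x \<Longrightarrow> \<not> N dvd x \<Longrightarrow> N div t dvd y \<Longrightarrow> \<not> N dvd y \<Longrightarrow> c x = c y"
    using sp unfolding splits_def by blast+
  obtain s where s: "N = t * s" using t(1) by blast
  have Ns: "N div t = s" using s t(4) by simp
  have s0: "0 < s" using xdiv_pos[OF t(2)] unfolding Ns .
  show "xdiv N c (N div t)" "xdiv N c N" by (rule t, rule xdiv_N[OF S])
  show "N div t dvd N" unfolding Ns using s by simp
  have "N div (N div t) = t" unfolding Ns using s s0 by simp
  then show "\<not> Factorial_Ring.prime (N div (N div t))" using t(3) by simp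
  fix d assume d: "xdiv N c d" "N div t dvd d" "d dvd N"
  have d0: "0 < d" by (rule xdiv_pos[OF d(1)])
  show "d = N div t \<or> d = N"
  proof (cases "N dvd d")
    case True
    then show ?thesis using pos_dvd_antisym[OF d0 N d(3)] by blast
  next
    case False
    have "\<not> N dvd s"
    proof
      assume "N dvd s"
      then have "t * s \<le> s" using zdvd_imp_le[OF _ s0] s by simp
      then show False using t(4) s0 by simp
    qed
    then have e: "c d = c s" using hash[of d s] d(2) False unfolding Ns by simp
    then have "d dvd s" using iffD1[OF xdiv_iff[OF S d(1) e]] by simp
    then have "d = s" using d(2) unfolding Ns by (intro pos_dvd_antisym[OF d0 s0]) simp_all
    then show ?thesis unfolding Ns by simp
  qed
qed

text \<open>As long as the class contains an element divisible by a prime of \<open>N\<close>,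
  \<open>bad_split\<close> removes a trivial summand, and the other component of \<open>k\<close> is
  a class with the same properties in a smaller cyclic group.\<close>

lemma ex_regular_part:
  assumes S: "spair N c c'" and gn1: "gn N (cl c k) = 1" and rdN: "rd (cl c k) = N"
  shows "\<exists>t th. regular_part N c c' k t th"
  using assms
proof (induction "nat N" arbitrary: N c c' k rule: less_induct)
  case less
  note S = less.prems(1) and gn1 = less.prems(2) and rdN = less.prems(3)
  have S0: "spair N c c" by (rule spair_left[OF S])
  have N: "0 < N" by (rule spair_pos[OF S])
  show ?case
  proof (cases "\<exists>x p. c x = c k \<and> Factorial_Ring.prime p \<and> p dvd N \<and> p dvd x")
    case False
    have "\<not> p dvd 1" if "Factorial_Ring.prime p" for p :: int using that not_prime_unit by blast
    then have "regular_part N c c' k 1 k"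
      unfolding regular_part_def using gn1 rdN xdiv_1[OF S0] False by auto
    then show ?thesis by blast
  next
    case True
    then obtain x p where x: "c x = c k" "Factorial_Ring.prime p" "p dvd N" "p dvd x" by blast
    obtain P M q where pr: "pring N c p P M q" using ex_pring[OF S0 x(2,3)] .
    obtain t1 th1 where sp: "splits N c k t1 th1" using pring.bad_split[OF pr gn1 rdN x(1,4)] by blast
    have t1: "t1 dvd N" "coprime t1 (N div t1)" "xdiv N c t1" "xdiv N c (N div t1)" "t1 dvd th1" "1 < t1"
      and Qeq: "cl c k = splus (mult (N div t1) - mult N) (cl c th1)"
      using sp unfolding splits_def by blast+
    define s where "s = N div t1"
    have Ns: "N = t1 * s" using t1(1) by (simp add: s_def)
    have s0: "0 < s" using xdiv_pos[OF t1(4)] unfolding s_def .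
    have "s < N" unfolding Ns using t1(6) s0 by simp
    have "k \<in> cl c k" by simp
    then obtain a w where aw: "k = a + w" "s dvd a" "\<not> N dvd a" "c w = c th1"
      unfolding Qeq splus_def s_def[symmetric] by auto
    have clw: "cl c w = cl c th1" unfolding cl_def aw(4) ..
    have tcl: "t1 dvd z" if "z \<in> cl c w" for z
      using that xdiv_iff[OF S0 t1(3), of z th1] t1(5) unfolding clw by simp
    obtain k1 where k1: "w = t1 * k1" using tcl[of w] by auto
    have xcl: "xset c (cl c w)" by (rule xset_cl)
    have gw: "gn N (cl c w) = t1"
    proof -
      have "t1 dvd gn N (cl c w)" by (rule gn_greatest[OF t1(1) tcl])
      then obtain g where g: "gn N (cl c w) = t1 * g" by blast
      have "t1 * g dvd t1 * s" using gn_dvd(1)[of N "cl c w"] unfolding g Ns[symmetric] .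
      then have gs: "g dvd s" using t1(6) by simp
      have "g dvd gn N (cl c k)"
      proof (rule gn_greatest)
        show "g dvd N" unfolding Ns using gs by simp
        fix z assume "z \<in> cl c k"
        then obtain b v where b: "z = b + v" "s dvd b" "v \<in> cl c w"
          unfolding Qeq clw[symmetric] splus_def s_def[symmetric] by auto
        have "g dvd gn N (cl c w)" unfolding g by simp
        then have "g dvd v" using gn_dvd(2)[OF b(3)] dvd_trans by blast
        then show "g dvd z" unfolding b(1) using dvd_trans[OF gs b(2)] by (intro dvd_add)
      qed
      then have "g dvd 1" unfolding gn1 .
      moreover have "0 < t1 * g" using gn_pos[OF N, of "cl c w"] unfolding g .
      then have "0 < g" using t1(6) by (simp add: zero_less_mult_iff)
      ultimately have "g = 1" by simp
      then show ?thesis using g by simp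
    qed
    have rw: "rd (cl c w) = N"
    proof -
      note pQ = xs_per[OF S0 xset_cl[of c k]] and pw = xs_per[OF S0 xset_cl[of c w]]
      have "rd (cl c k) dvd rd (cl c w)"
        unfolding rd_dvd_iff[OF N pQ]
      proof
        fix z assume "z \<in> cl c k"
        then obtain b v where b: "z = b + v" "b \<in> mult s - mult N" "v \<in> cl c w"
          unfolding Qeq clw[symmetric] splus_def s_def[symmetric] by blast
        have "v + rd (cl c w) \<in> cl c w" using rd_period[OF N pw dvd_refl] b(3) by blast
        moreover have "z + rd (cl c w) = b + (v + rd (cl c w))" using b(1) by simp
        ultimately show "z + rd (cl c w) \<in> cl c k"
          unfolding Qeq clw[symmetric] splus_def s_def[symmetric] using b(2) by blast
      qed
      then have "N dvd rd (cl c w)" unfolding rdN .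
      then show ?thesis by (rule pos_dvd_antisym[OF rd_pos[OF N pw] N rd_dvd[OF N pw]])
    qed
    have t1N: "t1 dvd N" "0 < t1" using t1 by auto
    define d d' where "d = sub c t1" and "d' = sub c' t1"
    have S1: "spair s d d'" unfolding s_def d_def d'_def by (rule spair_sub[OF S t1(3)])
    have S10: "spair s d d" by (rule spair_left[OF S1])
    have cld: "cl d z = {x. t1 * x \<in> cl c (t1 * z)}" for z unfolding d_def by (rule cl_sub)
    have gd: "t1 * gn s (cl d z) = gn N (cl c (t1 * z))" for z
      unfolding cld s_def by (rule gn_sub[OF S0 t1N]) (use xdiv_iff[OF S0 t1(3)] in \<open>metis cl_iff dvd_triv_left\<close>)
    have rdd: "t1 * rd (cl d z) = rd (cl c (t1 * z))" for z
      unfolding cld by (rule rd_sub[OF S0 t1N xs_per[OF S0 xset_cl]])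
        (use xdiv_iff[OF S0 t1(3)] in \<open>auto simp: cl_def\<close>)
    have g1: "gn s (cl d k1) = 1" using gd[of k1] gw t1N(2) unfolding k1[symmetric] by simp
    have r1: "rd (cl d k1) = s" using rdd[of k1] rw t1N(2) unfolding k1[symmetric] Ns by simp
    have "nat s < nat N" using \<open>s < N\<close> s0 by simp
    from less.hyps[OF this S1 g1 r1] obtain t2 th2 where R: "regular_part s d d' k1 t2 th2" by blast
    have t2: "0 < t2" "t2 dvd s" "coprime t2 (s div t2)" "xdiv s d t2" "gn s (cl d th2) = t2" "rd (cl d th2) = s"
      "s div t2 dvd k1 - th2"
      and R2: "\<And>x p. d x = d th2 \<Longrightarrow> Factorial_Ring.prime p \<Longrightarrow> p dvd s div t2 \<Longrightarrow> \<not> t2 * p dvd x"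
      and B2: "\<And>p. Factorial_Ring.prime p \<Longrightarrow> p dvd t2 \<Longrightarrow>
       (\<exists>d1 d2. primitive_section s d d1 d2 \<and> \<not> p dvd d1 \<and> \<not> p dvd s div d2)"
      and T2: "\<And>th'. d th2 = d' th' \<Longrightarrow> d k1 = d' (k1 - th2 + th')"
      using R unfolding regular_part_def by blast+
    define s2 where "s2 = s div t2"
    have ss2: "s = t2 * s2" using t2(2) by (simp add: s2_def)
    have Nt: "N div (t1 * t2) = s2" unfolding Ns ss2 using t1N(2) t2(1) by simp
    have cop1: "coprime t1 s" using t1(2) unfolding s_def .
    have "regular_part N c c' k (t1 * t2) (t1 * th2)"
      unfolding regular_part_def Nt
    proof (intro conjI allI impI)
      show "0 < t1 * t2" using t1N t2 by simp
      show "t1 * t2 dvd N" unfolding Ns using t2(2) by simp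
      show "coprime (t1 * t2) s2" using cop1 t2(3)[folded s2_def] ss2 by simp
      show "xdiv N c (t1 * t2)" using t2(4) xdiv_sub_iff[OF S0 t1(3)] unfolding s_def d_def by simp
      show "gn N (cl c (t1 * th2)) = t1 * t2" using gd[of th2] t2(5) by simp
      show "rd (cl c (t1 * th2)) = N" using rdd[of th2] t2(6) Ns by simp
      have "s2 dvd a" using aw(2) ss2 by (metis dvd_mult_right)
      moreover have "s2 dvd t1 * (k1 - th2)" using t2(7) unfolding s2_def[symmetric] by simp
      moreover have "k - t1 * th2 = a + t1 * (k1 - th2)" using aw(1) k1 by (simp add: algebra_simps)
      ultimately show "s2 dvd k - t1 * th2" by simp
    next
      fix x p assume x: "c x = c (t1 * th2)" and p: "Factorial_Ring.prime p" "p dvd s2"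
      have "t1 dvd x" using xdiv_iff[OF S0 t1(3) x] by simp
      then obtain y where y: "x = t1 * y" by blast
      have "d y = d th2" using x unfolding y d_def sub_def .
      then have "\<not> t2 * p dvd y" using R2 p unfolding s2_def by blast
      then show "\<not> t1 * t2 * p dvd x" unfolding y mult.assoc using t1N(2) by simp
    next
      fix p assume p: "Factorial_Ring.prime p" "p dvd t1 * t2"
      show "\<exists>d1 d2. primitive_section N c d1 d2 \<and> \<not> p dvd d1 \<and> \<not> p dvd N div d2"
      proof (cases "p dvd t1")
        case True
        have "\<not> p dvd s" using True cop1 p(1) by (meson coprime_common_divisor not_prime_unit)
        moreover have "\<not> p dvd N div N" using p(1) N not_prime_unit by auto
        ultimately show ?thesis using splits_primitive[OF S0 sp] unfolding s_def by blast
      next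
        case False
        then have "p dvd t2" using p by (simp add: prime_dvd_mult_iff)
        then obtain d1 d2 where D: "primitive_section s d d1 d2" "\<not> p dvd d1" "\<not> p dvd s div d2" using B2 p(1) by blast
        have "primitive_section N c (t1 * d1) (t1 * d2)"
          by (rule primitive_section_sub[OF S0 t1(3)]) (use D(1) in \<open>unfold s_def d_def\<close>)
        moreover have "\<not> p dvd t1 * d1" using D(2) False p(1) by (simp add: prime_dvd_mult_iff)
        moreover have "N div (t1 * d2) = s div d2" unfolding Ns using t1N(2) by simp
        ultimately show ?thesis using D(3) by metis
      qed
    next
      fix th' assume th: "c (t1 * th2) = c' th'"
      have "t1 dvd th'" using xdiv_iff[OF S t1(3) th] by simp
      then obtain z where z: "th' = t1 * z" by blast
      have "d th2 = d' z" using th unfolding z d_def d'_def sub_def .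
      from T2[OF this] have "c w = c' (t1 * (k1 - th2 + z))" unfolding d_def d'_def sub_def k1 .
      moreover have "t1 * (k1 - th2 + z) = w - t1 * th2 + th'" unfolding k1 z by (simp add: algebra_simps)
      ultimately have cw: "c w = c' (w - t1 * th2 + th')" by simp
      \<comment> \<open>The isomorphism preserves the set of nonzero elements of the trivial
        summand, so the image of \<open>k = a + w\<close> may keep the component \<open>a\<close>
        and replace \<open>w\<close> by its image \<open>v\<close>.\<close>
      define v where "v = w - t1 * th2 + th'"
      have xp: "xs c c' (splus (mult s - mult N) (cl c w)) (splus (mult s - mult N) (cl c' v))"
        by (rule xs_splus[OF S xs_Diff[OF _ xs_zero[OF S]] xs_cl[of c w c' v]])
          (use xdiv_pair[OF S t1(4)] cw in \<open>simp_all only: s_def v_def\<close>)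
      obtain y where y: "c y = c' (a + v)" using spair_ex'[OF S] .
      have "a \<in> mult s - mult N" "v \<in> cl c' v" using aw(2,3) by simp_all
      then have "a + v \<in> splus (mult s - mult N) (cl c' v)" unfolding splus_def by blast
      then have "y \<in> splus (mult s - mult N) (cl c w)" using xsD[OF xp y] by blast
      then have "y \<in> cl c k" unfolding Qeq clw s_def .
      then have "c k = c' (a + v)" using y by simp
      moreover have "a + v = k - t1 * th2 + th'" unfolding v_def aw(1) by simp
      ultimately show "c k = c' (k - t1 * th2 + th')" by simp
    qed
    then show ?thesis by blast
  qed
qed

section \<open>Classes consisting of units\<close>

text \<open>All binomial terms from the square on are divisible by \<open>p * p * u\<close>. The
  middle ones get a factor \<open>p\<close> from the binomial coefficient; the last one,
  \<open>u ^ p\<close>, needs \<open>4 dvd u\<close> if \<open>p = 2\<close>.\<close>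

lemma binomial_prime_power:
  fixes u :: int
  assumes p: "Factorial_Ring.prime (p::nat)" and pu: "int p dvd u" and p2: "p = 2 \<Longrightarrow> 4 dvd u"
  shows "\<exists>w. (1 + u) ^ p = 1 + int p * u + int p * (int p * u * w)"
proof -
  have p1: "1 < p" using p prime_gt_1_nat by blast
  have "(u + 1) ^ p = (\<Sum>i\<le>p. of_nat (p choose i) * u ^ i * 1 ^ (p - i))" by (rule binomial_ring)
  also have "{..p} = {0, 1} \<union> {2..p}" using p1 by auto
  also have "(\<Sum>i\<in>{0, 1} \<union> {2..p}. of_nat (p choose i) * u ^ i * 1 ^ (p - i)) =
      1 + int p * u + (\<Sum>i\<in>{2..p}. of_nat (p choose i) * u ^ i)"
    by (subst sum.union_disjoint) auto
  finally have eq: "(1 + u) ^ p = 1 + int p * u + (\<Sum>i\<in>{2..p}. of_nat (p choose i) * u ^ i)"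
    by (simp add: add.commute)
  have "int p * (int p * u) dvd (\<Sum>i\<in>{2..p}. of_nat (p choose i) * u ^ i)"
  proof (rule dvd_sum)
    fix i assume i: "i \<in> {2..p}"
    show "int p * (int p * u) dvd of_nat (p choose i) * u ^ i"
    proof (cases "i = p")
      case True
      have "int p * int p dvd u ^ (p - 1)"
      proof (cases "p = 2")
        case True
        then show ?thesis using p2 by simp
      next
        case False
        then have "2 \<le> p - 1" using p1 by simp
        then have "u ^ 2 dvd u ^ (p - 1)" by (rule le_imp_power_dvd)
        moreover have "int p * int p dvd u ^ 2" using mult_dvd_mono[OF pu pu] by (simp add: power2_eq_square)
        ultimately show ?thesis using dvd_trans by blast
      qed
      then have "int p * int p * u dvd u ^ (p - 1) * u" by (rule mult_dvd_mono) simp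
      moreover have "u ^ (p - 1) * u = u ^ p" using p1 by (metis power_minus_mult order.strict_trans zero_less_one)
      ultimately have "int p * int p * u dvd u ^ p" by metis
      then show ?thesis unfolding True mult.assoc by (simp only: binomial_n_n of_nat_1 mult_1)
    next
      case False
      then have "p dvd (p choose i)" using i p by (intro dvd_choose_prime) auto
      then have 1: "int p dvd int (p choose i)" by (simp add: int_dvd_int_iff)
      have "u ^ 2 dvd u ^ i" using i by (intro le_imp_power_dvd) simp
      moreover have "int p * u dvd u ^ 2" using mult_dvd_mono[OF pu dvd_refl, of u] by (simp add: power2_eq_square)
      ultimately have "int p * u dvd u ^ i" using dvd_trans by blast
      then show ?thesis by (rule mult_dvd_mono[OF 1])
    qed
  qed
  then obtain w where "(\<Sum>i\<in>{2..p}. of_nat (p choose i) * u ^ i) = int p * (int p * u) * w" by blast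
  then show ?thesis using eq by (intro exI[of _ w]) (simp add: mult_ac)
qed

lemma power_cong_1: fixes a :: int assumes p: "Factorial_Ring.prime (p::int)" and a: "p dvd a - 1"
  shows "p ^ f dvd a ^ nat (p ^ f) - 1"
proof -
  have p1: "1 < p" using p prime_gt_1_int by blast
  have step: "p ^ Suc j dvd a ^ nat (p ^ j) - 1" for j
  proof (induction j)
    case (Suc j)
    define b where "b = a ^ nat (p ^ j)"
    have pj: "nat (p ^ Suc j) = nat (p ^ j) * nat p" using p1 by (simp add: nat_mult_distrib mult.commute)
    have "a ^ nat (p ^ Suc j) - 1 = b ^ nat p - 1 ^ nat p" unfolding pj b_def power_mult by simp
    also have "\<dots> = (b - 1) * (\<Sum>i<nat p. b ^ i * 1 ^ (nat p - Suc i))"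
      by (subst power_diff_sumr2) (simp add: mult.commute)
    finally have eq: "a ^ nat (p ^ Suc j) - 1 = (b - 1) * (\<Sum>i<nat p. b ^ i)" by simp
    have pb: "p dvd b - 1" using Suc.IH unfolding b_def[symmetric] by (rule dvd_trans[rotated]) simp
    have "p dvd (\<Sum>i<nat p. b ^ i - 1)"
    proof (rule dvd_sum)
      fix i
      have "b - 1 dvd b ^ i - 1" by (metis power_one power_diff_1_eq dvd_triv_left)
      then show "p dvd b ^ i - 1" using pb dvd_trans by blast
    qed
    then have "p dvd (\<Sum>i<nat p. b ^ i) - int (nat p)" by (simp add: sum_subtractf)
    then have "p dvd ((\<Sum>i<nat p. b ^ i) - int (nat p)) + p" by (intro dvd_add) simp_all
    then have "p dvd (\<Sum>i<nat p. b ^ i)" using p1 by simp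
    then have "p ^ Suc j * p dvd (b - 1) * (\<Sum>i<nat p. b ^ i)" using Suc.IH unfolding b_def[symmetric] by (intro mult_dvd_mono)
    then show ?case unfolding eq by (simp add: mult.commute)
  qed (use a in simp)
  show ?thesis using step[of f] by (rule dvd_trans[rotated]) simp
qed

lemma xdiv_by_prime_powers:
  assumes S: "spair N c c" and d: "0 < d" "d dvd N"
    and pp: "\<And>p j. Factorial_Ring.prime p \<Longrightarrow> p ^ j dvd d \<Longrightarrow> xdiv N c (p ^ j)"
  shows "xdiv N c d"
proof -
  define K where "K = {g. xdiv N c g \<and> g dvd d}"
  have "finite K" by (rule finite_subset[of _ "{r. r dvd d}"]) (use d in \<open>auto simp: K_def intro!: finite_divisors_int\<close>)
  moreover have "1 \<in> K" using xdiv_1[OF S] by (simp add: K_def)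
  ultimately have m: "Max K \<in> K" "\<And>g. g \<in> K \<Longrightarrow> g \<le> Max K" using Max_in Max_ge by blast+
  define g where "g = Max K"
  have g: "xdiv N c g" "g dvd d" using m(1) unfolding g_def K_def by blast+
  have g0: "0 < g" by (rule xdiv_pos[OF g(1)])
  have "d dvd g"
  proof (rule multiplicity_le_imp_dvd)
    show "d \<noteq> 0" using d by simp
    fix p :: int assume p: "Factorial_Ring.prime p"
    define j where "j = multiplicity p d"
    have pj: "p ^ j dvd d" unfolding j_def by (rule multiplicity_dvd)
    have xl: "xdiv N c (lcm g (p ^ j))" by (rule xdiv_lcm[OF S g(1) pp[OF p pj]])
    have "lcm g (p ^ j) dvd d" using g(2) pj by simp
    then have "lcm g (p ^ j) \<le> g" using m(2) xl unfolding g_def K_def by blast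
    moreover have "g \<le> lcm g (p ^ j)" using zdvd_imp_le[OF dvd_lcm1 xdiv_pos[OF xl]] .
    ultimately have "lcm g (p ^ j) = g" by simp
    then have "p ^ j dvd g" by (metis dvd_lcm2)
    then show "multiplicity p d \<le> multiplicity p g"
      unfolding j_def[symmetric] using g0 p by (intro multiplicity_geI) auto
  qed
  then show ?thesis using g pos_dvd_antisym[OF g0 d(1)] by simp
qed

section \<open>Rigidity of a class of units with trivial radical\<close>

locale regular =
  fixes N :: int and c :: "int \<Rightarrow> 'k" and k :: int
  assumes S: "spair N c c" and rdN: "rd (cl c k) = N" and units: "\<And>x. c x = c k \<Longrightarrow> coprime x N"
begin

text \<open>The multipliers preserving the class. As the class consists of units, it is one coset of
  this group, by \<open>stab_quotient\<close>.\<close>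

definition stab :: "int \<Rightarrow> bool" where "stab a \<longleftrightarrow> coprime a N \<and> (\<forall>x. c x = c k \<longrightarrow> c (a * x) = c k)"

lemma N0: "0 < N" by (rule spair_pos[OF S])

lemma stab_quotient: assumes "c x = c k" "c y = c k" shows "\<exists>a. stab a \<and> N dvd a * x - y"
proof -
  obtain b where b: "coprime b N" "N dvd b * x - 1" using unit_inverse[OF units[OF assms(1)]] .
  define a where "a = y * b"
  have ca: "coprime a N" using units[OF assms(2)] b(1) unfolding a_def by simp
  have "a * x - y = y * (b * x - 1)" unfolding a_def by (simp add: algebra_simps)
  then have ax: "N dvd a * x - y" using b(2) by simp
  have "c (a * z) = c k" if "c z = c k" for z
  proof -
    have "c (a * z) = c (a * x)" by (rule multiplier[OF S _ ca]) (use assms that in simp)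
    then show ?thesis using spair_eq[OF S ax] assms(2) by simp
  qed
  then show ?thesis using ca ax unfolding stab_def by blast
qed

lemma stab_pow: "stab a \<Longrightarrow> stab (a ^ n)"
proof (induction n)
  case (Suc n)
  then show ?case unfolding stab_def by (auto simp: mult.assoc)
qed (simp add: stab_def)

lemma no_period: assumes "\<And>x. c x = c k \<Longrightarrow> c (x + s) = c k" shows "N dvd s"
proof -
  have "rd (cl c k) dvd s"
    unfolding rd_dvd_iff[OF N0 xs_per[OF S xset_cl]] using assms by simp
  then show ?thesis unfolding rdN .
qed

text \<open>Raising to the \<open>p\<close>-th power increases \<open>f\<close> by one and keeps
  \<open>s\<close> prime to \<open>p\<close>, until \<open>f = e - 1\<close>. There the multiplier
  is \<open>1 + q * s\<close>, and its powers translate the class by \<open>q\<close>.\<close>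

lemma stab_near_one_exact:
  assumes pr: "pring N c p P M q" and P: "P = p ^ e" and a: "stab (1 + M * p ^ f * s)" "\<not> p dvd s"
    and f: "1 \<le> f" "p = 2 \<Longrightarrow> 2 \<le> f" "f < e"
  shows False
  using a f
proof (induction "e - f" arbitrary: f s rule: less_induct)
  case (less f s)
  interpret pring N c p P M q by (rule pr)
  define u where "u = M * p ^ f * s"
  show False
  proof (cases "Suc f = e")
    case True
    have u: "u = q * s"
    proof -
      have "P div p = p ^ f" unfolding P True[symmetric] using p1 by simp
      then show ?thesis unfolding u_def qPM by (simp add: mult_ac)
    qed
    have "N dvd q * q"
    proof -
      have "p dvd q"
      proof -
        have "p dvd p ^ f" using less.prems(3) by simp
        moreover have "P div p = p ^ f" unfolding P True[symmetric] using p1 by simp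
        ultimately show ?thesis unfolding qPM by simp
      qed
      then show ?thesis unfolding Npq by (intro mult_dvd_mono) simp_all
    qed
    then have "N dvd (q * q) * (s * s)" by (rule dvd_mult2)
    then have uu: "N dvd u * u" unfolding u by (simp only: mult_ac)
    have pow: "N dvd (1 + u) ^ n - (1 + int n * u)" for n
    proof (induction n)
      case (Suc n)
      have "(1 + u) ^ Suc n - (1 + int (Suc n) * u) = (1 + u) * ((1 + u) ^ n - (1 + int n * u)) + int n * (u * u)"
        by (simp add: algebra_simps)
      then show ?case using Suc.IH uu by simp
    qed simp
    have "c (x + q) = c k" if x: "c x = c k" for x
    proof -
      have "\<not> p dvd x" using coprime_pD[OF units[OF x]] .
      then have "\<not> p dvd s * x" using less.prems(2) p by (simp add: prime_dvd_mult_iff)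
      then have "coprime (s * x) p" using p by (metis coprime_commute prime_imp_coprime)
      then have "gcd (s * x) p dvd 1" by simp
      then obtain n0 where n0: "p dvd n0 * (s * x) - 1" using solve_cong by blast
      \<comment> \<open>The exponent inverts \<open>s * x\<close> modulo \<open>p\<close>, so that
        \<open>(1 + q * s) ^ n * x = x + q\<close> modulo \<open>N\<close>.\<close>
      define n where "n = nat (n0 mod p)"
      have n: "int n = n0 mod p" unfolding n_def using p1 by simp
      have "p dvd int n - n0" unfolding n using mod_eq_dvd_iff[of "n0 mod p" p n0] by simp
      then have "p dvd (int n - n0) * (s * x) + (n0 * (s * x) - 1)" using n0 by (metis dvd_add dvd_mult2)
      then have "p dvd int n * (s * x) - 1" by (simp add: algebra_simps)
      then have "N dvd (int n * (s * x) - 1) * q" using N_dvd_jq by blast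
      moreover have "N dvd ((1 + u) ^ n - (1 + int n * u)) * x" using pow by simp
      moreover have "(1 + u) ^ n * x - (x + q) = ((1 + u) ^ n - (1 + int n * u)) * x + (int n * (s * x) - 1) * q"
        unfolding u by (simp add: algebra_simps)
      ultimately have "N dvd (1 + u) ^ n * x - (x + q)" by simp
      moreover have "stab ((1 + u) ^ n)" by (rule stab_pow) (use less.prems(1) in \<open>simp add: u_def\<close>)
      ultimately show ?thesis using x spair_eq[OF S] unfolding stab_def by metis
    qed
    then have "N dvd q" by (rule no_period)
    then show False using not_N_dvd_q by simp
  next
    case False
    have pu: "p dvd u" "p = 2 \<Longrightarrow> 4 dvd u"
    proof -
      have "p dvd p ^ f" using less.prems(3) by simp
      then show "p dvd u" unfolding u_def by simp
      assume "p = 2"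
      then have "(2::int) ^ 2 dvd 2 ^ f" using less.prems(4) by (intro le_imp_power_dvd) simp
      then show "4 dvd u" unfolding u_def \<open>p = 2\<close> by simp
    qed
    have pn: "Factorial_Ring.prime (nat p)" "int (nat p) = p"
      using iffD1[OF prime_int_nat_transfer p] p1 by linarith+
    have "nat p = 2 \<Longrightarrow> 4 dvd u" using pu(2) pn(2) by simp
    then obtain w where w: "(1 + u) ^ nat p = 1 + p * u + p * (p * u * w)"
      using binomial_prime_power[OF pn(1), of u] pu(1) unfolding pn(2) by blast
    have eq: "(1 + u) ^ nat p = 1 + M * p ^ Suc f * (s * (1 + p * w))"
      by (subst w) (simp add: u_def algebra_simps)
    have "\<not> p dvd s * (1 + p * w)"
    proof
      assume "p dvd s * (1 + p * w)"
      then have "p dvd 1 + p * w" using less.prems(2) p by (simp add: prime_dvd_mult_iff)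
      then have "p dvd (1 + p * w) - p * w" by (rule dvd_diff) simp
      then show False using p1 by simp
    qed
    moreover have "stab (1 + M * p ^ Suc f * (s * (1 + p * w)))"
      unfolding eq[symmetric] by (rule stab_pow) (use less.prems(1) in \<open>simp add: u_def\<close>)
    moreover have "e - Suc f < e - f" "Suc f < e" using less.prems(5) False by linarith+
    moreover have "1 \<le> Suc f" "p = 2 \<Longrightarrow> 2 \<le> Suc f" using less.prems(3) by simp_all
    ultimately show False
      using less.hyps[of "Suc f" "s * (1 + p * w)"] by blast
  qed
qed

text \<open>A nontrivial stabilizing multiplier close to \<open>1\<close> would produce a period of the class.\<close>
lemma stab_near_one:
  assumes pr: "pring N c p P M q" and a: "stab a" "M dvd a - 1" "p dvd a - 1" "p = 2 \<Longrightarrow> 4 dvd a - 1"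
  shows "N dvd a - 1"
proof (rule ccontr)
  assume n: "\<not> N dvd a - 1"
  interpret pring N c p P M q by (rule pr)
  obtain e where e: "P = p ^ e" using Pp by blast
  have a0: "a - 1 \<noteq> 0" using n by auto
  obtain s0 where s0: "a - 1 = p ^ multiplicity p (a - 1) * s0" "\<not> p dvd s0"
    using multiplicity_decompose'[OF a0, of p] p by (metis not_prime_unit)
  define f where "f = multiplicity p (a - 1)"
  have sf: "a - 1 = p ^ f * s0" using s0(1) unfolding f_def .
  have "coprime M (p ^ f)" using pM by (simp add: coprime_commute)
  moreover have "M dvd p ^ f * s0" using a(2) unfolding sf .
  ultimately have "M dvd s0" by (simp add: coprime_dvd_mult_right_iff)
  then obtain s where s: "s0 = M * s" by blast
  have "a - 1 = M * p ^ f * s" unfolding sf s by (simp add: mult_ac)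
  then have eq: "a = 1 + M * p ^ f * s" by simp
  have ps: "\<not> p dvd s" using s0(2) unfolding s by (metis dvd_mult)
  have pj: "j \<le> f" if "p ^ j dvd a - 1" for j
    unfolding f_def using that a0 p by (intro multiplicity_geI) (auto)
  have "f < e"
  proof (rule ccontr)
    assume "\<not> f < e"
    then have "p ^ e dvd p ^ f" by (intro le_imp_power_dvd) simp
    then have "P dvd a - 1" unfolding e eq by simp
    then show False using n a(2) N_dvd_iff by blast
  qed
  moreover have "1 \<le> f" using pj[of 1] a(3) by simp
  moreover have "2 \<le> f" if "p = 2" using pj[of 2] a(4)[OF that] that by simp
  ultimately show False using stab_near_one_exact[OF pr e, of f s] a(1) ps unfolding eq[symmetric] by blast
qed

end

context regular begin

text \<open>No point \<open>p ^ j * y\<close> keeps its whole coset of order \<open>p\<close> inside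
  the set, so \<open>frob\<close> multiplies the entire set by \<open>p\<close>. Otherwise two
  points differing by \<open>q\<close> would give a nontrivial stabilizing multiplier close to
  \<open>1\<close>; in the top case \<open>Suc j = e\<close> the coset contains a point with trivial
  \<open>p\<close>-part, which the set does not.\<close>

lemma frob_dil:
  assumes pr: "pring N c p P M q" and P: "P = p ^ e" and j: "j < e" "p = 2 \<Longrightarrow> Suc j = e \<or> j + 3 \<le> e"
  shows "frob N p (dil N (p ^ j) (cl c k)) = dil N (p ^ Suc j) (cl c k)"
proof -
  interpret pring N c p P M q by (rule pr)
  define Q where "Q = cl c k"
  have Qu: "coprime y N" if "y \<in> Q" for y using units[of y] that unfolding Q_def by simp
  have leave: "\<exists>i. p ^ j * y + i * q \<notin> dil N (p ^ j) Q" if y: "y \<in> Q" for y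
  proof (cases "Suc j = e")
    case True
    have "gcd M p = 1" using pM by (simp add: coprime_iff_gcd_eq_1 gcd.commute)
    then have "gcd M p dvd - y" by simp
    then obtain i where i: "p dvd i * M - (- y)" using solve_cong by blast
    have "p ^ j * y + i * q = p ^ j * (i * M - (- y))"
    proof -
      have "P div p = p ^ j" unfolding P True[symmetric] using p1 by simp
      then show ?thesis unfolding qPM by (simp add: algebra_simps)
    qed
    then have Pz: "P dvd p ^ j * y + i * q" unfolding P True[symmetric] using i by simp
    have "p ^ j * y + i * q \<notin> dil N (p ^ j) Q"
    proof
      assume "p ^ j * y + i * q \<in> dil N (p ^ j) Q"
      then obtain z where z: "z \<in> Q" "N dvd (p ^ j * y + i * q) - p ^ j * z" unfolding dil_def by blast
      have "P dvd (p ^ j * y + i * q) - p ^ j * z" using z(2) PN dvd_trans by blast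
      then have "P dvd (p ^ j * y + i * q) - ((p ^ j * y + i * q) - p ^ j * z)" by (rule dvd_diff[OF Pz])
      then have "p ^ j * p dvd p ^ j * z" unfolding P True[symmetric] by (simp add: mult.commute)
      then have "p dvd z" using p1 by simp
      then show False using coprime_pD[OF Qu[OF z(1)]] by simp
    qed
    then show ?thesis by blast
  next
    case False
    have "p ^ j * y + 1 * q \<notin> dil N (p ^ j) Q"
    proof
      assume "p ^ j * y + 1 * q \<in> dil N (p ^ j) Q"
      then obtain z where z: "z \<in> Q" "N dvd (p ^ j * y + 1 * q) - p ^ j * z" unfolding dil_def by blast
      obtain a where a: "stab a" "N dvd a * y - z" using stab_quotient[of y z] y z(1) unfolding Q_def by auto
      have "p ^ j * ((a - 1) * y) - q = p ^ j * (a * y - z) - ((p ^ j * y + 1 * q) - p ^ j * z)" by (simp add: algebra_simps)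
      moreover have "N dvd p ^ j * (a * y - z) - ((p ^ j * y + 1 * q) - p ^ j * z)" by (rule dvd_diff[OF dvd_mult[OF a(2)] z(2)])
      ultimately have eq: "N dvd p ^ j * ((a - 1) * y) - q" by metis
      have cy: "coprime y N" by (rule Qu[OF y])
      have "M dvd p ^ j * ((a - 1) * y) - q" using eq MN dvd_trans by blast
      then have "M dvd p ^ j * ((a - 1) * y)" using Mq dvd_diffD1 dvd_diff_right_iff by (metis dvd_add_right_iff diff_add_cancel)
      moreover have "coprime M (p ^ j)" using pM by (simp add: coprime_commute)
      moreover have "coprime M y" using cy unfolding NPM by (simp add: coprime_commute)
      ultimately have Ma: "M dvd a - 1" by (simp add: coprime_dvd_mult_right_iff coprime_dvd_mult_left_iff)
      \<comment> \<open>The multiplier \<open>a\<close> is \<open>1\<close> modulo \<open>M\<close>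
        and modulo \<open>p ^ l\<close>. For \<open>p = 2\<close> closeness to \<open>1\<close>
        requires \<open>l\<close> of at least \<open>2\<close>, which is the bound
        \<open>j + 3 \<le> e\<close>.\<close>
      define l where "l = e - Suc j"
      have e: "e = j + Suc (e - Suc (Suc j)) + 1" "l = Suc (e - Suc (Suc j))" using j False unfolding l_def by auto
      have Pl: "P = p ^ j * (p ^ l * p)" "P div p = p ^ j * p ^ l"
      proof -
        have "e = Suc (j + l)" using e by simp
        then have "P = p * (p ^ j * p ^ l)" unfolding P by (simp add: power_add)
        then show "P = p ^ j * (p ^ l * p)" "P div p = p ^ j * p ^ l" using p1 by (simp_all add: mult_ac)
      qed
      have "P dvd p ^ j * ((a - 1) * y) - q" using eq PN dvd_trans by blast
      then have "p ^ j * (p ^ l * p) dvd p ^ j * ((a - 1) * y - p ^ l * M)"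
        unfolding Pl(1)[symmetric] qPM Pl(2) by (simp add: algebra_simps)
      then have "p ^ l * p dvd (a - 1) * y - p ^ l * M" using p1 by simp
      then have "p ^ l dvd (a - 1) * y - p ^ l * M" by (rule dvd_mult_left)
      then have "p ^ l dvd ((a - 1) * y - p ^ l * M) + p ^ l * M" by (intro dvd_add) simp_all
      moreover have "coprime (p ^ l) y"
      proof -
        have "coprime p y" using coprime_pD[OF cy] p by (rule prime_imp_coprime[rotated])
        then show ?thesis by simp
      qed
      ultimately have pl: "p ^ l dvd a - 1" by (simp add: coprime_dvd_mult_left_iff)
      have "p dvd a - 1" using pl e(2) by (metis dvd_mult_left power_Suc)
      moreover have "4 dvd a - 1" if "p = 2"
      proof -
        have "2 \<le> l" using j(2)[OF that] False unfolding l_def by auto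
        then have "p ^ 2 dvd p ^ l" by (rule le_imp_power_dvd)
        then have "p ^ 2 dvd a - 1" using pl dvd_trans by blast
        then show ?thesis using that by simp
      qed
      ultimately have "N dvd a - 1" using stab_near_one[OF pr a(1) Ma] by blast
      then have "N dvd p ^ j * ((a - 1) * y)" by simp
      then have "N dvd p ^ j * ((a - 1) * y) - (p ^ j * ((a - 1) * y) - q)" using eq by (rule dvd_diff)
      then show False using not_N_dvd_q by simp
    qed
    then show ?thesis by blast
  qed
  show ?thesis unfolding Q_def[symmetric]
  proof (rule equalityI; rule subsetI)
    fix h assume "h \<in> frob N p (dil N (p ^ j) Q)"
    then obtain x y where x: "N dvd h - p * x" "y \<in> Q" "N dvd x - p ^ j * y" unfolding frob_def dil_def by blast
    have "h - p ^ Suc j * y = (h - p * x) + p * (x - p ^ j * y)" by (simp add: algebra_simps)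
    moreover have "N dvd (h - p * x) + p * (x - p ^ j * y)" using x by (intro dvd_add dvd_mult)
    ultimately have "N dvd h - p ^ Suc j * y" by metis
    then show "h \<in> dil N (p ^ Suc j) Q" using x(2) unfolding dil_def by blast
  next
    fix h assume "h \<in> dil N (p ^ Suc j) Q"
    then obtain y where y: "y \<in> Q" "N dvd h - p ^ Suc j * y" unfolding dil_def by blast
    have "N dvd p ^ j * y - p ^ j * y" by simp
    then have "p ^ j * y \<in> dil N (p ^ j) Q" using y(1) unfolding dil_def by blast
    moreover have "N dvd h - p * (p ^ j * y)" using y(2) by (simp add: mult.assoc)
    ultimately show "h \<in> frob N p (dil N (p ^ j) Q)" using leave[OF y(1)] unfolding frob_def qdiv by blast
  qed
qed

lemma dil_1: assumes "pset N D" shows "dil N 1 D = D"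
proof (rule equalityI; rule subsetI)
  fix g assume "g \<in> dil N 1 D"
  then obtain x where "x \<in> D" "N dvd g - x" unfolding dil_def by auto
  then show "g \<in> D" using periodicD[OF assms] by blast
next
  fix g assume "g \<in> D"
  moreover have "N dvd g - 1 * g" by simp
  ultimately show "g \<in> dil N 1 D" unfolding dil_def by blast
qed

lemma xset_dil_power:
  assumes pr: "pring N c p P M q" and P: "P = p ^ e" and j: "j \<le> e" "p = 2 \<Longrightarrow> e = 1 \<or> j + 2 \<le> e"
  shows "xset c (dil N (p ^ j) (cl c k))"
  using j
proof (induction j)
  case 0
  then show ?case using dil_1[OF xs_per[OF S xset_cl]] xset_cl by simp
next
  case (Suc j)
  interpret pring N c p P M q by (rule pr)
  have "xset c (dil N (p ^ j) (cl c k))" by (rule Suc.IH) (use Suc.prems in auto)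
  then have "xset c (frob N p (dil N (p ^ j) (cl c k)))" by (rule xs_frob[OF S _ p pN])
  moreover have "frob N p (dil N (p ^ j) (cl c k)) = dil N (p ^ Suc j) (cl c k)"
    by (rule frob_dil[OF pr P]) (use Suc.prems in auto)
  ultimately show ?case by simp
qed

lemma xdiv_from_dil:
  assumes t: "0 < t" "t dvd N" and D: "xset c D" "\<And>x. x \<in> D \<Longrightarrow> t dvd x" and x: "t * a \<in> D" "coprime a N"
  shows "xdiv N c t"
proof -
  have "t dvd gn N D" by (rule gn_greatest[OF t(2) D(2)])
  moreover have "gn N D dvd t"
  proof -
    have "gn N D dvd t * a" by (rule gn_dvd(2)[OF x(1)])
    moreover have "coprime (gn N D) a" using x(2) gn_dvd(1)[of N D] by (meson coprime_commute coprime_divisors dvd_refl)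
    ultimately show ?thesis by (simp add: coprime_dvd_mult_left_iff)
  qed
  ultimately have "gn N D = t" using pos_dvd_antisym[OF gn_pos[OF N0] t(1)] by blast
  then show ?thesis using xdiv_gn[OF S D(1)] by simp
qed

lemma k_unit: "coprime k N" by (rule units) simp

lemma xdiv_power:
  assumes pr: "pring N c p P M q" and P: "P = p ^ e" and j: "j \<le> e" "p = 2 \<Longrightarrow> e = 1 \<or> j + 2 \<le> e"
  shows "xdiv N c (p ^ j)"
proof (rule xdiv_from_dil[OF _ _ xset_dil_power[OF pr P j]])
  interpret pring N c p P M q by (rule pr)
  show "0 < p ^ j" using p1 by simp
  have "p ^ j dvd p ^ e" using j(1) by (rule le_imp_power_dvd)
  then show pjN: "p ^ j dvd N" unfolding P[symmetric] using PN dvd_trans by blast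
  show "p ^ j dvd x" if x: "x \<in> dil N (p ^ j) (cl c k)" for x
  proof -
    obtain y where "N dvd x - p ^ j * y" using x unfolding dil_def by blast
    then have "p ^ j dvd (x - p ^ j * y) + p ^ j * y" using pjN dvd_trans by (intro dvd_add) auto
    then show ?thesis by simp
  qed
  have "N dvd p ^ j * k - p ^ j * k" "k \<in> cl c k" by simp_all
  then show "p ^ j * k \<in> dil N (p ^ j) (cl c k)" unfolding dil_def by blast
  show "coprime k N" by (rule k_unit)
qed

text \<open>Dilations reach only \<open>2 ^ (e - 2)\<close>. The sum of that dilation with itself
  consists of multiples of \<open>2 ^ (e - 1)\<close>, because a sum of two odd numbers is even, and
  it contains \<open>2 ^ (e - 1) * k\<close>.\<close>

lemma xdiv_two_power:
  assumes pr: "pring N c 2 P M q" and P: "P = 2 ^ e" and e: "2 \<le> e"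
  shows "xdiv N c (2 ^ (e - 1))"
proof -
  interpret pring N c 2 P M q by (rule pr)
  define D where "D = dil N (2 ^ (e - 2)) (cl c k)"
  have xD: "xset c D" unfolding D_def by (rule xset_dil_power[OF pr P]) (use e in auto)
  have e2: "(2::int) ^ (e - 1) = 2 ^ (e - 2) * 2" using e by (metis Suc_diff_Suc Suc_1 Suc_le_lessD diff_Suc_1 power_Suc2 numeral_2_eq_2)
  have tN: "(2::int) ^ (e - 1) dvd N"
  proof -
    have "(2::int) ^ (e - 1) dvd 2 ^ e" by (rule le_imp_power_dvd) simp
    then show ?thesis unfolding P[symmetric] using PN dvd_trans by blast
  qed
  show ?thesis
  proof (rule xdiv_from_dil[OF _ tN xs_splus[OF S xD xD]])
    fix x assume "x \<in> splus D D"
    then obtain a b where ab: "x = a + b" "a \<in> D" "b \<in> D" unfolding splus_def by blast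
    obtain y where y: "c y = c k" "N dvd a - 2 ^ (e - 2) * y" using ab(2) unfolding D_def dil_def by auto
    obtain z where z: "c z = c k" "N dvd b - 2 ^ (e - 2) * z" using ab(3) unfolding D_def dil_def by auto
    have "\<not> 2 dvd y" "\<not> 2 dvd z" using coprime_pD units y(1) z(1) by blast+
    then have "2 dvd y + z" by simp
    then have "2 ^ (e - 1) dvd 2 ^ (e - 2) * (y + z)" unfolding e2 by (rule mult_dvd_mono[OF dvd_refl])
    moreover have "2 ^ (e - 1) dvd (a - 2 ^ (e - 2) * y) + (b - 2 ^ (e - 2) * z)"
      by (rule dvd_add[OF dvd_trans[OF tN y(2)] dvd_trans[OF tN z(2)]])
    ultimately have "2 ^ (e - 1) dvd ((a - 2 ^ (e - 2) * y) + (b - 2 ^ (e - 2) * z)) + 2 ^ (e - 2) * (y + z)" by (rule dvd_add[rotated])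
    then show "2 ^ (e - 1) dvd x" unfolding ab(1) by (simp add: algebra_simps)
  next
    have "N dvd 2 ^ (e - 2) * k - 2 ^ (e - 2) * k" "k \<in> cl c k" by simp_all
    then have "2 ^ (e - 2) * k \<in> D" unfolding D_def dil_def by blast
    then have "2 ^ (e - 2) * k + 2 ^ (e - 2) * k \<in> splus D D" unfolding splus_def by blast
    moreover have "2 ^ (e - 2) * k + 2 ^ (e - 2) * k = 2 ^ (e - 1) * k" unfolding e2 by simp
    ultimately show "2 ^ (e - 1) * k \<in> splus D D" by simp
    show "coprime k N" by (rule k_unit)
  qed simp
qed

end

lemma int_power_dvd_imp_le: assumes "p ^ m dvd p ^ n" "1 < (p::int)" shows "m \<le> n"
proof -
  have "p ^ m \<le> p ^ n" using zdvd_imp_le[OF assms(1)] assms(2) by simp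
  then show ?thesis using assms(2) by simp
qed

lemma two_is_prime_int: "Factorial_Ring.prime (2::int)" by simp

lemma (in pring) power_dvd_N: assumes "P = p ^ e" "p ^ j dvd N" shows "j \<le> e"
proof -
  have "coprime (p ^ j) M" using pM by simp
  then have "p ^ j dvd p ^ e" using assms unfolding NPM by (simp add: coprime_dvd_mult_left_iff)
  then show ?thesis by (rule int_power_dvd_imp_le[OF _ p1])
qed

context regular begin

lemma xdiv_half:
  assumes pr: "pring N c 2 P M q" and P4: "4 dvd P" and d: "0 < d" "d dvd q"
  shows "xdiv N c d"
proof -
  interpret t: pring N c 2 P M q by (rule pr)
  have qN: "q dvd N" using t.Npq by simp
  show ?thesis
  proof (rule xdiv_by_prime_powers[OF S d(1) dvd_trans[OF d(2) qN]])
    fix p j assume p: "Factorial_Ring.prime p" "p ^ j dvd d"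
    have pq: "p ^ j dvd q" using p(2) d(2) dvd_trans by blast
    show "xdiv N c (p ^ j)"
    proof (cases "p = 2")
      case True
      obtain e where e: "P = 2 ^ e" using t.Pp by blast
      have "(2::int) * 2 ^ j dvd 2 * q" using pq True by simp
      then have "2 ^ Suc j dvd N" unfolding t.Npq by simp
      then have je: "Suc j \<le> e" by (rule t.power_dvd_N[OF e])
      have "(2::int) ^ 2 dvd 2 ^ e" using P4 unfolding e by simp
      then have e2: "2 \<le> e" by (rule int_power_dvd_imp_le) simp
      show ?thesis
      proof (cases "j + 2 \<le> e")
        case True
        then show ?thesis unfolding \<open>p = 2\<close> by (intro xdiv_power[OF pr e]) auto
      next
        case False
        then have "j = e - 1" using je by simp
        then show ?thesis unfolding \<open>p = 2\<close> using xdiv_two_power[OF pr e e2] by simp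
      qed
    next
      case False
      show ?thesis
      proof (cases "j = 0")
        case True
        then show ?thesis using xdiv_1[OF S] by simp
      next
        case False
        then have "p dvd p ^ j" by simp
        then have "p dvd N" using pq qN dvd_trans by blast
        then obtain P' M' q' where pr': "pring N c p P' M' q'" using ex_pring[OF S p(1)] by blast
        then interpret r: pring N c p P' M' q' .
        obtain e where e: "P' = p ^ e" using r.Pp by blast
        have "p ^ j dvd N" using pq qN dvd_trans by blast
        then have "j \<le> e" by (rule r.power_dvd_N[OF e])
        then show ?thesis by (rule xdiv_power[OF pr' e]) (use \<open>p \<noteq> 2\<close> in simp)
      qed
    qed
  qed
qed

text \<open>For even \<open>N\<close> the Sylow subgroups of odd order are unions of classes. Otherwise the classes near
  such a subgroup are invariant under the involution \<open>q\<close>, and comparing coefficients of products of \<open>Q\<close>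
  produces a multiplier that gives \<open>Q\<close> the period \<open>q\<close>.\<close>
lemma xdiv_sylow:
  assumes pr: "pring N c 2 P M q" and P4: "4 dvd P" and prr: "pring N c r R L s" and r2: "r \<noteq> 2"
  shows "xdiv N c L"
proof (rule ccontr)
  assume nL: "\<not> xdiv N c L"
  interpret t: pring N c 2 P M q by (rule pr)
  interpret o: pring N c r R L s by (rule prr)
  define Q where "Q = cl c k"
  have xQ: "xset c Q" unfolding Q_def by (rule xset_cl)
  have pQ: "pset N Q" by (rule xs_per[OF S xQ])
  have Qu: "coprime y N" if "y \<in> Q" for y using units[of y] that unfolding Q_def by simp
  have stabQ: "a * y \<in> Q" if "stab a" "y \<in> Q" for a y using that unfolding stab_def Q_def by simp
  obtain f where f: "R = r ^ f" using o.Pp by blast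
  have oddR: "odd R"
  proof -
    have "odd r" using o.p r2 by (metis primes_dvd_imp_eq two_is_prime_int)
    then show ?thesis unfolding f by simp
  qed
  have evL: "2 dvd L"
  proof -
    have "2 dvd R * L" using t.pN o.NPM by simp
    then show ?thesis using oddR by simp
  qed
  define h where "h = L div 2"
  have Lh: "L = 2 * h" using evL by (simp add: h_def)
  have h0: "0 < h" using o.M0 Lh by simp
  have qh: "q = R * h"
  proof -
    have "2 * q = 2 * (R * h)" using t.Npq o.NPM Lh by simp
    then show ?thesis by simp
  qed
  have oddQ: "odd y" if "y \<in> Q" for y using t.coprime_pD[OF Qu[OF that]] .
  have qN: "N dvd z * q - q" if "odd z" for z
  proof -
    have "2 dvd z - 1" using that by simp
    then have "2 * q dvd (z - 1) * q" by (rule mult_dvd_mono) simp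
    then show ?thesis using t.Npq by (simp add: algebra_simps)
  qed
  have Ls2: "L dvd N" using o.MN .
  \<comment> \<open>The least element \<open>g\<close> gives the largest subgroup of the Sylow
    subgroup \<open>mult L\<close> that is a union of classes. It is \<open>L * m\<close> with
    \<open>m\<close> a power of \<open>r\<close>, and \<open>m\<close> is not \<open>1\<close> if
    the claim fails.\<close>
  define K where "K = {g. xdiv N c g \<and> L dvd g}"
  have finK: "finite K" by (rule finite_subset[of _ "{r. r dvd N}"]) (use N0 in \<open>auto simp: K_def xdiv_def intro!: finite_divisors_int\<close>)
  have "N \<in> K" using xdiv_N[OF S] Ls2 by (simp add: K_def)
  then have mK: "Min K \<in> K" "\<And>g. g \<in> K \<Longrightarrow> Min K \<le> g" using finK Min_in Min_le by blast+
  define g where "g = Min K"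
  have g: "xdiv N c g" "L dvd g" using mK(1) unfolding g_def K_def by blast+
  have g0: "0 < g" by (rule xdiv_pos[OF g(1)])
  have gmin: "g dvd d" if d: "xdiv N c d" "L dvd d" for d
  proof -
    have "gcd g d \<in> K" using xdiv_gcd[OF S g(1) d(1)] g(2) d(2) by (simp add: K_def)
    then have "g \<le> gcd g d" using mK(2) unfolding g_def by blast
    moreover have "gcd g d \<le> g" by (rule zdvd_imp_le[OF gcd_dvd1 g0])
    ultimately have "gcd g d = g" by simp
    then show ?thesis by (metis gcd_dvd2)
  qed
  obtain m where m: "g = L * m" using g(2) by blast
  have mR: "m dvd R"
  proof -
    have "L * m dvd L * R" using xdiv_dvd[OF g(1)] o.NPM unfolding m by (simp add: mult.commute)
    then show ?thesis using o.M0 by simp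
  qed
  have m0: "0 < m" using g0 o.M0 unfolding m by (simp add: zero_less_mult_iff)
  have rm: "r dvd m"
  proof (rule ccontr)
    assume "\<not> r dvd m"
    then have "coprime r m" using o.p by (rule prime_imp_coprime[rotated])
    then have "coprime R m" unfolding f by simp
    then have "is_unit m" using mR by (meson coprime_absorb_right)
    then have "m = 1" using m0 by simp
    then show False using g(1) nL m by simp
  qed
  have oddm: "odd m" using mR oddR dvd_trans by blast
  have gh: "g = 2 * (h * m)" unfolding m Lh by simp
  have xh: "xdiv N c h" by (rule xdiv_half[OF pr P4 h0]) (simp add: qh)
  have xhm: "xdiv N c (h * m)" by (rule xdiv_half[OF pr P4]) (use h0 m0 mR in \<open>simp_all add: qh mult.commute mult_dvd_mono\<close>)
  \<comment> \<open>All of \<open>frob N 2 C\<close> lies in \<open>mult L\<close> and hence, by the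
    choice of \<open>g\<close>, in \<open>mult g\<close>. That would make \<open>h * m\<close>
    divide elements of the class of \<open>w\<close>. So \<open>frob N 2 C\<close> is empty, which
    means that \<open>C\<close> is invariant under the involution \<open>q\<close>.\<close>
  have inv: "c (w + q) = c w" if w: "h dvd w" "\<not> h * m dvd w" for w
  proof -
    define C where "C = cl c w"
    have xC: "xset c C" unfolding C_def by (rule xset_cl)
    have xF: "xset c (frob N 2 C)" by (rule xs_frob[OF S xC t.p t.pN])
    have "frob N 2 C = {}"
    proof (rule ccontr)
      assume "frob N 2 C \<noteq> {}"
      then obtain z x where z: "z \<in> frob N 2 C" "x \<in> C" "N dvd z - 2 * x" unfolding frob_def by blast
      have Lz: "L dvd z" if zF: "z \<in> frob N 2 C" for z
      proof -
        obtain x where x: "x \<in> C" "N dvd z - 2 * x" using zF unfolding frob_def by blast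
        have cx: "c x = c w" using x(1) unfolding C_def by simp
        have "h dvd x" using xdiv_iff[OF S xh cx] w(1) by simp
        then have "L dvd 2 * x" unfolding Lh by simp
        then have "L dvd (z - 2 * x) + 2 * x" using dvd_trans[OF Ls2 x(2)] by (intro dvd_add)
        then show ?thesis by simp
      qed
      have "L dvd gn N (frob N 2 C)" by (rule gn_greatest[OF Ls2 Lz])
      then have "g dvd gn N (frob N 2 C)" by (rule gmin[OF xdiv_gn[OF S xF]])
      then have "g dvd z" using gn_dvd(2)[OF z(1)] dvd_trans by blast
      moreover have "g dvd z - 2 * x" using xdiv_dvd[OF g(1)] z(3) by (rule dvd_trans)
      ultimately have "g dvd z - (z - 2 * x)" by (rule dvd_diff)
      then have "h * m dvd x" unfolding gh by simp
      moreover have cx: "c x = c w" using z(2) unfolding C_def by simp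
      ultimately show False using xdiv_iff[OF S xhm cx] w(2) by simp
    qed
    moreover have "2 * w \<in> frob N 2 C" if "w + 1 * q \<notin> C"
    proof -
      have "w \<in> C" unfolding C_def by simp
      moreover have "w + 1 * (N div 2) \<notin> C" using that t.qdiv by simp
      moreover have "N dvd 2 * w - 2 * w" by simp
      ultimately show ?thesis unfolding frob_def by blast
    qed
    ultimately have "w + 1 * q \<in> C" by blast
    then show ?thesis unfolding C_def by simp
  qed
  obtain i where i: "m = r ^ i"
  proof -
    obtain i where "i \<le> f" "normalize m = r ^ i"
      using divides_primepow[OF o.p, of m f] mR f o.p
      by (metis normalize_idem_imp_unit_factor_eq prime_imp_prime_elem divides_primepow_weak)
    then show ?thesis using that m0 by simp
  qed
  have iN: "i \<le> f"
  proof (rule int_power_dvd_imp_le)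
    show "r ^ i dvd r ^ f" using mR unfolding i f .
    show "1 < r" by (rule o.p1)
  qed
  have "\<exists>rho. stab rho \<and> (\<forall>y\<in>Q. L dvd rho * y - (y + q))"
  proof -
    have "coprime (r ^ i) L" using o.pM by simp
    then have "gcd (r ^ i) L dvd 1" by simp
    then obtain v0 where v0: "L dvd v0 * r ^ i - 1" using solve_cong by blast
    obtain v where v: "R dvd v - 1" "L dvd v - v0" using crt_int[OF o.cop] by blast
    have vi: "L dvd v * r ^ i - 1"
    proof -
      have "v * r ^ i - 1 = (v - v0) * r ^ i + (v0 * r ^ i - 1)" by (simp add: algebra_simps)
      then show ?thesis using dvd_add[OF dvd_mult2[OF v(2)] v0] by metis
    qed
    have cv: "coprime v N"
    proof -
      have "coprime v R" by (rule coprime_cong[OF v(1)]) simp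
      moreover have "coprime (v * r ^ i) L" by (rule coprime_cong[OF vi]) simp
      ultimately show ?thesis unfolding o.NPM by simp
    qed
    define D0 where "D0 = dil N v (dil N (r ^ i) Q)"
    have xD0: "xset c D0" unfolding D0_def Q_def
      by (rule o.xs_dil[OF xset_dil_power[OF prr f iN] cv]) (use r2 in simp)
    have xs: "xset c (splus Q (uminus ` D0))" by (rule xs_splus[OF S xQ xs_neg[OF S xD0]])
    \<comment> \<open>As \<open>v * r ^ i\<close> is \<open>1\<close> modulo \<open>L\<close>, this
      difference of an element of \<open>Q\<close> and one of \<open>D0\<close> lies in
      \<open>mult L\<close>, but not in \<open>mult (h * m)\<close>, because \<open>r\<close>
      divides only one of the two terms. Its class is invariant under \<open>q\<close>, so
      \<open>w + q\<close> is such a difference as well, and this yields two elements of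
      \<open>Q\<close> that differ by \<open>q\<close> modulo \<open>L\<close>.\<close>
    define w where "w = k - v * (r ^ i * k)"
    have kQ: "k \<in> Q" unfolding Q_def by simp
    have "N dvd r ^ i * k - r ^ i * k" "N dvd v * (r ^ i * k) - v * (r ^ i * k)" by simp_all
    then have "v * (r ^ i * k) \<in> D0" unfolding D0_def dil_def using kQ by blast
    then have "- (v * (r ^ i * k)) \<in> uminus ` D0" by blast
    moreover have "w = k + - (v * (r ^ i * k))" unfolding w_def by simp
    ultimately have wS: "w \<in> splus Q (uminus ` D0)" unfolding splus_def using kQ by blast
    have "w = - ((v * r ^ i - 1) * k)" unfolding w_def by (simp add: algebra_simps)
    then have Lw: "L dvd w" using vi by simp
    have "\<not> h * m dvd w"
    proof
      assume "h * m dvd w"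
      then have "m dvd w" by (rule dvd_mult_right)
      then have "r dvd w" using rm dvd_trans by blast
      moreover have "r dvd v * (r ^ i * k)"
      proof -
        have "r dvd r ^ i" using rm unfolding i .
        then show ?thesis by simp
      qed
      ultimately have "r dvd w + v * (r ^ i * k)" by (rule dvd_add)
      then have "r dvd k" unfolding w_def by simp
      then show False using o.coprime_pD[OF k_unit] by simp
    qed
    moreover have "h dvd w" using Lw Lh by (metis dvd_mult_right)
    ultimately have "c (w + q) = c w" using inv by blast
    then have "w + q \<in> splus Q (uminus ` D0)" using xsD[OF xs, of "w + q" w] wS by blast
    then obtain x d where x: "w + q = x + d" "x \<in> Q" "- d \<in> D0" unfolding splus_def uminus_image_iff by blast
    obtain z' z where z: "z \<in> Q" "N dvd z' - r ^ i * z" "N dvd - d - v * z'" using x(3) unfolding D0_def dil_def by blast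
    have Lx: "L dvd x - (z + q)"
    proof -
      have "x - (z + q) = w + (- d - v * z') + v * (z' - r ^ i * z) + (v * r ^ i - 1) * z"
        using x(1) by (simp add: algebra_simps)
      moreover have "L dvd w + (- d - v * z') + v * (z' - r ^ i * z) + (v * r ^ i - 1) * z"
        by (intro dvd_add dvd_mult dvd_mult2 Lw vi dvd_trans[OF Ls2 z(3)] dvd_trans[OF Ls2 z(2)])
      ultimately show ?thesis by metis
    qed
    obtain rho where rho: "stab rho" "N dvd rho * z - x" using stab_quotient[of z x] z(1) x(2) unfolding Q_def by auto
    have "L dvd rho * y - (y + q)" if y: "y \<in> Q" for y
    proof -
      obtain a where a: "stab a" "N dvd a * z - y" using stab_quotient[of z y] z(1) y unfolding Q_def by auto
      have "odd a" using a(1) t.coprime_pD unfolding stab_def by blast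
      have "rho * y - (y + q) = (1 - rho) * (a * z - y) + a * (rho * z - x) + a * (x - (z + q)) + (a * q - q)" by (simp add: algebra_simps)
      moreover have "L dvd (1 - rho) * (a * z - y) + a * (rho * z - x) + a * (x - (z + q)) + (a * q - q)"
        by (intro dvd_add dvd_mult Lx dvd_trans[OF Ls2 a(2)] dvd_trans[OF Ls2 rho(2)] dvd_trans[OF Ls2 qN[OF \<open>odd a\<close>]])
      ultimately show ?thesis by metis
    qed
    then show ?thesis using rho(1) by blast
  qed
  then obtain rho where rho: "stab rho" "\<And>y. y \<in> Q \<Longrightarrow> L dvd rho * y - (y + q)" by blast
  define n where "n w = cnt N {x. x \<in> Q \<and> x + w \<in> Q}" for w
  have ncompat: "n w = n w'" if "c w = c w'" for w w'
  proof -
    have "n w = cnt N {y. y \<in> uminus ` Q \<and> w - y \<in> Q}" for w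
    proof -
      have pp: "pset N {x. x \<in> Q \<and> x + w \<in> Q}" using pset_Int[OF pQ pset_shift[OF pQ, of w]] by (simp add: Int_def)
      have "n w = cnt N {x. 0 - x \<in> {x. x \<in> Q \<and> x + w \<in> Q}}" unfolding n_def
        using cnt_refl[OF N0 pp, of 0] by simp
      then show ?thesis by (simp add: uminus_image_iff add.commute)
    qed
    then show ?thesis using compatD[OF compat_cnt[OF S xs_neg[OF S xQ] xQ] that] by simp
  qed
  have pL: "pset N (mult L)" by (rule pset_mult[OF Ls2])
  have fib: "cnt N {w. w \<in> mult L \<and> x + w \<in> Q} = cnt N {w. w \<in> mult L \<and> x + (w + q) \<in> Q}" if x: "x \<in> Q" for x
  proof -
    define A where "A = {y. y \<in> Q \<and> L dvd y - x}"
    define B where "B = {y. y \<in> Q \<and> L dvd y - x - q}"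
    have pA: "pset N A" using pset_Int[OF pQ pset_shift[OF pL, of "- x"]] unfolding A_def by (simp add: Int_def)
    have pB: "pset N B" using pset_Int[OF pQ pset_shift[OF pL, of "- x - q"]] unfolding B_def by (simp add: Int_def algebra_simps)
    have AB: "{y. rho * y \<in> B} = A"
    proof (rule equalityI; rule subsetI)
      fix y assume "y \<in> {y. rho * y \<in> B}"
      then have y: "rho * y \<in> Q" "L dvd rho * y - x - q" unfolding B_def by blast+
      obtain a where a: "stab a" "N dvd a * (rho * k) - k"
        using stab_quotient[of "rho * k" k] rho(1) unfolding stab_def by auto
      have "c (a * (rho * y)) = c k" using a(1) y(1) unfolding stab_def Q_def by simp
      moreover have "N dvd (a * rho - 1) * y"
      proof -
        have "N dvd (a * rho - 1) * k" using a(2) by (simp add: algebra_simps)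
        then have "N dvd a * rho - 1" using k_unit by (simp add: coprime_commute coprime_dvd_mult_left_iff)
        then show ?thesis by simp
      qed
      then have "c (a * (rho * y)) = c y" using spair_eq[OF S, of "a * (rho * y)" y] by (simp add: algebra_simps)
      ultimately have yQ: "y \<in> Q" unfolding Q_def by simp
      have "L dvd (rho * y - x - q) - (rho * y - (y + q))" using y(2) rho(2)[OF yQ] by (rule dvd_diff)
      then show "y \<in> A" using yQ unfolding A_def by simp
    next
      fix y assume "y \<in> A"
      then have y: "y \<in> Q" "L dvd y - x" unfolding A_def by blast+
      have "L dvd (rho * y - (y + q)) + (y - x)" using rho(2)[OF y(1)] y(2) by (rule dvd_add)
      then have "L dvd rho * y - x - q" by (simp add: algebra_simps)
      then show "y \<in> {y. rho * y \<in> B}" using stabQ[OF rho(1) y(1)] unfolding B_def by blast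
    qed
    have "coprime rho N" using rho(1) unfolding stab_def by blast
    then have cAB: "cnt N A = cnt N B" using cnt_unit[OF N0 pB] AB by metis
    have "{w. w \<in> mult L \<and> x + w \<in> Q} = {w. w + x \<in> A}" unfolding A_def by (auto simp: add.commute)
    moreover have "{w. w \<in> mult L \<and> x + (w + q) \<in> Q} = {w. w + (x + q) \<in> B}" unfolding B_def by (auto simp: add_ac)
    ultimately show ?thesis using cAB cnt_shift[OF N0 pA] cnt_shift[OF N0 pB] by simp
  qed
  \<comment> \<open>Multiplication by \<open>rho\<close> matches the points of \<open>Q\<close> in a
    coset of \<open>mult L\<close> with those in the coset shifted by \<open>q\<close>.\<close>
  have tot: "(\<Sum>w\<in>{0..<N}. of_bool (w \<in> mult L) * n w) = (\<Sum>w\<in>{0..<N}. of_bool (w \<in> mult L) * n (w + q))"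
  proof -
    have "(\<Sum>w\<in>{0..<N}. of_bool (w \<in> mult L) * n w) = (\<Sum>x\<in>{0..<N}. of_bool (x \<in> Q) * cnt N {w. w \<in> mult L \<and> x + w \<in> Q})"
      unfolding n_def by (rule double_count)
    also have "\<dots> = (\<Sum>x\<in>{0..<N}. of_bool (x \<in> Q) * cnt N {w. w \<in> mult L \<and> x + (w + q) \<in> Q})"
      by (rule sum.cong[OF refl]) (use fib in auto)
    also have "\<dots> = (\<Sum>w\<in>{0..<N}. of_bool (w \<in> mult L) * n (w + q))"
      unfolding n_def by (rule double_count[symmetric])
    finally show ?thesis .
  qed
  have neq: "n (w + q) = n w" if w: "L dvd w" "\<not> g dvd w" for w
  proof -
    have "\<not> h * m dvd w"
    proof
      assume hm: "h * m dvd w"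
      obtain w' where w': "w = 2 * h * w'" using w(1) unfolding Lh by blast
      then have "h * m dvd h * (2 * w')" using hm by (simp add: mult_ac)
      then have "m dvd 2 * w'" using h0 by simp
      moreover have "coprime m 2" using oddm by simp
      ultimately have "m dvd w'" by (simp add: coprime_dvd_mult_right_iff)
      then have "g dvd w" unfolding gh w' by (simp add: mult.assoc mult_dvd_mono)
      then show False using w(2) by simp
    qed
    moreover have "h dvd w" using w(1) Lh by (metis dvd_mult_right)
    ultimately show ?thesis using ncompat inv by blast
  qed
  \<comment> \<open>In the equality of the two sums the terms with \<open>w\<close> outside
    \<open>mult g\<close> agree by \<open>inv\<close>. On \<open>mult g\<close> the term at
    \<open>w = 0\<close> of one sum is positive, so some term of the other sum is nonzero.\<close>
  have "\<exists>w. g dvd w \<and> n (w + q) \<noteq> 0"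
  proof (rule ccontr)
    assume no: "\<not> (\<exists>w. g dvd w \<and> n (w + q) \<noteq> 0)"
    have nn: "0 \<le> n w" for w unfolding n_def by (rule cnt_nonneg)
    have "(\<Sum>w\<in>{0..<N}. of_bool (w \<in> mult L) * n (w + q)) < (\<Sum>w\<in>{0..<N}. of_bool (w \<in> mult L) * n w)"
    proof (rule sum_strict_mono_ex1)
      show "\<forall>w\<in>{0..<N}. of_bool (w \<in> mult L) * n (w + q) \<le> of_bool (w \<in> mult L) * n w"
      proof
        fix w
        have "n (w + q) \<le> n w" if "L dvd w"
          using neq[OF that] no nn[of w] by (cases "g dvd w") auto
        then show "of_bool (w \<in> mult L) * n (w + q) \<le> of_bool (w \<in> mult L) * n w" by simp
      qed
      have "n (0 + q) = 0" using no by blast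
      moreover have "0 < n 0"
      proof -
        have "Q \<noteq> {}" unfolding Q_def by auto
        then have "cnt N Q \<noteq> 0" using cnt_zero_iff[OF N0 pQ] by blast
        then show ?thesis using cnt_nonneg[of N Q] unfolding n_def by simp
      qed
      moreover have "0 \<in> {0..<N}" using N0 by simp
      ultimately show "\<exists>w\<in>{0..<N}. of_bool (w \<in> mult L) * n (w + q) < of_bool (w \<in> mult L) * n w"
        by (intro bexI[of _ 0]) auto
    qed simp
    then show False using tot by simp
  qed
  then obtain w where w: "g dvd w" "n (w + q) \<noteq> 0" by blast
  have "{x. x \<in> Q \<and> x + (w + q) \<in> Q} \<noteq> {}"
  proof
    assume "{x. x \<in> Q \<and> x + (w + q) \<in> Q} = {}"
    then have "n (w + q) = cnt N {}" unfolding n_def by (rule arg_cong)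
    then show False using w(2) by simp
  qed
  then obtain x where x: "x \<in> Q" "x + (w + q) \<in> Q" by blast
  obtain a where a: "stab a" "N dvd a * x - (x + (w + q))" using stab_quotient[of x "x + (w + q)"] x unfolding Q_def by auto
  have rw: "r dvd w" and Lw: "L dvd w"
  proof -
    show "L dvd w" using g(2) w(1) by (rule dvd_trans)
    have "m dvd g" unfolding m by simp
    then show "r dvd w" using rm w(1) dvd_trans by blast
  qed
  have Rq: "R dvd q" and rq: "r dvd q"
  proof -
    show "R dvd q" unfolding qh by simp
    then show "r dvd q" using o.pP dvd_trans by blast
  qed
  have ra: "r dvd a - 1"
  proof -
    have "r dvd a * x - (x + (w + q))" using o.pN a(2) by (rule dvd_trans)
    then have "r dvd (a * x - (x + (w + q))) + (w + q)" using rw rq by (intro dvd_add)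
    then have "r dvd (a - 1) * x" by (simp add: algebra_simps)
    moreover have "coprime r x" using o.coprime_pD[OF Qu[OF x(1)]] o.p by (rule prime_imp_coprime[rotated])
    ultimately show ?thesis by (simp add: coprime_dvd_mult_left_iff)
  qed
  have La: "L dvd a * x - (x + q)"
  proof -
    have "L dvd (a * x - (x + (w + q))) + w" using dvd_trans[OF Ls2 a(2)] Lw by (rule dvd_add)
    then show ?thesis by (simp add: algebra_simps)
  qed
  have odda: "odd a" using a(1) t.coprime_pD unfolding stab_def by blast
  have L2q: "L dvd 2 * q" using Ls2 t.Npq by simp
  have La2: "L dvd a * a - 1"
  proof -
    have aq: "L dvd a * q - q" using dvd_trans[OF Ls2 qN[OF odda]] .
    have "(a * a - 1) * x = a * (a * x - (x + q)) + (a * x - (x + q)) + (a * q - q) + 2 * q" by (simp add: algebra_simps)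
    moreover have "L dvd a * (a * x - (x + q)) + (a * x - (x + q)) + (a * q - q) + 2 * q"
      by (rule dvd_add[OF dvd_add[OF dvd_add[OF dvd_mult[OF La] La] aq] L2q])
    ultimately have "L dvd (a * a - 1) * x" by metis
    moreover have "coprime L x" using Qu[OF x(1)] unfolding o.NPM by (simp add: coprime_commute)
    ultimately show ?thesis by (simp add: coprime_dvd_mult_left_iff)
  qed
  \<comment> \<open>The power \<open>R\<close> kills the \<open>r\<close>-component of
    \<open>a\<close>, since \<open>a\<close> is \<open>1\<close> modulo \<open>r\<close>. It changes
    nothing modulo \<open>L\<close>, since \<open>R\<close> is odd and \<open>a * a\<close> is
    \<open>1\<close> there. So \<open>b\<close> adds exactly \<open>q\<close> to every element of
    \<open>Q\<close>.\<close>
  define b where "b = a ^ nat R"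
  have sb: "stab b" unfolding b_def by (rule stab_pow[OF a(1)])
  have Rb: "R dvd b - 1" unfolding b_def f by (rule power_cong_1[OF o.p ra])
  have Lb: "L dvd b - a"
  proof -
    have "odd (nat R)" using oddR o.P0 by (simp add: even_nat_iff)
    then obtain l where l: "nat R = Suc (2 * l)" by (metis oddE Suc_eq_plus1)
    have "L dvd (a * a) ^ l - 1"
    proof -
      have "a * a - 1 dvd (a * a) ^ l - 1" by (metis power_diff_1_eq dvd_triv_left)
      then show ?thesis using La2 dvd_trans by blast
    qed
    then have "L dvd a * ((a * a) ^ l - 1)" by simp
    moreover have "b = a * (a * a) ^ l" unfolding b_def l by (simp add: power_mult power2_eq_square)
    ultimately show ?thesis by (simp add: algebra_simps)
  qed
  have bx: "N dvd b * x - (x + q)"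
  proof -
    have "R dvd (b - 1) * x - q" using Rb Rq by (intro dvd_diff) simp_all
    moreover have "L dvd (b - a) * x + (a * x - (x + q))" using Lb La by (intro dvd_add) simp_all
    ultimately show ?thesis using o.N_dvd_iff[of "b * x - (x + q)"] by (simp add: algebra_simps)
  qed
  have "N dvd q"
  proof (rule no_period)
    fix y assume y: "c y = c k"
    obtain l where l: "stab l" "N dvd l * x - y" using stab_quotient[of x y] x(1) y unfolding Q_def by auto
    have "odd l" using l(1) t.coprime_pD unfolding stab_def by blast
    have "b * y - (y + q) = (1 - b) * (l * x - y) + l * (b * x - (x + q)) + (l * q - q)" by (simp add: algebra_simps)
    moreover have "N dvd (1 - b) * (l * x - y) + l * (b * x - (x + q)) + (l * q - q)"
      using l(2) bx qN[OF \<open>odd l\<close>] by (intro dvd_add dvd_mult)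
    ultimately have "N dvd b * y - (y + q)" by metis
    then have "c (b * y) = c (y + q)" by (rule spair_eq[OF S])
    then show "c (y + q) = c k" using sb y unfolding stab_def by simp
  qed
  then show False using t.not_N_dvd_q by simp
qed

text \<open>What dilations and halves leave open is the full power of \<open>2\<close> when
  \<open>4 dvd N\<close>, that is, the subgroup of odd order. It is the sum of the Sylow subgroups
  treated in \<open>xdiv_sylow\<close>.\<close>

lemma xdiv_all: assumes d: "0 < d" "d dvd N" shows "xdiv N c d"
proof (rule xdiv_by_prime_powers[OF S d])
  fix p j assume p: "Factorial_Ring.prime p" "p ^ j dvd d"
  have pjN: "p ^ j dvd N" using p(2) d(2) by (rule dvd_trans)
  show "xdiv N c (p ^ j)"
  proof (cases "j = 0")
    case True
    then show ?thesis using xdiv_1[OF S] by simp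
  next
    case False
    then have "p dvd N" using pjN by (metis dvd_power dvd_trans neq0_conv)
    then obtain P M q where pr: "pring N c p P M q" using ex_pring[OF S p(1)] by blast
    interpret t: pring N c p P M q by (rule pr)
    obtain e where e: "P = p ^ e" using t.Pp by blast
    have je: "j \<le> e" by (rule t.power_dvd_N[OF e pjN])
    show ?thesis
    proof (cases "p = 2 \<and> e \<noteq> 1 \<and> \<not> j + 2 \<le> e")
      case False
      then show ?thesis by (intro xdiv_power[OF pr e je]) auto
    next
      case True
      then have p2: "p = 2" by blast
      have e2: "2 \<le> e" using True je \<open>j \<noteq> 0\<close> by auto
      then have "(2::int) ^ 2 dvd 2 ^ e" by (intro le_imp_power_dvd)
      then have P4: "4 dvd P" unfolding e p2 by simp
      have pr2: "pring N c 2 P M q" using pr unfolding p2 .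
      show ?thesis
      proof (cases "j = e")
        case False
        then have "Suc j \<le> e" using je by simp
        then have "(2::int) ^ Suc j dvd 2 ^ e" by (rule le_imp_power_dvd)
        then have "(2::int) * 2 ^ j dvd 2 * q" using t.PN dvd_trans unfolding e p2 t.Npq by fastforce
        then show ?thesis unfolding p2 by (intro xdiv_half[OF pr2 P4]) simp_all
      next
        case True
        \<comment> \<open>The minimum stands for the largest subgroup of odd order that is a union
          of classes. If an odd prime \<open>r\<close> still divided \<open>g'\<close>, adding the
          Sylow \<open>r\<close>-subgroup, which is a gcd of divisors, would enlarge it.\<close>
        define K where "K = {g. xdiv N c g \<and> P dvd g}"
        have "finite K" by (rule finite_subset[of _ "{r. r dvd N}"]) (use N0 in \<open>auto simp: K_def xdiv_def intro!: finite_divisors_int\<close>)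
        moreover have "N \<in> K" using xdiv_N[OF S] t.PN by (simp add: K_def)
        ultimately have mK: "Min K \<in> K" "\<And>g. g \<in> K \<Longrightarrow> Min K \<le> g" using Min_in Min_le by blast+
        define g where "g = Min K"
        have g: "xdiv N c g" "P dvd g" using mK(1) unfolding g_def K_def by blast+
        have g0: "0 < g" by (rule xdiv_pos[OF g(1)])
        obtain g' where g': "g = P * g'" using g(2) by blast
        have g'M: "g' dvd M"
        proof -
          have "P * g' dvd P * M" using xdiv_dvd[OF g(1)] unfolding g' t.NPM .
          then show ?thesis using t.P0 by simp
        qed
        have "g' = 1"
        proof (rule ccontr)
          assume "g' \<noteq> 1"
          have g'0: "0 < g'" using g0 t.P0 unfolding g' by (simp add: zero_less_mult_iff)
          then have "\<not> is_unit g'" using \<open>g' \<noteq> 1\<close> by simp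
          then obtain r where r: "r dvd g'" "Factorial_Ring.prime r" using prime_divisor_exists[of g'] g'0 by auto
          have rM: "r dvd M" using r(1) g'M by (rule dvd_trans)
          have r2: "r \<noteq> 2"
          proof
            assume "r = 2"
            then have "p dvd M" using rM p2 by simp
            then show False using t.pM p(1) by (meson coprime_common_divisor dvd_refl not_prime_unit)
          qed
          have "r dvd N" using rM t.MN by (rule dvd_trans)
          then obtain R L s where prr: "pring N c r R L s" using ex_pring[OF S r(2)] by blast
          interpret o: pring N c r R L s by (rule prr)
          have xL: "xdiv N c L" by (rule xdiv_sylow[OF pr2 P4 prr r2])
          have "coprime P R"
          proof -
            have "coprime (2::int) r" using primes_coprime[OF two_is_prime_int r(2)] r2 by metis
            moreover obtain f where "R = r ^ f" using o.Pp by blast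
            ultimately show ?thesis unfolding e p2 by simp
          qed
          moreover have "P dvd R * L" using t.PN unfolding o.NPM[symmetric] .
          ultimately have "P dvd L" by (simp add: coprime_dvd_mult_right_iff)
          then have "gcd g L \<in> K" using xdiv_gcd[OF S g(1) xL] g(2) by (simp add: K_def)
          then have "g \<le> gcd g L" using mK(2) unfolding g_def by blast
          moreover have "gcd g L \<le> g" by (rule zdvd_imp_le[OF gcd_dvd1 g0])
          ultimately have "gcd g L = g" by simp
          then have "g dvd L" by (metis gcd_dvd2)
          moreover have "r dvd g" using r(1) unfolding g' by simp
          ultimately have "r dvd L" by (rule dvd_trans[rotated])
          then show False using o.pM r(2) by (meson coprime_common_divisor dvd_refl not_prime_unit)
        qed
        then show ?thesis using g(1) unfolding g' e True by simp
      qed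
    qed
  qed
qed

end

section \<open>Multipliers from a fixed point\<close>

lemma crt_primes:
  assumes "finite K" "\<And>p. p \<in> K \<Longrightarrow> Factorial_Ring.prime (p::int)"
  shows "\<exists>x. \<forall>p\<in>K. p ^ f p dvd x - a p"
  using assms
proof (induction K rule: finite_induct)
  case (insert p K)
  then obtain x where x: "\<forall>p\<in>K. p ^ f p dvd x - a p" by auto
  have "coprime p r" if "r \<in> K" for r
    using primes_coprime[of p r] insert.prems insert.hyps(2) that by auto
  then have "coprime (p ^ f p) (\<Prod>r\<in>K. r ^ f r)" by (intro prod_coprime_right) simp
  then obtain y where y: "p ^ f p dvd y - a p" "(\<Prod>r\<in>K. r ^ f r) dvd y - x" using crt_int by blast
  have "r ^ f r dvd y - a r" if r: "r \<in> K" for r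
  proof -
    have "r ^ f r dvd (\<Prod>r\<in>K. r ^ f r)" by (rule dvd_prodI[OF insert.hyps(1) r])
    then have "r ^ f r dvd (y - x) + (x - a r)" using y(2) x r dvd_trans by (intro dvd_add) auto
    then show ?thesis by simp
  qed
  then show ?case using y(1) by blast
qed simp

lemma dvd_by_primes:
  assumes N: "0 < (N::int)" and x: "\<And>p. Factorial_Ring.prime p \<Longrightarrow> p dvd N \<Longrightarrow> p ^ multiplicity p N dvd x"
  shows "N dvd x"
proof (cases "x = 0")
  case False
  show ?thesis
  proof (rule multiplicity_le_imp_dvd)
    show "N \<noteq> 0" using N by simp
    fix p :: int assume p: "Factorial_Ring.prime p"
    show "multiplicity p N \<le> multiplicity p x"
    proof (cases "p dvd N")
      case True
      then show ?thesis using x[OF p] False p by (intro multiplicity_geI) auto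
    qed (simp add: not_dvd_imp_multiplicity_0)
  qed
qed simp

lemma (in pring) P_eq: "P = p ^ multiplicity p N"
proof -
  obtain e where e: "P = p ^ e" using Pp by blast
  have "e \<le> multiplicity p N"
    by (rule multiplicity_geI) (use N0 p PN e in auto)
  moreover have "multiplicity p N \<le> e" by (rule power_dvd_N[OF e]) (rule multiplicity_dvd)
  ultimately show ?thesis using e by simp
qed

text \<open>\<open>R x x'\<close> will say that \<open>\<psi>\<close> maps the class of \<open>(1, x)\<close> to the class of \<open>(1, x')\<close>
  in the point extensions.\<close>

locale fibre =
  fixes N :: int and c c' :: "int \<Rightarrow> 'k" and R :: "int \<Rightarrow> int \<Rightarrow> bool"
  assumes S: "spair N c c'" and R0: "R 0 0"
    and R0': "R 0 x' \<Longrightarrow> N dvd x'" and R0'': "R x 0 \<Longrightarrow> N dvd x"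
    and zig: "R x x' \<Longrightarrow> \<exists>z'. R z z' \<and> c (x - z) = c' (x' - z')"
    and zag: "R x x' \<Longrightarrow> \<exists>z. R z z' \<and> c (x - z) = c' (x' - z')"
begin

text \<open>The point \<open>g\<close> is isolated in the fibre: it is related to \<open>g'\<close>
  only, and conversely. Entries of the base tuple provide such points.\<close>

definition iso :: "int \<Rightarrow> int \<Rightarrow> bool" where
  "iso g g' \<longleftrightarrow> R g g' \<and> (\<forall>x'. R g x' \<longrightarrow> N dvd x' - g') \<and> (\<forall>x. R x g' \<longrightarrow> N dvd x - g)"

lemma R_colour: assumes "R x x'" shows "c x = c' x'"
proof -
  obtain z' where z: "R 0 z'" "c (x - 0) = c' (x' - z')" using zig[OF assms, of 0] by blast
  have "N dvd (x' - z') - x'" using R0'[OF z(1)] by simp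
  then show ?thesis using z(2) periodicD[OF spair_per'[OF S]] by fastforce
qed

lemma iso_diff: assumes g: "iso g g'" and x: "R x x'" shows "c (x - g) = c' (x' - g')"
proof -
  obtain z' where z: "R g z'" "c (x - g) = c' (x' - z')" using zig[OF x, of g] by blast
  have "N dvd z' - g'" using g z(1) unfolding iso_def by blast
  then have "N dvd g' - z'" by (simp only: dvd_diff_commute)
  then have "c' (x' - z') = c' (x' - g')" by (intro periodicD[OF spair_per'[OF S]]) simp
  then show ?thesis using z(2) by simp
qed

lemma ex_image: obtains x' where "R x x'"
  using zig[OF R0, of x] by blast

lemma iso_0: "iso 0 0"
  unfolding iso_def using R0 R0' R0'' by auto

end

text \<open>The relation induced on the section between \<open>mult u\<close> and
  \<open>mult r\<close>, with coordinates divided by \<open>u\<close>.\<close>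

definition sec_fibre :: "int \<Rightarrow> int \<Rightarrow> (int \<Rightarrow> int \<Rightarrow> bool) \<Rightarrow> int \<Rightarrow> int \<Rightarrow> bool" where
  "sec_fibre u r R y y' \<longleftrightarrow> (\<exists>x x'. R x x' \<and> r dvd x - u * y \<and> r dvd x' - u * y')"

definition sec :: "(int \<Rightarrow> 'k) \<Rightarrow> int \<Rightarrow> int \<Rightarrow> int \<Rightarrow> 'k set" where
  "sec c u r = sub (quot c r) u"

lemma spair_sec: assumes S: "spair N c c'" and u: "xdiv N c u" and r: "xdiv N c r" and ur: "u dvd r"
  shows "spair (r div u) (sec c u r) (sec c' u r)"
  unfolding sec_def
  by (rule spair_sub[OF spair_quot[OF S r]]) (use xdiv_quot_iff[OF spair_left[OF S] r ur] u in simp)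

lemma quot_cong: assumes "r dvd x - y" shows "quot c r x = quot c r y"
  by (rule periodicD[OF quot_per assms])

lemma (in fibre) iso_sec_aux:
  assumes r: "xdiv N c r" and g: "iso g g'" and x: "R x x'"
  shows "r dvd x - g \<longleftrightarrow> r dvd x' - g'"
  by (rule xdiv_iff[OF S r iso_diff[OF g x]])

lemma (in fibre) iso_sec:
  assumes u: "xdiv N c u" and r: "xdiv N c r" and ur: "u dvd r" and g: "iso (u * h) (u * h')"
  shows "sec_fibre u r R h h'" "sec_fibre u r R h y' \<Longrightarrow> r div u dvd y' - h'" "sec_fibre u r R y h' \<Longrightarrow> r div u dvd y - h"
proof -
  have u0: "0 < u" by (rule xdiv_pos[OF u])
  obtain n where n: "r = u * n" using ur by blast
  have rn: "r div u = n" using n u0 by simp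
  have "R (u * h) (u * h')" using g unfolding iso_def by blast
  then show "sec_fibre u r R h h'" unfolding sec_fibre_def by (intro exI[of _ "u * h"] exI[of _ "u * h'"]) simp
  have rd: "n dvd a - b" if "r dvd u * a - u * b" for a b
  proof -
    have "u * n dvd u * (a - b)" using that unfolding n by (simp add: right_diff_distrib)
    then show ?thesis using u0 by simp
  qed
  show "r div u dvd y' - h'" if h: "sec_fibre u r R h y'"
  proof -
    obtain x x' where x: "R x x'" "r dvd x - u * h" "r dvd x' - u * y'" using h unfolding sec_fibre_def by blast
    have "r dvd x' - u * h'" using iso_sec_aux[OF r g x(1)] x(2) by simp
    then have "r dvd (x' - u * h') - (x' - u * y')" using x(3) by (rule dvd_diff)
    then have "r dvd u * y' - u * h'" by (simp add: algebra_simps)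
    then show ?thesis unfolding rn by (rule rd)
  qed
  show "r div u dvd y - h" if h: "sec_fibre u r R y h'"
  proof -
    obtain x x' where x: "R x x'" "r dvd x - u * y" "r dvd x' - u * h'" using h unfolding sec_fibre_def by blast
    have "r dvd x - u * h" using iso_sec_aux[OF r g x(1)] x(3) by simp
    then have "r dvd (x - u * h) - (x - u * y)" using x(2) by (rule dvd_diff)
    then have "r dvd u * y - u * h" by (simp add: algebra_simps)
    then show ?thesis unfolding rn by (rule rd)
  qed
qed

lemma (in fibre) fibre_sec:
  assumes u: "xdiv N c u" and r: "xdiv N c r" and ur: "u dvd r"
  shows "fibre (r div u) (sec c u r) (sec c' u r) (sec_fibre u r R)"
proof
  have i0: "iso (u * 0) (u * 0)" using iso_0 by simp
  show "spair (r div u) (sec c u r) (sec c' u r)" by (rule spair_sec[OF S u r ur])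
  show "sec_fibre u r R 0 0" by (rule iso_sec(1)[OF u r ur i0])
  show "r div u dvd x'" if "sec_fibre u r R 0 x'" for x' using iso_sec(2)[OF u r ur i0 that] by simp
  show "r div u dvd x" if "sec_fibre u r R x 0" for x using iso_sec(3)[OF u r ur i0 that] by simp
  fix y y' assume "sec_fibre u r R y y'"
  then obtain x x' where x: "R x x'" "r dvd x - u * y" "r dvd x' - u * y'" unfolding sec_fibre_def by blast
  have q1: "quot c r (u * (y - z)) = quot c r (x - w)" if "r dvd w - u * z" for w z
    by (rule quot_cong) (use dvd_diff[OF that x(2)] in \<open>simp add: algebra_simps\<close>)
  have q2: "quot c' r (u * (y' - z)) = quot c' r (x' - w)" if "r dvd w - u * z" for w z
    by (rule quot_cong) (use dvd_diff[OF that x(3)] in \<open>simp add: algebra_simps\<close>)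
  have fin: "sec c u r (y - z) = sec c' u r (y' - z')"
    if "r dvd w - u * z" "r dvd w' - u * z'" "c (x - w) = c' (x' - w')" for w z w' z'
    using q1[OF that(1)] q2[OF that(2)] quot_eqI[OF S r that(3)] unfolding sec_def sub_def by simp
  show "\<exists>z'. sec_fibre u r R z z' \<and> sec c u r (y - z) = sec c' u r (y' - z')" for z
  proof -
    obtain w' where w: "R (u * z) w'" "c (x - u * z) = c' (x' - w')" using zig[OF x(1)] by blast
    have "u dvd w'" using xdiv_iff[OF S u R_colour[OF w(1)]] by simp
    then obtain z' where z': "w' = u * z'" by blast
    have "sec_fibre u r R z z'" unfolding sec_fibre_def using w(1) z' by (intro exI[of _ "u * z"] exI[of _ w']) simp
    moreover have "sec c u r (y - z) = sec c' u r (y' - z')" by (rule fin[OF _ _ w(2)]) (simp_all add: z')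
    ultimately show ?thesis by blast
  qed
  show "\<exists>z. sec_fibre u r R z z' \<and> sec c u r (y - z) = sec c' u r (y' - z')" for z'
  proof -
    obtain w where w: "R w (u * z')" "c (x - w) = c' (x' - u * z')" using zag[OF x(1)] by blast
    have "u dvd w" using xdiv_iff[OF S u R_colour[OF w(1)]] by simp
    then obtain z where z: "w = u * z" by blast
    have "sec_fibre u r R z z'" unfolding sec_fibre_def using w(1) z by (intro exI[of _ w] exI[of _ "u * z'"]) simp
    moreover have "sec c u r (y - z) = sec c' u r (y' - z')" by (rule fin[OF _ _ w(2)]) (simp_all add: z)
    ultimately show ?thesis by blast
  qed
qed

text \<open>Take \<open>a\<close> to be the quotient of \<open>z\<close> by \<open>x\<close>. Any
  unit \<open>w\<close> is a unit multiple of \<open>x\<close>, so \<open>multiplier\<close> carries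
  the equality of colours from \<open>x\<close> and \<open>z\<close> to \<open>w\<close> and
  \<open>a * w\<close>.\<close>

lemma unit_stab:
  assumes S: "spair N c c" and x: "coprime x N" "c x = c z"
  obtains a where "N dvd a * x - z" "\<And>w. c (a * w) = c w \<or> \<not> coprime w N" "coprime a N \<or> \<not> coprime z N"
proof -
  obtain b where b: "coprime b N" "N dvd b * x - 1" using unit_inverse[OF x(1)] .
  have "N dvd z * (b * x - 1)" using b(2) by simp
  then have ax: "N dvd (z * b) * x - z" by (simp add: algebra_simps)
  have "c ((z * b) * w) = c w" if w: "coprime w N" for w
  proof -
    have "c ((w * b) * x) = c ((w * b) * z)" by (rule multiplier[OF S x(2)]) (use w b(1) in simp)
    moreover have "N dvd w * (b * x - 1)" using b(2) by simp
    then have "c ((w * b) * x) = c w" using spair_eq[OF S, of "(w * b) * x" w] by (simp add: algebra_simps)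
    ultimately show ?thesis by (simp add: mult_ac)
  qed
  then show ?thesis using that[OF ax] b(1) by auto
qed

text \<open>The quotient of the two units stabilizes the class and is close to \<open>1\<close>, so
  \<open>stab_near_one\<close> applies. If \<open>p = 2\<close> and \<open>4\<close> does not divide
  \<open>N\<close>, agreement modulo \<open>2\<close> is already agreement modulo
  \<open>P\<close>.\<close>

lemma (in regular) near_unique:
  assumes pr: "pring N c p P M q" and x: "coprime x N" "coprime z N" "c x = c z"
    and d: "M dvd x - z" "p dvd x - z" "p = 2 \<Longrightarrow> 4 dvd x - z"
  shows "N dvd x - z"
proof -
  interpret pring N c p P M q by (rule pr)
  obtain a where a: "N dvd a * x - z" "\<And>w. c (a * w) = c w \<or> \<not> coprime w N" "coprime a N \<or> \<not> coprime z N"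
    using unit_stab[OF S x(1,3)] by blast
  have st: "stab a" unfolding stab_def using a(2,3) x(2) units by metis
  have dd: "m dvd a - 1" if m: "m dvd N" "m dvd x - z" for m
  proof -
    have "m dvd (a * x - z) - (x - z)" using dvd_trans[OF m(1) a(1)] m(2) by (rule dvd_diff)
    then have "m dvd (a - 1) * x" by (simp add: algebra_simps)
    moreover have "coprime m x" using x(1) m(1) by (meson coprime_commute coprime_divisors dvd_refl)
    ultimately show ?thesis by (simp add: coprime_dvd_mult_left_iff)
  qed
  have "N dvd a - 1"
  proof (cases "p = 2 \<and> \<not> 4 dvd N")
    case True
    obtain e where e: "P = 2 ^ e" using Pp True by blast
    have "e < 2"
    proof (rule ccontr)
      assume "\<not> e < 2"
      then have "(2::int) ^ 2 dvd 2 ^ e" by (intro le_imp_power_dvd) simp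
      then have "4 dvd P" unfolding e by simp
      then show False using True dvd_trans[OF _ PN] by blast
    qed
    then have "P dvd 2" unfolding e by (auto simp: less_2_cases_iff)
    then have "P dvd a - 1" using dd[OF pN d(2)] True dvd_trans by blast
    then show ?thesis using dd[OF MN d(1)] N_dvd_iff by blast
  next
    case False
    then have "p = 2 \<Longrightarrow> 4 dvd a - 1" using dd d(3) by blast
    then show ?thesis using stab_near_one[OF pr st dd[OF MN d(1)] dd[OF pN d(2)]] by blast
  qed
  then have "N dvd (a * x - z) - (a - 1) * x" by (intro dvd_diff[OF a(1)]) simp
  then show ?thesis by (simp add: algebra_simps)
qed

lemma even_mod_4: assumes "2 dvd (x::int)" "2 dvd y" "4 dvd x \<longleftrightarrow> 4 dvd y" shows "4 dvd x - y"
proof -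
  obtain a b where ab: "x = 2 * a" "y = 2 * b" using assms by (metis dvdE)
  have "2 dvd a \<longleftrightarrow> 2 dvd b" using assms(3) unfolding ab by presburger
  then have "2 dvd a - b" by simp
  then have "2 * 2 dvd 2 * (a - b)" by (rule mult_dvd_mono[OF dvd_refl])
  then show ?thesis unfolding ab by (simp add: right_diff_distrib)
qed

text \<open>A unit \<open>x0\<close> that agrees with \<open>g p\<close> modulo each full prime
  power is isolated, because differences from the \<open>g p\<close> are tracked and all subgroups
  are unions of classes. The multiplier is the quotient of its image by \<open>x0\<close>. Linearity
  on the fibre follows by comparing points with \<open>x0\<close> and using rigidity.\<close>

lemma (in fibre) regular_multiplier:
  assumes reg: "regular N c k"
    and g: "\<And>p. Factorial_Ring.prime p \<Longrightarrow> p dvd N \<Longrightarrow> iso (g p) (g' p) \<and> \<not> p dvd g p"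
  shows "\<exists>m. coprime m N \<and> (\<forall>x. coprime x N \<longrightarrow> c x = c' (m * x)) \<and>
    (\<forall>p. Factorial_Ring.prime p \<longrightarrow> p dvd N \<longrightarrow> p ^ multiplicity p N dvd g' p - m * g p) \<and>
    (\<forall>p y y'. Factorial_Ring.prime p \<longrightarrow> p * p dvd N \<longrightarrow> R y y' \<longrightarrow> p ^ multiplicity p N dvd y' - m * y)"
proof -
  interpret reg: regular N c k by (rule reg)
  have Sc: "spair N c c" by (rule spair_left[OF S])
  have N: "0 < N" by (rule reg.N0)
  have xd: "d dvd x \<longleftrightarrow> d dvd x'" if "d dvd N" "c x = c' x'" for d x x'
  proof -
    have "d \<noteq> 0" using that(1) N by auto
    have "xdiv N c \<bar>d\<bar>" by (rule reg.xdiv_all) (use \<open>d \<noteq> 0\<close> that(1) in auto)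
    then show ?thesis using xdiv_iff[OF S _ that(2)] by fastforce
  qed
  define K where "K = {p. Factorial_Ring.prime p \<and> p dvd N}"
  have fK: "finite K" by (rule finite_subset[of _ "{r. r dvd N}"]) (use N in \<open>auto simp: K_def intro!: finite_divisors_int\<close>)
  obtain x0 where x0: "\<forall>p\<in>K. p ^ multiplicity p N dvd x0 - g p"
    using crt_primes[OF fK, of "\<lambda>p. multiplicity p N" g] unfolding K_def by blast
  have x0': "p ^ multiplicity p N dvd x' - g' p" if p: "Factorial_Ring.prime p" "p dvd N" and x': "R x0 x'" for p x'
  proof -
    have e: "c (x0 - g p) = c' (x' - g' p)" using iso_diff[of "g p" "g' p"] g[OF p] x' by blast
    show ?thesis using xd[OF multiplicity_dvd e] x0 p unfolding K_def by blast
  qed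
  have x0u: "N dvd x' - x''" if "R x0 x'" "R x0 x''" for x' x''
  proof (rule dvd_by_primes[OF N])
    fix p assume p: "Factorial_Ring.prime p" "p dvd N"
    have "p ^ multiplicity p N dvd (x' - g' p) - (x'' - g' p)"
      using x0'[OF p that(1)] x0'[OF p that(2)] by (rule dvd_diff)
    then show "p ^ multiplicity p N dvd x' - x''" by simp
  qed
  obtain y0 where y0: "R x0 y0" using ex_image .
  have diff0: "c (x - x0) = c' (x' - y0)" if Rx: "R x x'" for x x'
  proof -
    obtain z where z: "R x0 z" "c (x - x0) = c' (x' - z)" using zig[OF Rx, of x0] by blast
    have "N dvd (x' - z) - (x' - y0)" using x0u[OF y0 z(1)] by simp
    then have "c' (x' - z) = c' (x' - y0)" by (rule periodicD[OF spair_per'[OF S]])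
    then show ?thesis using z(2) by simp
  qed
  have pm: "p dvd p ^ multiplicity p N" if "Factorial_Ring.prime p" "p dvd N" for p
  proof -
    have "0 < multiplicity p N" using prime_multiplicity_gt_zero_iff that N by (metis less_irrefl prime_imp_prime_elem)
    then show ?thesis by (simp add: dvd_power)
  qed
  have cx0: "coprime x0 N"
  proof (rule coprime_primesI)
    show "N \<noteq> 0" using N by simp
    fix p assume p: "Factorial_Ring.prime p" "p dvd x0" "p dvd N"
    have "p dvd x0 - g p" using pm[OF p(1,3)] x0 p(1,3) dvd_trans unfolding K_def by blast
    then have "p dvd x0 - (x0 - g p)" using p(2) by (rule dvd_diff[rotated])
    then show False using g[OF p(1,3)] by simp
  qed
  have c0: "c x0 = c' y0" by (rule R_colour[OF y0])
  have unit_iff: "coprime x N \<longleftrightarrow> coprime x' N" if "c x = c' x'" for x x'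
  proof -
    have "gcd x N dvd x'" using xd[OF gcd_dvd2[of x N] that] by simp
    moreover have "gcd x' N dvd x" using xd[OF gcd_dvd2[of x' N] that] by simp
    ultimately have "gcd x N dvd gcd x' N" "gcd x' N dvd gcd x N" by simp_all
    then show ?thesis by (metis coprime_iff_gcd_eq_1 is_unit_gcd gcd_ge_0_int zdvd_antisym_nonneg)
  qed
  have cy0: "coprime y0 N" using unit_iff[OF c0] cx0 by simp
  obtain b where b: "coprime b N" "N dvd b * x0 - 1" using unit_inverse[OF cx0] .
  define m where "m = y0 * b"
  have cm: "coprime m N" using cy0 b(1) unfolding m_def by simp
  have mx0: "N dvd m * x0 - y0"
  proof -
    have "m * x0 - y0 = y0 * (b * x0 - 1)" unfolding m_def by (simp add: algebra_simps)
    then show ?thesis using b(2) by simp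
  qed
  have munit: "c x = c' (m * x)" if "coprime x N" for x
  proof -
    have "c ((x * b) * x0) = c' ((x * b) * y0)" by (rule multiplier[OF S c0]) (use that b(1) in simp)
    moreover have "N dvd x * (b * x0 - 1)" using b(2) by simp
    then have "c ((x * b) * x0) = c x" using spair_eq[OF Sc, of "(x * b) * x0" x] by (simp add: algebra_simps)
    ultimately show ?thesis unfolding m_def by (simp add: mult_ac)
  qed
  obtain mi where mi: "coprime mi N" "N dvd mi * m - 1" using unit_inverse[OF cm] .
  have minv: "N dvd m * (mi * y) - y" for y
  proof -
    have "N dvd (mi * m - 1) * y" using mi(2) by simp
    then show ?thesis by (simp add: algebra_simps)
  qed
  \<comment> \<open>after twisting \<open>c'\<close> by \<open>m\<close> the isomorphism is the identity on units\<close>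
  have twist: "c x = c y \<and> coprime y N" if x: "coprime x N" and e: "c x = c' w" "N dvd w - m * y" for x y w
  proof -
    have e': "c x = c' (m * y)" using e periodicD[OF spair_per'[OF S] e(2)] by simp
    have "coprime (m * y) N" using unit_iff[OF e'] x by simp
    then have "coprime y N" by simp
    then show ?thesis using munit e' by simp
  qed
  have lin: "p ^ multiplicity p N dvd y' - m * y"
    if p: "Factorial_Ring.prime p" and pp: "p * p dvd N" and Ry: "R y y'" for p y y'
  proof -
    have pN: "p dvd N" using pp by (rule dvd_mult_left)
    obtain P M q where pr: "pring N c p P M q" using ex_pring[OF Sc p pN] .
    interpret t: pring N c p P M q by (rule pr)
    have Pe: "p ^ multiplicity p N = P" using t.P_eq by simp
    have ppP: "p * p dvd P"
    proof -
      have "coprime (p * p) M" using t.pM by simp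
      then show ?thesis using pp unfolding t.NPM by (simp add: coprime_dvd_mult_left_iff)
    qed
    have m2: "odd m" if "p = 2" using t.coprime_pD[OF cm] that by simp
    have m4: "coprime 4 m" if p2: "p = 2"
    proof -
      have "coprime 2 m" using m2[OF p2] by simp
      then have "coprime (2 ^ 2) m" by (simp only: coprime_power_left_iff) simp
      then show ?thesis by simp
    qed
    have four: "4 dvd N" if "p = 2" using pp that by simp
    have even4: "4 dvd m * x - x'" if p2: "p = 2" and x: "c x = c' x'" "2 dvd x" for x x'
    proof (rule even_mod_4)
      show "2 dvd m * x" using x(2) by simp
      show "2 dvd x'" using xd[OF pN x(1)] x(2) p2 by simp
      have "coprime 4 m" by (rule m4[OF p2])
      then have "4 dvd m * x \<longleftrightarrow> 4 dvd x" by (simp add: coprime_dvd_mult_right_iff)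
      then show "4 dvd m * x \<longleftrightarrow> 4 dvd x'" using xd[OF four[OF p2] x(1)] by simp
    qed
    have Mm: "coprime M m" using cm unfolding t.NPM by (simp add: coprime_commute)
    \<comment> \<open>Here \<open>x0 - y\<close> is a unit and \<open>y\<close> lies in the
      \<open>p\<close>-component, divisible by \<open>p\<close>. After the twist the units
      \<open>x0 - y\<close> and \<open>x0 - w\<close> lie in one class and are close to each other,
      so they are equal.\<close>
    have caseA: "N dvd y' - m * y" if Ry: "R y y'" and y: "p dvd y" "M dvd y" for y y'
    proof -
      define w where "w = mi * y'"
      have w: "N dvd y' - m * w" using minv[of y'] unfolding w_def by (simp only: dvd_diff_commute)
      have cx: "coprime (x0 - y) N"
      proof (rule t.coprime_N)
        show "\<not> p dvd x0 - y"
        proof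
          assume "p dvd x0 - y"
          then have "p dvd (x0 - y) + y" using y(1) by (rule dvd_add)
          then show False using t.coprime_pD[OF cx0] by simp
        qed
        show "coprime (x0 - y) M" by (rule coprime_cong[of M _ x0]) (use y(2) cx0 t.NPM in simp_all)
      qed
      have "c (x0 - y) = c' (y0 - y')" using spair_neg[OF S diff0[OF Ry]] by simp
      moreover have "N dvd (y0 - y') - m * (x0 - w)"
      proof -
        have "N dvd - (m * x0 - y0) - (y' - m * w)" by (rule dvd_diff[OF _ w]) (use mx0 in \<open>simp only: dvd_minus_iff\<close>)
        then show ?thesis by (simp add: algebra_simps)
      qed
      ultimately have t: "c (x0 - y) = c (x0 - w)" "coprime (x0 - w) N" using twist[OF cx] by blast+
      have cy: "c y = c' y'" by (rule R_colour[OF Ry])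
      have dw: "d dvd w" if d: "d dvd N" "d dvd y" for d
      proof -
        have "d dvd y'" using xd[OF d(1) cy] d(2) by simp
        then show ?thesis unfolding w_def by simp
      qed
      have "N dvd (x0 - y) - (x0 - w)"
      proof (rule reg.near_unique[OF pr cx t(2) t(1)])
        show "M dvd (x0 - y) - (x0 - w)" using dvd_diff[OF dw[OF t.MN y(2)] y(2)] by simp
        show "p dvd (x0 - y) - (x0 - w)" using dvd_diff[OF dw[OF pN y(1)] y(1)] by simp
        assume p2: "p = 2"
        have "4 dvd m * y - y'" by (rule even4[OF p2 cy]) (use y(1) p2 in simp)
        moreover have "4 dvd y' - m * w" using four[OF p2] w dvd_trans by blast
        ultimately have "4 dvd (m * y - y') + (y' - m * w)" by (rule dvd_add)
        then have "4 dvd m * (y - w)" by (simp add: algebra_simps)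
        moreover have "coprime 4 m" by (rule m4[OF p2])
        ultimately have "4 dvd y - w" by (simp add: coprime_dvd_mult_right_iff)
        then show "4 dvd (x0 - y) - (x0 - w)" by (simp add: dvd_diff_commute)
      qed
      then have "N dvd m * ((x0 - y) - (x0 - w)) + (y' - m * w)" using w by (intro dvd_add) simp_all
      then show ?thesis by (simp add: algebra_simps)
    qed
    have reduce: "P dvd y' - m * y" if Ry: "R y y'" and z: "P dvd y - z" and zz: "\<And>z'. R z z' \<Longrightarrow> N dvd z' - m * z" for y y' z
    proof -
      obtain z' where z': "R z z'" "c (y - z) = c' (y' - z')" using zig[OF Ry] by blast
      have "P dvd y' - z'" using xd[OF t.PN z'(2)] z by simp
      moreover have "P dvd z' - m * z" using t.PN zz[OF z'(1)] by (rule dvd_trans)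
      moreover have "P dvd m * (z - y)" using z by (simp add: dvd_diff_commute)
      ultimately have "P dvd (y' - z') + (z' - m * z) + m * (z - y)" by (intro dvd_add)
      then show ?thesis by (simp add: algebra_simps)
    qed
    show ?thesis unfolding Pe
    proof (cases "p dvd y")
      case True
      obtain z where z: "P dvd z - y" "M dvd z - 0" using crt_int[OF t.cop] by blast
      have "p dvd (z - y) + y" using dvd_trans[OF t.pP z(1)] True by (rule dvd_add)
      then have pz: "p dvd z" by simp
      show "P dvd y' - m * y"
        by (rule reduce[OF Ry, of z]) (use z caseA pz in \<open>auto simp: dvd_diff_commute\<close>)
    next
      case False
      obtain e where e: "P = p ^ e" using t.Pp by blast
      show "P dvd y' - m * y"
      proof (cases "P = 4")
        case True
        \<comment> \<open>The case \<open>P = 4\<close> is separate because the general argument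
          would only give \<open>a\<close> congruent to \<open>1\<close> modulo
          \<open>P div p = 2\<close>. Here \<open>y - x0\<close> is even, and even residues are
          determined modulo \<open>4\<close> by divisibility.\<close>
        have p2: "p = 2"
        proof -
          have "p dvd 4" using t.pP True by simp
          then have "p dvd 2 * 2" by simp
          then have "p dvd 2" using p by (simp only: prime_dvd_mult_iff) simp
          then show ?thesis using primes_dvd_imp_eq[OF p] by simp
        qed
        have "odd y" "odd x0" using False t.coprime_pD[OF cx0] p2 by simp_all
        then have "2 dvd y - x0" by simp
        from even4[OF p2 diff0[OF Ry] this] have "4 dvd m * (y - x0) - (y' - y0)" .
        moreover have "4 dvd m * x0 - y0" using four[OF p2] mx0 by (rule dvd_trans)
        ultimately have "4 dvd - (m * (y - x0) - (y' - y0)) - (m * x0 - y0)" by (metis dvd_diff dvd_minus_iff)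
        then show ?thesis unfolding True by (simp add: algebra_simps)
      next
        case P4: False
        obtain z where z: "P dvd z - y" "M dvd z - x0" using crt_int[OF t.cop] by blast
        have "N dvd z' - m * z" if Rz: "R z z'" for z'
        proof -
          define w where "w = mi * z'"
          have w: "N dvd z' - m * w" using minv[of z'] unfolding w_def by (simp only: dvd_diff_commute)
          have npz: "\<not> p dvd z"
          proof
            assume "p dvd z"
            then have "p dvd z - (z - y)" using dvd_trans[OF t.pP z(1)] by (rule dvd_diff)
            then show False using False by simp
          qed
          have cMx: "coprime x0 M" using cx0 unfolding t.NPM by simp
          have cz: "coprime z N" by (rule t.coprime_N[OF npz coprime_cong[OF z(2) cMx]])
          have t1: "c z = c w" "coprime w N" using twist[OF cz R_colour[OF Rz] w] by blast+
          have Mw: "M dvd w - z"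
          proof -
            have "M dvd z' - y0" using xd[OF t.MN diff0[OF Rz]] z(2) by simp
            moreover have "M dvd m * x0 - y0" using t.MN mx0 by (rule dvd_trans)
            moreover have "M dvd m * (z - x0)" using z(2) by simp
            moreover have "M dvd z' - m * w" using t.MN w by (rule dvd_trans)
            ultimately have "M dvd ((z' - y0) - (z' - m * w)) - (m * x0 - y0) - m * (z - x0)" by (metis dvd_diff)
            then have "M dvd m * (w - z)" by (simp add: algebra_simps)
            then show ?thesis using Mm by (simp add: coprime_dvd_mult_right_iff)
          qed
          \<comment> \<open>This element of order \<open>P div p\<close> is known to be multiplied
            by \<open>m\<close>, by \<open>caseA\<close>. Comparing the quotients of
            \<open>w\<close> by \<open>z\<close> and of \<open>w - e0\<close> by
            \<open>z - e0\<close> tests how far the quotient is from \<open>1\<close>.\<close>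
          define e0 where "e0 = p * M"
          obtain e0' where e0': "R e0 e0'" "c (z - e0) = c' (z' - e0')" using zig[OF Rz] by blast
          have me0: "N dvd e0' - m * e0" by (rule caseA[OF e0'(1)]) (simp_all add: e0_def)
          have cze: "coprime (z - e0) N"
          proof (rule t.coprime_N)
            show "\<not> p dvd z - e0"
            proof
              assume "p dvd z - e0"
              then have "p dvd (z - e0) + e0" unfolding e0_def by (intro dvd_add) simp_all
              then show False using npz by simp
            qed
            show "coprime (z - e0) M"
              by (rule coprime_cong[of M _ z]) (use cz t.NPM in \<open>simp_all add: e0_def\<close>)
          qed
          have "N dvd (z' - e0') - m * (w - e0)"
          proof -
            have "N dvd (z' - m * w) - (e0' - m * e0)" using w me0 by (rule dvd_diff)
            then show ?thesis by (simp add: algebra_simps)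
          qed
          from twist[OF cze e0'(2) this] have t2: "c (z - e0) = c (w - e0)" "coprime (w - e0) N" by blast+
          obtain a where a: "N dvd a * z - w" "\<And>w. c (a * w) = c w \<or> \<not> coprime w N" "coprime a N \<or> \<not> coprime w N"
            using unit_stab[OF Sc cz t1(1)] by blast
          obtain d where d: "N dvd d * (z - e0) - (w - e0)" "\<And>w. c (d * w) = c w \<or> \<not> coprime w N"
            "coprime d N \<or> \<not> coprime (w - e0) N"
            using unit_stab[OF Sc cze t2(1)] by blast
          have ca: "coprime a N" and cd: "coprime d N" using a(3) d(3) t1(2) t2(2) by blast+
          have Ma: "M dvd a - 1"
          proof -
            have "M dvd (a * z - w) + (w - z)" using dvd_trans[OF t.MN a(1)] Mw by (rule dvd_add)
            then have "M dvd (a - 1) * z" by (simp add: algebra_simps)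
            moreover have "coprime M z" using cz unfolding t.NPM by (simp add: coprime_commute)
            ultimately show ?thesis by (simp add: coprime_dvd_mult_left_iff)
          qed
          have Md: "M dvd d * z - w"
          proof -
            have "M dvd (d * (z - e0) - (w - e0)) + (d - 1) * e0"
              using dvd_trans[OF t.MN d(1)] unfolding e0_def by (intro dvd_add) simp_all
            then show ?thesis by (simp add: algebra_simps)
          qed
          \<comment> \<open>So the two quotients \<open>a\<close> and \<open>d\<close> coincide,
            hence \<open>(a - 1) * e0\<close> vanishes modulo \<open>N\<close> and \<open>a\<close>
            is \<open>1\<close> modulo \<open>P div p\<close>. That is close enough to conclude
            \<open>w = z\<close> modulo \<open>N\<close>.\<close>
          have "N dvd d * z - a * z"
          proof (rule reg.near_unique[OF pr])
            show "coprime (d * z) N" "coprime (a * z) N" using ca cd cz by simp_all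
            show "c (d * z) = c (a * z)" using a(2)[of z] d(2)[of z] cz by simp
            show "M dvd d * z - a * z" using dvd_diff[OF Md dvd_trans[OF t.MN a(1)]] by simp
            show "p dvd d * z - a * z"
            proof -
              have "p dvd (d * (z - e0) - (w - e0)) + (d - 1) * e0"
                using dvd_trans[OF pN d(1)] unfolding e0_def by (intro dvd_add) simp_all
              then have "p dvd d * z - w" by (simp add: algebra_simps)
              then show ?thesis using dvd_diff[OF _ dvd_trans[OF pN a(1)]] by fastforce
            qed
            assume p2: "p = 2"
            have "odd d" using t.coprime_pD[OF cd] p2 by simp
            then have "2 dvd d - 1" by simp
            then have "2 * 2 dvd (d - 1) * (2 * M)" by (intro mult_dvd_mono) simp_all
            then have "4 dvd (d - 1) * e0" unfolding e0_def p2 by simp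
            then have "4 dvd (d * (z - e0) - (w - e0)) + (d - 1) * e0"
              using dvd_trans[OF four[OF p2] d(1)] by (intro dvd_add)
            then have "4 dvd d * z - w" by (simp add: algebra_simps)
            then show "4 dvd d * z - a * z" using dvd_diff[OF _ dvd_trans[OF four[OF p2] a(1)]] by fastforce
          qed
          then have da: "N dvd (d - a) * z" by (simp add: left_diff_distrib)
          then have da': "N dvd d - a" using cz by (simp add: coprime_commute coprime_dvd_mult_left_iff)
          have "N dvd (a * z - w) - (d * (z - e0) - (w - e0)) + (d - a) * z - (d - a) * e0"
            by (rule dvd_diff[OF dvd_add[OF dvd_diff[OF a(1) d(1)] da] dvd_mult2[OF da']])
          then have "N dvd (a - 1) * e0" by (simp add: algebra_simps)
          then have "P dvd (a - 1) * p"
          proof -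
            assume "N dvd (a - 1) * e0"
            then have "P * M dvd ((a - 1) * p) * M" unfolding e0_def t.NPM by (simp add: mult_ac)
            then show ?thesis using t.M0 by simp
          qed
          then have Pa: "P div p dvd a - 1"
          proof -
            assume "P dvd (a - 1) * p"
            then have "p * (P div p) dvd p * (a - 1)" using t.Ppp by (simp add: mult.commute)
            then show ?thesis using t.p1 by simp
          qed
          have pa: "p dvd a - 1"
          proof -
            have "p * p dvd p * (P div p)" using ppP t.Ppp by simp
            then have "p dvd P div p" using t.p1 by simp
            then show ?thesis using Pa dvd_trans by blast
          qed
          have "N dvd a * z - z"
          proof (rule reg.near_unique[OF pr])
            show "coprime (a * z) N" "coprime z N" using ca cz by simp_all
            show "c (a * z) = c z" using a(2)[of z] cz by simp
            have eq: "a * z - z = (a - 1) * z" by (simp add: algebra_simps)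
            show "M dvd a * z - z" "p dvd a * z - z" unfolding eq using Ma pa by simp_all
            assume p2: "p = 2"
            have "4 dvd P div p"
            proof -
              have "e \<noteq> 0" "e \<noteq> 1"
              proof -
                show "e \<noteq> 0" using e t.pP p2 by auto
                show "e \<noteq> 1" using e ppP p2 by auto
              qed
              moreover have "e \<noteq> 2" using e P4 p2 by auto
              ultimately obtain f where f: "e = Suc (Suc (Suc f))" by (metis One_nat_def Suc_1 not0_implies_Suc)
              show ?thesis unfolding e f p2 by simp
            qed
            then show "4 dvd a * z - z" unfolding eq using Pa dvd_trans by (metis dvd_mult2)
          qed
          then have "N dvd m * ((a * z - z) - (a * z - w)) + (z' - m * w)"
            by (rule dvd_add[OF dvd_mult[OF dvd_diff[OF _ a(1)]] w])
          then show ?thesis by (simp add: algebra_simps)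
        qed
        then show ?thesis
          by (intro reduce[OF Ry, of z]) (use z(1) in \<open>simp_all add: dvd_diff_commute\<close>)
      qed
    qed
  qed
  have gm: "p ^ multiplicity p N dvd g' p - m * g p" if p: "Factorial_Ring.prime p" "p dvd N" for p
  proof -
    have "p ^ multiplicity p N dvd y0 - g' p" by (rule x0'[OF p y0])
    moreover have "p ^ multiplicity p N dvd x0 - g p" using x0 p unfolding K_def by blast
    moreover have "p ^ multiplicity p N dvd m * x0 - y0" using multiplicity_dvd mx0 by (rule dvd_trans)
    ultimately have "p ^ multiplicity p N dvd m * (x0 - g p) - (m * x0 - y0) - (y0 - g' p)"
      by (metis dvd_diff dvd_mult)
    then show ?thesis by (simp add: algebra_simps)
  qed
  show ?thesis
    by (rule exI[of _ m]) (use cm munit gm lin in blast)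
qed

section \<open>Assembling the permutation\<close>

lemma class_section:
  assumes S: "spair N c c" and D: "xset c D" "D \<noteq> {}"
  shows "xdiv N c (gn N D)" "xdiv N c (rd D)" "gn N D dvd rd D"
  by (rule xdiv_gn[OF S D(1)] xdiv_rd[OF S D(1)] gn_dvd_rd[OF S D])+

lemma multiplicity_times_nondvd: assumes "Factorial_Ring.prime (p::int)" "\<not> p dvd b" "a \<noteq> 0" shows "multiplicity p (a * b) = multiplicity p a"
proof -
  have "b \<noteq> 0" using assms(2) by auto
  then have "multiplicity p (a * b) = multiplicity p a + multiplicity p b"
    using assms by (intro prime_elem_multiplicity_mult_distrib) auto
  then show ?thesis using not_dvd_imp_multiplicity_0[OF assms(2)] by simp
qed

lemma cl_period:
  assumes S: "spair N c c'" and xy: "rd (cl c k) dvd x - k" shows "c x = c k"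
proof -
  have "k + (x - k) \<in> cl c k"
    using rd_period[OF spair_pos[OF S] xs_per[OF spair_left[OF S] xset_cl] xy, of k] by simp
  then show ?thesis by simp
qed

lemma sec_class:
  fixes u :: int
  assumes S: "spair N c c" and r: "r = rd (cl c (u * k))" and u: "xdiv N c u" "u dvd gn N (cl c (u * k))"
  shows "u * gn (r div u) (cl (sec c u r) k) = gn N (cl c (u * k))" "u * rd (cl (sec c u r) k) = r"
proof -
  let ?D = "cl c (u * k)"
  have xr: "xdiv N c r" unfolding r by (rule xdiv_rd[OF S xset_cl])
  have u0: "0 < u" by (rule xdiv_pos[OF u(1)])
  have ne: "?D \<noteq> {}" by auto
  have gr: "gn N ?D dvd r" unfolding r by (rule gn_dvd_rd[OF S xset_cl ne])
  have ur: "u dvd r" by (rule dvd_trans[OF u(2) gr])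
  have uD: "u dvd x" if "x \<in> ?D" for x using gn_dvd(2)[OF that] u(2) dvd_trans by blast
  have per: "pset r ?D" unfolding periodic_def
  proof (intro allI impI)
    fix x y assume "r dvd x - y"
    then have "y + (x - y) \<in> ?D \<longleftrightarrow> y \<in> ?D"
      unfolding r by (rule rd_period[OF spair_pos[OF S] xs_per[OF S xset_cl]])
    then show "(x \<in> ?D) = (y \<in> ?D)" by simp
  qed
  have "cl (quot c r) (u * k) = ?D" unfolding cl_quot[OF S xr]
  proof
    show "splus ?D (mult r) \<subseteq> ?D" unfolding splus_def
    proof clarify
      fix a b assume "a \<in> ?D" "b \<in> mult r"
      then show "a + b \<in> ?D" using periodicD[OF per, of "a + b" a] by simp
    qed
    show "?D \<subseteq> splus ?D (mult r)" unfolding splus_def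
    proof
      fix a assume "a \<in> ?D"
      then show "a \<in> {a + b |a b. a \<in> ?D \<and> b \<in> mult r}" by (intro CollectI exI[of _ a] exI[of _ 0]) simp
    qed
  qed
  then have e: "cl (sec c u r) k = {x. u * x \<in> ?D}" unfolding sec_def cl_sub by simp
  have "u * gn (r div u) {x. u * x \<in> ?D} = gn r ?D"
    by (rule gn_sub[OF spair_left[OF spair_quot[OF S xr]] ur u0 uD])
  then show "u * gn (r div u) (cl (sec c u r) k) = gn N ?D" using gn_quot[OF S xr per gr] e by simp
  show "u * rd (cl (sec c u r) k) = r" unfolding e r[symmetric]
    using rd_sub[OF spair_left[OF spair_quot[OF S xr]] ur u0 per ne uD] r by simp
qed

lemma sec_sec: assumes "u * t = w" shows "sec c w r x = sec c u r (t * x)"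
  unfolding sec_def sub_def by (simp add: assms[symmetric] mult.assoc)

locale based_fibre = fibre +
  assumes base: "xdiv N c u \<Longrightarrow> xdiv N c r \<Longrightarrow> u dvd r \<Longrightarrow> Factorial_Ring.prime (r div u) \<Longrightarrow>
    \<exists>g g'. iso g g' \<and> gcd g r = u"
begin

lemma Sc: "spair N c c" by (rule spair_left[OF S])

lemma N0: "0 < N" by (rule spair_pos[OF S])

text \<open>A base point and its image that serve for all subgroups whose divisor contains
  \<open>p\<close> exactly \<open>e\<close> times. Depending on \<open>p\<close> and
  \<open>e\<close> only, it makes multipliers obtained from different classes comparable.\<close>

definition base_pair :: "int \<Rightarrow> nat \<Rightarrow> int \<times> int \<Rightarrow> bool" where
  "base_pair p e G \<longleftrightarrow> iso (fst G) (snd G) \<and> \<not> p ^ Suc e dvd fst G \<and>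
     (\<forall>d. xdiv N c d \<longrightarrow> multiplicity p d = e \<longrightarrow> d dvd fst G)"

lemma ex_base_pair:
  assumes p: "Factorial_Ring.prime p" and w: "xdiv N c w" "xdiv N c (w * p)"
  shows "\<exists>G. base_pair p (multiplicity p w) G"
proof -
  define e where "e = multiplicity p w"
  define A where "A = {d. xdiv N c d \<and> multiplicity p d = e}"
  have fin: "finite A"
    by (rule finite_subset[of _ "{d. d dvd N}"]) (use N0 xdiv_dvd in \<open>auto simp: A_def\<close>)
  have wA: "w \<in> A" using w(1) by (simp add: A_def e_def)
  \<comment> \<open>The set \<open>A\<close> is closed under lcm, so its largest member is a
    multiple of all others, that is, the smallest subgroup of this level. A base point for the
    section of order \<open>p\<close> below \<open>U\<close> lies in all the subgroups
    considered.\<close>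
  define U where "U = Max A"
  have UA: "U \<in> A" unfolding U_def using fin wA by (intro Max_in) auto
  have U: "xdiv N c U" "multiplicity p U = e" "0 < U" using UA xdiv_pos unfolding A_def by auto
  have dU: "d dvd U" if d: "d \<in> A" for d
  proof -
    have dx: "xdiv N c d" "multiplicity p d = e" "0 < d" using d xdiv_pos unfolding A_def by auto
    have "multiplicity p (lcm d U) = e"
      using dx U multiplicity_lcm[of d U p] p by simp
    then have "lcm d U \<in> A" using xdiv_lcm[OF Sc dx(1) U(1)] unfolding A_def by simp
    then have "lcm d U \<le> U" unfolding U_def using fin by (intro Max_ge) auto
    moreover have "U \<le> lcm d U" by (rule zdvd_imp_le) (use dx U in \<open>auto simp: lcm_pos_int\<close>)
    ultimately have "lcm d U = U" by simp
    then show ?thesis by (metis dvd_lcm1)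
  qed
  obtain a where a: "U = p ^ e * a" "\<not> p dvd a"
    using multiplicity_decompose'[of U p] U(2,3) p not_prime_unit by (metis less_irrefl)
  have "lcm U (w * p) = U * p"
  proof -
    obtain v where v: "U = w * v" using dU[OF wA] by blast
    have w0: "0 < w" by (rule xdiv_pos[OF w(1)])
    have "\<not> p dvd v"
    proof
      assume "p dvd v"
      moreover have "p ^ e dvd w" unfolding e_def by (rule multiplicity_dvd)
      ultimately have "p ^ e * p dvd U" unfolding v by (rule mult_dvd_mono[rotated])
      then show False using a p by simp
    qed
    then have cop: "coprime v p" using p by (metis coprime_commute prime_imp_coprime)
    have "v > 0" using v U(3) w0 by (simp add: zero_less_mult_iff)
    then have "lcm v p = v * p" using lcm_coprime[OF cop] prime_gt_0_int[OF p] by simp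
    moreover have "lcm (w * v) (w * p) = w * lcm v p" using lcm_mult_left[of w v p] w0 by simp
    ultimately show ?thesis using v by simp
  qed
  then have Up: "xdiv N c (U * p)" using xdiv_lcm[OF Sc U(1) w(2)] by simp
  obtain g g' where g: "iso g g'" "gcd g (U * p) = U"
    using base[OF U(1) Up] U(3) p by auto
  have "\<not> p ^ Suc e dvd g"
  proof
    assume "p ^ Suc e dvd g"
    moreover have "a dvd g" using g(2) a(1) by (metis dvd_trans dvd_triv_right gcd_dvd1)
    moreover have "coprime (p ^ Suc e) a" using a(2) p by (simp add: prime_imp_coprime)
    ultimately have "p ^ Suc e * a dvd g" by (rule divides_mult)
    then have "U * p dvd gcd g (U * p)" unfolding a(1) by (simp add: mult_ac)
    then have "U * p dvd U" using g(2) by simp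
    then have "p dvd 1" using U(3) by simp
    then show False using p not_prime_unit by blast
  qed
  moreover have "d dvd g" if "xdiv N c d" "multiplicity p d = e" for d
  proof -
    have "d dvd U" using dU that unfolding A_def by blast
    moreover have "U dvd g" using g(2) gcd_dvd1 by metis
    ultimately show ?thesis by (rule dvd_trans)
  qed
  ultimately show ?thesis using g(1) unfolding base_pair_def e_def by (intro exI[of _ "(g, g')"]) simp
qed

definition bp :: "int \<Rightarrow> nat \<Rightarrow> int \<times> int" where "bp p e = (SOME G. base_pair p e G)"

abbreviation "ua k \<equiv> gn N (cl c k)"
abbreviation "ra k \<equiv> rd (cl c k)"

text \<open>Below the radical \<open>ra k\<close> of its class, \<open>k\<close> has a regular part \<open>th\<close>, lying in the section of order
  \<open>ra k div w\<close>, on which the isomorphism is multiplication by \<open>m\<close>. At the other primes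
  where \<open>ua k\<close> and \<open>ra k\<close> differ, the class fills a section of composite order that has no intermediate
  subgroup, and any multiplier will do.\<close>
definition local_data :: "int \<Rightarrow> int \<Rightarrow> int \<Rightarrow> int \<Rightarrow> bool" where
  "local_data k w th m \<longleftrightarrow> xdiv N c w \<and> w dvd ra k \<and> w dvd th \<and>
    (\<forall>z. ra k dvd z - (k - th + m * th) \<longrightarrow> c k = c' z) \<and>
    (\<forall>d>0. d dvd ra k div w \<longrightarrow> xdiv N c (w * d)) \<and>
    (\<forall>p. Factorial_Ring.prime p \<longrightarrow> p dvd ra k div w \<longrightarrow>
      p ^ multiplicity p (ra k) dvd k - th \<and> multiplicity p w = multiplicity p (ua k) \<and>
      p ^ multiplicity p (ra k) dvd snd (bp p (multiplicity p (ua k))) - m * fst (bp p (multiplicity p (ua k)))) \<and>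
    (\<forall>p x x'. Factorial_Ring.prime p \<longrightarrow> p * p dvd ra k div w \<longrightarrow> R x x' \<longrightarrow> w dvd x \<longrightarrow>
      p ^ multiplicity p (ra k) dvd x' - m * x) \<and>
    (\<forall>p. Factorial_Ring.prime p \<longrightarrow> \<not> p dvd ra k div w \<longrightarrow> p ^ multiplicity p (ra k) dvd th \<and>
      (multiplicity p (ua k) < multiplicity p (ra k) \<longrightarrow> (\<exists>d1 d2. primitive_section N c d1 d2 \<and>
        multiplicity p d1 = multiplicity p (ua k) \<and> multiplicity p d2 = multiplicity p (ra k))))"

lemma bp: "base_pair p e G \<Longrightarrow> base_pair p e (bp p e)"
  unfolding bp_def by (rule someI)

text \<open>In the section between \<open>ua k\<close> and \<open>ra k\<close> the class of
  \<open>k\<close> generates everything and has trivial radical, so it has a regular part. That part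
  is a class of units of the smaller section between \<open>w\<close> and \<open>ra k\<close>, where
  the chosen base points \<open>bp\<close> determine the multiplier.\<close>

lemma ex_local_data: "\<exists>w th m. local_data k w th m"
proof -
  define u r where "u = ua k" and "r = ra k"
  have xu: "xdiv N c u" and xr: "xdiv N c r" and ur: "u dvd r" and u0: "0 < u" and r0: "0 < r"
  proof -
    have ne: "cl c k \<noteq> {}" by auto
    show "xdiv N c u" "xdiv N c r" "u dvd r" unfolding u_def r_def by (rule class_section[OF Sc xset_cl ne])+
    then show "0 < u" "0 < r" using xdiv_pos by blast+
  qed
  have "k \<in> cl c k" by simp
  then have "u dvd k" unfolding u_def by (rule gn_dvd(2))
  then obtain k1 where k1: "k = u * k1" by blast
  define n where "n = r div u"
  have rn: "r = u * n" using ur by (simp add: n_def)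
  have n0: "0 < n" using r0 u0 unfolding rn by (simp add: zero_less_mult_iff)
  note SC = spair_sec[OF S xu xr ur]
  have S2: "spair n (sec c u r) (sec c' u r)" using SC unfolding n_def .
  have S2c: "spair n (sec c u r) (sec c u r)" by (rule spair_left[OF S2])
  have gC: "gn n (cl (sec c u r) k1) = 1" "rd (cl (sec c u r) k1) = n"
  proof -
    have e: "r = rd (cl c (u * k1))" "u dvd gn N (cl c (u * k1))" unfolding r_def u_def k1[symmetric, unfolded u_def] by simp_all
    have "u * gn n (cl (sec c u r) k1) = u * 1"
      using sec_class(1)[OF Sc e(1) xu e(2)] k1 unfolding u_def n_def r_def by simp
    then show "gn n (cl (sec c u r) k1) = 1" using u0 by simp
    have "u * rd (cl (sec c u r) k1) = u * n" using sec_class(2)[OF Sc e(1) xu e(2)] rn by simp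
    then show "rd (cl (sec c u r) k1) = n" using u0 by simp
  qed
  obtain t h where th: "regular_part n (sec c u r) (sec c' u r) k1 t h" using ex_regular_part[OF S2 gC] by blast
  have t: "0 < t" "t dvd n" "coprime t (n div t)" "xdiv n (sec c u r) t"
      "gn n (cl (sec c u r) h) = t" "rd (cl (sec c u r) h) = n" "n div t dvd k1 - h"
    and units: "\<And>x p. sec c u r x = sec c u r h \<Longrightarrow> Factorial_Ring.prime p \<Longrightarrow> p dvd n div t \<Longrightarrow> \<not> t * p dvd x"
    and prm: "\<And>p. Factorial_Ring.prime p \<Longrightarrow> p dvd t \<Longrightarrow>
       (\<exists>d1 d2. primitive_section n (sec c u r) d1 d2 \<and> \<not> p dvd d1 \<and> \<not> p dvd n div d2)"
    and img: "\<And>h'. sec c u r h = sec c' u r h' \<Longrightarrow> sec c u r k1 = sec c' u r (k1 - h + h')"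
    using th unfolding regular_part_def by blast+
  define s where "s = n div t"
  have nts: "n = t * s" using t(2) by (simp add: s_def)
  have s0: "0 < s" using n0 t(1) unfolding nts by (simp add: zero_less_mult_iff)
  have cts: "coprime t s" using t(3) unfolding s_def .
  define w where "w = u * t"
  have w0: "0 < w" unfolding w_def using u0 t(1) by simp
  have rws: "r = w * s" unfolding rn nts w_def by simp
  have rw: "r div w = s" unfolding rws using w0 by simp
  have wr: "w dvd r" unfolding rws by simp
  have nn: "n = r div u" by (simp add: n_def)
  have sxd: "xdiv N c (u * d)" if "xdiv n (sec c u r) d" for d
  proof -
    have "xdiv r (quot c r) u" using xdiv_quot_iff[OF Sc xr ur] xu by blast
    then have 1: "xdiv r (quot c r) (u * d)"
      using that xdiv_sub_iff[OF spair_left[OF spair_quot[OF S xr]], of u d] unfolding sec_def nn by blast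
    show ?thesis using xdiv_quot_iff[OF Sc xr xdiv_dvd[OF 1]] 1 by blast
  qed
  have sxd': "xdiv n (sec c u r) d" if "xdiv N c (u * d)" "u * d dvd r" for d
  proof -
    have "xdiv r (quot c r) u" using xdiv_quot_iff[OF Sc xr ur] xu by blast
    moreover have "xdiv r (quot c r) (u * d)" using xdiv_quot_iff[OF Sc xr that(2)] that(1) by blast
    ultimately show ?thesis
      using xdiv_sub_iff[OF spair_left[OF spair_quot[OF S xr]], of u d] unfolding sec_def nn by blast
  qed
  have xw: "xdiv N c w" unfolding w_def by (rule sxd[OF t(4)])
  have "h \<in> cl (sec c u r) h" by simp
  then have "t dvd h" using gn_dvd(2)[of h _ n] t(5) by metis
  then obtain h1 where h1: "h = t * h1" by blast
  have ss: "sec c w r x = sec c u r (t * x)" for x by (rule sec_sec) (simp add: w_def)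
  have ss': "sec c' w r x = sec c' u r (t * x)" for x by (rule sec_sec) (simp add: w_def)
  have Sw: "spair s (sec c w r) (sec c w r)" using spair_left[OF spair_sec[OF S xw xr wr]] unfolding rw .
  have reg: "regular s (sec c w r) h1"
  proof
    show "spair s (sec c w r) (sec c w r)" by (rule Sw)
    have "{x. t * x \<in> cl (sec c u r) h} = cl (sec c w r) h1" unfolding cl_def ss h1 by simp
    moreover have "t * rd {x. t * x \<in> cl (sec c u r) h} = n"
    proof -
      have "t * rd {x. t * x \<in> cl (sec c u r) h} = rd (cl (sec c u r) h)"
      proof (rule rd_sub[OF S2c t(2,1) xs_per[OF S2c xset_cl]])
        show "cl (sec c u r) h \<noteq> {}" by auto
        show "t dvd x" if "x \<in> cl (sec c u r) h" for x using gn_dvd(2)[OF that, of n] t(5) by metis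
      qed
      then show ?thesis using t(6) by simp
    qed
    ultimately show "rd (cl (sec c w r) h1) = s" using nts t(1) by simp
    show "coprime x s" if x: "sec c w r x = sec c w r h1" for x
    proof (rule coprime_primesI)
      show "s \<noteq> 0" using s0 by simp
      fix p assume p: "Factorial_Ring.prime p" "p dvd x" "p dvd s"
      have "sec c u r (t * x) = sec c u r h" using x unfolding ss h1 .
      then have "\<not> t * p dvd t * x" using units p(1,3) unfolding s_def by blast
      then show False using p(2) by simp
    qed
  qed
  interpret reg: regular s "sec c w r" h1 by (rule reg)
  have div: "xdiv N c (w * d)" if d: "0 < d" "d dvd s" for d
  proof -
    have 1: "xdiv s (sec c w r) d" by (rule reg.xdiv_all[OF d])
    have q: "xdiv r (quot c r) w" using xdiv_quot_iff[OF Sc xr wr] xw by blast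
    have 2: "xdiv r (quot c r) (w * d)"
      using 1 xdiv_sub_iff[OF spair_left[OF spair_quot[OF S xr]] q, of d] unfolding sec_def rw by blast
    show ?thesis using xdiv_quot_iff[OF Sc xr xdiv_dvd[OF 2]] 2 by blast
  qed
  have vw: "multiplicity p w = multiplicity p u" if p: "Factorial_Ring.prime p" "p dvd s" for p
  proof -
    have "\<not> p dvd t" using cts p by (metis coprime_common_divisor not_prime_unit)
    then show ?thesis unfolding w_def by (rule multiplicity_times_nondvd[OF p(1)]) (use u0 in simp)
  qed
  have bpp: "base_pair p (multiplicity p u) (bp p (multiplicity p u))" if p: "Factorial_Ring.prime p" "p dvd s" for p
  proof -
    have "xdiv N c (w * p)" by (rule div[OF _ p(2)]) (use p in \<open>simp add: prime_gt_0_int\<close>)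
    then show ?thesis using ex_base_pair[OF p(1) xw] bp vw[OF p] by metis
  qed
  interpret F: fibre s "sec c w r" "sec c' w r" "sec_fibre w r R"
    using fibre_sec[OF xw xr wr] unfolding rw .
  define g g' where "g p = fst (bp p (multiplicity p u))" and "g' p = snd (bp p (multiplicity p u))" for p
  have gg: "w dvd g p \<and> w dvd g' p \<and> F.iso (g p div w) (g' p div w) \<and> \<not> p dvd g p div w"
    if p: "Factorial_Ring.prime p" "p dvd s" for p
  proof -
    have b: "iso (g p) (g' p)" "\<not> p ^ Suc (multiplicity p u) dvd g p" "w dvd g p"
      using bpp[OF p] vw[OF p] xw unfolding base_pair_def g_def g'_def by blast+
    have "c (g p) = c' (g' p)" using b(1) unfolding iso_def by (intro R_colour) blast
    then have w': "w dvd g' p" using xdiv_iff[OF S xw] b(3) by blast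
    obtain a a' where a: "g p = w * a" "g' p = w * a'" using b(3) w' by blast
    have ga: "g p div w = a" "g' p div w = a'" using a w0 by simp_all
    have "F.iso a a'" unfolding F.iso_def
      using iso_sec[OF xw xr wr b(1)[unfolded a]] unfolding rw by blast
    moreover have "\<not> p dvd a"
    proof
      assume pa: "p dvd a"
      have "p ^ multiplicity p w dvd w" by (rule multiplicity_dvd)
      then have "p ^ multiplicity p w * p dvd w * a" using pa by (rule mult_dvd_mono)
      then show False using b(2) vw[OF p] a(1) by (simp add: mult.commute)
    qed
    ultimately show ?thesis unfolding ga using b(3) w' by blast
  qed
  have "\<exists>m. coprime m s \<and> (\<forall>x. coprime x s \<longrightarrow> sec c w r x = sec c' w r (m * x)) \<and>
    (\<forall>p. Factorial_Ring.prime p \<longrightarrow> p dvd s \<longrightarrow> p ^ multiplicity p s dvd (g' p div w) - m * (g p div w)) \<and>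
    (\<forall>p y y'. Factorial_Ring.prime p \<longrightarrow> p * p dvd s \<longrightarrow> sec_fibre w r R y y' \<longrightarrow> p ^ multiplicity p s dvd y' - m * y)"
    by (rule F.regular_multiplier[OF reg]) (use gg in blast)
  then obtain m where m: "\<And>x. coprime x s \<Longrightarrow> sec c w r x = sec c' w r (m * x)"
     "\<And>p. Factorial_Ring.prime p \<Longrightarrow> p dvd s \<Longrightarrow> p ^ multiplicity p s dvd (g' p div w) - m * (g p div w)"
     "\<And>p y y'. Factorial_Ring.prime p \<Longrightarrow> p * p dvd s \<Longrightarrow> sec_fibre w r R y y' \<Longrightarrow> p ^ multiplicity p s dvd y' - m * y"
    by blast
  have vr: "multiplicity p r = multiplicity p w + multiplicity p s" if "Factorial_Ring.prime p" for p
    unfolding rws by (rule prime_elem_multiplicity_mult_distrib) (use that w0 s0 in auto)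
  have lift: "p ^ multiplicity p r dvd w * y" if "Factorial_Ring.prime p" "p ^ multiplicity p s dvd y" for p y
    unfolding vr[OF that(1)] power_add by (rule mult_dvd_mono[OF multiplicity_dvd that(2)])
  have "local_data k w (u * h) m"
    unfolding local_data_def u_def[symmetric] r_def[symmetric] rw
  proof (intro conjI allI impI)
    show "xdiv N c w" "w dvd r" by fact+
    show "w dvd u * h" unfolding h1 w_def by simp
    show "xdiv N c (w * d)" if "0 < d" "d dvd s" for d by (rule div[OF that])
    show "c k = c' z" if z: "r dvd z - (k - u * h + m * (u * h))" for z
    proof -
      have "sec c w r h1 = sec c' w r (m * h1)" by (rule m(1)[OF reg.units]) simp
      then have "sec c u r h = sec c' u r (m * h)" unfolding ss ss' h1 by (simp add: mult_ac)
      then have "quot c r k = quot c' r (u * (k1 - h + m * h))" using img unfolding sec_def sub_def k1 by blast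
      then obtain y where y: "c k = c' y" "r dvd y - u * (k1 - h + m * h)" by (rule quot_obtain)
      have "r dvd (z - (k - u * h + m * (u * h))) - (y - u * (k1 - h + m * h))" by (rule dvd_diff[OF z y(2)])
      then have "r dvd z - y" unfolding k1 by (simp add: algebra_simps)
      then have "rd (cl c' y) dvd z - y" using rd_eq[OF S xs_cl[where c = c and c' = c', OF y(1)]] unfolding r_def by simp
      then show ?thesis using cl_period[OF spair_right[OF S]] y(1) by metis
    qed
    fix p :: int assume p: "Factorial_Ring.prime p"
    { assume ps: "p dvd s"
      show "p ^ multiplicity p r dvd k - u * h"
      proof -
        have "s dvd k1 - h" using t(7) unfolding s_def .
        then have "p ^ multiplicity p s dvd k1 - h" using multiplicity_dvd dvd_trans by blast
        then have "p ^ multiplicity p u * p ^ multiplicity p s dvd u * (k1 - h)" by (rule mult_dvd_mono[OF multiplicity_dvd])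
        then show ?thesis unfolding vr[OF p] vw[OF p ps] power_add k1 by (simp add: right_diff_distrib)
      qed
      show "multiplicity p w = multiplicity p u" by (rule vw[OF p ps])
      show "p ^ multiplicity p r dvd snd (bp p (multiplicity p u)) - m * fst (bp p (multiplicity p u))"
      proof -
        have e: "w * ((g' p div w) - m * (g p div w)) = g' p - m * g p" using gg[OF p ps] by (auto simp: algebra_simps)
        show ?thesis using lift[OF p m(2)[OF p ps]] unfolding e unfolding g_def g'_def .
      qed }
    show "p ^ multiplicity p r dvd x' - m * x" if "p * p dvd s" "R x x'" "w dvd x" for x x'
    proof -
      note wx = that(3)
      have "w dvd x'" using xdiv_iff[OF S xw R_colour[OF that(2)]] that(3) by simp
      then obtain y y' where y: "x = w * y" "x' = w * y'" using wx by blast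
      have "sec_fibre w r R y y'" unfolding sec_fibre_def using that(2) y by (intro exI[of _ x] exI[of _ x']) simp
      from lift[OF p m(3)[OF p that(1) this]] show ?thesis unfolding y by (simp add: algebra_simps)
    qed
    assume ps: "\<not> p dvd s"
    have v0: "multiplicity p r = multiplicity p w" using vr[OF p] not_dvd_imp_multiplicity_0[OF ps] by simp
    have "p ^ multiplicity p w dvd u * h" using dvd_trans[OF multiplicity_dvd, of w] unfolding h1 w_def by simp
    then show "p ^ multiplicity p r dvd u * h" unfolding v0 .
    show "\<exists>d1 d2. primitive_section N c d1 d2 \<and> multiplicity p d1 = multiplicity p u \<and> multiplicity p d2 = multiplicity p r"
      if less: "multiplicity p u < multiplicity p r"
    proof -
      have "p dvd t"
      proof (rule ccontr)
        assume "\<not> p dvd t"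
        then have "multiplicity p w = multiplicity p u" unfolding w_def by (rule multiplicity_times_nondvd[OF p]) (use u0 in simp)
        then show False using less v0 by simp
      qed
      then obtain d1 d2 where d: "primitive_section n (sec c u r) d1 d2" "\<not> p dvd d1" "\<not> p dvd n div d2"
        using prm p by blast
      have q: "xdiv r (quot c r) u" using xdiv_quot_iff[OF Sc xr ur] xu by blast
      have P: "primitive_section r (quot c r) (u * d1) (u * d2)"
        by (rule primitive_section_sub[OF spair_left[OF spair_quot[OF S xr]] q]) (use d(1) in \<open>unfold sec_def nn\<close>)
      have d2r: "u * d2 dvd r" using P xdiv_dvd unfolding primitive_section_def by blast
      have "primitive_section N c (u * d1) (u * d2)" unfolding primitive_section_def
      proof (intro conjI allI impI)
        have dv: "xdiv N c x" if "xdiv r (quot c r) x" for x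
          using that xdiv_quot_iff[OF Sc xr xdiv_dvd[OF that]] by blast
        show "xdiv N c (u * d1)" "xdiv N c (u * d2)" using P dv unfolding primitive_section_def by blast+
        show "u * d1 dvd u * d2" "\<not> Factorial_Ring.prime (u * d2 div (u * d1))" using P unfolding primitive_section_def by blast+
        fix x assume x: "xdiv N c x" "u * d1 dvd x" "x dvd u * d2"
        then have "x dvd r" using d2r dvd_trans by blast
        then have "xdiv r (quot c r) x" using x xdiv_quot_iff[OF Sc xr] by blast
        then show "x = u * d1 \<or> x = u * d2" using P x unfolding primitive_section_def by blast
      qed
      moreover have "multiplicity p (u * d1) = multiplicity p u" using multiplicity_times_nondvd[OF p d(2)] u0 by simp
      moreover have "multiplicity p (u * d2) = multiplicity p r"
      proof -
        have d2: "d2 dvd n" "0 < d2" using d(1) xdiv_dvd xdiv_pos unfolding primitive_section_def by blast+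
        then have "r = (u * d2) * (n div d2)" unfolding rn by simp
        then show ?thesis using multiplicity_times_nondvd[OF p d(3), of "u * d2"] u0 d2(2) by simp
      qed
      ultimately show ?thesis by blast
    qed
  qed
  then show ?thesis by blast
qed

end

section \<open>Interpolating the multipliers\<close>

lemma prime_power_cancel:
  assumes p: "Factorial_Ring.prime (p::int)" and g: "\<not> p ^ Suc e dvd g" "p ^ e dvd g" and x: "p ^ n dvd x * g" and e: "e \<le> n" "p ^ e dvd D"
  shows "p ^ n dvd x * D"
proof -
  obtain a where a: "g = p ^ e * a" using g(2) by blast
  have p0: "p ^ e \<noteq> 0" using p by auto
  have "\<not> p dvd a" using g(1) p0 unfolding a by (simp add: mult.commute)
  then have "coprime (p ^ (n - e)) a" using p by (simp add: prime_imp_coprime)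
  moreover have ne: "p ^ n = p ^ e * p ^ (n - e)" using e(1) by (simp add: power_add[symmetric])
  then have "p ^ e * p ^ (n - e) dvd p ^ e * (x * a)" using x unfolding a by (simp add: mult_ac)
  then have "p ^ (n - e) dvd x * a" using dvd_mult_cancel_left p0 by blast
  ultimately have "p ^ (n - e) dvd x" by (simp add: coprime_dvd_mult_left_iff)
  then have "p ^ (n - e) * p ^ e dvd x * D" using e(2) by (rule mult_dvd_mono)
  then show ?thesis using ne by (simp add: mult.commute)
qed

text \<open>Downward recursion on the level. Each residue is split into a multiple of
  \<open>W\<close> and a remainder; the function built so far is used on the multiple and the new
  slope on the remainder. Compatibility of neighbouring slopes reconciles the two.\<close>

lemma interpolate:
  fixes p :: int and w :: "nat \<Rightarrow> nat" and m :: "nat \<Rightarrow> int"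
  assumes mono: "\<And>i j. i \<le> j \<Longrightarrow> j \<le> V \<Longrightarrow> w i \<le> w j"
    and m: "\<And>j D. Suc j \<le> V \<Longrightarrow> p ^ w (Suc j) dvd D \<Longrightarrow> p ^ j dvd (m (Suc j) - m j) * D"
  shows "\<exists>f. \<forall>j a b. j \<le> V \<longrightarrow> p ^ w j dvd b - a \<longrightarrow> p ^ j dvd f b - f a - m j * (b - a)"
proof -
  have "\<exists>f. \<forall>j a b. V - i \<le> j \<longrightarrow> j \<le> V \<longrightarrow> p ^ w j dvd b - a \<longrightarrow> p ^ j dvd f b - f a - m j * (b - a)" for i
  proof (induction i)
    case 0
    show ?case by (rule exI[of _ "\<lambda>a. m V * a"]) (simp add: algebra_simps)
  next
    case (Suc i)
    then obtain f where f: "\<And>j a b. V - i \<le> j \<Longrightarrow> j \<le> V \<Longrightarrow> p ^ w j dvd b - a \<Longrightarrow> p ^ j dvd f b - f a - m j * (b - a)"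
      by blast
    show ?case
    proof (cases "i < V")
      case False
      then show ?thesis using f by (intro exI[of _ f]) auto
    next
      case True
      define s where "s = V - Suc i"
      have s: "V - i = Suc s" "Suc s \<le> V" using True by (simp_all add: s_def)
      define W where "W = p ^ w (Suc s)"
      \<comment> \<open>Points congruent modulo \<open>W\<close> have the same remainder, so
        \<open>h\<close> inherits all higher levels from \<open>f\<close>. At level \<open>s\<close>
        the slope \<open>m s\<close> acts on the remainder and may replace \<open>m (Suc s)\<close>
        on multiples of \<open>W\<close>.\<close>
      define h where "h a = f (a - a mod W) + m s * (a mod W)" for a
      have "p ^ j dvd h b - h a - m j * (b - a)" if j: "s \<le> j" "j \<le> V" and d: "p ^ w j dvd b - a" for j a b
      proof (cases "j = s")
        case True
        define D where "D = (b - b mod W) - (a - a mod W)"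
        have WD: "W dvd D" unfolding D_def minus_mod_eq_mult_div by simp
        have "p ^ Suc s dvd f (b - b mod W) - f (a - a mod W) - m (Suc s) * D"
          using f[of "Suc s" "b - b mod W" "a - a mod W"] s WD unfolding W_def D_def by simp
        then have 1: "p ^ s dvd f (b - b mod W) - f (a - a mod W) - m (Suc s) * D" by (metis dvd_mult_right power_Suc)
        have 2: "p ^ s dvd (m (Suc s) - m s) * D" by (rule m[OF s(2) WD[unfolded W_def]])
        have "h b - h a - m s * (b - a) = (f (b - b mod W) - f (a - a mod W) - m (Suc s) * D) + (m (Suc s) - m s) * D"
          unfolding h_def D_def by (simp add: algebra_simps)
        then show ?thesis using dvd_add[OF 1 2] True by simp
      next
        case False
        then have j': "V - i \<le> j" using j s by simp
        have "W dvd p ^ w j" unfolding W_def by (rule le_imp_power_dvd) (rule mono, use j' j s in auto)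
        then have "W dvd b - a" using d by (rule dvd_trans)
        then have e: "b mod W = a mod W" by (simp add: mod_eq_dvd_iff)
        have "p ^ j dvd f (b - b mod W) - f (a - b mod W) - m j * ((b - b mod W) - (a - b mod W))"
          by (rule f[OF j' j(2)]) (use d in simp)
        then show ?thesis unfolding h_def e by (simp add: algebra_simps)
      qed
      then show ?thesis unfolding s_def[symmetric] by blast
    qed
  qed
  from this[of V] show ?thesis by simp
qed

context based_fibre begin

definition lw :: "int \<Rightarrow> int" where "lw k = (SOME w. \<exists>th m. local_data k w th m)"
definition lt :: "int \<Rightarrow> int" where "lt k = (SOME th. \<exists>m. local_data k (lw k) th m)"
definition lm :: "int \<Rightarrow> int" where "lm k = (SOME m. local_data k (lw k) (lt k) m)"

lemma local_data: "local_data k (lw k) (lt k) (lm k)"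
proof -
  have "\<exists>th m. local_data k (lw k) th m" unfolding lw_def by (rule someI_ex[OF ex_local_data])
  then have "\<exists>m. local_data k (lw k) (lt k) m" unfolding lt_def by (rule someI_ex)
  then show ?thesis unfolding lm_def by (rule someI_ex)
qed

lemmas ld = local_data[unfolded local_data_def]

text \<open>The exponents from \<open>al\<close> up to \<open>be\<close> form the
  \<open>p\<close>-adic range of the class of \<open>k\<close>: the exponents of \<open>p\<close> in
  the subgroup that it generates and in its radical.\<close>

definition al :: "int \<Rightarrow> int \<Rightarrow> nat" where "al p k = multiplicity p (ua k)"
definition be :: "int \<Rightarrow> int \<Rightarrow> nat" where "be p k = multiplicity p (ra k)"
definition regp :: "int \<Rightarrow> int \<Rightarrow> bool" where "regp p k \<longleftrightarrow> p dvd ra k div lw k"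
text \<open>The default \<open>1\<close> is harmless where \<open>p\<close> is not regular: the
  class fills the primitive section there, so any slope is admissible.\<close>

definition mu :: "int \<Rightarrow> int \<Rightarrow> int" where "mu p k = (if regp p k then lm k else 1)"

lemma lw: "xdiv N c (lw k)" "0 < lw k" "lw k dvd ra k"
  using ld xdiv_pos by blast+

lemma ra_pos: "0 < ra k"
  by (rule rd_pos[OF N0 xs_per[OF Sc xset_cl]])

lemma ra_dvd: "ra k dvd N"
  by (rule rd_dvd[OF N0 xs_per[OF Sc xset_cl]])

lemma be_eq: assumes p: "Factorial_Ring.prime p" shows "be p k = multiplicity p (lw k) + multiplicity p (ra k div lw k)"
proof -
  have e: "ra k = lw k * (ra k div lw k)" using lw by simp
  have "ra k div lw k \<noteq> 0" using ra_pos[of k] e by auto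
  then have "multiplicity p (lw k * (ra k div lw k)) = multiplicity p (lw k) + multiplicity p (ra k div lw k)"
    by (intro prime_elem_multiplicity_mult_distrib) (use p lw(2)[of k] in auto)
  then show ?thesis unfolding be_def e[symmetric] .
qed

lemma regular_powers:
  assumes p: "Factorial_Ring.prime p" and r: "regp p k"
  shows "multiplicity p (lw k) = al p k" "al p k < be p k" "be p k = al p k + multiplicity p (ra k div lw k)"
    "j \<le> be p k - al p k \<Longrightarrow> xdiv N c (lw k * p ^ j)"
    "base_pair p (al p k) (bp p (al p k))"
    "p ^ be p k dvd snd (bp p (al p k)) - lm k * fst (bp p (al p k))"
proof -
  have rp: "p dvd ra k div lw k" using r unfolding regp_def .
  show a: "multiplicity p (lw k) = al p k" using ld p rp unfolding al_def by blast
  show b: "be p k = al p k + multiplicity p (ra k div lw k)" using be_eq[OF p] a by simp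
  have nz: "ra k div lw k \<noteq> 0" using lw(2,3)[of k] ra_pos[of k] by auto
  have "0 < multiplicity p (ra k div lw k)"
    using prime_multiplicity_gt_zero_iff[OF prime_imp_prime_elem[OF p] nz] rp by blast
  then show l: "al p k < be p k" using b by simp
  show x: "xdiv N c (lw k * p ^ j)" if "j \<le> be p k - al p k" for j
  proof -
    have "p ^ j dvd ra k div lw k" by (rule multiplicity_dvd') (use that b in simp)
    moreover have "0 < p ^ j" using p by (simp add: prime_gt_0_int)
    ultimately show ?thesis using ld by blast
  qed
  show "base_pair p (al p k) (bp p (al p k))"
  proof -
    have "xdiv N c (lw k * p)" using x[of 1] l by simp
    then obtain G where "base_pair p (al p k) G" using ex_base_pair[OF p lw(1)[of k]] unfolding a by blast
    then show ?thesis by (rule bp)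
  qed
  show "p ^ be p k dvd snd (bp p (al p k)) - lm k * fst (bp p (al p k))"
    using ld p rp unfolding al_def be_def by blast
qed

lemma not_regular:
  assumes p: "Factorial_Ring.prime p" and r: "\<not> regp p k" "al p k < be p k"
  obtains d1 d2 where "primitive_section N c d1 d2" "multiplicity p d1 = al p k" "multiplicity p d2 = be p k"
  using ld p r unfolding regp_def al_def be_def by blast

text \<open>The regular class supplies two subgroups whose divisors differ by one factor
  \<open>p\<close> at a level inside the range of the other class. Projected into the primitive
  section they become its two ends, whose quotient then divides \<open>p\<close>; but the section
  does not have prime order.\<close>

lemma regular_not_regular:
  assumes p: "Factorial_Ring.prime p" and k: "regp p k" and l: "\<not> regp p l"
    and o: "al p k < be p l" "al p l < be p k" "al p l < be p l"
  shows False
proof -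
  define s where "s = max (al p k) (al p l)"
  have s: "al p k \<le> s" "s < be p k" "al p l \<le> s" "s < be p l"
    using o regular_powers(2)[OF p k] unfolding s_def by auto
  obtain d1 d2 where d: "primitive_section N c d1 d2" and v1: "multiplicity p d1 = al p l" and v2: "multiplicity p d2 = be p l"
    using not_regular[OF p l o(3)] .
  have xd: "xdiv N c d1" "xdiv N c d2" "d1 dvd d2" "0 < d1" "0 < d2"
    using d xdiv_pos unfolding primitive_section_def by blast+
  define Z where "Z = lw k * p ^ (s - al p k)"
  \<comment> \<open>The projection of a subgroup to the interval between \<open>d1\<close> and
    \<open>d2\<close>. By primitivity it takes only the two values \<open>d1\<close> and
    \<open>d2\<close>.\<close>
  define E where "E Y = lcm d1 (gcd d2 Y)" for Y
  have p0: "0 < p" using p by (simp add: prime_gt_0_int)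
  have xZ: "xdiv N c Z" unfolding Z_def by (rule regular_powers(4)[OF p k]) (use s in simp)
  have "Z * p = lw k * p ^ (Suc s - al p k)" unfolding Z_def using s(1) by (simp add: Suc_diff_le mult_ac)
  then have xZp: "xdiv N c (Z * p)" using regular_powers(4)[OF p k, of "Suc s - al p k"] s by simp
  have Z0: "0 < Z" by (rule xdiv_pos[OF xZ])
  have vZ: "multiplicity p Z = s"
  proof -
    have "multiplicity p Z = multiplicity p (lw k) + multiplicity p (p ^ (s - al p k))"
      unfolding Z_def by (rule prime_elem_multiplicity_mult_distrib) (use p p0 lw(2)[of k] in auto)
    then show ?thesis using regular_powers(1)[OF p k] s(1) multiplicity_same_power[of p "s - al p k"] p p0 not_prime_unit by auto
  qed
  have vZp: "multiplicity p (Z * p) = Suc s"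
  proof -
    have "multiplicity p (Z * p) = multiplicity p Z + multiplicity p p"
      by (rule prime_elem_multiplicity_mult_distrib) (use p p0 Z0 in auto)
    then show ?thesis using vZ multiplicity_same_power[of p 1] p p0 not_prime_unit by auto
  qed
  have E: "E Y = d1 \<or> E Y = d2" if Y: "xdiv N c Y" for Y
  proof -
    have "xdiv N c (E Y)" unfolding E_def by (rule xdiv_lcm[OF Sc xd(1) xdiv_gcd[OF Sc xd(2) Y]])
    moreover have "d1 dvd E Y" "E Y dvd d2" unfolding E_def using xd(3) by simp_all
    ultimately show ?thesis using d unfolding primitive_section_def by blast
  qed
  have vE: "multiplicity p (E Y) = max (al p l) (min (be p l) (multiplicity p Y))" if "0 < Y" for Y
    unfolding E_def using multiplicity_lcm[of d1 "gcd d2 Y" p] multiplicity_gcd[of d2 Y p] that xd p v1 v2 by simp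
  have a: "multiplicity p (E Z) = s" "multiplicity p (E (Z * p)) = Suc s"
    using vE[OF Z0] vE[of "Z * p"] Z0 p0 vZ vZp s by simp_all
  have E1: "E Z = d1" using E[OF xZ] a(1) v2 s by auto
  have E2: "E (Z * p) = d2" using E[OF xZp] a(2) v1 s by auto
  have "E (Z * p) dvd p * E Z"
  proof -
    have "gcd d2 (Z * p) dvd p * gcd d2 Z"
    proof -
      have "gcd d2 (Z * p) dvd gcd (p * d2) (p * Z)" by (simp add: mult.commute)
      then show ?thesis using p0 by (simp add: gcd_mult_distrib_int[symmetric] abs_mult)
    qed
    moreover have "p * gcd d2 Z dvd p * E Z" unfolding E_def by simp
    ultimately have "gcd d2 (Z * p) dvd p * E Z" using dvd_trans by blast
    then show ?thesis unfolding E_def by (intro lcm_least) simp_all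
  qed
  then have "d2 dvd p * d1" unfolding E1 E2 .
  moreover obtain q where q: "d2 = d1 * q" using xd(3) by blast
  ultimately have "q dvd p" using xd(4) by (simp add: mult.commute)
  moreover have "q \<noteq> 1" using q E1 E2 a by auto
  moreover have "0 < q" using q xd by (simp add: zero_less_mult_iff)
  ultimately have "q = p" using p by (metis prime_int_iff less_imp_le)
  moreover have "d2 div d1 = q" using q xd(4) by simp
  ultimately show False using d p unfolding primitive_section_def by blast
qed

text \<open>The range of \<open>l\<close> starts strictly below that of \<open>k\<close> and
  continues beyond its start, so its section has order divisible by \<open>p * p\<close> and
  \<open>lm l\<close> describes the whole fibre there. Evaluated near the base point of
  \<open>k\<close>, it must agree with \<open>lm k\<close>.\<close>

lemma multiplier_compat:
  assumes p: "Factorial_Ring.prime p" and k: "regp p k" and l: "regp p l"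
    and o: "al p l < al p k" "al p k < be p l" and B: "B \<le> be p k" "B \<le> be p l" "al p k \<le> B" and D: "p ^ al p k dvd D"
  shows "p ^ B dvd (lm l - lm k) * D"
proof -
  define g g' where "g = fst (bp p (al p k))" and "g' = snd (bp p (al p k))"
  have b: "iso g g'" "\<not> p ^ Suc (al p k) dvd g" "lw k dvd g"
    using regular_powers(1,5)[OF p k] lw(1)[of k] unfolding base_pair_def g_def g'_def by blast+
  have p0: "0 < p" using p by (simp add: prime_gt_0_int)
  define j where "j = B - al p k"
  have x: "xdiv N c (lw k * p ^ j)" by (rule regular_powers(4)[OF p k]) (use B in \<open>simp add: j_def\<close>)
  have Bd: "p ^ B dvd lw k * p ^ j"
  proof -
    have "p ^ al p k dvd lw k" using multiplicity_dvd[of p "lw k"] regular_powers(1)[OF p k] by simp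
    then have "p ^ al p k * p ^ j dvd lw k * p ^ j" by (rule mult_dvd_mono) simp
    then show ?thesis unfolding power_add[symmetric] j_def using B(3) by simp
  qed
  have lw0: "lw l \<noteq> 0" "lw k \<noteq> 0" using lw(2) by (metis less_irrefl)+
  have "gcd (lw l) (lw k * p ^ j) dvd lw k"
  proof (rule multiplicity_le_imp_dvd)
    let ?e = "gcd (lw l) (lw k * p ^ j)"
    show e0: "?e \<noteq> 0" using lw0 by simp
    fix q :: int assume q: "Factorial_Ring.prime q"
    show "multiplicity q ?e \<le> multiplicity q (lw k)"
    proof (cases "q = p")
      case True
      have "multiplicity p ?e \<le> multiplicity p (lw l)" by (rule dvd_imp_multiplicity_le) (use lw0 in auto)
      then show ?thesis using True regular_powers(1)[OF p k] regular_powers(1)[OF p l] o(1) by simp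
    next
      case False
      have "multiplicity q ?e \<le> multiplicity q (lw k * p ^ j)" by (rule dvd_imp_multiplicity_le) (use lw0 p0 in auto)
      moreover have "\<not> q dvd p ^ j" using False p q by (metis prime_dvd_power primes_dvd_imp_eq)
      ultimately show ?thesis using multiplicity_times_nondvd[OF q] lw0(2) by metis
    qed
  qed
  then have "gcd (lw l) (lw k * p ^ j) dvd g" using b(3) by (rule dvd_trans)
  then obtain s where s: "lw k * p ^ j dvd s * lw l - g" using solve_cong by blast
  \<comment> \<open>The base point \<open>g\<close> need not lie in the subgroup of
    \<open>lw l\<close>. The point \<open>y\<close> does, and it agrees with \<open>g\<close> modulo
    \<open>lw k * p ^ j\<close>, which suffices since \<open>g\<close> is isolated.\<close>
  define y where "y = s * lw l"
  obtain y' where y: "R y y'" by (rule ex_image)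
  have "lw k * p ^ j dvd y' - g'" using iso_sec_aux[OF x b(1) y] s unfolding y_def by blast
  then have 1: "p ^ B dvd y' - g'" using Bd dvd_trans by blast
  have 2: "p ^ B dvd y - g" using s Bd dvd_trans unfolding y_def by blast
  have "2 \<le> multiplicity p (ra l div lw l)" using regular_powers(3)[OF p l] o by simp
  then have "p ^ 2 dvd ra l div lw l" by (rule multiplicity_dvd')
  then have pp: "p * p dvd ra l div lw l" by (simp add: power2_eq_square)
  have "lw l dvd y" unfolding y_def by simp
  then have "p ^ be p l dvd y' - lm l * y" using ld[of l] p pp y unfolding be_def by blast
  then have 3: "p ^ B dvd y' - lm l * y" using le_imp_power_dvd[OF B(2)] dvd_trans by blast
  have "p ^ be p k dvd g' - lm k * g" using regular_powers(6)[OF p k] unfolding g_def g'_def .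
  then have 4: "p ^ B dvd g' - lm k * g" using le_imp_power_dvd[OF B(1)] dvd_trans by blast
  have "p ^ B dvd ((y' - g') + (g' - lm k * g)) - ((y' - lm l * y) + lm l * (y - g))"
    using 1 2 3 4 by (metis dvd_add dvd_diff dvd_mult)
  moreover have "((y' - g') + (g' - lm k * g)) - ((y' - lm l * y) + lm l * (y - g)) = (lm l - lm k) * g"
    by (simp add: algebra_simps)
  ultimately have 5: "p ^ B dvd (lm l - lm k) * g" by metis
  have "p ^ al p k dvd g" using b(3) multiplicity_dvd[of p "lw k"] regular_powers(1)[OF p k] dvd_trans by metis
  then show ?thesis by (rule prime_power_cancel[OF p b(2) _ 5 B(3) D])
qed

text \<open>If the ranges do not overlap below \<open>B\<close>, then \<open>D\<close> already
  vanishes modulo \<open>p ^ B\<close>. Otherwise both classes are regular or both are not; two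
  regular classes share the base point if their ranges start together, and
  \<open>multiplier_compat\<close> handles the rest.\<close>

lemma mu_compat:
  assumes p: "Factorial_Ring.prime p" and Dk: "p ^ al p k dvd D" and Dl: "p ^ al p l dvd D"
    and B: "B \<le> be p k" "B \<le> be p l"
  shows "p ^ B dvd (mu p k - mu p l) * D"
proof (cases "B \<le> al p k \<or> B \<le> al p l")
  case True
  then have "p ^ B dvd D" using Dk Dl le_imp_power_dvd dvd_trans by blast
  then show ?thesis by simp
next
  case False
  then have a: "al p k < B" "al p l < B" by auto
  consider "\<not> regp p k" "\<not> regp p l" | "regp p k" "\<not> regp p l" | "\<not> regp p k" "regp p l" | "regp p k" "regp p l" by blast
  then show ?thesis
  proof cases
    case 1
    then show ?thesis by (simp add: mu_def)
  next
    case 2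
    have False by (rule regular_not_regular[OF p 2]) (use a B in linarith)+
    then show ?thesis ..
  next
    case 3
    have False by (rule regular_not_regular[OF p 3(2,1)]) (use a B in linarith)+
    then show ?thesis ..
  next
    case 4
    have mm: "mu p k = lm k" "mu p l = lm l" using 4 by (simp_all add: mu_def)
    consider "al p k = al p l" | "al p k < al p l" | "al p l < al p k" by linarith
    then show ?thesis
    proof cases
      case 1
      define g g' where "g = fst (bp p (al p k))" and "g' = snd (bp p (al p k))"
      have b: "\<not> p ^ Suc (al p k) dvd g" "lw k dvd g"
        using regular_powers(1,5)[OF p 4(1)] lw(1)[of k] unfolding base_pair_def g_def by blast+
      have "p ^ be p k dvd g' - lm k * g" using regular_powers(6)[OF p 4(1)] unfolding g_def g'_def .
      then have 2: "p ^ B dvd g' - lm k * g" using le_imp_power_dvd[OF B(1)] dvd_trans by blast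
      have "p ^ be p l dvd g' - lm l * g" using regular_powers(6)[OF p 4(2)] 1 unfolding g_def g'_def by simp
      then have "p ^ B dvd g' - lm l * g" using le_imp_power_dvd[OF B(2)] dvd_trans by blast
      then have "p ^ B dvd (g' - lm l * g) - (g' - lm k * g)" using 2 by (rule dvd_diff)
      then have 3: "p ^ B dvd (lm k - lm l) * g" by (simp add: algebra_simps)
      have "p ^ al p k dvd g" using b(2) multiplicity_dvd[of p "lw k"] regular_powers(1)[OF p 4(1)] dvd_trans by metis
      then show ?thesis unfolding mm using prime_power_cancel[OF p b(1) _ 3 _ Dk] a by simp
    next
      case 2
      show ?thesis unfolding mm by (rule multiplier_compat[OF p 4(2,1) 2 _ B(2,1) _ Dl]) (use a B in auto)
    next
      case 3
      have "p ^ B dvd (lm l - lm k) * D"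
        by (rule multiplier_compat[OF p 4(1,2) 3 _ B _ Dk]) (use a B in auto)
      then have "p ^ B dvd - ((lm l - lm k) * D)" by (simp only: dvd_minus_iff)
      then show ?thesis unfolding mm by (simp add: algebra_simps)
    qed
  qed
qed

text \<open>Modulo \<open>p ^ i\<close> a slope is needed as soon as some class has a range reaching
  \<open>i\<close>, and on the largest subgroup where this occurs. So the class with the least
  \<open>al\<close> is taken for each \<open>i\<close>; \<open>mu_compat\<close> passes from it to
  any other class.\<close>

lemma local_function:
  assumes p: "Factorial_Ring.prime p"
  shows "\<exists>f. \<forall>a b. p ^ be p (b - a) dvd f b - f a - mu p (b - a) * (b - a)"
proof -
  define V where "V = multiplicity p N"
  define Q where "Q i k \<longleftrightarrow> i \<le> be p k" for i k
  \<comment> \<open>The class of \<open>0\<close> has radical \<open>N\<close>, so every level up to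
    \<open>V\<close> is reached by some class.\<close>
  have be0: "be p 0 = V"
  proof -
    have "0 + ra 0 \<in> cl c 0" by (subst rd_period[OF N0 xs_per[OF Sc xset_cl]]) simp_all
    then have "c (ra 0) = c 0" by simp
    then have "N dvd ra 0" using spair_zero[OF Sc] dvd_0_right by blast
    then have "ra 0 = N" using ra_dvd[of 0] ra_pos[of 0] N0 by (meson zdvd_antisym_nonneg less_imp_le)
    then show ?thesis by (simp add: be_def V_def)
  qed
  have beV: "be p k \<le> V" for k
    unfolding be_def V_def by (rule dvd_imp_multiplicity_le[OF ra_dvd]) (use N0 in simp)
  have ex: "\<exists>k. i \<le> be p k \<and> (\<forall>l. i \<le> be p l \<longrightarrow> al p k \<le> al p l)" if i: "i \<le> V" for i
  proof -
    have "Q i 0" unfolding Q_def be0 by (rule i)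
    then have "\<exists>k. Q i k \<and> (\<forall>l. al p l < al p k \<longrightarrow> \<not> Q i l)"
      using ex_has_least_nat[of "Q i" 0 "al p"] by (metis not_le)
    then show ?thesis unfolding Q_def by (meson not_le)
  qed
  \<comment> \<open>By compatibility the multipliers modulo \<open>p ^ i\<close> are governed by one class for each \<open>i\<close>.\<close>
  define q where "q i = (SOME k. i \<le> be p k \<and> (\<forall>l. i \<le> be p l \<longrightarrow> al p k \<le> al p l))" for i
  have q: "i \<le> be p (q i)" "i \<le> be p l \<Longrightarrow> al p (q i) \<le> al p l" if i: "i \<le> V" for i l
    using someI_ex[OF ex[OF i]] unfolding q_def by blast+
  have "\<exists>f. \<forall>j a b. j \<le> V \<longrightarrow> p ^ al p (q j) dvd b - a \<longrightarrow> p ^ j dvd f b - f a - mu p (q j) * (b - a)"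
  proof (rule interpolate)
    show mono: "al p (q i) \<le> al p (q j)" if "i \<le> j" "j \<le> V" for i j
      using q(2)[of i "q j"] q(1)[of j] that by linarith
    fix j D assume j: "Suc j \<le> V" and D: "p ^ al p (q (Suc j)) dvd D"
    have "al p (q j) \<le> al p (q (Suc j))" by (rule mono) (use j in simp_all)
    then have "p ^ al p (q j) dvd D" using D by (metis dvd_trans le_imp_power_dvd)
    then show "p ^ j dvd (mu p (q (Suc j)) - mu p (q j)) * D"
      by (rule mu_compat[OF p D]) (use q(1)[OF j] q(1)[of j] j in linarith)+
  qed
  then obtain f where f: "\<And>j a b. j \<le> V \<Longrightarrow> p ^ al p (q j) dvd b - a \<Longrightarrow> p ^ j dvd f b - f a - mu p (q j) * (b - a)"
    by blast
  have "p ^ be p (b - a) dvd f b - f a - mu p (b - a) * (b - a)" for a b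
  proof -
    define k where "k = b - a"
    define j where "j = be p k"
    have jV: "j \<le> V" unfolding j_def by (rule beV)
    have "k \<in> cl c k" by simp
    then have "ua k dvd k" by (rule gn_dvd(2))
    then have ak: "p ^ al p k dvd k" unfolding al_def using multiplicity_dvd dvd_trans by blast
    have "p ^ al p (q j) dvd p ^ al p k" by (rule le_imp_power_dvd, rule q(2)[OF jV]) (simp add: j_def)
    then have aq: "p ^ al p (q j) dvd k" using ak by (rule dvd_trans)
    have 1: "p ^ j dvd f b - f a - mu p (q j) * k" using f[OF jV] aq unfolding k_def by blast
    have 2: "p ^ j dvd (mu p (q j) - mu p k) * k"
      by (rule mu_compat[OF p aq ak]) (use q(1)[OF jV] in \<open>simp_all add: j_def\<close>)
    have "p ^ j dvd (f b - f a - mu p (q j) * k) + (mu p (q j) - mu p k) * k" by (rule dvd_add[OF 1 2])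
    then show ?thesis unfolding k_def[symmetric] j_def[symmetric] by (simp add: algebra_simps)
  qed
  then show ?thesis by blast
qed

theorem ex_isomorphism: "\<exists>f. \<forall>a b. c' (f b - f a) = c (b - a)"
proof -
  define K where "K = {p. Factorial_Ring.prime p \<and> p dvd N}"
  have fK: "finite K" by (rule finite_subset[of _ "{r. r dvd N}"]) (use N0 in \<open>auto simp: K_def intro!: finite_divisors_int\<close>)
  define F where "F p = (SOME f. \<forall>a b. p ^ be p (b - a) dvd f b - f a - mu p (b - a) * (b - a))" for p
  have F: "p ^ be p (b - a) dvd F p b - F p a - mu p (b - a) * (b - a)" if "Factorial_Ring.prime p" for p a b
    using someI_ex[OF local_function[OF that]] unfolding F_def by blast
  have "\<exists>x. \<forall>p\<in>K. p ^ multiplicity p N dvd x - F p a" for a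
    by (rule crt_primes[OF fK]) (simp add: K_def)
  then obtain f where f: "\<And>p a. p \<in> K \<Longrightarrow> p ^ multiplicity p N dvd f a - F p a" by metis
  have "c' (f b - f a) = c (b - a)" for a b
  proof -
    define k where "k = b - a"
    have "ra k dvd (f b - f a) - (k - lt k + lm k * lt k)"
    proof (rule dvd_by_primes[OF ra_pos])
      fix p assume p: "Factorial_Ring.prime p" "p dvd ra k"
      have pK: "p \<in> K" unfolding K_def using p dvd_trans[OF p(2) ra_dvd] by simp
      have "be p k \<le> multiplicity p N"
        unfolding be_def by (rule dvd_imp_multiplicity_le[OF ra_dvd]) (use N0 in simp)
      then have d: "p ^ be p k dvd f x - F p x" for x using f[OF pK] le_imp_power_dvd dvd_trans by blast
      have e: "p ^ be p k dvd F p b - F p a - mu p k * k" using F[OF p(1)] unfolding k_def .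
      \<comment> \<open>At a regular prime \<open>k - lt k\<close> vanishes, at any other prime
        \<open>lt k\<close> does. So in both cases the prescribed image of \<open>k\<close> agrees
        with \<open>mu p k * k\<close>.\<close>
      have "p ^ be p k dvd mu p k * k - (k - lt k + lm k * lt k)"
      proof (cases "regp p k")
        case True
        then have "p ^ be p k dvd k - lt k" using ld p(1) unfolding regp_def be_def by blast
        then have "p ^ be p k dvd (lm k - 1) * (k - lt k)" by simp
        moreover have "(lm k - 1) * (k - lt k) = mu p k * k - (k - lt k + lm k * lt k)"
          using True by (simp add: mu_def algebra_simps)
        ultimately show ?thesis by metis
      next
        case False
        then have "p ^ be p k dvd lt k" using ld p(1) unfolding regp_def be_def by blast
        then have "p ^ be p k dvd (1 - lm k) * lt k" by simp
        moreover have "(1 - lm k) * lt k = mu p k * k - (k - lt k + lm k * lt k)"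
          using False by (simp add: mu_def algebra_simps)
        ultimately show ?thesis by metis
      qed
      then have "p ^ be p k dvd ((f b - F p b) - (f a - F p a)) + (F p b - F p a - mu p k * k)
          + (mu p k * k - (k - lt k + lm k * lt k))"
        using d e by (metis dvd_add dvd_diff)
      then show "p ^ multiplicity p (ra k) dvd f b - f a - (k - lt k + lm k * lt k)"
        unfolding be_def[symmetric] by (simp add: algebra_simps)
    qed
    then have "c k = c' (f b - f a)" using ld by blast
    then show ?thesis unfolding k_def by simp
  qed
  then show ?thesis by blast
qed

end

section \<open>Translation from coherent configurations\<close>

definition br :: "'a rel set \<Rightarrow> 'a \<Rightarrow> 'a \<Rightarrow> 'a rel" where
  "br S a b = (THE s. s \<in> S \<and> (a, b) \<in> s)"

lemma coherentD:
  assumes "coherent_configuration \<Omega> S"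
  shows "finite \<Omega>" "partition_on (\<Omega> \<times> \<Omega>) S" "union_of_basis S (Id_on \<Omega>)" "s \<in> S \<Longrightarrow> s\<inverse> \<in> S" "s \<in> S \<Longrightarrow> s \<subseteq> \<Omega> \<times> \<Omega>"
    "s \<in> S \<Longrightarrow> s \<noteq> {}"
  using assms unfolding coherent_configuration_def partition_on_def by auto

lemma br_eq: assumes S: "coherent_configuration \<Omega> S" and "s \<in> S" "(a, b) \<in> s" shows "br S a b = s"
unfolding br_def
proof (rule the_equality)
  show "s \<in> S \<and> (a, b) \<in> s" using assms by blast
  show "t = s" if "t \<in> S \<and> (a, b) \<in> t" for t
    by (rule partition_on_eqI[OF coherentD(2)[OF S], of t s "(a, b)"]) (use assms that in simp_all)
qed

lemma br: assumes S: "coherent_configuration \<Omega> S" and "a \<in> \<Omega>" "b \<in> \<Omega>" shows "br S a b \<in> S" "(a, b) \<in> br S a b"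
proof -
  obtain s where s: "s \<in> S" "(a, b) \<in> s" using partition_onD1[OF coherentD(2)[OF S]] assms(2,3) by blast
  then show "br S a b \<in> S" "(a, b) \<in> br S a b" using br_eq[OF S s] by auto
qed

lemma br_iff: assumes S: "coherent_configuration \<Omega> S" and "a \<in> \<Omega>" "b \<in> \<Omega>" "s \<in> S" shows "(a, b) \<in> s \<longleftrightarrow> br S a b = s"
  using br_eq[OF S] br[OF S] assms by metis

lemma card_path:
  assumes S: "coherent_configuration \<Omega> S" and "r \<in> S" "s \<in> S" "t \<in> S" "(a, b) \<in> t"
  shows "card {x. (a, x) \<in> r \<and> (x, b) \<in> s} = intersection_number r s t"
proof -
  obtain k where k: "\<forall>(a, b)\<in>t. card {x. (a, x) \<in> r \<and> (x, b) \<in> s} = k"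
    using S assms(2-4) unfolding coherent_configuration_def by meson
  have "intersection_number r s t = k" unfolding intersection_number_def
  proof (rule the_equality)
    show "\<forall>(a, b)\<in>t. card {x. (a, x) \<in> r \<and> (x, b) \<in> s} = k" by (rule k)
    fix k' assume "\<forall>(a, b)\<in>t. card {x. (a, x) \<in> r \<and> (x, b) \<in> s} = k'"
    from bspec[OF this assms(5)] bspec[OF k assms(5)] show "k' = k" by simp
  qed
  then show ?thesis using bspec[OF k assms(5)] by simp
qed

lemma path_iff:
  assumes S: "coherent_configuration \<Omega> S" and "r \<in> S" "s \<in> S" "t \<in> S" "(a, b) \<in> t"
  shows "(\<exists>x. (a, x) \<in> r \<and> (x, b) \<in> s) \<longleftrightarrow> intersection_number r s t \<noteq> 0"
proof -
  have "finite {x. (a, x) \<in> r \<and> (x, b) \<in> s}"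
    by (rule finite_subset[OF _ coherentD(1)[OF S]]) (use coherentD(5)[OF S \<open>r \<in> S\<close>] in blast)
  then show ?thesis unfolding card_path[OF assms, symmetric] by auto
qed

lemma diag_iff: assumes S: "coherent_configuration \<Omega> S" and s: "s \<in> S" "(a, b) \<in> s"
  shows "s \<subseteq> Id \<longleftrightarrow> a = b"
proof
  assume "a = b"
  moreover have "(a, b) \<in> \<Omega> \<times> \<Omega>" using coherentD(5)[OF S s(1)] s(2) by blast
  ultimately have "s \<inter> Id_on \<Omega> \<noteq> {}" using s(2) by auto
  then have "s \<subseteq> Id_on \<Omega>" using coherentD(3)[OF S] s(1) unfolding union_of_basis_alt[OF coherentD(2)[OF S]] by blast
  then show "s \<subseteq> Id" by auto
qed (use s in auto)

text \<open>Reflexive relations have to be recognized by intersection numbers alone, as only these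
  are preserved: composing with such a relation must not lead to a different relation.\<close>

lemma diag_char: assumes S: "coherent_configuration \<Omega> S" and s: "s \<in> S"
  shows "s \<subseteq> Id \<longleftrightarrow> (\<forall>r\<in>S. \<forall>t\<in>S. intersection_number s r t \<noteq> 0 \<longrightarrow> r = t)"
proof
  assume a: "s \<subseteq> Id"
  show "\<forall>r\<in>S. \<forall>t\<in>S. intersection_number s r t \<noteq> 0 \<longrightarrow> r = t"
  proof (intro ballI impI)
    fix r t assume rt: "r \<in> S" "t \<in> S" "intersection_number s r t \<noteq> 0"
    obtain u v where uv: "(u, v) \<in> t" using coherentD(6)[OF S rt(2)] by auto
    then obtain x where "(u, x) \<in> s" "(x, v) \<in> r" using path_iff[OF S s rt(1,2) uv] rt(3) by blast
    then have "(u, v) \<in> r" using a by auto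
    then show "r = t" using br_eq[OF S rt(1)] br_eq[OF S rt(2) uv] by simp
  qed
next
  assume a: "\<forall>r\<in>S. \<forall>t\<in>S. intersection_number s r t \<noteq> 0 \<longrightarrow> r = t"
  obtain u v where uv: "(u, v) \<in> s" using coherentD(6)[OF S s] by auto
  have v: "v \<in> \<Omega>" using coherentD(5)[OF S s] uv by blast
  define r where "r = br S v v"
  have r: "r \<in> S" "(v, v) \<in> r" unfolding r_def using br[OF S v v] by auto
  have "intersection_number s r s \<noteq> 0" using path_iff[OF S s r(1) s uv] uv r(2) by blast
  then have "r = s" using a r(1) s by blast
  then show "s \<subseteq> Id" using diag_iff[OF S r] by simp
qed

text \<open>A path through \<open>s\<close> and \<open>r\<close> that returns to its start exists
  exactly if \<open>r\<close> is the converse of \<open>s\<close>. So transposition is preserved as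
  well.\<close>

lemma converse_char: assumes S: "coherent_configuration \<Omega> S" and s: "s \<in> S" and r: "r \<in> S"
  shows "r = s\<inverse> \<longleftrightarrow> (\<exists>e\<in>S. e \<subseteq> Id \<and> intersection_number s r e \<noteq> 0)"
proof
  assume a: "r = s\<inverse>"
  obtain u v where uv: "(u, v) \<in> s" using coherentD(6)[OF S s] by auto
  have u: "u \<in> \<Omega>" using coherentD(5)[OF S s] uv by blast
  note b = br[OF S u u]
  have "intersection_number s r (br S u u) \<noteq> 0" using path_iff[OF S s r b] uv a by blast
  then show "\<exists>e\<in>S. e \<subseteq> Id \<and> intersection_number s r e \<noteq> 0" using b diag_iff[OF S b] by blast
next
  assume "\<exists>e\<in>S. e \<subseteq> Id \<and> intersection_number s r e \<noteq> 0"
  then obtain e where e: "e \<in> S" "e \<subseteq> Id" "intersection_number s r e \<noteq> 0" by blast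
  obtain u v where uv: "(u, v) \<in> e" using coherentD(6)[OF S e(1)] by auto
  then obtain x where x: "(u, x) \<in> s" "(x, v) \<in> r" using path_iff[OF S s r e(1) uv] e(3) by blast
  have "(x, v) \<in> s\<inverse>" using x(1) uv e(2) by auto
  then show "r = s\<inverse>" using br_eq[OF S r x(2)] br_eq[OF S coherentD(4)[OF S s]] by simp
qed

locale alg_iso =
  fixes \<Omega> :: "'a set" and S S' :: "'a rel set" and \<phi> :: "'a rel \<Rightarrow> 'a rel"
  assumes S: "coherent_configuration \<Omega> S" and S': "coherent_configuration \<Omega> S'"
    and iso: "algebraic_isomorphism S S' \<phi>"
begin

lemma bij: "bij_betw \<phi> S S'" using iso unfolding algebraic_isomorphism_def by blast
lemma im: "s \<in> S \<Longrightarrow> \<phi> s \<in> S'" using bij unfolding bij_betw_def by blast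
lemma inj: "r \<in> S \<Longrightarrow> s \<in> S \<Longrightarrow> \<phi> r = \<phi> s \<Longrightarrow> r = s" using bij unfolding bij_betw_def inj_on_def by blast
lemma surj: assumes "s' \<in> S'" obtains s where "s \<in> S" "s' = \<phi> s" using bij assms unfolding bij_betw_def by blast

lemma number: "r \<in> S \<Longrightarrow> s \<in> S \<Longrightarrow> t \<in> S \<Longrightarrow> intersection_number (\<phi> r) (\<phi> s) (\<phi> t) = intersection_number r s t"
  using iso unfolding algebraic_isomorphism_def by blast

lemma path: assumes "r \<in> S" "s \<in> S" "t \<in> S" "(a, b) \<in> t" "(a', b') \<in> \<phi> t"
  shows "(\<exists>x. (a, x) \<in> r \<and> (x, b) \<in> s) \<longleftrightarrow> (\<exists>x. (a', x) \<in> \<phi> r \<and> (x, b') \<in> \<phi> s)"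
  unfolding path_iff[OF S assms(1-4)] path_iff[OF S' im[OF assms(1)] im[OF assms(2)] im[OF assms(3)] assms(5)]
    number[OF assms(1-3)] ..

lemma point: assumes t: "t \<in> S" "(a, b) \<in> t" "(a', b') \<in> \<phi> t" and q: "{(q, q)} \<in> S" "\<phi> {(q, q)} = {(q', q')}"
  shows "a = q \<longleftrightarrow> a' = q'" "b = q \<longleftrightarrow> b' = q'"
  using path[OF q(1) t(1) t] path[OF t(1) q(1) t] t(2,3) unfolding q(2) by auto

lemma diag: assumes s: "s \<in> S" shows "s \<subseteq> Id \<longleftrightarrow> \<phi> s \<subseteq> Id"
proof -
  have "(\<forall>r\<in>S. \<forall>t\<in>S. intersection_number s r t \<noteq> 0 \<longrightarrow> r = t) \<longleftrightarrow>
    (\<forall>r\<in>S. \<forall>t\<in>S. intersection_number (\<phi> s) (\<phi> r) (\<phi> t) \<noteq> 0 \<longrightarrow> \<phi> r = \<phi> t)"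
    using number[OF s] inj by (metis (no_types, lifting))
  also have "\<dots> \<longleftrightarrow> (\<forall>r\<in>\<phi> ` S. \<forall>t\<in>\<phi> ` S. intersection_number (\<phi> s) r t \<noteq> 0 \<longrightarrow> r = t)" by simp
  also have "\<phi> ` S = S'" using bij unfolding bij_betw_def by blast
  finally show ?thesis unfolding diag_char[OF S s] diag_char[OF S' im[OF s]] .
qed

lemma converse: assumes s: "s \<in> S" shows "\<phi> (s\<inverse>) = (\<phi> s)\<inverse>"
proof -
  have c: "s\<inverse> \<in> S" by (rule coherentD(4)[OF S s])
  then obtain e where e: "e \<in> S" "e \<subseteq> Id" "intersection_number s (s\<inverse>) e \<noteq> 0" using converse_char[OF S s c] by blast
  have "intersection_number (\<phi> s) (\<phi> (s\<inverse>)) (\<phi> e) \<noteq> 0" using number[OF s c e(1)] e(3) by simp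
  then show ?thesis using converse_char[OF S' im[OF s] im[OF c]] im[OF e(1)] diag[OF e(1)] e(2) by blast
qed

end

locale coded_iso = alg_iso \<Omega> S S \<phi> for \<Omega> :: "'a set" and S \<phi> +
  fixes N :: int and e :: "int \<Rightarrow> 'a"
  assumes N0: "0 < N" and Omega: "\<Omega> = range e" and e_eq: "e x = e y \<longleftrightarrow> N dvd x - y"
    and shift: "s \<in> S \<Longrightarrow> (e a, e b) \<in> s \<Longrightarrow> (e (a + d), e (b + d)) \<in> s"
begin

definition col :: "int \<Rightarrow> 'a rel" where "col a = br S (e 0) (e a)"
definition col' :: "int \<Rightarrow> 'a rel" where "col' a = the_inv_into S \<phi> (col a)"

lemma e_in: "e a \<in> \<Omega>" unfolding Omega by simp

lemma col_in: "col a \<in> S" unfolding col_def by (rule br[OF S e_in e_in])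

lemma rel_iff: assumes "s \<in> S" shows "(e a, e b) \<in> s \<longleftrightarrow> col (b - a) = s"
proof -
  have "(e a, e b) \<in> s \<longleftrightarrow> (e 0, e (b - a)) \<in> s"
    using shift[OF assms, of a b "- a"] shift[OF assms, of 0 "b - a" a] by auto
  then show ?thesis unfolding col_def br_iff[OF S e_in e_in assms] .
qed

lemma col'_in: "col' a \<in> S" and phi_col': "\<phi> (col' a) = col a"
proof -
  obtain s where s: "s \<in> S" "col a = \<phi> s" using surj[OF col_in] .
  have "inj_on \<phi> S" using bij unfolding bij_betw_def by blast
  then have "col' a = s" unfolding col'_def s(2) using s(1) by (rule the_inv_into_f_f)
  then show "col' a \<in> S" "\<phi> (col' a) = col a" using s by simp_all
qed

lemma col'_iff: assumes "s \<in> S" shows "col a = \<phi> s \<longleftrightarrow> col' a = s"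
  using inj[OF col'_in assms, of a] phi_col'[of a] by metis

lemma rel'_iff: assumes "s \<in> S" shows "(e a, e b) \<in> \<phi> s \<longleftrightarrow> col' (b - a) = s"
  unfolding rel_iff[OF im[OF assms]] col'_iff[OF assms] ..

lemma ex_col: assumes "s \<in> S" obtains a where "col a = s"
proof -
  obtain u v where uv: "(u, v) \<in> s" using coherentD(6)[OF S assms] by auto
  have "u \<in> \<Omega>" "v \<in> \<Omega>" using coherentD(5)[OF S assms] uv by auto
  then obtain a b where "u = e a" "v = e b" unfolding Omega by blast
  then show ?thesis using that rel_iff[OF assms, of a b] uv by blast
qed

lemma ex_col': assumes "s \<in> S" obtains a where "col' a = s"
  using ex_col[OF im[OF assms]] col'_iff[OF assms] by metis

lemma card_code: "card {y \<in> {0..<N}. (e 0, e y) \<in> p \<and> (e y, e x) \<in> q} = card {z \<in> \<Omega>. (e 0, z) \<in> p \<and> (z, e x) \<in> q}"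
proof (rule bij_betw_same_card[of e])
  have "inj_on e {0..<N}"
  proof (rule inj_onI)
    fix x y assume x: "x \<in> {0..<N}" "y \<in> {0..<N}" "e x = e y"
    then have "x mod N = y mod N" unfolding e_eq mod_eq_dvd_iff by simp
    then show "x = y" using x by simp
  qed
  then have i: "inj_on e {y \<in> {0..<N}. (e 0, e y) \<in> p \<and> (e y, e x) \<in> q}" by (rule inj_on_subset) auto
  have "z \<in> e ` {y \<in> {0..<N}. (e 0, e y) \<in> p \<and> (e y, e x) \<in> q}" if z: "z \<in> \<Omega>" "(e 0, z) \<in> p" "(z, e x) \<in> q" for z
  proof -
    obtain y where y: "z = e y" using z(1) Omega by blast
    have "e (y mod N) = z" unfolding y e_eq mod_eq_dvd_iff[symmetric] by simp
    then show ?thesis using z(2,3) N0 by (intro image_eqI[of _ _ "y mod N"]) auto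
  qed
  then show "bij_betw e {y \<in> {0..<N}. (e 0, e y) \<in> p \<and> (e y, e x) \<in> q} {z \<in> \<Omega>. (e 0, z) \<in> p \<and> (z, e x) \<in> q}"
    unfolding bij_betw_def using i e_in by auto
qed

lemma card_path_code:
  assumes "r \<in> S" "s \<in> S" "t \<in> S" "(e 0, e x) \<in> t"
  shows "card {y \<in> {0..<N}. (e 0, e y) \<in> r \<and> (e y, e x) \<in> s} = intersection_number r s t"
proof -
  have "{z \<in> \<Omega>. (e 0, z) \<in> r \<and> (z, e x) \<in> s} = {z. (e 0, z) \<in> r \<and> (z, e x) \<in> s}"
    using coherentD(5)[OF S assms(1)] by blast
  then show ?thesis unfolding card_code using card_path[OF S assms] by simp
qed

text \<open>Grouping the summation index by the pair of relations it passes through turns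
  convolution into a sum weighted by intersection numbers. The right-hand side is therefore the same
  for \<open>col\<close> and \<open>col'\<close>.\<close>

lemma conv_classes:
  assumes f: "\<And>y. f y = F (d y)" and g: "\<And>y. g y = H (d y)" and d: "\<And>y. d y \<in> S"
    and n: "\<And>r s. r \<in> S \<Longrightarrow> s \<in> S \<Longrightarrow> card {y \<in> {0..<N}. d y = r \<and> d (x - y) = s} = intersection_number r s t"
  shows "conv N f g x = (\<Sum>(r, s)\<in>S \<times> S. of_nat (intersection_number r s t) * (F r * H s))"
proof -
  have fS: "finite S" using finite_elements[OF _ coherentD(2)[OF S]] coherentD(1)[OF S] by simp
  have "conv N f g x = (\<Sum>y\<in>{0..<N}. (\<lambda>(r, s). F r * H s) (d y, d (x - y)))" unfolding conv_def f g by simp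
  also have "\<dots> = (\<Sum>q\<in>S \<times> S. of_nat (card {y \<in> {0..<N}. (d y, d (x - y)) = q}) * (\<lambda>(r, s). F r * H s) q)"
    by (rule sum_fun_comp) (use fS d in auto)
  also have "\<dots> = (\<Sum>(r, s)\<in>S \<times> S. of_nat (intersection_number r s t) * (F r * H s))"
    by (rule sum.cong) (use n in auto)
  finally show ?thesis .
qed

lemma compat_fun: assumes "compat col col' f f'"
  shows "\<exists>F. \<forall>y. f y = F (col y) \<and> f' y = F (col' y)"
proof -
  define F where "F s = f (SOME y. col y = s)" for s
  have F': "F (col' y) = f' y" for y
  proof -
    have "\<exists>z. col z = col' y" using ex_col[OF col'_in] by metis
    then have "col (SOME z. col z = col' y) = col' y" by (rule someI_ex)
    then show ?thesis unfolding F_def by (rule compatD[OF assms])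
  qed
  have "f y = F (col y)" for y
  proof -
    obtain w where w: "col' w = col y" using ex_col'[OF col_in] .
    then have "f y = f' w" using compatD[OF assms] by metis
    then show ?thesis using F'[of w] w by simp
  qed
  then show ?thesis using F' by metis
qed

lemma zero_iff: "N dvd x \<longleftrightarrow> col x \<subseteq> Id"
  using diag_iff[OF S col_in br(2)[OF S e_in e_in, of 0 x, folded col_def]] e_eq[of x 0] by (metis diff_zero)

lemma col_neg: "col (- x) = (col x)\<inverse>"
proof -
  have "(e 0, e x) \<in> col x" unfolding col_def by (rule br(2)[OF S e_in e_in])
  then show ?thesis using rel_iff[OF coherentD(4)[OF S col_in], of x 0] by simp
qed

lemma periodic_col: "periodic N col"
  unfolding periodic_def col_def using e_eq by metis

lemma spair: "spair N col col'"
  unfolding spair_def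
proof (intro conjI allI impI)
  show "0 < N" by (rule N0)
  show "periodic N col" by (rule periodic_col)
  show "periodic N col'" using periodic_col unfolding periodic_def col'_def by metis
  have "range col = S" using col_in ex_col by (metis rangeI subsetI subset_antisym image_subset_iff)
  moreover have "range col' = S" using col'_in ex_col' by (metis rangeI subsetI subset_antisym image_subset_iff)
  ultimately show "range col = range col'" by simp
next
  fix x y assume xy: "col x = col' y"
  have p: "col y = \<phi> (col x)" unfolding xy phi_col' ..
  show "N dvd x \<longleftrightarrow> N dvd y" unfolding zero_iff p by (rule diag[OF col_in])
  have "col (- y) = \<phi> (col (- x))" unfolding col_neg p by (rule converse[OF col_in, symmetric])
  then show "col (- x) = col' (- y)" using col'_iff[OF col_in] by metis
next
  fix f f' g g' :: "int \<Rightarrow> int" assume f: "compat col col' f f'" and g: "compat col col' g g'"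
  obtain F where F: "\<And>y. f y = F (col y)" "\<And>y. f' y = F (col' y)" using compat_fun[OF f] by blast
  obtain H where H: "\<And>y. g y = H (col y)" "\<And>y. g' y = H (col' y)" using compat_fun[OF g] by blast
  show "compat col col' (conv N f g) (conv N f' g')" unfolding compat_def
  proof (intro allI impI)
    fix x y assume xy: "col x = col' y"
    have "conv N f g x = (\<Sum>(r, s)\<in>S \<times> S. of_nat (intersection_number r s (col x)) * (F r * H s))"
    proof (rule conv_classes[where d = col and F = F and H = H, OF F(1) H(1) col_in])
      fix r s assume rs: "r \<in> S" "s \<in> S"
      have "(e 0, e x) \<in> col x" unfolding col_def by (rule br(2)[OF S e_in e_in])
      from card_path_code[OF rs col_in this]
      show "card {y \<in> {0..<N}. col y = r \<and> col (x - y) = s} = intersection_number r s (col x)"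
        unfolding rel_iff[OF rs(1)] rel_iff[OF rs(2)] by simp
    qed
    moreover have "conv N f' g' y = (\<Sum>(r, s)\<in>S \<times> S. of_nat (intersection_number r s (col x)) * (F r * H s))"
    proof (rule conv_classes[where d = col' and F = F and H = H, OF F(2) H(2) col'_in])
      fix r s assume rs: "r \<in> S" "s \<in> S"
      have "(e 0, e y) \<in> \<phi> (col x)" using rel'_iff[OF col_in, of 0 y x] xy by simp
      from card_path_code[OF im[OF rs(1)] im[OF rs(2)] im[OF col_in] this]
      show "card {z \<in> {0..<N}. col' z = r \<and> col' (y - z) = s} = intersection_number r s (col x)"
        unfolding rel'_iff[OF rs(1)] rel'_iff[OF rs(2)] number[OF rs col_in] by simp
    qed
    ultimately show "conv N f g x = conv N f' g' y" by simp
  qed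
qed

text \<open>Membership of pairs in relations depends on differences only. Injectivity of the induced
  map follows because \<phi> preserves reflexive relations.\<close>

lemma isomorphism:
  assumes f: "\<And>a b. col' (f b - f a) = col (b - a)"
  shows "\<exists>h. bij_betw h \<Omega> \<Omega> \<and> (\<forall>s\<in>S. image_rel h s = \<phi> s)"
proof -
  define dlog where "dlog \<alpha> = (SOME a. e a = \<alpha>)" for \<alpha>
  have dlog: "e (dlog \<alpha>) = \<alpha>" if "\<alpha> \<in> \<Omega>" for \<alpha>
    unfolding dlog_def by (rule someI_ex) (use that Omega in blast)
  define h where "h \<alpha> = e (f (dlog \<alpha>))" for \<alpha>
  have h: "(h \<alpha>, h \<beta>) \<in> \<phi> s \<longleftrightarrow> (\<alpha>, \<beta>) \<in> s" if ab: "\<alpha> \<in> \<Omega>" "\<beta> \<in> \<Omega>" "s \<in> S" for \<alpha> \<beta> s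
    unfolding h_def rel'_iff[OF ab(3)] f using rel_iff[OF ab(3), of "dlog \<alpha>" "dlog \<beta>"] dlog ab(1,2) by simp
  have "inj_on h \<Omega>"
  proof (rule inj_onI)
    fix \<alpha> \<beta> assume ab: "\<alpha> \<in> \<Omega>" "\<beta> \<in> \<Omega>" "h \<alpha> = h \<beta>"
    have "(h \<alpha>, h \<beta>) \<in> \<phi> (br S \<alpha> \<beta>)" using h[OF ab(1,2) br(1)[OF S ab(1,2)]] br(2)[OF S ab(1,2)] by blast
    then have "\<phi> (br S \<alpha> \<beta>) \<subseteq> Id" using diag_iff[OF S im[OF br(1)[OF S ab(1,2)]]] ab(3) by blast
    then have "br S \<alpha> \<beta> \<subseteq> Id" using diag[OF br(1)[OF S ab(1,2)]] by blast
    then show "\<alpha> = \<beta>" using br(2)[OF S ab(1,2)] by blast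
  qed
  moreover have "h ` \<Omega> \<subseteq> \<Omega>" using e_in unfolding h_def by blast
  ultimately have b: "bij_betw h \<Omega> \<Omega>" unfolding bij_betw_def using endo_inj_surj[OF coherentD(1)[OF S]] by blast
  have "image_rel h s = \<phi> s" if s: "s \<in> S" for s
  proof
    note sub = coherentD(5)[OF S s] coherentD(5)[OF S im[OF s]]
    show "image_rel h s \<subseteq> \<phi> s" unfolding image_rel_def using h[OF _ _ s] sub(1) by fastforce
    show "\<phi> s \<subseteq> image_rel h s"
    proof clarify
      fix a b assume ab: "(a, b) \<in> \<phi> s"
      then obtain \<alpha> \<beta> where "\<alpha> \<in> \<Omega>" "\<beta> \<in> \<Omega>" "a = h \<alpha>" "b = h \<beta>"
        using sub(2) b unfolding bij_betw_def by blast
      then show "(a, b) \<in> image_rel h s" unfolding image_rel_def using h[OF _ _ s] ab by force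
    qed
  qed
  then show ?thesis using b by blast
qed

end

section \<open>The point extension as a relation on the fibre\<close>

locale coded_extension = coded_iso \<Omega> S \<phi> N e + ext: alg_iso \<Omega> T T' \<psi>
  for \<Omega> :: "'a set" and S \<phi> N e T T' \<psi> +
  fixes \<eta> :: int
  assumes ref: "t \<in> T \<Longrightarrow> \<exists>s\<in>S. t \<subseteq> s" and extends: "s \<in> S \<Longrightarrow> extend_to_unions T \<psi> s = \<phi> s"
    and origin: "{(e 0, e 0)} \<in> T" "\<psi> {(e 0, e 0)} = {(e \<eta>, e \<eta>)}"
begin

lemma ext_col: assumes t: "t \<in> T" "(e a, e b) \<in> t" "(e a', e b') \<in> \<psi> t" shows "col (b - a) = col' (b' - a')"
proof -
  obtain s where s: "s \<in> S" "t \<subseteq> s" using ref[OF t(1)] by blast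
  have "col (b - a) = s" using rel_iff[OF s(1)] s(2) t(2) by blast
  moreover have "\<psi> t \<subseteq> \<phi> s" unfolding extends[OF s(1), symmetric] extend_to_unions_def using t(1) s(2) by blast
  then have "col' (b' - a') = s" using rel'_iff[OF s(1)] t(3) by blast
  ultimately show ?thesis by simp
qed

text \<open>The identity goes to \<open>e \<eta>\<close>, which may differ from it; images are
  therefore measured from \<open>\<eta>\<close>, so that \<open>0\<close> is related to
  \<open>0\<close>.\<close>

definition R :: "int \<Rightarrow> int \<Rightarrow> bool" where
  "R x x' \<longleftrightarrow> (e \<eta>, e (\<eta> + x')) \<in> \<psi> (br T (e 0) (e x))"

lemma brT: "br T (e a) (e b) \<in> T" "(e a, e b) \<in> br T (e a) (e b)"
  by (rule br[OF ext.S e_in e_in])+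

lemma R_iff: assumes "t \<in> T" "(e 0, e x) \<in> t" shows "R x x' \<longleftrightarrow> (e \<eta>, e (\<eta> + x')) \<in> \<psi> t"
  unfolding R_def br_eq[OF ext.S assms] ..

lemma ext_start: assumes t: "t \<in> T" "(e 0, a) \<in> t" shows "\<exists>y. (e \<eta>, e (\<eta> + y)) \<in> \<psi> t"
proof -
  obtain u v where uv: "(u, v) \<in> \<psi> t" using coherentD(6)[OF ext.S' ext.im[OF t(1)]] by auto
  have "u = e \<eta>" using ext.point(1)[OF t uv origin] by simp
  moreover have "v \<in> range e" using coherentD(5)[OF ext.S' ext.im[OF t(1)]] uv Omega by auto
  then obtain y where "v = e y" by blast
  ultimately show ?thesis using uv by (intro exI[of _ "y - \<eta>"]) simp
qed

text \<open>Both exchange properties come from triangles: a path from the base point through a third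
  point is matched by one through its image, because intersection numbers of the extensions agree.
  Differences keep their colours since \<psi> extends \<phi>.\<close>

lemma fibre: "fibre N col col' R"
proof
  show "spair N col col'" by (rule spair)
  show "R 0 0" unfolding R_iff[OF origin(1), of 0 0, simplified] origin(2) by simp
  show "N dvd x'" if "R 0 x'" for x'
    using that unfolding R_iff[OF origin(1), of 0 x', simplified] origin(2) using e_eq[of "\<eta> + x'" \<eta>] by simp
  show "N dvd x" if "R x 0" for x
  proof -
    have "(e \<eta>, e \<eta>) \<in> \<psi> (br T (e 0) (e x))" using that unfolding R_def by simp
    from ext.point(2)[OF brT this origin] show ?thesis using e_eq[of x 0] by simp
  qed
next
  fix x x' assume Rx: "R x x'"
  define t where "t = br T (e 0) (e x)"
  have t: "t \<in> T" "(e 0, e x) \<in> t" "(e \<eta>, e (\<eta> + x')) \<in> \<psi> t" using brT Rx unfolding t_def R_def by auto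
  show "\<exists>z'. R z z' \<and> col (x - z) = col' (x' - z')" for z
  proof -
    have "\<exists>y. (e 0, y) \<in> br T (e 0) (e z) \<and> (y, e x) \<in> br T (e z) (e x)" using brT(2) by blast
    then obtain y where y: "(e \<eta>, y) \<in> \<psi> (br T (e 0) (e z))" "(y, e (\<eta> + x')) \<in> \<psi> (br T (e z) (e x))"
      using ext.path[OF brT(1) brT(1) t] by blast
    have "y \<in> range e" using coherentD(5)[OF ext.S' ext.im[OF brT(1)]] y(1) Omega by auto
    then obtain w where w: "y = e w" by blast
    have "R z (w - \<eta>)" using y(1) unfolding R_def w by simp
    moreover have "col (x - z) = col' ((\<eta> + x') - w)" by (rule ext_col[OF brT y(2)[unfolded w]])
    ultimately show ?thesis by (intro exI[of _ "w - \<eta>"]) (simp add: algebra_simps)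
  qed
  show "\<exists>z. R z z' \<and> col (x - z) = col' (x' - z')" for z'
  proof -
    define r' s' where "r' = br T' (e \<eta>) (e (\<eta> + z'))" and "s' = br T' (e (\<eta> + z')) (e (\<eta> + x'))"
    have rs': "r' \<in> T'" "(e \<eta>, e (\<eta> + z')) \<in> r'" "s' \<in> T'" "(e (\<eta> + z'), e (\<eta> + x')) \<in> s'"
      unfolding r'_def s'_def using br[OF ext.S' e_in e_in] by auto
    obtain r s where rs: "r \<in> T" "r' = \<psi> r" "s \<in> T" "s' = \<psi> s" using ext.surj rs'(1,3) by metis
    have "\<exists>y. (e \<eta>, y) \<in> \<psi> r \<and> (y, e (\<eta> + x')) \<in> \<psi> s" using rs' rs by blast
    then obtain y where y: "(e 0, y) \<in> r" "(y, e x) \<in> s" using ext.path[OF rs(1,3) t] by blast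
    have "y \<in> range e" using coherentD(5)[OF ext.S rs(1)] y(1) Omega by auto
    then obtain w where w: "y = e w" by blast
    have "R w z'" unfolding R_iff[OF rs(1) y(1)[unfolded w]] using rs' rs by blast
    moreover have "col (x - w) = col' ((\<eta> + x') - (\<eta> + z'))"
      by (rule ext_col[OF rs(3) y(2)[unfolded w]]) (use rs' rs in blast)
    ultimately show ?thesis by (intro exI[of _ w]) simp
  qed
qed

text \<open>A singleton diagonal relation determines the end point of every pair leading into it, on
  both sides of \<psi>.\<close>

lemma iso_point:
  assumes q: "{(e a, e a)} \<in> T" "\<psi> {(e a, e a)} = {(e a', e a')}"
  shows "fibre.iso N R a (a' - \<eta>)"
  unfolding fibre.iso_def[OF fibre]
proof (intro conjI allI impI)
  obtain y where y: "(e \<eta>, e (\<eta> + y)) \<in> \<psi> (br T (e 0) (e a))" using ext_start[OF brT] by blast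
  have "e (\<eta> + y) = e a'" using ext.point(2)[OF brT y q] by simp
  then show "R a (a' - \<eta>)" using y unfolding R_def by simp
  show "N dvd x' - (a' - \<eta>)" if "R a x'" for x'
  proof -
    have "e (\<eta> + x') = e a'" using ext.point(2)[OF brT that[unfolded R_def] q] by simp
    then show ?thesis unfolding e_eq by (simp add: algebra_simps)
  qed
  show "N dvd x - a" if "R x (a' - \<eta>)" for x
    using ext.point(2)[OF brT that[unfolded R_def] q] e_eq by simp
qed

end

locale circulant_iso = coded_iso "carrier G" S \<phi> N e for G (structure) and S \<phi> N e +
  assumes G: "group G" and e_mult: "e a \<otimes> e b = e (a + b)"
begin

definition subgrp :: "int \<Rightarrow> 'a set" where "subgrp u = e ` mult u"

lemma e_one: "e 0 = \<one>"
  using group.r_cancel_one[OF G e_in e_in, of 0 0] e_mult[of 0 0] by simp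

lemma e_inv: "inv (e a) = e (- a)"
  by (rule group.inv_equality[OF G]) (use e_mult[of "- a" a] e_one e_in in simp_all)

lemma comm: "comm_group G"
proof (rule group.group_comm_groupI[OF G])
  fix x y assume "x \<in> carrier G" "y \<in> carrier G"
  then obtain a b where "x = e a" "y = e b" unfolding Omega by blast
  then show "x \<otimes> y = y \<otimes> x" by (simp add: e_mult add.commute)
qed

lemma subgroup_subgrp: assumes "u dvd N" shows "subgroup (subgrp u) G"
proof (rule subgroup.intro)
  show "subgrp u \<subseteq> carrier G" unfolding subgrp_def using e_in by blast
  show "\<one> \<in> subgrp u" unfolding e_one[symmetric] subgrp_def by simp
  fix x assume "x \<in> subgrp u"
  then obtain a where a: "x = e a" "u dvd a" unfolding subgrp_def by auto
  then show "inv x \<in> subgrp u" unfolding subgrp_def by (simp add: e_inv)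
  fix y assume "y \<in> subgrp u"
  then obtain b where "y = e b" "u dvd b" unfolding subgrp_def by auto
  then show "x \<otimes> y \<in> subgrp u" using a unfolding subgrp_def by (simp add: e_mult)
qed

lemma card_subgrp: assumes u: "0 < u" "u dvd N" shows "card (subgrp u) = nat (N div u)"
proof -
  have "subgrp u = (\<lambda>i. e (u * i)) ` {0..<N div u}"
  proof
    show "subgrp u \<subseteq> (\<lambda>i. e (u * i)) ` {0..<N div u}"
    proof
      fix x assume "x \<in> subgrp u"
      then obtain b where b: "x = e (u * b)" unfolding subgrp_def by (auto simp: dvd_def)
      have "0 < N div u" using u N0 by (simp add: pos_imp_zdiv_pos_iff zdvd_imp_le)
      moreover have "(N div u) dvd b - b mod (N div u)" by simp
      then have "u * (N div u) dvd u * (b - b mod (N div u))" by (rule mult_dvd_mono[OF dvd_refl])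
      then have "x = e (u * (b mod (N div u)))" unfolding b e_eq using u by (simp add: right_diff_distrib)
      ultimately show "x \<in> (\<lambda>i. e (u * i)) ` {0..<N div u}" by (intro image_eqI[of _ _ "b mod (N div u)"]) simp_all
    qed
    show "(\<lambda>i. e (u * i)) ` {0..<N div u} \<subseteq> subgrp u" unfolding subgrp_def by auto
  qed
  moreover have "inj_on (\<lambda>i. e (u * i)) {0..<N div u}"
  proof (rule inj_onI)
    fix i j assume ij: "i \<in> {0..<N div u}" "j \<in> {0..<N div u}" "e (u * i) = e (u * j)"
    then have "u * (N div u) dvd u * (i - j)" using u unfolding e_eq by (simp add: right_diff_distrib)
    then have "N div u dvd i - j" using u(1) by (simp only: dvd_mult_cancel_left) simp
    then have "i mod (N div u) = j mod (N div u)" by (simp add: mod_eq_dvd_iff)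
    then show "i = j" using ij by simp
  qed
  ultimately show ?thesis by (simp add: card_image)
qed

lemma r_coset_subgrp: assumes "u dvd N" shows "subgrp u #> e a = {e b |b. u dvd b - a}"
proof
  show "subgrp u #> e a \<subseteq> {e b |b. u dvd b - a}"
    unfolding r_coset_def subgrp_def by (auto simp: e_mult)
  show "{e b |b. u dvd b - a} \<subseteq> subgrp u #> e a"
  proof clarify
    fix b assume "u dvd b - a"
    moreover have "e b = e (b - a) \<otimes> e a" by (simp add: e_mult)
    ultimately show "e b \<in> subgrp u #> e a" unfolding r_coset_def subgrp_def by auto
  qed
qed

lemma coset_relation: assumes u: "u dvd N"
  shows "(e a, e b) \<in> (\<Union>C\<in>rcosets (subgrp u). C \<times> C) \<longleftrightarrow> u dvd b - a"
proof
  assume "(e a, e b) \<in> (\<Union>C\<in>rcosets (subgrp u). C \<times> C)"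
  then obtain C where C: "C \<in> rcosets (subgrp u)" "e a \<in> C" "e b \<in> C" by blast
  then obtain d where d: "C = subgrp u #> e d" unfolding RCOSETS_def Omega by blast
  obtain a' b' where ab: "e a = e a'" "u dvd a' - d" "e b = e b'" "u dvd b' - d"
    using C(2,3) unfolding d r_coset_subgrp[OF u] by blast
  have "u dvd a - a'" "u dvd b - b'" using ab(1,3) u dvd_trans unfolding e_eq by blast+
  then have "u dvd ((b - b') + (b' - d)) - ((a - a') + (a' - d))" using ab(2,4) by (metis dvd_add dvd_diff)
  then show "u dvd b - a" by simp
next
  assume "u dvd b - a"
  then have "e a \<in> subgrp u #> e a" "e b \<in> subgrp u #> e a" unfolding r_coset_subgrp[OF u] by auto
  moreover have "subgrp u #> e a \<in> rcosets (subgrp u)" unfolding RCOSETS_def using e_in by blast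
  ultimately show "(e a, e b) \<in> (\<Union>C\<in>rcosets (subgrp u). C \<times> C)" by blast
qed

lemma scheme_subgroup_subgrp: assumes u: "xdiv N col u" shows "scheme_subgroup G S (subgrp u)"
  unfolding scheme_subgroup_def
proof
  have uN: "u dvd N" by (rule xdiv_dvd[OF u])
  show "subgroup (subgrp u) G" by (rule subgroup_subgrp[OF uN])
  let ?R = "\<Union>C\<in>rcosets (subgrp u). C \<times> C"
  show "union_of_basis S ?R" unfolding union_of_basis_alt[OF coherentD(2)[OF S]]
  proof (intro conjI ballI impI)
    have "C \<subseteq> carrier G" if C: "C \<in> rcosets (subgrp u)" for C
      by (rule subgroup.rcosets_carrier[OF subgroup_subgrp[OF uN] G C])
    then show "?R \<subseteq> carrier G \<times> carrier G" by blast
    fix s assume s: "s \<in> S" "s \<inter> ?R \<noteq> {}"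
    have sc: "s \<subseteq> carrier G \<times> carrier G" by (rule coherentD(5)[OF S s(1)])
    obtain x y where xy: "(x, y) \<in> s" "(x, y) \<in> ?R" using s(2) by auto
    obtain a b where ab: "x = e a" "y = e b" using sc xy(1) unfolding Omega by blast
    have d: "u dvd b - a" using coset_relation[OF uN] xy(2) unfolding ab by blast
    have c: "col (b - a) = s" using rel_iff[OF s(1)] xy(1) unfolding ab by blast
    show "s \<subseteq> ?R"
    proof clarify
      fix x' y' assume x': "(x', y') \<in> s"
      obtain a' b' where ab': "x' = e a'" "y' = e b'" using sc x' unfolding Omega by blast
      have "col (b' - a') = s" using rel_iff[OF s(1)] x' unfolding ab' by blast
      then have "u dvd b' - a'" using xdiv_iff[OF spair_left[OF spair] u] c d by metis
      then have "(x', y') \<in> ?R" using coset_relation[OF uN] unfolding ab' by blast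
      then show "(x', y') \<in> ?R" .
    qed
  qed
qed

text \<open>The section between the two subgroups has prime order, so the base tuple contains an
  element of the larger subgroup whose coset generates it. Were the gcd not \<open>u\<close>,
  primality would put that element into the smaller subgroup, and it would generate only the trivial
  group.\<close>

lemma base_point:
  assumes B: "base_tuple G S x" and u: "xdiv N col u" and r: "xdiv N col r" and ur: "u dvd r"
    and p: "Factorial_Ring.prime (r div u)"
  shows "\<exists>a. e a \<in> set x \<and> gcd a r = u"
proof -
  note uN = xdiv_dvd[OF u] and rN = xdiv_dvd[OF r] and u0 = xdiv_pos[OF u] and r0 = xdiv_pos[OF r]
  define q where "q = r div u"
  have ruq: "r = u * q" using ur by (simp add: q_def)
  have q1: "1 < q" using p prime_gt_1_int unfolding q_def by blast
  let ?H = "G\<lparr>carrier := subgrp u\<rparr>"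
  have sub: "subgrp r \<subseteq> subgrp u" unfolding subgrp_def using dvd_trans[OF ur] by auto
  have H: "group ?H" by (rule group.subgroup_imp_group[OF G subgroup_subgrp[OF uN]])
  have LH: "subgroup (subgrp r) ?H"
    by (rule group.subgroup_incl[OF G subgroup_subgrp[OF rN] subgroup_subgrp[OF uN] sub])
  have n: "subgrp r \<lhd> ?H"
  proof -
    have "comm_group ?H" by (rule group.group_comm_groupI[OF H]) (use comm_groupE(4)[OF comm] subgroup.subset[OF subgroup_subgrp[OF uN]] in auto)
    then show ?thesis using comm_group.subgroup_imp_normal LH by blast
  qed
  interpret Q: group "?H Mod subgrp r" by (rule normal.factorgroup_is_group[OF n])
  have sg: "sec_group G (subgrp u, subgrp r) = ?H Mod subgrp r" unfolding sec_group_def by simp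
  have "card (carrier (?H Mod subgrp r)) * card (subgrp r) = card (subgrp u)"
    using group.lagrange[OF H LH] by (simp add: FactGroup_def Coset.order_def)
  moreover have "card (subgrp u) = nat q * card (subgrp r)"
  proof -
    obtain k where k: "N = r * k" using rN by blast
    have "N = u * (q * k)" unfolding k ruq by simp
    then have "N div u = q * k" using u0 by simp
    moreover have "N div r = k" using k r0 by simp
    ultimately have "N div u = q * (N div r)" by simp
    then show ?thesis unfolding card_subgrp[OF u0 uN] card_subgrp[OF r0 rN] using q1 by (simp add: nat_mult_distrib)
  qed
  moreover have "0 < N div r" using rN r0 N0 by (simp add: pos_imp_zdiv_pos_iff zdvd_imp_le)
  then have "0 < card (subgrp r)" unfolding card_subgrp[OF r0 rN] by simp
  ultimately have oq: "Coset.order (?H Mod subgrp r) = nat q" unfolding Coset.order_def by simp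
  have "Factorial_Ring.prime (nat q)" using iffD1[OF prime_int_nat_transfer p] unfolding q_def by blast
  then have pk: "\<exists>p k. Factorial_Ring.prime (p :: nat) \<and> Coset.order (sec_group G (subgrp u, subgrp r)) = p ^ k"
    unfolding sg oq by (intro exI[of _ "nat q"] exI[of _ 1]) simp
  have sec: "(subgrp u, subgrp r) \<in> Sec1 G S"
    unfolding Sec1_def using scheme_subgroup_subgrp[OF u] scheme_subgroup_subgrp[OF r] sub by simp
  have "\<exists>g\<in>set x \<inter> fst (subgrp u, subgrp r). carrier (sec_group G (subgrp u, subgrp r)) =
      generate (sec_group G (subgrp u, subgrp r)) {sec_elem G (subgrp u, subgrp r) g}"
    by (rule mp[OF bspec[OF conjunct2[OF conjunct2[OF B[unfolded base_tuple_def]]] sec] pk])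
  then obtain g where g: "g \<in> set x" "g \<in> subgrp u"
      and gen: "carrier (?H Mod subgrp r) = generate (?H Mod subgrp r) {sec_elem G (subgrp u, subgrp r) g}"
    unfolding sg fst_conv by blast
  obtain a where a: "g = e a" "u dvd a" using g(2) unfolding subgrp_def by auto
  have "gcd a r = u"
  proof (rule ccontr)
    assume ne: "gcd a r \<noteq> u"
    have "u dvd gcd a r" using a(2) ur by simp
    then obtain m where m: "gcd a r = u * m" by blast
    have g0: "0 < gcd a r" using r0 by simp
    have "u * m dvd r" using gcd_dvd2[of a r] m by simp
    then have "m dvd q" using u0 unfolding ruq by (simp only: dvd_mult_cancel_left) simp
    moreover have "0 < m" "m \<noteq> 1" using g0 ne u0 unfolding m by (auto simp: zero_less_mult_iff)
    ultimately have "m = q" using p unfolding q_def by (metis prime_int_iff less_imp_le)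
    then have "r dvd a" using m ruq by (metis gcd_dvd1)
    then have gr: "g \<in> subgrp r" unfolding a(1) subgrp_def by simp
    have "l_coset G g (subgrp r) = subgrp r"
      by (rule group.coset_join3[OF G _ subgroup_subgrp[OF rN] gr]) (simp add: a(1) e_in)
    then have "sec_elem G (subgrp u, subgrp r) g = \<one>\<^bsub>?H Mod subgrp r\<^esub>" unfolding sec_elem_def using g(2) by simp
    then have "carrier (?H Mod subgrp r) = {\<one>\<^bsub>?H Mod subgrp r\<^esub>}" using gen Q.generate_one by metis
    then have "Coset.order (?H Mod subgrp r) = 1" unfolding Coset.order_def by simp
    then show False using oq q1 by simp
  qed
  then show ?thesis using g(1) a(1) by blast
qed

end

theorem theorem7p4:
  fixes G :: "('a, 'b) monoid_scheme" and S :: "'a rel set"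
    and \<phi> :: "'a rel \<Rightarrow> 'a rel" and x :: "'a list"
  assumes "group G" and "cyclic_group G" and "finite (carrier G)"
    and "circulant_scheme G S"
    and "quasinormal G S"
    and "algebraic_automorphism S \<phi>"
    and "base_tuple G S x"
    and "extendable_at (carrier G) S \<phi> x"
  shows "\<exists>f. bij_betw f (carrier G) (carrier G) \<and> (\<forall>s\<in>S. image_rel f s = \<phi> s)"
proof -
  interpret group G by (rule assms(1))
  have coh: "coherent_configuration (carrier G) S"
    and tr: "\<And>s \<alpha> \<beta> g. s \<in> S \<Longrightarrow> (\<alpha>, \<beta>) \<in> s \<Longrightarrow> g \<in> carrier G \<Longrightarrow> (\<alpha> \<otimes>\<^bsub>G\<^esub> g, \<beta> \<otimes>\<^bsub>G\<^esub> g) \<in> s"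
    using assms(4) unfolding circulant_scheme_def by blast+
  obtain g where g: "g \<in> carrier G" "carrier G = range (\<lambda>n::int. g [^]\<^bsub>G\<^esub> n)"
    using assms(2) unfolding cyclic_group by blast
  define e :: "int \<Rightarrow> 'a" where "e n = g [^]\<^bsub>G\<^esub> n" for n
  define N where "N = int (ord g)"
  have em: "e a \<otimes>\<^bsub>G\<^esub> e b = e (a + b)" for a b unfolding e_def using g(1) by (simp add: int_pow_mult)
  have ei: "e a \<in> carrier G" for a unfolding e_def using g(1) by simp
  have e0: "e 0 = \<one>\<^bsub>G\<^esub>" unfolding e_def by simp
  have Om: "carrier G = range e" unfolding e_def by (rule g(2))
  interpret C: circulant_iso G S \<phi> N e
  proof
    show "0 < N" unfolding N_def using ord_ge_1[OF assms(3) g(1)] by simp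
    show "e x = e y \<longleftrightarrow> N dvd x - y" for x y
      unfolding e_def N_def int_pow_eq[OF g(1)] by (rule dvd_diff_commute)
    show "(e (a + d), e (b + d)) \<in> s" if "s \<in> S" "(e a, e b) \<in> s" for s a b d
      using tr[OF that ei[of d]] by (simp add: em)
  qed (rule coh assms(6) Om em)+
  define T where "T y = point_extension (carrier G) S y" for y
  have T: "coherent_configuration (carrier G) (T y)" "\<And>t. t \<in> T y \<Longrightarrow> \<exists>s\<in>S. t \<subseteq> s"
    "\<And>z. z \<in> set y \<Longrightarrow> {(z, z)} \<in> T y" if y: "set y \<subseteq> carrier G" for y
  proof -
    have "is_point_extension (carrier G) S y (T y)"
      unfolding T_def point_extension_def by (rule theI'[OF point_extension_unique[OF coh y]])
    then have F: "fixes_points_refining (carrier G) S y (T y)" unfolding is_point_extension_def by blast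
    show "coherent_configuration (carrier G) (T y)" "\<And>t. t \<in> T y \<Longrightarrow> \<exists>s\<in>S. t \<subseteq> s"
      "\<And>z. z \<in> set y \<Longrightarrow> {(z, z)} \<in> T y"
      using F unfolding fixes_points_refining_def refines_def by blast+
  qed
  have xG: "set x \<subseteq> carrier G" "\<one>\<^bsub>G\<^esub> \<in> set x" using assms(7) unfolding base_tuple_def by blast+
  obtain x' \<psi> where x': "length x' = length x" "set x' \<subseteq> carrier G"
    and \<psi>: "algebraic_isomorphism (T x) (T x') \<psi>" "\<And>s. s \<in> S \<Longrightarrow> extend_to_unions (T x) \<psi> s = \<phi> s"
      "\<And>i. i < length x \<Longrightarrow> \<psi> {(x ! i, x ! i)} = {(x' ! i, x' ! i)}"
    using assms(8) unfolding extendable_at_def T_def by blast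
  have image: "\<exists>a'. \<psi> {(e a, e a)} = {(e a', e a')}" if a: "e a \<in> set x" for a
  proof -
    obtain i where i: "i < length x" "x ! i = e a" using a by (metis in_set_conv_nth)
    have "x' ! i \<in> range e" using nth_mem[of i x'] i(1) x' unfolding Om by auto
    then show ?thesis using \<psi>(3)[OF i(1)] i(2) by auto
  qed
  \<comment> \<open>The identity belongs to the base tuple, so its diagonal pair is a basis relation
    of the extension and has a definite image.\<close>
  obtain \<eta> where \<eta>: "\<psi> {(e 0, e 0)} = {(e \<eta>, e \<eta>)}" using image[of 0] xG(2) e0 by auto
  interpret E: coded_extension "carrier G" S \<phi> N e "T x" "T x'" \<psi> \<eta>
    by unfold_locales (rule T(1)[OF xG(1)] T(1)[OF x'(2)] \<psi>(1) T(2)[OF xG(1)] \<psi>(2) \<eta> T(3)[OF xG(1) xG(2)[folded e0]] | assumption)+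
  interpret F: fibre N C.col C.col' E.R by (rule E.fibre)
  interpret B: based_fibre N C.col C.col' E.R
  proof
    fix u r assume ur: "xdiv N C.col u" "xdiv N C.col r" "u dvd r" "Factorial_Ring.prime (r div u)"
    obtain a where a: "e a \<in> set x" "gcd a r = u" using C.base_point[OF assms(7) ur] by blast
    obtain a' where "\<psi> {(e a, e a)} = {(e a', e a')}" using image[OF a(1)] by blast
    \<comment> \<open>Shifting by \<open>\<eta>\<close> turns the image of a base point into a
      coordinate relative to the image of the identity.\<close>
    then have "F.iso a (a' - \<eta>)" by (rule E.iso_point[OF T(3)[OF xG(1) a(1)]])
    then show "\<exists>g g'. F.iso g g' \<and> gcd g r = u" using a(2) by blast
  qed
  obtain f where "\<And>a b. C.col' (f b - f a) = C.col (b - a)" using B.ex_isomorphism by blast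
  then show ?thesis by (rule C.isomorphism)
qed

end
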